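(* Assume (B0)–(B3). There exist $\varepsilon_c'>0$ small, depending only on the dimension and the cost function, and a constant $C(n)$, depending only on the dimension, such that the following holds. Let $\tilde y\in\overline V$ and let $\tilde u:\overline U_{\tilde y}\to\mathbb R$ be the $\tilde c$-convex function $\tilde u(q)=u(x(q))+c(x(q),\tilde y)$ associated with a $c$-convex function $u$. Let $Q$ denote the section $\{\tilde u\le0\}\subset U_{\tilde y}$, and assume $|\partial^{\tilde c}\tilde u|\le1/\lambda$ in $Q$ (with $\lambda>0$) and $\tilde u=0$ on $\partial Q$. Assume also that there exists a ball $B$ such that $Q\subset B\subset4B\subset U_{\tilde y}$ (where $4B$ is the dilation of $B$ by $4$ about its center), and that $\operatorname{diam}(Q)\le\varepsilon_c'$. For $\frac1{2n}<t\le1$, let $q_t\in Q$ be a point with $q_t\in t\,\partial Q$, where $t\,\partial Q$ denotes the dilation of $\partial Q$ by the factor $t$ with respect to the center of $E$, the ellipsoid given by John's Lemma for $Q$. Then $$|\tilde u(q_t)|^n\le C(n)\,\frac{\gamma^+_{\tilde c}}{\lambda}\,(1-t)^{1/2^{n-1}}\,\mathscr L^n(Q)^2,$$ where $\gamma^+_{\tilde c}=\gamma^+_{\tilde c}(Q\times V)$, which satisfies $\gamma^+_{\tilde c}\le\gamma_c^+\gamma_c^-$. Moreover, $$\frac{|\inf_Q\tilde u|^n}{\mathscr L^n(Q)^2}\le C(n)\,\frac{\gamma^+_{\tilde c}}{\lambda}.$$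
   Context: $D_x, D_y$ denote derivatives in the first and second variables of $c$. Conditions on the cost: (B0) $U,V\subset\mathbb R^n$ are open and bounded and $c\in C^4(\overline U\times\overline V)$. (B1) For each $(\tilde x,\tilde y)\in\overline U\times\overline V$, the maps $x\in\overline U\mapsto -D_yc(x,\tilde y)$ and $y\in\overline V\mapsto -D_xc(\tilde x,y)$ are diffeomorphisms onto their ranges. (B2) For each $(\tilde x,\tilde y)\in\overline U\times\overline V$, the sets $U_{\tilde y}:=-D_yc(U,\tilde y)$ and $V_{\tilde x}:=-D_xc(\tilde x,V)$ are convex subsets of $\mathbb R^n$. (B3) For every curve $t\in[-1,1]\mapsto (D_yc(x(t),y(0)),D_xc(x(0),y(t)))\in\mathbb R^{2n}$ which is an affinely parameterized line segment, $-\frac{\partial^4}{\partial s^2\partial t^2}\big|_{(s,t)=(0,0)}c(x(s),y(t))\ge 0$ provided $\frac{\partial^2}{\partial s\partial t}\big|_{(s,t)=(0,0)}c(x(s),y(t))=0$. $c$-convexity: $v^c(x):=\sup_{y\in\overline V}-c(x,y)-v(y)$, $u^{c^*}(y):=\sup_{x\in\overline U}-c(x,y)-u(x)$; $u$ is $c$-convex if $u=(u^{c^*})^c$. $\partial^cu(x):=\{y\in\overline V: u(x)+u^{c^*}(y)+c(x,y)=0\}$. The $c$-Monge–Ampère measure is $|\partial^cu|(X):=\mathscr L^n\big(\bigcup_{x\in X}\partial^cu(x)\big)$, and $|\partial^cu|\le\Lambda$ on a set means $|\partial^cu|(X)\le\Lambda\mathscr L^n(X)$ for all Borel subsets $X$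 of it. The same definitions with $(\overline U_{\tilde y},\tilde c)$ in place of $(\overline U,c)$ define $\tilde c$-convexity, $\partial^{\tilde c}$ and $|\partial^{\tilde c}\cdot|$. $x:\overline U_{\tilde y}\to\overline U$ is the inverse of $x\mapsto-D_yc(x,\tilde y)$; the modified cost at $\tilde y$ is $\tilde c(q,y):=c(x(q),y)-c(x(q),\tilde y)$. Under (B0)–(B3) the sublevel sets of $\tilde u$ are convex. Constants: $\gamma_c^\pm:=\|\det(D^2_{xy}c)^{\pm1}\|_{L^\infty(U\times V)}$, $\gamma^\pm_{\tilde c}(Q\times V):=\|\det(D^2_{qy}\tilde c)^{\pm1}\|_{L^\infty(Q\times V)}$. John's Lemma: a compact convex set $Q\subset\mathbb R^n$ with nonempty interior contains an ellipsoid $E$ with $E\subset Q\subset nE$, where $nE$ is the dilation of $E$ by $n$ about its center; "the ellipsoid given by John's Lemma" is such an $E$. *)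

theory Defs
  imports "HOL-Analysis.Analysis" "HOL-Probability.Essential_Supremum"
begin

text \<open>
  A function on the closure of an open set \<open>S\<close> belongs to \<open>C\<^sup>k(closure S)\<close> if it is \<open>C\<^sup>k\<close> on \<open>S\<close> and it and
  all its partial derivatives of order at most \<open>k\<close> have continuous extensions to the closure.
\<close>

primrec Ck_closure :: "nat \<Rightarrow> 'a::euclidean_space set \<Rightarrow> ('a \<Rightarrow> real) \<Rightarrow> bool" where
  "Ck_closure 0 S f \<longleftrightarrow> (\<exists>g. continuous_on (closure S) g \<and> (\<forall>x\<in>S. g x = f x))"
| "Ck_closure (Suc k) S f \<longleftrightarrow>
     (\<exists>g. continuous_on (closure S) g \<and> (\<forall>x\<in>S. g x = f x)) \<and>
     (\<forall>x\<in>S. f differentiable (at x)) \<and>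
     (\<forall>b\<in>Basis. Ck_closure k S (\<lambda>x. frechet_derivative f (at x) b))"

text \<open>
  At boundary points derivatives are read as the values of these continuous extensions.
\<close>

definition closure_ext :: "'a::topological_space set \<Rightarrow> ('a \<Rightarrow> 'b::t2_space) \<Rightarrow> 'a \<Rightarrow> 'b" where
  "closure_ext S f p = (if p \<in> S then f p else Lim (at p within S) f)"

definition grad :: "(real^'n \<Rightarrow> real) \<Rightarrow> real^'n \<Rightarrow> real^'n" where
  "grad f x = (\<chi> i. frechet_derivative f (at x) (axis i 1))"

type_synonym 'n cost = "real^'n \<Rightarrow> real^'n \<Rightarrow> real"

definition Dx :: "(real^'n) set \<Rightarrow> (real^'n) set \<Rightarrow> 'n cost \<Rightarrow> real^'n \<Rightarrow> real^'n \<Rightarrow> real^'n" where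
  "Dx U V c x y = closure_ext (U \<times> V) (\<lambda>(x, y). grad (\<lambda>x'. c x' y) x) (x, y)"

definition Dy :: "(real^'n) set \<Rightarrow> (real^'n) set \<Rightarrow> 'n cost \<Rightarrow> real^'n \<Rightarrow> real^'n \<Rightarrow> real^'n" where
  "Dy U V c x y = closure_ext (U \<times> V) (\<lambda>(x, y). grad (\<lambda>y'. c x y') y) (x, y)"

text \<open>
  On sets that need not be open, differentiability is relative to the set.
\<close>

definition C1_on :: "'a::real_normed_vector set \<Rightarrow> ('a \<Rightarrow> 'b::real_normed_vector) \<Rightarrow> bool" where
  "C1_on S f \<longleftrightarrow>
     (\<exists>f' :: 'a \<Rightarrow> 'a \<Rightarrow>\<^sub>L 'b. continuous_on S f' \<and>
        (\<forall>x\<in>S. (f has_derivative blinfun_apply (f' x)) (at x within S)))"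

definition diffeo_onto_range :: "'a::real_normed_vector set \<Rightarrow> ('a \<Rightarrow> 'b::real_normed_vector) \<Rightarrow> bool" where
  "diffeo_onto_range S f \<longleftrightarrow> inj_on f S \<and> C1_on S f \<and> C1_on (f ` S) (inv_into S f)"

definition U_at :: "(real^'n) set \<Rightarrow> (real^'n) set \<Rightarrow> 'n cost \<Rightarrow> real^'n \<Rightarrow> (real^'n) set" where
  "U_at U V c y0 = (\<lambda>x. - Dy U V c x y0) ` U"

definition V_at :: "(real^'n) set \<Rightarrow> (real^'n) set \<Rightarrow> 'n cost \<Rightarrow> real^'n \<Rightarrow> (real^'n) set" where
  "V_at U V c x0 = (\<lambda>y. - Dx U V c x0 y) ` V"

definition B0 :: "(real^'n) set \<Rightarrow> (real^'n) set \<Rightarrow> 'n cost \<Rightarrow> bool" where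
  "B0 U V c \<longleftrightarrow> open U \<and> bounded U \<and> open V \<and> bounded V \<and>
     continuous_on (closure U \<times> closure V) (\<lambda>(x, y). c x y) \<and>
     Ck_closure 4 (U \<times> V) (\<lambda>(x, y). c x y)"

definition B1 :: "(real^'n) set \<Rightarrow> (real^'n) set \<Rightarrow> 'n cost \<Rightarrow> bool" where
  "B1 U V c \<longleftrightarrow> (\<forall>x0\<in>closure U. \<forall>y0\<in>closure V.
     diffeo_onto_range (closure U) (\<lambda>x. - Dy U V c x y0) \<and>
     diffeo_onto_range (closure V) (\<lambda>y. - Dx U V c x0 y))"

definition B2 :: "(real^'n) set \<Rightarrow> (real^'n) set \<Rightarrow> 'n cost \<Rightarrow> bool" where
  "B2 U V c \<longleftrightarrow> (\<forall>x0\<in>closure U. \<forall>y0\<in>closure V.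
     convex (U_at U V c y0) \<and> convex (V_at U V c x0))"

definition B3 :: "(real^'n) set \<Rightarrow> (real^'n) set \<Rightarrow> 'n cost \<Rightarrow> bool" where
  "B3 U V c \<longleftrightarrow>
     (\<forall>(x :: real \<Rightarrow> real^'n) (y :: real \<Rightarrow> real^'n).
        (\<forall>t\<in>{-1..1}. x t \<in> closure U \<and> y t \<in> closure V) \<and>
        (\<exists>a b. \<forall>t\<in>{-1..1}. (Dy U V c (x t) (y 0), Dx U V c (x 0) (y t)) = a + t *\<^sub>R b) \<and>
        deriv (\<lambda>s. deriv (\<lambda>t. c (x s) (y t)) 0) 0 = 0 \<longrightarrow>
        - (deriv ^^ 2) (\<lambda>s. (deriv ^^ 2) (\<lambda>t. c (x s) (y t)) 0) 0 \<ge> 0)"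

text \<open>
  The transforms take values in \<open>ereal\<close>, so that the suprema are meaningful before
  finiteness is known. \<open>X\<close> and \<open>Y\<close> are the (closed) sets on which the cost is considered.
\<close>

definition c_transform :: "(real^'n) set \<Rightarrow> 'n cost \<Rightarrow> (real^'n \<Rightarrow> ereal) \<Rightarrow> real^'n \<Rightarrow> ereal" where
  "c_transform Y c v x = (SUP y\<in>Y. - ereal (c x y) - v y)"

definition c_star_transform :: "(real^'n) set \<Rightarrow> 'n cost \<Rightarrow> (real^'n \<Rightarrow> ereal) \<Rightarrow> real^'n \<Rightarrow> ereal" where
  "c_star_transform X c u y = (SUP x\<in>X. - ereal (c x y) - u x)"

definition c_convex :: "(real^'n) set \<Rightarrow> (real^'n) set \<Rightarrow> 'n cost \<Rightarrow> (real^'n \<Rightarrow> real) \<Rightarrow> bool" where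
  "c_convex X Y c u \<longleftrightarrow>
     (\<forall>x\<in>X. ereal (u x) = c_transform Y c (c_star_transform X c (\<lambda>x'. ereal (u x'))) x)"

definition c_subdiff ::
  "(real^'n) set \<Rightarrow> (real^'n) set \<Rightarrow> 'n cost \<Rightarrow> (real^'n \<Rightarrow> real) \<Rightarrow> real^'n \<Rightarrow> (real^'n) set" where
  "c_subdiff X Y c u x =
     {y \<in> Y. ereal (u x) + c_star_transform X c (\<lambda>x'. ereal (u x')) y + ereal (c x y) = 0}"

text \<open>
  The Lebesgue rather than the Borel measure: the image of a Borel set under the
  subdifferential is an analytic set, hence Lebesgue measurable, but need not be Borel.
\<close>

definition c_MA_measure ::
  "(real^'n) set \<Rightarrow> (real^'n) set \<Rightarrow> 'n cost \<Rightarrow> (real^'n \<Rightarrow> real) \<Rightarrow> (real^'n) set \<Rightarrow> ennreal" where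
  "c_MA_measure X Y c u A = emeasure lebesgue (\<Union>x\<in>A. c_subdiff X Y c u x)"

definition c_MA_le ::
  "(real^'n) set \<Rightarrow> (real^'n) set \<Rightarrow> 'n cost \<Rightarrow> (real^'n \<Rightarrow> real) \<Rightarrow> real \<Rightarrow> (real^'n) set \<Rightarrow> bool" where
  "c_MA_le X Y c u \<Lambda> S \<longleftrightarrow>
     (\<forall>A\<in>sets borel. A \<subseteq> S \<longrightarrow> c_MA_measure X Y c u A \<le> ennreal \<Lambda> * emeasure lebesgue A)"

definition x_of :: "(real^'n) set \<Rightarrow> (real^'n) set \<Rightarrow> 'n cost \<Rightarrow> real^'n \<Rightarrow> real^'n \<Rightarrow> real^'n" where
  "x_of U V c y0 = inv_into (closure U) (\<lambda>x. - Dy U V c x y0)"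

definition modified_cost :: "(real^'n) set \<Rightarrow> (real^'n) set \<Rightarrow> 'n cost \<Rightarrow> real^'n \<Rightarrow> 'n cost" where
  "modified_cost U V c y0 q y = c (x_of U V c y0 q) y - c (x_of U V c y0 q) y0"

definition modified_fun ::
  "(real^'n) set \<Rightarrow> (real^'n) set \<Rightarrow> 'n cost \<Rightarrow> real^'n \<Rightarrow> (real^'n \<Rightarrow> real) \<Rightarrow> real^'n \<Rightarrow> real" where
  "modified_fun U V c y0 u q = u (x_of U V c y0 q) + c (x_of U V c y0 q) y0"

definition mixed_hessian :: "'n cost \<Rightarrow> real^'n \<Rightarrow> real^'n \<Rightarrow> real^'n^'n" where
  "mixed_hessian k x y =
     (\<chi> i j. frechet_derivative
        (\<lambda>x'. frechet_derivative (\<lambda>y'. k x' y') (at y) (axis j 1)) (at x) (axis i 1))"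

text \<open>
  The norms are taken in \<open>ennreal\<close>; in particular \<open>gamma_minus\<close> is infinite if the determinant
  vanishes on a set of positive measure.
\<close>

definition gamma_plus :: "'n cost \<Rightarrow> ((real^'n) \<times> (real^'n)) set \<Rightarrow> ennreal" where
  "gamma_plus k S = esssup (restrict_space lborel S)
     (\<lambda>(x, y). ennreal \<bar>det (mixed_hessian k x y)\<bar>)"

definition gamma_minus :: "'n cost \<Rightarrow> ((real^'n) \<times> (real^'n)) set \<Rightarrow> ennreal" where
  "gamma_minus k S = esssup (restrict_space lborel S)
     (\<lambda>(x, y). inverse (ennreal \<bar>det (mixed_hessian k x y)\<bar>))"

definition dilation :: "'a::real_vector \<Rightarrow> real \<Rightarrow> 'a set \<Rightarrow> 'a set" where
  "dilation a t S = (\<lambda>z. a + t *\<^sub>R (z - a)) ` S"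

definition is_ellipsoid :: "real^'n \<Rightarrow> (real^'n) set \<Rightarrow> bool" where
  "is_ellipsoid a E \<longleftrightarrow> (\<exists>A :: real^'n \<Rightarrow> real^'n. linear A \<and> bij A \<and> E = (\<lambda>v. a + A v) ` cball 0 1)"

definition john_ellipsoid :: "(real^'n) set \<Rightarrow> real^'n \<Rightarrow> (real^'n) set \<Rightarrow> bool" where
  "john_ellipsoid Q a E \<longleftrightarrow> is_ellipsoid a E \<and> E \<subseteq> Q \<and> Q \<subseteq> dilation a (real CARD('n)) E"

end

(*
  Write psi(q, y) = - ct(q, y) for the negative of the modified cost, so that psi(q, y0) = 0, and
  P(q, y) for its gradient in q. Condition (B3) gives Loeper's maximum principle: along the curve y(t)
  for which P(q0, y(t)) traverses a segment, f(t) = psi(q, y(t)) - psi(q0, y(t)) satisfies f'' >= 0 where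
  f' = 0, hence f'' >= - C |f'|, so f has no interior strict maximum. Its first-order consequence is that
  psi(., y) is quasiconvex, so sections are convex. Boundary points are reached by continuity, the mixed
  Hessian being uniformly invertible by (B1) and compactness.

  Let ut(q) = - h < 0 in the section Q and let w_1, ..., w_n be an orthonormal frame with
  w_i . (x - q) <= d_i on Q. At the point of Q farthest in the direction w_i slide the supporting function
  until it takes the value - h at q; this yields y_i with psi(., y_i) - psi(q, y_i) <= h on Q and
  P(q, y_i) nearly parallel to w_i (Q is small) of length at least h / (4 d_i). All y with
  psi(., y) - psi(q, y) <= h on Q lie in the subdifferential image of Q, and their P(q, .)-image is convex;
  comparing its volume with that of the simplex spanned by 0 and the P(q, y_i) bounds h^n by
  gamma |Q| / lam times the product of the d_i.

  Singular vectors of an inscribed simplex of maximal volume form a frame for which the product of the d_i is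
  comparable with |Q|.
  For q = a + t (z - a) near the boundary, a supporting normal at z whose small coordinates with respect to
  John's ellipsoid have been dropped is the first vector of a frame for which the product gains
  (1 - t)^(1/n) <= (1 - t)^(1/2^(n-1)).
*)

theory Submission
  imports Defs
begin

section \<open>Change of variables in dimension \<open>CARD('n)\<close>\<close>

text \<open>The constant may depend on the dimension only, while sections can be arbitrarily thin
  and the gradients \<open>P q y\<close> arbitrarily small. Bounding the oscillation of
  \<open>P\<close> over \<open>Q\<close> is therefore useless unless the bound is relative to the
  size of \<open>P\<close>. The modified cost makes this possible: \<open>P q y\<close> vanishes for
  all \<open>q\<close> when \<open>y\<close> is \<open>y0\<close>, so its variation in
  \<open>q\<close> is controlled by \<open>K\<close> times |q - q'| times \<open>P\<close> itself.
  Only K diam(Q) enters the estimates, and a diameter of at most \<eta> / (K + 1), with \<eta>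
  dimensional, hides \<open>K\<close>. The second obstacle is the choice of frame. The volume
  comparison wants orthonormal directions, but for a thin body in oblique position every width can
  be of the order of the longest axis, and the product of the widths then far exceeds |Q|. Singular
  vectors avoid this. Near the boundary one direction is dictated by the supporting hyperplane, and
  it must be corrected before it can be completed to a good frame. The ball B provides room: the
  comparison evaluates \<open>\<psi>\<close> at a point of the supporting hyperplane that may lie
  outside \<open>Q\<close>, and 4B keeps this point in the domain.\<close>

text \<open>
  The change of variables theorems of the library require the index type to be well-ordered; they are
  transported to an arbitrary finite index type through a copy of it.
\<close>

typedef 'a wo = "UNIV :: 'a set" ..

lemma bij_Rep_wo: "bij Rep_wo"
  by (metis Abs_wo_inverse Rep_wo_inverse UNIV_I bijI')

lemma Rep_wo_Abs_wo [simp]: "Rep_wo (Abs_wo x) = x"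
  by (simp add: Abs_wo_inverse)

declare Rep_wo_inverse [simp]

instance wo :: (finite) finite
proof
  show "finite (UNIV :: 'a wo set)"
    by (rule finite_imageD [of Rep_wo]) (auto intro: inj_on_subset [OF bij_is_inj [OF bij_Rep_wo]])
qed

instantiation wo :: (finite) wellorder
begin

definition "wo_code = (SOME f :: 'a wo \<Rightarrow> nat. inj f)"
definition "less_eq_wo x y \<longleftrightarrow> wo_code x \<le> wo_code y"
definition "less_wo x y \<longleftrightarrow> wo_code x < wo_code y"

instance
proof
  obtain f :: "'a wo \<Rightarrow> nat" where "inj f"
    using finite_imp_inj_to_nat_seg[of "UNIV :: 'a wo set"] by auto
  then have inj: "inj (wo_code :: 'a wo \<Rightarrow> nat)"
    unfolding wo_code_def by (rule someI[where P="\<lambda>f. inj f"])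
  fix x y z :: "'a wo"
  show "x < y \<longleftrightarrow> x \<le> y \<and> \<not> y \<le> x" "x \<le> x" "x \<le> y \<or> y \<le> x"
    by (auto simp: less_eq_wo_def less_wo_def)
  show "x \<le> y \<Longrightarrow> y \<le> z \<Longrightarrow> x \<le> z"
    by (auto simp: less_eq_wo_def)
  show "x \<le> y \<Longrightarrow> y \<le> x \<Longrightarrow> x = y"
    using inj by (auto simp: less_eq_wo_def inj_def)
  fix P :: "'a wo \<Rightarrow> bool" and a
  assume *: "\<And>x. (\<And>y. y < x \<Longrightarrow> P y) \<Longrightarrow> P x"
  show "P a"
    by (induction a rule: measure_induct_rule [of wo_code]) (use * in \<open>auto simp: less_wo_def\<close>)
qed

end

definition to_wo :: "'b^'n \<Rightarrow> 'b^('n wo)" where "to_wo x = (\<chi> i. x $ Rep_wo i)"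
definition of_wo :: "'b^('n wo) \<Rightarrow> 'b^'n" where "of_wo x = (\<chi> i. x $ Abs_wo i)"

lemma to_wo_of_wo [simp]: "to_wo (of_wo x) = x" and of_wo_to_wo [simp]: "of_wo (to_wo y) = y"
  by (simp_all add: to_wo_def of_wo_def vec_eq_iff)

lemma linear_to_wo: "linear (to_wo :: real^'n \<Rightarrow> _)" and linear_of_wo: "linear (of_wo :: _ \<Rightarrow> real^'n)"
  by (auto intro!: linearI simp: to_wo_def of_wo_def vec_eq_iff)

lemma continuous_on_to_wo: "continuous_on S (to_wo :: real^'n \<Rightarrow> _)"
  and continuous_on_of_wo: "continuous_on T (of_wo :: _ \<Rightarrow> real^'n)"
  by (intro linear_continuous_on linear_linear[THEN iffD2] linear_to_wo linear_of_wo linear_conv_bounded_linear[THEN iffD1])+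

lemma of_wo_vimage: "of_wo -` S = to_wo ` S"
  by (auto intro: image_eqI[where x="of_wo _"])

lemma borel_to_wo_image:
  fixes S :: "(real^'n) set"
  assumes "S \<in> sets borel" shows "to_wo ` S \<in> sets borel"
proof -
  have "of_wo \<in> borel_measurable (borel :: (real^('n wo)) measure)"
    by (rule borel_measurable_continuous_onI [OF continuous_on_of_wo])
  from measurable_sets[OF this assms] show ?thesis by (simp add: of_wo_vimage)
qed

text \<open>Relabelling coordinates maps boxes to boxes with the same side lengths, and Lebesgue
  measure is determined by its values on boxes.\<close>

lemma lborel_distr_of_wo: "lborel = distr lborel borel (of_wo :: real^('n wo) \<Rightarrow> real^'n)"
proof (rule lborel_eqI)
  fix l u :: "real^'n" assume le: "\<And>b. b \<in> Basis \<Longrightarrow> l \<bullet> b \<le> u \<bullet> b"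
  have le': "l $ i \<le> u $ i" for i using le[of "axis i 1"] by (simp add: axis_in_Basis_iff inner_axis)
  have m: "of_wo \<in> borel_measurable (lborel :: (real^('n wo)) measure)"
    using borel_measurable_continuous_onI [OF continuous_on_of_wo] by simp
  have "of_wo -` box l u = box (to_wo l) (to_wo u)"
    unfolding of_wo_def to_wo_def set_eq_iff vimage_def mem_box_cart
    by simp (metis Rep_wo_Abs_wo Rep_wo_inverse)
  moreover have "emeasure lborel (box (to_wo l) (to_wo u)) = (\<Prod>b\<in>Basis. (to_wo u - to_wo l) \<bullet> b)"
    by (rule emeasure_lborel_box) (use le' in \<open>auto simp: Basis_vec_def to_wo_def inner_axis\<close>)
  moreover have "(\<Prod>b\<in>Basis. (to_wo u - to_wo l) \<bullet> b) = (\<Prod>i\<in>UNIV. (to_wo u - to_wo l) $ i)"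
    by (simp add: Basis_vec_def inner_axis axis_eq_axis prod.UNION_disjoint flip: prod.reindex[of "\<lambda>i. axis i (1::real)", unfolded inj_on_def])
  moreover have "(\<Prod>b\<in>Basis. (u - l) \<bullet> b) = (\<Prod>i\<in>UNIV. (u - l) $ i)"
    by (simp add: Basis_vec_def inner_axis axis_eq_axis prod.UNION_disjoint)
  moreover have "(\<Prod>i\<in>UNIV. (to_wo u - to_wo l) $ i) = (\<Prod>i\<in>UNIV. (u - l) $ i)"
    using prod.reindex_bij_betw[OF bij_Rep_wo, of "\<lambda>i. (u-l)$i"] by (simp add: to_wo_def)
  ultimately show "emeasure (distr lborel borel of_wo) (box l u) = (\<Prod>b\<in>Basis. (u - l) \<bullet> b)"
    using m by (simp add: emeasure_distr)
qed simp

lemma emeasure_to_wo_image: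
  fixes S :: "(real^'n) set"
  assumes "S \<in> sets borel" shows "emeasure lborel (to_wo ` S) = emeasure lborel S"
proof -
  have m: "of_wo \<in> borel_measurable (lborel :: (real^('n wo)) measure)"
    using borel_measurable_continuous_onI [OF continuous_on_of_wo] by simp
  show ?thesis
    by (subst (2) lborel_distr_of_wo) (simp add: emeasure_distr[OF m] assms of_wo_vimage)
qed

text \<open>Serves \<open>det_wo\<close>: conjugation by the bijection of index types turns each
  transposition into a transposition, so signs of permutations are preserved.\<close>

lemma swapidseq_wo:
  "swapidseq n p \<Longrightarrow> swapidseq n (Abs_wo \<circ> p \<circ> Rep_wo)"
proof (induction rule: swapidseq.induct)
  case id
  have "Abs_wo \<circ> id \<circ> Rep_wo = id" by auto
  then show ?case by (metis swapidseq.id)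
next
  case (comp_Suc n p a b)
  have "Abs_wo \<circ> (Transposition.transpose a b \<circ> p) \<circ> Rep_wo = Transposition.transpose (Abs_wo a) (Abs_wo b) \<circ> (Abs_wo \<circ> p \<circ> Rep_wo)"
    by (auto simp: fun_eq_iff Transposition.transpose_def Abs_wo_inject)
  moreover have "Abs_wo a \<noteq> Abs_wo b" using comp_Suc by (simp add: Abs_wo_inject)
  ultimately show ?case using comp_Suc.IH by (metis swapidseq.comp_Suc)
qed

lemma det_wo:
  fixes M :: "real^'n^'n"
  shows "det (\<chi> i j. M $ Rep_wo i $ Rep_wo j) = det M"
proof -
  let ?\<phi> = "\<lambda>p::'n \<Rightarrow> 'n. Abs_wo \<circ> p \<circ> Rep_wo"
  have bij: "bij_betw ?\<phi> {p. p permutes UNIV} {p. p permutes UNIV}"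
  proof (rule bij_betwI[where g="\<lambda>p. Rep_wo \<circ> p \<circ> Abs_wo"])
    show "?\<phi> \<in> {p. p permutes UNIV} \<rightarrow> {p. p permutes UNIV}"
      by (auto simp: permutes_univ) (metis Rep_wo_inverse Rep_wo_Abs_wo)+
    show "(\<lambda>p. Rep_wo \<circ> p \<circ> Abs_wo) \<in> {p. p permutes UNIV} \<rightarrow> {p. p permutes UNIV}"
      by (auto simp: permutes_univ) (metis Rep_wo_inverse Rep_wo_Abs_wo)+
  qed (auto simp: fun_eq_iff)
  have sgn: "sign (?\<phi> p) = sign p" if "p permutes UNIV" for p :: "'n \<Rightarrow> 'n"
  proof -
    have "permutation p" using that by (metis finite_class.finite_UNIV permutation_permutes)
    then obtain k where k: "swapidseq k p" unfolding permutation_def by blast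
    from evenperm_unique[OF k refl] evenperm_unique[OF swapidseq_wo[OF k] refl]
    show ?thesis by (simp add: sign_def)
  qed
  have "det (\<chi> i j. M $ Rep_wo i $ Rep_wo j) =
     (\<Sum>p\<in>{p. p permutes UNIV}. of_int (sign p) * (\<Prod>i\<in>UNIV. M $ Rep_wo i $ Rep_wo (p i)))"
    by (simp add: det_def)
  also have "\<dots> = (\<Sum>p\<in>{p. p permutes UNIV}. of_int (sign (?\<phi> p)) * (\<Prod>i\<in>UNIV. M $ Rep_wo i $ Rep_wo (?\<phi> p i)))"
    by (rule sum.reindex_bij_betw[OF bij, symmetric])
  also have "\<dots> = (\<Sum>p\<in>{p. p permutes UNIV}. of_int (sign p) * (\<Prod>i\<in>UNIV. M $ i $ p i))"
  proof (rule sum.cong[OF refl])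
    fix p :: "'n \<Rightarrow> 'n" assume "p \<in> {p. p permutes UNIV}"
    then show "real_of_int (sign (?\<phi> p)) * (\<Prod>i\<in>UNIV. M $ Rep_wo i $ Rep_wo (?\<phi> p i)) = of_int (sign p) * (\<Prod>i\<in>UNIV. M $ i $ p i)"
      using prod.reindex_bij_betw[OF bij_Rep_wo, of "\<lambda>i. M $ i $ p i"] by (simp add: sgn)
  qed
  finally show ?thesis by (simp add: det_def)
qed

lemma matrix_wo:
  fixes f :: "real^'n \<Rightarrow> real^'n"
  shows "matrix (to_wo \<circ> f \<circ> of_wo) = (\<chi> i j. matrix f $ Rep_wo i $ Rep_wo j)"
proof -
  have "of_wo (axis j (1::real)) = axis (Rep_wo j) 1" for j :: "'n wo"
    by (auto simp: of_wo_def axis_def vec_eq_iff)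
  then show ?thesis unfolding matrix_def to_wo_def comp_def by simp
qed

text \<open>No injectivity is involved because only an upper bound is claimed. Continuity of the
  determinant yields integrability over the bounded set \<open>S\<close>, and the Borel assumption
  on the image lets its measure be transported between the two index types.\<close>

lemma emeasure_differentiable_image_le:
  fixes f :: "real^'n \<Rightarrow> real^'n"
  assumes S: "S \<in> sets borel" "bounded S" and fS: "f ` S \<in> sets borel"
    and der: "\<And>x. x \<in> S \<Longrightarrow> (f has_derivative f' x) (at x)"
    and cont: "continuous_on S (\<lambda>x. det (matrix (f' x)))"
    and B: "\<And>x. x \<in> S \<Longrightarrow> \<bar>det (matrix (f' x))\<bar> \<le> B"
  shows "emeasure lebesgue (f ` S) \<le> ennreal B * emeasure lebesgue S"
proof -
  let ?g = "to_wo \<circ> f \<circ> of_wo" and ?g' = "\<lambda>x. to_wo \<circ> f' (of_wo x) \<circ> of_wo" and ?S = "to_wo ` S"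
  have dg: "(?g has_derivative ?g' x) (at x within ?S)" if "x \<in> ?S" for x
  proof -
    from that have "of_wo x \<in> S" by auto
    then have "(f has_derivative f' (of_wo x)) (at (of_wo x))" by (rule der)
    then have "(f \<circ> of_wo has_derivative f' (of_wo x) \<circ> of_wo) (at x)"
      by (rule diff_chain_at[rotated]) (rule linear_imp_has_derivative[OF linear_of_wo])
    then have "(to_wo \<circ> (f \<circ> of_wo) has_derivative to_wo \<circ> (f' (of_wo x) \<circ> of_wo)) (at x)"
      by (rule diff_chain_at) (rule linear_imp_has_derivative[OF linear_to_wo])
    then show ?thesis by (simp add: comp_assoc has_derivative_at_withinI)
  qed
  have det_eq: "det (matrix (?g' x)) = det (matrix (f' (of_wo x)))" for x
    by (simp add: matrix_wo det_wo)
  have bS: "bounded ?S"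
    using S(2) by (rule bounded_linear_image) (use linear_to_wo linear_conv_bounded_linear in blast)
  have Sb: "?S \<in> sets borel" by (rule borel_to_wo_image[OF S(1)])
  then have Sl: "?S \<in> lmeasurable" using bS by (intro bounded_set_imp_lmeasurable) auto
  have contw: "continuous_on ?S (\<lambda>x. \<bar>det (matrix (?g' x))\<bar>)"
    unfolding det_eq by (intro continuous_intros continuous_on_compose2[OF cont continuous_on_of_wo]) auto
  have Bw: "\<bar>det (matrix (?g' x))\<bar> \<le> B" if "x \<in> ?S" for x
    using that B unfolding det_eq by auto
  have int: "(\<lambda>x. \<bar>det (matrix (?g' x))\<bar>) integrable_on ?S"
    by (rule measurable_bounded_by_integrable_imp_integrable[where g="\<lambda>_. B"])
      (use Sl Bw contw continuous_imp_measurable_on_sets_lebesgue Sb in \<open>auto intro!: integrable_on_const continuous_imp_measurable_on_sets_lebesgue\<close>)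
  have le: "measure lebesgue (?g ` ?S) \<le> B * measure lebesgue ?S" and lm: "?g ` ?S \<in> lmeasurable"
    using measure_bounded_differentiable_image[OF Sl dg int Bw] measurable_bounded_differentiable_image[OF Sl dg int Bw]
    by auto
  have eq: "?g ` ?S = to_wo ` (f ` S)" by (auto simp: image_image)
  have "emeasure lebesgue (f ` S) = emeasure lebesgue (?g ` ?S)"
    unfolding eq using emeasure_to_wo_image[OF fS] borel_to_wo_image[OF fS] fS by simp
  also have "\<dots> = ennreal (measure lebesgue (?g ` ?S))"
    using lm by (simp add: emeasure_eq_measure2)
  also have "\<dots> \<le> ennreal (B * measure lebesgue ?S)" using le by (rule ennreal_leI)
  also have "\<dots> \<le> ennreal B * ennreal (measure lebesgue ?S)"
    by (cases "B \<ge> 0") (auto simp: ennreal_mult ennreal_neg mult_nonpos_nonneg)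
  also have "ennreal (measure lebesgue ?S) = emeasure lebesgue ?S"
    using Sl by (simp add: emeasure_eq_measure2)
  also have "\<dots> = emeasure lebesgue S"
    using emeasure_to_wo_image[OF S(1)] Sb S(1) by simp
  finally show ?thesis .
qed

lemma emeasure_linear_image:
  fixes f :: "real^'n \<Rightarrow> real^'n"
  assumes "linear f" "compact S"
  shows "emeasure lebesgue (f ` S) = ennreal \<bar>det (matrix f)\<bar> * emeasure lebesgue S"
proof -
  let ?g = "to_wo \<circ> f \<circ> of_wo" and ?S = "to_wo ` S"
  have lin: "linear ?g" by (intro linear_compose linear_of_wo assms linear_to_wo)
  have cS: "compact ?S" by (intro compact_continuous_image continuous_on_to_wo assms)
  then have Sl: "?S \<in> lmeasurable" by (rule lmeasurable_compact)
  have cf: "compact (f ` S)"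
    by (intro compact_continuous_image linear_continuous_on assms) (use assms linear_conv_bounded_linear in blast)
  have eq: "?g ` ?S = to_wo ` (f ` S)" by (auto simp: image_image)
  have "emeasure lebesgue (f ` S) = emeasure lebesgue (?g ` ?S)"
    unfolding eq using emeasure_to_wo_image[of "f ` S"] borel_to_wo_image[of "f ` S"] cf
    by (simp add: borel_compact)
  also have "\<dots> = ennreal (\<bar>det (matrix ?g)\<bar> * measure lebesgue ?S)"
    using measure_linear_image[OF lin Sl] measurable_linear_image[OF lin Sl] by (simp add: emeasure_eq_measure2)
  also have "\<dots> = ennreal \<bar>det (matrix ?g)\<bar> * emeasure lebesgue ?S"
    using Sl by (simp add: ennreal_mult emeasure_eq_measure2)
  also have "emeasure lebesgue ?S = emeasure lebesgue S"
    using emeasure_to_wo_image[of S] borel_to_wo_image[of S] assms(2) by (simp add: borel_compact)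
  also have "det (matrix ?g) = det (matrix f)"
    by (simp add: matrix_wo det_wo)
  finally show ?thesis .
qed

section \<open>Orthonormal frames and widths of convex bodies\<close>

definition orthonormal_frame :: "('n \<Rightarrow> real^'n) \<Rightarrow> bool" where
  "orthonormal_frame w \<longleftrightarrow> (\<forall>i j. w i \<bullet> w j = (if i = j then 1 else 0))"

text \<open>A singular value decomposition by the variational method: a unit vector \<open>e\<close>
  of \<open>S\<close> maximising |f e| satisfies a first-order condition, namely that f e is
  orthogonal to f v for every v in \<open>S\<close> orthogonal to \<open>e\<close>. The rest of the
  basis comes from the orthogonal complement of \<open>e\<close> in \<open>S\<close>.\<close>

lemma orthogonal_basis_with_orthogonal_image:
  fixes f :: "'a::euclidean_space \<Rightarrow> 'a"
  assumes lin: "linear f"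
  shows "subspace S \<Longrightarrow> \<exists>B\<subseteq>S. finite B \<and> card B = dim S \<and> (\<forall>b\<in>B. norm b = 1) \<and>
    (\<forall>b\<in>B. \<forall>c\<in>B. b \<noteq> c \<longrightarrow> b \<bullet> c = 0 \<and> f b \<bullet> f c = 0)"
proof (induction "dim S" arbitrary: S)
  case 0
  then show ?case by (intro exI[of _ "{}"]) auto
next
  case (Suc d)
  have "\<exists>x\<in>S. x \<noteq> 0" using Suc.hyps(2) dim_eq_0[of S] by fastforce
  then obtain x where x: "x \<in> S" "x \<noteq> 0" by blast
  let ?K = "S \<inter> sphere 0 1"
  have K: "compact ?K" "?K \<noteq> {}"
    using closed_subspace[OF Suc.prems] x subspace_scale[OF Suc.prems, of x "inverse (norm x)"]
    by (auto intro!: closed_Int_compact exI[of _ "inverse (norm x) *\<^sub>R x"] simp: set_eq_iff)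
  have "continuous_on ?K (\<lambda>x. norm (f x))"
    using lin by (intro continuous_intros linear_continuous_on) (simp add: linear_conv_bounded_linear)
  from continuous_attains_sup[OF K this]
  obtain e where e: "e \<in> S" "norm e = 1" and max: "\<And>y. y \<in> S \<Longrightarrow> norm y = 1 \<Longrightarrow> norm (f y) \<le> norm (f e)"
    by auto
  have maxy: "(norm (f y))\<^sup>2 \<le> (norm (f e))\<^sup>2 * (norm y)\<^sup>2" if "y \<in> S" for y
  proof (cases "y = 0")
    case True then show ?thesis using linear_0[OF lin] by simp
  next
    case False
    have "norm (f (inverse (norm y) *\<^sub>R y)) \<le> norm (f e)"
      by (rule max) (use that False subspace_scale[OF Suc.prems] in auto)
    then have "norm (f y) \<le> norm (f e) * norm y"
      using False by (simp add: linear_cmul[OF lin] field_simps)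
    then show ?thesis by (metis norm_ge_zero power_mono power_mult_distrib)
  qed
  have orth: "f e \<bullet> f v = 0" if "v \<in> S" "e \<bullet> v = 0" for v
  proof (rule ccontr)
    assume ne: "f e \<bullet> f v \<noteq> 0"
    define \<alpha> where "\<alpha> = f e \<bullet> f v"
    define K where "K = (norm (f e))\<^sup>2 * (norm v)\<^sup>2 - (norm (f v))\<^sup>2"
    have ineq: "2 * t * \<alpha> \<le> t\<^sup>2 * K" for t
    proof -
      have "(norm (f (e + t *\<^sub>R v)))\<^sup>2 \<le> (norm (f e))\<^sup>2 * (norm (e + t *\<^sub>R v))\<^sup>2"
        by (intro maxy subspace_add subspace_scale Suc.prems e that)
      moreover have "(norm (e + t *\<^sub>R v))\<^sup>2 = 1 + t\<^sup>2 * (norm v)\<^sup>2"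
        using e that unfolding power2_norm_eq_inner
        by (simp add: inner_add_left inner_add_right inner_commute power2_eq_square norm_eq_1)
      moreover have "(norm (f (e + t *\<^sub>R v)))\<^sup>2 = (norm (f e))\<^sup>2 + 2 * t * \<alpha> + t\<^sup>2 * (norm (f v))\<^sup>2"
        unfolding power2_norm_eq_inner linear_add[OF lin] linear_cmul[OF lin]
        by (simp add: inner_add_left inner_add_right inner_commute power2_eq_square \<alpha>_def algebra_simps)
      ultimately show ?thesis by (simp add: K_def algebra_simps)
    qed
    \<comment> \<open>Any step t = s \<alpha> with s K < 1 lets the linear term 2 t \<alpha> beat
      the quadratic one; the 1 keeps the denominator positive.\<close>
    define s where "s = 1 / (\<bar>K\<bar> + 1)"
    have s: "s > 0" "s * K < 1" by (auto simp: s_def field_simps)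
    from ineq[of "s * \<alpha>"] have "2 * s * \<alpha>\<^sup>2 \<le> s * \<alpha>\<^sup>2 * (s * K)"
      by (simp add: power2_eq_square algebra_simps)
    also have "\<dots> \<le> s * \<alpha>\<^sup>2 * 1" using s by (intro mult_left_mono) auto
    finally show False using s ne by (simp add: \<alpha>_def)
  qed
  let ?S = "S \<inter> {x. e \<bullet> x = 0}"
  have subS: "subspace ?S" using Suc.prems subspace_hyperplane subspace_inter by blast
  have "dim {y \<in> S. \<forall>x\<in>span {e}. orthogonal x y} + dim (span {e}) = dim S"
    by (rule dim_subspace_orthogonal_to_vectors) (use e Suc.prems span_minimal[of "{e}" S] in auto)
  moreover have "{y \<in> S. \<forall>x\<in>span {e}. orthogonal x y} = ?S"
    by (auto simp: span_singleton orthogonal_def)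
  moreover have "dim {e} = 1" using e by (metis dim_singleton norm_zero zero_neq_one)
  ultimately have "d = dim ?S" using Suc.hyps(2) by simp
  from Suc.hyps(1)[OF this subS] obtain B where B: "B \<subseteq> ?S" "finite B" "card B = dim ?S" "\<forall>b\<in>B. norm b = 1"
    "\<forall>b\<in>B. \<forall>c\<in>B. b \<noteq> c \<longrightarrow> b \<bullet> c = 0 \<and> f b \<bullet> f c = 0" by blast
  have "e \<notin> B" using B(1) e by (auto simp: norm_eq_1)
  then show ?case
    using B e orth \<open>d = dim ?S\<close> Suc.hyps(2)
    by (intro exI[of _ "insert e B"]) (auto simp: inner_commute subset_eq)
qed

lemma orthonormal_frame_orthogonal_image:
  fixes f :: "real^'n \<Rightarrow> real^'n"
  assumes "linear f"
  obtains w where "orthonormal_frame w" "\<And>i j. i \<noteq> j \<Longrightarrow> f (w i) \<bullet> f (w j) = 0"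
proof -
  obtain B :: "(real^'n) set" where B: "finite B" "card B = dim (UNIV :: (real^'n) set)" "\<forall>b\<in>B. norm b = 1"
    "\<forall>b\<in>B. \<forall>c\<in>B. b \<noteq> c \<longrightarrow> b \<bullet> c = 0 \<and> f b \<bullet> f c = 0"
    using orthogonal_basis_with_orthogonal_image[OF assms, of UNIV] by auto
  then have "card (UNIV :: 'n set) = card B" by simp
  then obtain w where "bij_betw w (UNIV :: 'n set) B" using B(1) by (meson finite finite_same_card_bij)
  then have w: "inj w" "\<And>i. w i \<in> B" by (auto simp: bij_betw_def)
  show thesis
  proof
    show "orthonormal_frame w"
      unfolding orthonormal_frame_def using B w by (auto simp: norm_eq_1 inj_eq)
    show "f (w i) \<bullet> f (w j) = 0" if "i \<noteq> j" for i j
      using B w that by (metis injD)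
  qed
qed

text \<open>The prescribed vector \<open>\<nu>\<close> is in general not a singular vector of
  \<open>f\<close>, so orthogonality of images can be arranged only among the remaining vectors,
  within the hyperplane orthogonal to \<open>\<nu>\<close>.\<close>

lemma orthonormal_frame_extending:
  fixes f :: "real^'n \<Rightarrow> real^'n"
  assumes "linear f" and \<nu>: "norm \<nu> = 1"
  obtains w where "orthonormal_frame w" "w k = \<nu>"
    "\<And>i j. i \<noteq> k \<Longrightarrow> j \<noteq> k \<Longrightarrow> i \<noteq> j \<Longrightarrow> f (w i) \<bullet> f (w j) = 0"
proof -
  obtain B :: "(real^'n) set" where B: "B \<subseteq> {x. \<nu> \<bullet> x = 0}" "finite B" "card B = dim {x. \<nu> \<bullet> x = 0}" "\<forall>b\<in>B. norm b = 1"
    "\<forall>b\<in>B. \<forall>c\<in>B. b \<noteq> c \<longrightarrow> b \<bullet> c = 0 \<and> f b \<bullet> f c = 0"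
    using orthogonal_basis_with_orthogonal_image[OF assms(1) subspace_hyperplane] by blast
  have "\<nu> \<noteq> 0" using \<nu> by auto
  then have "card (UNIV - {k}) = card B" using B(3) by (simp add: dim_hyperplane)
  then obtain v where "bij_betw v (UNIV - {k}) B" using B(2) by (meson finite finite_same_card_bij)
  then have v: "inj_on v (UNIV - {k})" "\<And>i. i \<noteq> k \<Longrightarrow> v i \<in> B" by (auto simp: bij_betw_def)
  let ?w = "v(k := \<nu>)"
  have vv: "v i \<noteq> v j" if "i \<noteq> k" "j \<noteq> k" "i \<noteq> j" for i j using v(1) that by (auto simp: inj_on_def)
  show thesis
  proof
    have "v i \<bullet> v j = 0" if "i \<noteq> k" "j \<noteq> k" "i \<noteq> j" for i j using vv[OF that] B(5) v(2) that by blast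
    moreover have "\<nu> \<bullet> v i = 0" if "i \<noteq> k" for i using v(2)[OF that] B(1) by blast
    ultimately show "orthonormal_frame ?w"
      unfolding orthonormal_frame_def using B(4) v(2) \<nu> by (auto simp: norm_eq_1 inner_commute)
    show "f (?w i) \<bullet> f (?w j) = 0" if "i \<noteq> k" "j \<noteq> k" "i \<noteq> j" for i j
      using vv[OF that] B(5) v(2) that by auto
  qed auto
qed

section \<open>Determinants and norms expressed in a frame\<close>

lemma orthonormal_frame_norm [simp]: "orthonormal_frame w \<Longrightarrow> norm (w i) = 1"
  by (simp add: orthonormal_frame_def norm_eq_1)

lemma orthonormal_frame_matrix:
  assumes "orthonormal_frame w" shows "orthogonal_matrix (\<chi> i. w i)"
proof -
  have "(\<chi> i. w i) ** transpose (\<chi> i. w i) = mat 1"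
    using assms by (auto simp: orthonormal_frame_def vec_eq_iff transpose_def mat_def inner_vec_def matrix_matrix_mult_def)
  then show ?thesis by (simp add: orthogonal_matrix_def matrix_left_right_inverse)
qed

lemma orthonormal_frame_det:
  assumes "orthonormal_frame w" shows "\<bar>det (\<chi> i. w i)\<bar> = 1"
  using det_orthogonal_matrix[OF orthonormal_frame_matrix[OF assms]] by auto

lemma orthonormal_frame_expansion:
  assumes "orthonormal_frame w" shows "(\<Sum>i\<in>UNIV. (x \<bullet> w i) *\<^sub>R w i) = x"
proof -
  have "transpose (\<chi> i. w i) ** (\<chi> i. w i) = mat 1"
    using orthonormal_frame_matrix[OF assms] by (simp add: orthogonal_matrix_def)
  then have "transpose (\<chi> i. w i) *v ((\<chi> i. w i) *v x) = x" by (simp add: matrix_vector_mul_assoc)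
  moreover have "(\<chi> i. w i) *v x = (\<chi> i. x \<bullet> w i)"
    by (simp add: matrix_vector_mult_def inner_vec_def mult.commute)
  moreover have "transpose (\<chi> i. w i) *v (\<chi> i. x \<bullet> w i) = (\<Sum>i\<in>UNIV. (x \<bullet> w i) *\<^sub>R w i)"
    by (simp add: matrix_vector_mult_def transpose_def vec_eq_iff mult.commute)
  ultimately show ?thesis by simp
qed

text \<open>A permutation other than the identity moves at least two indices, hence one different
  from \<open>k\<close>, and there the corresponding factor is zero.\<close>

lemma det_diagonal_but_row:
  fixes M :: "real^'n^'n"
  assumes "\<And>i j. i \<noteq> k \<Longrightarrow> j \<noteq> i \<Longrightarrow> M $ i $ j = 0"
  shows "det M = (\<Prod>i\<in>UNIV. M $ i $ i)"
proof -
  have "(\<Prod>i\<in>UNIV. M $ i $ p i) = 0" if p: "p permutes UNIV" "p \<noteq> id" for p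
  proof -
    obtain i where i: "p i \<noteq> i" using p(2) by (auto simp: fun_eq_iff)
    have "\<exists>i. i \<noteq> k \<and> p i \<noteq> i"
      using i permutes_inj[OF p(1)] by (metis injD)
    then show ?thesis using assms by (metis finite prod_zero UNIV_I)
  qed
  then have "det M = (\<Sum>p\<in>{id}. of_int (sign p) * (\<Prod>i\<in>UNIV. M $ i $ p i))"
    unfolding det_def by (intro sum.mono_neutral_right) (auto simp: permutes_id)
  then show ?thesis by simp
qed

lemma det_adjoint_frame:
  fixes A :: "real^'n \<Rightarrow> real^'n"
  assumes "linear A" "orthonormal_frame w"
  shows "\<bar>det (\<chi> i. adjoint A (w i))\<bar> = \<bar>det (matrix A)\<bar>"
proof -
  have adj: "adjoint A x = transpose (matrix A) *v x" for x
    using adjoint_matrix[of "matrix A"] matrix_vector_mul(2)[OF assms(1)] by metis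
  have "(\<chi> i. adjoint A (w i)) = (\<chi> i. w i) ** matrix A"
    by (simp add: adj vec_eq_iff matrix_matrix_mult_def matrix_vector_mult_def transpose_def mult.commute)
  then show ?thesis using orthonormal_frame_det[OF assms(2)] by (simp add: det_mul abs_mult)
qed

lemma prod_power2_sqrt: "x\<^sup>2 = (\<Prod>i\<in>I. (f i)\<^sup>2) \<Longrightarrow> (\<And>i. i \<in> I \<Longrightarrow> f i \<ge> 0) \<Longrightarrow> \<bar>x\<bar> = (\<Prod>i\<in>I. f i :: real)"
  by (metis abs_of_nonneg power2_eq_iff_nonneg prod_nonneg prod_power_distrib abs_ge_zero power2_abs)

lemma abs_det_orthogonal_rows:
  fixes R :: "'n \<Rightarrow> real^'n"
  assumes "\<And>i j. i \<noteq> j \<Longrightarrow> R i \<bullet> R j = 0"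
  shows "\<bar>det (\<chi> i. R i)\<bar> = (\<Prod>i\<in>UNIV. norm (R i))"
proof (rule prod_power2_sqrt)
  have "det ((\<chi> i. R i) ** transpose (\<chi> i. R i)) = (\<Prod>i\<in>UNIV. (norm (R i))\<^sup>2)"
    by (subst det_diagonal_but_row)
      (use assms in \<open>auto simp: matrix_matrix_mult_def transpose_def inner_vec_def power2_norm_eq_inner\<close>)
  then show "(det (\<chi> i. R i))\<^sup>2 = (\<Prod>i\<in>UNIV. (norm (R i))\<^sup>2)"
    by (simp add: det_mul power2_eq_square)
qed auto

lemma adjoint_nz:
  fixes A :: "real^'n \<Rightarrow> real^'n"
  assumes "linear A" "bij A" "w \<noteq> 0" shows "adjoint A w \<noteq> 0"
proof
  assume 0: "adjoint A w = 0"
  obtain x where "A x = w" using assms(2) by (metis bij_pointE)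
  then have "w \<bullet> w = x \<bullet> adjoint A w" using adjoint_works[OF assms(1)] by metis
  then show False using 0 assms(3) by simp
qed

text \<open>Put R_i = A^T w_i. Since A m = w_k, the vector \<open>m\<close> is dual to the R_i: its
  inner product with R_i is 1 for i = k and 0 otherwise. Replacing R_k by \<open>m\<close> gives
  orthogonal rows \<open>Z\<close>, with |det Z| = |m| p, where p is the product on the left. On the
  other hand R Z^T is diagonal except in row \<open>k\<close> and has determinant p^2. Dividing
  gives p = |m| |det A|.\<close>

lemma prod_norm_adjoint_frame:
  fixes A :: "real^'n \<Rightarrow> real^'n"
  assumes lin: "linear A" and bij: "bij A" and w: "orthonormal_frame w" "A m = w k"
    and orth: "\<And>i j. i \<noteq> k \<Longrightarrow> j \<noteq> k \<Longrightarrow> i \<noteq> j \<Longrightarrow> adjoint A (w i) \<bullet> adjoint A (w j) = 0"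
  shows "(\<Prod>i\<in>UNIV - {k}. norm (adjoint A (w i))) = norm m * \<bar>det (matrix A)\<bar>"
proof -
  define R where "R = (\<lambda>i. adjoint A (w i))"
  define Z where "Z = (\<lambda>i. if i = k then m else R i)"
  define p where "p = (\<Prod>i\<in>UNIV - {k}. norm (R i))"
  have Rm: "R i \<bullet> m = (if i = k then 1 else 0)" for i
    unfolding R_def using adjoint_works[OF lin, of m "w i"] w by (simp add: inner_commute orthonormal_frame_def)
  have split: "(\<Prod>i\<in>UNIV. g i) = g k * (\<Prod>i\<in>UNIV - {k}. g i)" for g :: "'n \<Rightarrow> real"
    by (simp add: prod.remove)
  have RZ: "((\<chi> i. R i) ** transpose (\<chi> i. Z i)) $ i $ j = R i \<bullet> Z j" for i j
    by (simp add: matrix_matrix_mult_def transpose_def inner_vec_def)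
  have RZ0: "R i \<bullet> Z j = 0" if "i \<noteq> k" "j \<noteq> i" for i j
    using orth[of i j] Rm[of i] that by (simp add: Z_def R_def)
  have "det ((\<chi> i. R i) ** transpose (\<chi> i. Z i)) = (\<Prod>i\<in>UNIV. R i \<bullet> Z i)"
    by (subst det_diagonal_but_row[of k]) (simp_all add: RZ RZ0)
  also have "\<dots> = p\<^sup>2"
    unfolding split p_def prod_power_distrib[symmetric] by (simp add: Z_def Rm power2_norm_eq_inner prod_power_distrib)
  finally have 1: "det (\<chi> i. R i) * det (\<chi> i. Z i) = p\<^sup>2" by (simp add: det_mul)
  have "\<bar>det (\<chi> i. Z i)\<bar> = (\<Prod>i\<in>UNIV. norm (Z i))"
    by (rule abs_det_orthogonal_rows) (use orth Rm in \<open>auto simp: Z_def R_def inner_commute\<close>)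
  also have "\<dots> = norm m * p" unfolding split p_def by (simp add: Z_def)
  finally have 2: "\<bar>det (\<chi> i. Z i)\<bar> = norm m * p" .
  have "p > 0" unfolding p_def R_def
    using adjoint_nz[OF lin bij] w by (intro prod_pos) (metis norm_eq_zero orthonormal_frame_norm zero_less_norm_iff zero_neq_one)
  moreover have "\<bar>det (\<chi> i. R i)\<bar> * (norm m * p) = p\<^sup>2"
    using 1 2 by (metis abs_mult abs_power2)
  ultimately have "p = norm m * \<bar>det (\<chi> i. R i)\<bar>" by (simp add: power2_eq_square field_simps)
  then show ?thesis using det_adjoint_frame[OF lin w(1)] by (simp add: p_def R_def)
qed

text \<open>There are n half-open intervals from \<rho>^(k+1) to \<rho>^k with k < n. The value 1 at
  \<open>m\<close> lies in none of them, so the other n - 1 indices leave one interval empty; \<tau>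
  is its upper end. The last conclusion records k + 1 \<le> n, which later lets 1 - t = \<rho>^n be
  absorbed into \<rho> \<tau>.\<close>

lemma gap_in_sizes:
  fixes \<omega> :: "'n::finite \<Rightarrow> real"
  assumes m: "\<bar>\<omega> m\<bar> = 1" and \<rho>: "0 < \<rho>" "\<rho> < 1"
  obtains \<tau> I where "m \<in> I" "0 < \<tau>" "\<And>i. i \<in> I \<Longrightarrow> \<tau> \<le> \<bar>\<omega> i\<bar>" "\<And>i. i \<notin> I \<Longrightarrow> \<bar>\<omega> i\<bar> \<le> \<rho> * \<tau>"
    "\<rho> ^ CARD('n) \<le> \<rho> * \<tau>"
proof -
  have "\<exists>k<CARD('n). \<forall>i. \<not> (\<rho> ^ Suc k \<le> \<bar>\<omega> i\<bar> \<and> \<bar>\<omega> i\<bar> < \<rho> ^ k)"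
  proof (rule ccontr)
    assume "\<not> ?thesis"
    then obtain i where i: "\<And>k. k < CARD('n) \<Longrightarrow> \<rho> ^ Suc k \<le> \<bar>\<omega> (i k)\<bar> \<and> \<bar>\<omega> (i k)\<bar> < \<rho> ^ k" by metis
    have neq: "i k \<noteq> i l" if "k < l" "l < CARD('n)" for k l
    proof
      assume "i k = i l"
      moreover have "\<rho> ^ l \<le> \<rho> ^ Suc k" using that \<rho> by (intro power_decreasing) auto
      ultimately show False using i[of k] i[of l] that by force
    qed
    have "inj_on i {..<CARD('n)}"
      by (rule inj_onI) (metis lessThan_iff linorder_neqE_nat neq)
    moreover have "i ` {..<CARD('n)} \<subseteq> UNIV - {m}"
    proof clarsimp
      fix k assume "k < CARD('n)" "m = i k"
      then have "1 < \<rho> ^ k" using i[of k] m by simp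
      then show False using \<rho> power_le_one[of \<rho> k] by simp
    qed
    ultimately have "CARD('n) \<le> card (UNIV - {m})"
      by (metis card_inj_on_le card_lessThan finite)
    then show False by (simp add: card_Diff_singleton) (metis One_nat_def Suc_pred' UNIV_I card_gt_0_iff diff_less empty_iff finite leD zero_less_Suc zero_less_one)
  qed
  then obtain k where k: "k < CARD('n)" "\<And>i. \<not> (\<rho> ^ Suc k \<le> \<bar>\<omega> i\<bar> \<and> \<bar>\<omega> i\<bar> < \<rho> ^ k)" by blast
  show thesis
  proof
    show "m \<in> {i. \<rho> ^ k \<le> \<bar>\<omega> i\<bar>}" using m \<rho> by (simp add: power_le_one)
    show "0 < \<rho> ^ k" using \<rho> by simp
    show "\<bar>\<omega> i\<bar> \<le> \<rho> * \<rho> ^ k" if "i \<notin> {i. \<rho> ^ k \<le> \<bar>\<omega> i\<bar>}" for i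
      using k(2)[of i] that by (auto simp: not_le)
    show "\<rho> ^ CARD('n) \<le> \<rho> * \<rho> ^ k"
      using k(1) \<rho> power_decreasing[of "Suc k" "CARD('n)" \<rho>] by simp
  qed auto
qed

section \<open>Inscribed simplices of maximal volume and the widths they control\<close>

lemma continuous_on_det:
  fixes M :: "'a::topological_space \<Rightarrow> real^'n^'n"
  assumes "\<And>i j. continuous_on S (\<lambda>x. M x $ i $ j)"
  shows "continuous_on S (\<lambda>x. det (M x))"
  unfolding det_def by (intro continuous_intros assms)

text \<open>With the vertex \<open>x0\<close> fixed in the interior, maximise |det| over matrices
  whose rows lead from \<open>x0\<close> to points of \<open>Q\<close>. By Cramer's rule, replacing
  row \<open>k\<close> by x - x0 multiplies the determinant by the coordinate \<open>l $ k\<close>,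
  so maximality forces |l_k| \<le> 1. A small multiple of the identity is admissible, which makes
  the maximum nonzero.\<close>

lemma inscribed_simplex:
  fixes Q :: "(real^'n) set"
  assumes Q: "compact Q" "interior Q \<noteq> {}"
  obtains x0 and v :: "real^'n^'n" where "x0 \<in> Q" "\<And>i. x0 + v $ i \<in> Q" "det v \<noteq> 0"
    "\<And>x. x \<in> Q \<Longrightarrow> \<exists>l::real^'n. (\<forall>i. \<bar>l $ i\<bar> \<le> 1) \<and> x = x0 + transpose v *v l"
proof -
  obtain x0 r where r: "r > 0" "cball x0 r \<subseteq> Q"
    using Q(2) by (auto simp: mem_interior_cball set_eq_iff)
  then have x0: "x0 \<in> Q" by auto
  define K :: "(real^'n^'n) set" where "K = {X. \<forall>i. x0 + X $ i \<in> Q}"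
  have "K = (\<Inter>i. (\<lambda>X. x0 + X $ i) -` Q)" by (auto simp: K_def)
  moreover have "closed ((\<lambda>X::real^'n^'n. x0 + X $ i) -` Q)" for i
    by (rule closed_vimage) (use Q in \<open>auto intro!: continuous_intros compact_imp_closed\<close>)
  ultimately have "closed K" by auto
  obtain B where B: "\<And>x. x \<in> Q \<Longrightarrow> norm x \<le> B" using compact_imp_bounded[OF Q(1)] by (auto simp: bounded_iff)
  have "norm X \<le> (\<Sum>i\<in>(UNIV::'n set). B + norm x0)" if "X \<in> K" for X
  proof -
    have "norm (X $ i) \<le> B + norm x0" for i
      using that B[of "x0 + X $ i"] norm_triangle_ineq4[of "x0 + X $ i" x0] by (auto simp: K_def)
    then have "(\<Sum>i\<in>UNIV. norm (X $ i)) \<le> (\<Sum>i\<in>(UNIV::'n set). B + norm x0)" by (intro sum_mono) auto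
    moreover have "norm X \<le> (\<Sum>i\<in>UNIV. norm (X $ i))"
      unfolding norm_vec_def by (rule L2_set_le_sum) auto
    ultimately show ?thesis by linarith
  qed
  then have "bounded K" unfolding bounded_iff by blast
  with \<open>closed K\<close> have "compact K" using compact_eq_bounded_closed by blast
  have X0: "mat r \<in> K"
  proof -
    have "(mat r :: real^'n^'n) $ i = r *\<^sub>R axis i 1" for i by (auto simp: mat_def axis_def vec_eq_iff)
    then show ?thesis using r unfolding K_def
      by (auto simp: dist_norm intro!: subsetD[OF r(2)])
  qed
  have "continuous_on K (\<lambda>X. \<bar>det X\<bar>)"
    by (intro continuous_intros continuous_on_det)
  from continuous_attains_sup[OF \<open>compact K\<close> _ this] X0
  obtain v where v: "v \<in> K" and max: "\<And>X. X \<in> K \<Longrightarrow> \<bar>det X\<bar> \<le> \<bar>det v\<bar>" by blast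
  have "det (mat r :: real^'n^'n) = r ^ CARD('n)"
    by (subst det_diagonal) (auto simp: mat_def)
  then have "0 < \<bar>det (mat r :: real^'n^'n)\<bar>" using r by simp
  then have det: "det v \<noteq> 0" using max[OF X0] by auto
  show thesis
  proof
    show "x0 \<in> Q" by (rule x0)
    show "x0 + v $ i \<in> Q" for i using v by (auto simp: K_def)
    show "det v \<noteq> 0" by (rule det)
    fix x assume x: "x \<in> Q"
    have "invertible (transpose v)" using det by (simp add: invertible_det_nz)
    then obtain l where l: "transpose v *v l = x - x0"
      by (metis invertible_def matrix_vector_mul_assoc matrix_vector_mul_lid)
    have "\<bar>l $ k\<bar> \<le> 1" for k
    proof -
      define X where "X = (\<chi> i. if i = k then x - x0 else v $ i)"
      have "(\<Sum>i\<in>UNIV. l $ i *s row i v) = x - x0"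
        unfolding l[symmetric] by (simp add: matrix_vector_mult_def transpose_def row_def vec_eq_iff mult.commute)
      then have "(\<chi> i. if i = k then (\<Sum>i\<in>UNIV. l $ i *s row i v) else row i v) = X"
        by (auto simp: X_def row_def vec_eq_iff)
      with cramer_lemma_transpose[of k l v] have "det X = l $ k * det v" by simp
      moreover have "X \<in> K" using v x by (auto simp: K_def X_def)
      ultimately have "\<bar>l $ k\<bar> * \<bar>det v\<bar> \<le> 1 * \<bar>det v\<bar>" using max[of X] by (simp add: abs_mult)
      then show ?thesis using det by (metis mult_right_le_imp_le zero_less_abs_iff)
    qed
    then show "\<exists>l::real^'n. (\<forall>i. \<bar>l $ i\<bar> \<le> 1) \<and> x = x0 + transpose v *v l"
      using l by (intro exI[of _ l]) auto
  qed
qed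

definition simplex_content :: "'n::finite itself \<Rightarrow> real" where
  "simplex_content _ = measure lebesgue (convex hull (insert 0 (range (\<lambda>i. axis i (1::real)))) :: (real^'n) set)"

lemma simplex_content_pos: "simplex_content TYPE('n::finite) > 0"
proof -
  have "range (\<lambda>i::'n. axis i (1::real)) = Basis" by (auto simp: Basis_vec_def)
  then have "simplex_content TYPE('n) = measure lborel (convex hull (insert 0 Basis :: (real^'n) set))"
    unfolding simplex_content_def by (simp add: measure_completion finite_imp_compact_convex_hull borel_compact)
  then show ?thesis by (simp add: content_std_simplex)
qed

lemma emeasure_simplex:
  fixes v :: "real^'n^'n"
  shows "emeasure lebesgue (convex hull (insert x0 (range (\<lambda>i. x0 + v $ i)))) = ennreal (simplex_content TYPE('n) * \<bar>det v\<bar>)"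
proof -
  let ?f = "(*v) (transpose v)" and ?S = "convex hull (insert 0 (range (\<lambda>i. axis i 1))) :: (real^'n) set"
  have cS: "compact ?S" by (intro finite_imp_compact_convex_hull) auto
  have f: "?f (axis i 1) = v $ i" for i
    by (simp add: matrix_vector_mult_basis column_transpose row_def vec_eq_iff)
  have "insert x0 (range (\<lambda>i. x0 + v $ i)) = (+) x0 ` ?f ` (insert 0 (range (\<lambda>i. axis i 1)))"
    unfolding image_insert image_image f by simp
  then have "convex hull (insert x0 (range (\<lambda>i. x0 + v $ i))) = (+) x0 ` ?f ` ?S"
    by (simp only: convex_hull_translation convex_hull_linear_image[OF matrix_vector_mul_linear])
  moreover have "emeasure lebesgue ((+) x0 ` ?f ` ?S) = emeasure lebesgue (?f ` ?S)"
  proof -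
    have "compact (?f ` ?S)" by (intro compact_continuous_image cS linear_continuous_on) auto
    then have m: "?f ` ?S \<in> lmeasurable" by (rule lmeasurable_compact)
    then have "(+) x0 ` ?f ` ?S \<in> lmeasurable" by (rule measurable_translation)
    then show ?thesis using m by (simp add: emeasure_eq_measure2 measure_translation)
  qed
  moreover have "emeasure lebesgue (?f ` ?S) = ennreal \<bar>det v\<bar> * emeasure lebesgue ?S"
    using emeasure_linear_image[of ?f ?S] cS by (simp add: matrix_of_matrix_vector_mul)
  moreover have "emeasure lebesgue ?S = ennreal (simplex_content TYPE('n))"
    unfolding simplex_content_def using lmeasurable_compact[OF cS] by (simp add: emeasure_eq_measure2)
  ultimately show ?thesis by (simp add: ennreal_mult simplex_content_def mult.commute)
qed

text \<open>The frame consists of singular vectors of the simplex matrix \<open>v\<close>, so the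
  product of the |v w_i| is exactly |det v|, which is the volume of a simplex inside
  \<open>Q\<close> up to \<open>simplex_content\<close>. Two points of \<open>Q\<close> differ by
  v^T (l - l') with coordinates of l - l' at most 2, hence of norm at most 2n; this is the factor 2n
  in each width.\<close>

lemma frame_widths:
  fixes Q :: "(real^'n) set"
  assumes Q: "compact Q" "convex Q" "interior Q \<noteq> {}" and q: "q \<in> Q"
  obtains w d where "orthonormal_frame w" "\<And>i x. x \<in> Q \<Longrightarrow> w i \<bullet> (x - q) \<le> d i" "\<And>i. d i \<ge> 0"
    "(\<Prod>i\<in>UNIV. d i) \<le> (2 * real CARD('n)) ^ CARD('n) / simplex_content TYPE('n) * measure lebesgue Q"
proof -
  let ?n = "real CARD('n)"
  from inscribed_simplex[OF Q(1,3)] obtain x0 and v :: "real^'n^'n" where v: "x0 \<in> Q" "\<And>i. x0 + v $ i \<in> Q" "det v \<noteq> 0"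
    "\<And>x. x \<in> Q \<Longrightarrow> \<exists>l::real^'n. (\<forall>i. \<bar>l $ i\<bar> \<le> 1) \<and> x = x0 + transpose v *v l" by metis
  obtain w where w: "orthonormal_frame w" "\<And>i j. i \<noteq> j \<Longrightarrow> (v *v w i) \<bullet> (v *v w j) = 0"
    using orthonormal_frame_orthogonal_image[of "(*v) v"] by auto
  define d where "d = (\<lambda>i. 2 * ?n * norm (v *v w i))"
  have width: "w i \<bullet> (x - q) \<le> d i" if x: "x \<in> Q" for i x
  proof -
    obtain l l' where l: "\<forall>i. \<bar>l $ i\<bar> \<le> 1" "x = x0 + transpose v *v l" and l': "\<forall>i. \<bar>l' $ i\<bar> \<le> 1" "q = x0 + transpose v *v l'"
      using v(4)[OF x] v(4)[OF q] by blast
    have "x - q = transpose v *v (l - l')" using l l' by (simp add: matrix_vector_mult_diff_distrib)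
    then have "w i \<bullet> (x - q) = (v *v w i) \<bullet> (l - l')"
      by (metis dot_lmul_matrix inner_commute transpose_matrix_vector)
    also have "\<dots> \<le> norm (v *v w i) * norm (l - l')" by (rule norm_cauchy_schwarz)
    finally have le: "w i \<bullet> (x - q) \<le> norm (v *v w i) * norm (l - l')" .
    have "norm (l - l') \<le> (\<Sum>i\<in>UNIV. \<bar>(l - l') $ i\<bar>)" by (rule norm_le_l1_cart)
    also have "\<dots> \<le> (\<Sum>i\<in>(UNIV::'n set). 2)"
    proof (rule sum_mono)
      fix i show "\<bar>(l - l') $ i\<bar> \<le> 2" using l(1)[rule_format, of i] l'(1)[rule_format, of i] by simp
    qed
    finally have "norm (l - l') \<le> 2 * ?n" by simp
    then have "norm (v *v w i) * norm (l - l') \<le> d i" unfolding d_def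
      by (metis mult.commute mult_right_mono norm_ge_zero)
    with le show ?thesis by linarith
  qed
  have "(\<Prod>i\<in>UNIV. norm (v *v w i)) = \<bar>det (\<chi> i. v *v w i)\<bar>"
    using abs_det_orthogonal_rows[of "\<lambda>i. v *v w i"] w by simp
  also have "(\<chi> i. v *v w i) = (\<chi> i. w i) ** transpose v"
    by (simp add: vec_eq_iff matrix_matrix_mult_def matrix_vector_mult_def transpose_def mult.commute)
  also have "\<bar>det \<dots>\<bar> = \<bar>det v\<bar>" using orthonormal_frame_det[OF w(1)] by (simp add: det_mul abs_mult)
  finally have pd: "(\<Prod>i\<in>UNIV. d i) = (2 * ?n) ^ CARD('n) * \<bar>det v\<bar>" by (simp add: d_def prod.distrib)
  have "convex hull (insert x0 (range (\<lambda>i. x0 + v $ i))) \<subseteq> Q"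
    using v by (intro hull_minimal Q) auto
  then have "ennreal (simplex_content TYPE('n) * \<bar>det v\<bar>) \<le> emeasure lebesgue Q"
    unfolding emeasure_simplex[of x0 v, symmetric] by (rule emeasure_mono) (use lmeasurable_compact[OF Q(1)] in auto)
  also have "\<dots> = ennreal (measure lebesgue Q)" using lmeasurable_compact[OF Q(1)] by (simp add: emeasure_eq_measure2)
  finally have "simplex_content TYPE('n) * \<bar>det v\<bar> \<le> measure lebesgue Q" by simp
  then have "\<bar>det v\<bar> \<le> measure lebesgue Q / simplex_content TYPE('n)"
    using simplex_content_pos[where 'n='n] by (simp add: field_simps)
  then have "(\<Prod>i\<in>UNIV. d i) \<le> (2 * ?n) ^ CARD('n) / simplex_content TYPE('n) * measure lebesgue Q"
    unfolding pd times_divide_eq_left times_divide_eq_right[symmetric] by (rule mult_left_mono) auto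
  then show thesis using that[of w d] w width by (simp add: d_def)
qed

section \<open>Frames adapted to a point near the boundary\<close>

lemma adjoint_diff_inner:
  fixes A :: "real^'n \<Rightarrow> real^'n"
  assumes "linear A" "norm b \<le> r" "norm b' \<le> r"
  shows "w \<bullet> ((a + A b) - (a + A b')) \<le> norm (adjoint A w) * (2 * r)"
proof -
  have "w \<bullet> ((a + A b) - (a + A b')) = (b - b') \<bullet> adjoint A w"
    using adjoint_works[OF assms(1), of "b - b'" w] by (simp add: linear_diff[OF assms(1)] inner_commute)
  also have "\<dots> \<le> norm (b - b') * norm (adjoint A w)" by (rule norm_cauchy_schwarz)
  also have "\<dots> \<le> 2 * r * norm (adjoint A w)"
    using norm_triangle_ineq4[of b b'] assms by (intro mult_right_mono) auto
  finally show ?thesis by (simp add: mult.commute)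
qed

text \<open>
  A supporting normal at \<open>z\<close> may be badly skew to the axes of the ellipsoid. Dropping its small
  coordinates, measured relative to the axes, costs little in the distance to \<open>q\<close> and makes the
  remaining coordinates comparable; a pigeonhole argument finds a gap in their sizes.
\<close>

lemma close_supporting_direction:
  fixes A :: "real^'n \<Rightarrow> real^'n"
  assumes lin: "linear A" and bij: "bij A"
    and Q: "Q \<subseteq> (\<lambda>v. a + A v) ` cball 0 (real CARD('n))" and z: "z \<in> Q"
    and \<nu>0: "\<nu>0 \<noteq> 0" "\<And>x. x \<in> Q \<Longrightarrow> \<nu>0 \<bullet> x \<le> \<nu>0 \<bullet> z"
    and q: "q \<in> Q" "q = a + t *\<^sub>R (z - a)" and t: "0 < t" "t < 1"
  obtains \<nu> m where "norm \<nu> = 1" "A m = \<nu>"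
    "\<And>x. x \<in> Q \<Longrightarrow> \<nu> \<bullet> (x - q) * norm m \<le> 3 * (real CARD('n))\<^sup>2 * (1 - t) powr (1 / real CARD('n))"
proof -
  let ?n = "real CARD('n)"
  let ?T = "adjoint A"
  have n: "?n \<ge> 1" by (simp add: Suc_le_eq)
  obtain e where e: "orthonormal_frame e" "\<And>i j. i \<noteq> j \<Longrightarrow> ?T (e i) \<bullet> ?T (e j) = 0"
    using orthonormal_frame_orthogonal_image[OF adjoint_linear[OF lin]] by blast
  \<comment> \<open>The \<open>e i\<close> are the axes of the ellipsoid and |g i| are its
    semi-axes, as \<open>Ag\<close> shows: \<open>A\<close> maps \<open>g i\<close> to |g i|^2 times
    \<open>e i\<close>.\<close>
  define g where "g = (\<lambda>i. ?T (e i))"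
  have gpos: "norm (g i) > 0" for i
    using adjoint_nz[OF lin bij, of "e i"] orthonormal_frame_norm[OF e(1), of i] unfolding g_def
    by (metis norm_zero zero_less_norm_iff zero_neq_one)
  have Ag: "A (g i) = (norm (g i))\<^sup>2 *\<^sub>R e i" for i
  proof -
    have "A (g i) \<bullet> e j = (if i = j then (norm (g i))\<^sup>2 else 0)" for j
      using adjoint_works[OF lin, of "g i" "e j"] e(2)[of i j] by (auto simp: g_def power2_norm_eq_inner)
    then have "(\<Sum>j\<in>UNIV. (A (g i) \<bullet> e j) *\<^sub>R e j) = (\<Sum>j\<in>UNIV. if i = j then (norm (g i))\<^sup>2 *\<^sub>R e j else 0)"
      by (intro sum.cong) auto
    then show ?thesis using orthonormal_frame_expansion[OF e(1), of "A (g i)"] by simp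
  qed
  \<comment> \<open>The normal is rescaled so that its largest coordinate, measured relative to the
    axes, has absolute value 1. Then \<omega> satisfies the hypothesis of the pigeonhole
    lemma.\<close>
  define \<mu> where "\<mu> = Max (range (\<lambda>i. \<bar>\<nu>0 \<bullet> e i\<bar> * norm (g i)))"
  have \<mu>ge: "\<bar>\<nu>0 \<bullet> e i\<bar> * norm (g i) \<le> \<mu>" for i unfolding \<mu>_def by (rule Max_ge) auto
  have "\<exists>i. \<nu>0 \<bullet> e i \<noteq> 0"
    using orthonormal_frame_expansion[OF e(1), of \<nu>0] \<nu>0(1) by (metis (no_types, lifting) scaleR_zero_left sum.neutral)
  then have \<mu>: "\<mu> > 0" using \<mu>ge gpos by (metis less_le_trans mult_pos_pos zero_less_abs_iff)
  have "\<mu> \<in> range (\<lambda>i. \<bar>\<nu>0 \<bullet> e i\<bar> * norm (g i))" unfolding \<mu>_def by (rule Max_in) auto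
  then obtain k where k: "\<mu> = \<bar>\<nu>0 \<bullet> e k\<bar> * norm (g k)" by auto
  define c where "c = (\<lambda>i. (\<nu>0 \<bullet> e i) / \<mu>)"
  define \<omega> where "\<omega> = (\<lambda>i. c i * norm (g i))"
  have \<omega>k: "\<bar>\<omega> k\<bar> = 1" using k \<mu> gpos[of k] unfolding \<omega>_def c_def abs_mult abs_divide by auto
  have \<omega>le: "\<bar>\<omega> i\<bar> \<le> 1" for i using \<mu>ge[of i] \<mu> by (simp add: \<omega>_def c_def abs_mult field_simps)
  \<comment> \<open>The n-th root of 1 - t is the price of the pigeonhole: it is the ratio for which
    n successive size ranges end exactly at 1 - t.\<close>
  define \<rho> where "\<rho> = (1 - t) powr (1 / ?n)"
  have \<rho>: "0 < \<rho>" "\<rho> < 1" using t n powr_less_mono2[of "1 / ?n" "1 - t" 1] by (auto simp: \<rho>_def)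
  have \<rho>n: "\<rho> ^ CARD('n) = 1 - t"
    unfolding \<rho>_def using t n by (subst powr_realpow[symmetric]) (auto simp: powr_powr)
  from gap_in_sizes[of \<omega> k \<rho>, OF \<omega>k \<rho>] obtain \<tau> I where I: "k \<in> I" "0 < \<tau>" "\<And>i. i \<in> I \<Longrightarrow> \<tau> \<le> \<bar>\<omega> i\<bar>"
    "\<And>i. i \<notin> I \<Longrightarrow> \<bar>\<omega> i\<bar> \<le> \<rho> * \<tau>" "\<rho> ^ CARD('n) \<le> \<rho> * \<tau>" by metis
  define \<nu>1 where "\<nu>1 = (\<Sum>i\<in>I. c i *\<^sub>R e i)"
  define m1 where "m1 = (\<Sum>i\<in>I. (c i / (norm (g i))\<^sup>2) *\<^sub>R g i)"
  have Am1: "A m1 = \<nu>1"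
    unfolding m1_def \<nu>1_def linear_sum[OF lin] linear_cmul[OF lin] Ag
    by (intro sum.cong refl) (use gpos in \<open>simp add: less_imp_neq[symmetric]\<close>)
  have norm\<nu>1: "(norm \<nu>1)\<^sup>2 = (\<Sum>i\<in>I. (c i)\<^sup>2)"
  proof -
    have "(\<Sum>j\<in>I. c i * (c j * (e j \<bullet> e i))) = (c i)\<^sup>2" if "i \<in> I" for i
    proof -
      have "(\<Sum>j\<in>I. c i * (c j * (e j \<bullet> e i))) = (\<Sum>j\<in>I. if j = i then (c i)\<^sup>2 else 0)"
        using e(1) by (intro sum.cong) (auto simp: orthonormal_frame_def power2_eq_square)
      then show ?thesis using that by simp
    qed
    then show ?thesis
      unfolding \<nu>1_def power2_norm_eq_inner inner_sum_left inner_sum_right by simp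
  qed
  have "c k \<noteq> 0" using \<omega>k by (auto simp: \<omega>_def)
  then have \<nu>1pos: "norm \<nu>1 > 0"
  proof -
    have "(c k)\<^sup>2 \<le> (\<Sum>i\<in>I. (c i)\<^sup>2)" by (rule member_le_sum) (use I in auto)
    moreover have "0 < (c k)\<^sup>2" using \<open>c k \<noteq> 0\<close> by simp
    ultimately have "0 < (norm \<nu>1)\<^sup>2" unfolding norm\<nu>1 by linarith
    then show ?thesis by (cases "norm \<nu>1 = 0") auto
  qed
  \<comment> \<open>Here dropping the small coordinates pays off: on \<open>I\<close> the product
    |c_i| |g_i| is at least \<tau>, so |c_i| / |g_i| is at most c_i^2 / \<tau>. Without a lower
    bound the short axes would make the preimage \<open>m1\<close> uncontrollably long.\<close>
  have m1: "norm m1 \<le> (norm \<nu>1)\<^sup>2 / \<tau>"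
  proof -
    have "norm m1 \<le> (\<Sum>i\<in>I. norm ((c i / (norm (g i))\<^sup>2) *\<^sub>R g i))" unfolding m1_def by (rule norm_sum)
    also have "\<dots> \<le> (\<Sum>i\<in>I. (c i)\<^sup>2 / \<tau>)"
    proof (rule sum_mono)
      fix i assume i: "i \<in> I"
      have "\<tau> \<le> \<bar>c i\<bar> * norm (g i)" using I(3)[OF i] by (simp add: \<omega>_def abs_mult)
      then have "\<bar>c i\<bar> * \<tau> \<le> \<bar>c i\<bar> * (\<bar>c i\<bar> * norm (g i))" by (rule mult_left_mono) auto
      then have "\<bar>c i\<bar> / norm (g i) \<le> (c i)\<^sup>2 / \<tau>"
        using I(2) gpos[of i] by (simp add: field_simps power2_eq_square)
      then show "norm ((c i / (norm (g i))\<^sup>2) *\<^sub>R g i) \<le> (c i)\<^sup>2 / \<tau>"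
        using gpos[of i] by (auto simp add: power2_eq_square)
    qed
    finally show ?thesis by (simp add: norm\<nu>1 sum_divide_distrib)
  qed
  \<comment> \<open>The factor 3 n^2 is a sum. The full normal contributes (1 - t) n^2, because z -
    q = (1 - t)(z - a), and 1 - t \<le> \<rho> \<tau>. Each of the at most n dropped coordinates
    contributes up to 2 n \<rho> \<tau>.\<close>
  have dist: "\<nu>1 \<bullet> (x - q) \<le> 3 * ?n\<^sup>2 * \<rho> * \<tau>" if x: "x \<in> Q" for x
  proof -
    have ei: "\<bar>c i * (e i \<bullet> ((a + A b) - (a + A b')))\<bar> \<le> \<bar>\<omega> i\<bar> * (2 * ?n)" if "norm b \<le> ?n" "norm b' \<le> ?n" for i b b'
    proof -
      have "e i \<bullet> ((a + A b) - (a + A b')) \<le> norm (g i) * (2 * ?n)" "e i \<bullet> ((a + A b') - (a + A b)) \<le> norm (g i) * (2 * ?n)"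
        unfolding g_def using adjoint_diff_inner[OF lin] that by blast+
      then have "\<bar>e i \<bullet> ((a + A b) - (a + A b'))\<bar> \<le> norm (g i) * (2 * ?n)" by (auto simp: inner_diff_right)
      then have "\<bar>c i\<bar> * \<bar>e i \<bullet> ((a + A b) - (a + A b'))\<bar> \<le> \<bar>c i\<bar> * (norm (g i) * (2 * ?n))" by (intro mult_left_mono) auto
      then show ?thesis by (simp add: \<omega>_def abs_mult)
    qed
    obtain bx where bx: "norm bx \<le> ?n" "x = a + A bx" using x Q by auto
    obtain bq where bq: "norm bq \<le> ?n" "q = a + A bq" using q(1) Q by auto
    obtain bz where bz: "norm bz \<le> ?n" "z = a + A bz" using z Q by auto
    have cexp: "(\<Sum>i\<in>UNIV. c i *\<^sub>R e i) = \<nu>0 /\<^sub>R \<mu>"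
      using arg_cong[OF orthonormal_frame_expansion[OF e(1), of \<nu>0], of "\<lambda>x. x /\<^sub>R \<mu>"]
      by (simp add: c_def scaleR_sum_right divide_inverse mult.commute)
    have "(\<Sum>i\<in>UNIV. c i *\<^sub>R e i) = \<nu>1 + (\<Sum>i\<in>-I. c i *\<^sub>R e i)"
      unfolding \<nu>1_def by (metis (no_types, lifting) Compl_disjoint Compl_partition finite sum.union_disjoint)
    then have \<nu>1: "\<nu>1 = \<nu>0 /\<^sub>R \<mu> - (\<Sum>i\<in>-I. c i *\<^sub>R e i)" using cexp by simp
    have "(\<nu>0 /\<^sub>R \<mu>) \<bullet> (x - q) \<le> (\<nu>0 /\<^sub>R \<mu>) \<bullet> (z - q)"
      using \<nu>0(2)[OF x] \<mu> by (simp add: inner_diff_right field_simps)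
    also have "z - q = (1 - t) *\<^sub>R (z - a)" unfolding q(2) by (simp add: algebra_simps)
    also have "(\<nu>0 /\<^sub>R \<mu>) \<bullet> ((1 - t) *\<^sub>R (z - a)) = (1 - t) * (\<Sum>i\<in>UNIV. c i * (e i \<bullet> (z - a)))"
      unfolding cexp[symmetric] by (simp add: inner_sum_left)
    also have "(\<Sum>i\<in>UNIV. c i * (e i \<bullet> (z - a))) \<le> (\<Sum>i\<in>(UNIV::'n set). ?n)"
    proof (rule sum_mono)
      fix i
      have "e i \<bullet> (z - a) = bz \<bullet> g i"
        using adjoint_works[OF lin, of bz "e i"] by (simp add: bz(2) g_def inner_commute)
      then have "\<bar>e i \<bullet> (z - a)\<bar> \<le> ?n * norm (g i)"
        using Cauchy_Schwarz_ineq2[of bz "g i"] bz(1) by (metis mult_right_mono norm_ge_zero order_trans)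
      then have "\<bar>c i\<bar> * \<bar>e i \<bullet> (z - a)\<bar> \<le> \<bar>c i\<bar> * (?n * norm (g i))" by (intro mult_left_mono) auto
      also have "\<dots> = \<bar>\<omega> i\<bar> * ?n" by (simp add: \<omega>_def abs_mult)
      also have "\<dots> \<le> ?n" using \<omega>le[of i] by simp
      finally show "c i * (e i \<bullet> (z - a)) \<le> ?n" using abs_ge_self order_trans by (metis abs_mult)
    qed
    finally have 1: "(\<nu>0 /\<^sub>R \<mu>) \<bullet> (x - q) \<le> (1 - t) * ?n\<^sup>2" using t by (simp add: power2_eq_square mult_left_mono)
    have "- (\<Sum>i\<in>-I. c i *\<^sub>R e i) \<bullet> (x - q) \<le> (\<Sum>i\<in>-I. \<bar>\<omega> i\<bar> * (2 * ?n))"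
    proof -
      have "- (\<Sum>i\<in>-I. c i *\<^sub>R e i) \<bullet> (x - q) = (\<Sum>i\<in>-I. - (c i * (e i \<bullet> (x - q))))"
        by (simp add: inner_sum_left sum_negf)
      also have "\<dots> \<le> (\<Sum>i\<in>-I. \<bar>\<omega> i\<bar> * (2 * ?n))"
        unfolding bx(2) bq(2) by (rule sum_mono) (use ei[OF bx(1) bq(1)] in \<open>auto simp: abs_le_iff\<close>)
      finally show ?thesis .
    qed
    also have "\<dots> \<le> (\<Sum>i\<in>-I. \<rho> * \<tau> * (2 * ?n))"
      using I(4) by (intro sum_mono mult_right_mono) auto
    also have "\<dots> = card (-I) * (\<rho> * \<tau> * (2 * ?n))" by simp
    also have "\<dots> \<le> ?n * (\<rho> * \<tau> * (2 * ?n))"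
      using I(2) \<rho> by (intro mult_right_mono) (auto intro: card_mono)
    finally have 2: "- (\<Sum>i\<in>-I. c i *\<^sub>R e i) \<bullet> (x - q) \<le> 2 * ?n\<^sup>2 * \<rho> * \<tau>"
      by (simp add: power2_eq_square algebra_simps)
    have "(1 - t) * ?n\<^sup>2 \<le> \<rho> * \<tau> * ?n\<^sup>2" using I(5) \<rho>n by (intro mult_right_mono) auto
    then show ?thesis using 1 2 unfolding \<nu>1 by (simp add: inner_diff_left algebra_simps)
  qed
  show thesis
  proof
    show "norm (\<nu>1 /\<^sub>R norm \<nu>1) = 1" using \<nu>1pos by simp
    show "A (m1 /\<^sub>R norm \<nu>1) = \<nu>1 /\<^sub>R norm \<nu>1" by (simp add: linear_cmul[OF lin] Am1)
    fix x assume x: "x \<in> Q"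
    have "(\<nu>1 \<bullet> (x - q)) * norm m1 \<le> 3 * ?n\<^sup>2 * \<rho> * \<tau> * norm m1"
      by (intro mult_right_mono dist x) auto
    also have "\<dots> \<le> 3 * ?n\<^sup>2 * \<rho> * \<tau> * ((norm \<nu>1)\<^sup>2 / \<tau>)"
      using \<rho> I(2) by (intro mult_left_mono m1) auto
    finally have "(\<nu>1 \<bullet> (x - q)) * norm m1 \<le> 3 * ?n\<^sup>2 * \<rho> * (norm \<nu>1)\<^sup>2" using I(2) by simp
    then have "(\<nu>1 \<bullet> (x - q)) * norm m1 / (norm \<nu>1)\<^sup>2 \<le> 3 * ?n\<^sup>2 * \<rho>"
      using \<nu>1pos by (simp add: divide_le_eq)
    then show "(\<nu>1 /\<^sub>R norm \<nu>1) \<bullet> (x - q) * norm (m1 /\<^sub>R norm \<nu>1) \<le> 3 * ?n\<^sup>2 * (1 - t) powr (1 / ?n)"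
      using \<nu>1pos by (simp add: \<rho>_def field_simps power2_eq_square)
  qed
qed

text \<open>The corrected normal \<open>\<nu>\<close> becomes the vector \<open>w k\<close>, whose
  width carries the small factor and a division by |m|. The other widths are bounded by 2n |A^T
  w_i|, and their product is |m| |det A| up to (2n)^(n-1) by \<open>prod_norm_adjoint_frame\<close>.
  Thus |m| cancels, and |det A| is the volume of the ellipsoid in \<open>Q\<close> divided by that
  of the unit ball.\<close>

lemma frame_widths_near_boundary:
  fixes A :: "real^'n \<Rightarrow> real^'n"
  assumes lin: "linear A" and bij: "bij A"
    and EQ: "(\<lambda>v. a + A v) ` cball 0 1 \<subseteq> Q" and QE: "Q \<subseteq> (\<lambda>v. a + A v) ` cball 0 (real CARD('n))"
    and Q: "compact Q" "convex Q" "interior Q \<noteq> {}" and z: "z \<in> frontier Q"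
    and q: "q \<in> Q" "q = a + t *\<^sub>R (z - a)" and t: "0 < t" "t < 1"
  obtains w d where "orthonormal_frame w" "\<And>i x. x \<in> Q \<Longrightarrow> w i \<bullet> (x - q) \<le> d i" "\<And>i. d i \<ge> 0"
    "(\<Prod>i\<in>UNIV. d i) \<le> 3 * (real CARD('n))\<^sup>2 * (2 * real CARD('n)) ^ (CARD('n) - 1) / measure lebesgue (cball (0::real^'n) 1)
        * (1 - t) powr (1 / 2 ^ (CARD('n) - 1)) * measure lebesgue Q"
proof -
  let ?n = "real CARD('n)" and ?\<beta> = "measure lebesgue (cball (0::real^'n) 1)"
  have n: "?n \<ge> 1" by (simp add: Suc_le_eq)
  have zQ: "z \<in> Q" using z Q(1) by (simp add: compact_imp_closed frontier_def)
  have "z \<notin> rel_interior Q" using z Q(3) by (simp add: frontier_def rel_interior_nonempty_interior)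
  then obtain b where b: "b \<noteq> 0" "\<And>y. y \<in> Q \<Longrightarrow> b \<bullet> z \<le> b \<bullet> y"
    "\<And>y. y \<in> rel_interior Q \<Longrightarrow> b \<bullet> z < b \<bullet> y"
    using supporting_hyperplane_rel_boundary[OF Q(2) zQ] by metis
  define \<rho> where "\<rho> = (1 - t) powr (1 / ?n)"
  obtain \<nu> m where \<nu>: "norm \<nu> = 1" "A m = \<nu>" "\<And>x. x \<in> Q \<Longrightarrow> \<nu> \<bullet> (x - q) * norm m \<le> 3 * ?n\<^sup>2 * \<rho>"
    unfolding \<rho>_def
    by (rule close_supporting_direction[OF lin bij QE zQ _ _ q t, of "-b"]) (use b in auto)
  obtain k :: 'n where True by blast
  obtain w where w: "orthonormal_frame w" "w k = \<nu>"
    "\<And>i j. i \<noteq> k \<Longrightarrow> j \<noteq> k \<Longrightarrow> i \<noteq> j \<Longrightarrow> adjoint A (w i) \<bullet> adjoint A (w j) = 0"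
    using orthonormal_frame_extending[OF adjoint_linear[OF lin] \<nu>(1), of k] by blast
  have m: "norm m > 0" using \<nu>(1,2) linear_0[OF lin] by fastforce
  define d where "d = (\<lambda>i. if i = k then 3 * ?n\<^sup>2 * \<rho> / norm m else norm (adjoint A (w i)) * (2 * ?n))"
  have "(\<Prod>i\<in>UNIV. d i) = d k * (\<Prod>i\<in>UNIV - {k}. d i)" by (simp add: prod.remove)
  also have "(\<Prod>i\<in>UNIV - {k}. d i) = (\<Prod>i\<in>UNIV - {k}. norm (adjoint A (w i)) * (2 * ?n))"
    by (rule prod.cong) (simp_all add: d_def)
  also have "\<dots> = norm m * \<bar>det (matrix A)\<bar> * (2 * ?n) ^ (CARD('n) - 1)"
    unfolding prod.distrib using prod_norm_adjoint_frame[OF lin bij w(1) _ w(3), of m] \<nu>(2) w(2) by (simp add: card_Diff_singleton)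
  finally have pd: "(\<Prod>i\<in>UNIV. d i) = 3 * ?n\<^sup>2 * \<rho> * (2 * ?n) ^ (CARD('n) - 1) * \<bar>det (matrix A)\<bar>"
    using m by (simp add: d_def)
  have \<beta>: "?\<beta> > 0" by (simp add: content_cball_pos)
  have cE: "compact (A ` cball 0 1)"
    by (intro compact_continuous_image linear_continuous_on compact_cball) (use lin linear_conv_bounded_linear in blast)
  have "ennreal (\<bar>det (matrix A)\<bar> * ?\<beta>) = emeasure lebesgue (A ` cball 0 1)"
    using emeasure_linear_image[OF lin, of "cball 0 1"] lmeasurable_compact[of "cball (0::real^'n) 1"]
    by (simp add: emeasure_eq_measure2 ennreal_mult)
  also have "\<dots> = emeasure lebesgue ((+) a ` A ` cball 0 1)"
    using lmeasurable_compact[OF cE] measurable_translation[OF lmeasurable_compact[OF cE]]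
    by (simp add: emeasure_eq_measure2 measure_translation)
  also have "\<dots> \<le> emeasure lebesgue Q"
    by (rule emeasure_mono) (use EQ lmeasurable_compact[OF Q(1)] in \<open>auto simp: image_image\<close>)
  also have "\<dots> = ennreal (measure lebesgue Q)" using lmeasurable_compact[OF Q(1)] by (simp add: emeasure_eq_measure2)
  finally have "\<bar>det (matrix A)\<bar> * ?\<beta> \<le> measure lebesgue Q" by simp
  then have vol: "\<bar>det (matrix A)\<bar> \<le> measure lebesgue Q / ?\<beta>" using \<beta> by (simp only: pos_le_divide_eq)
  \<comment> \<open>This gives n \<le> 2^(n-1). As the base 1 - t lies below 1, passing to the
    smaller exponent 1 / 2^(n-1) only increases the power.\<close>
  have "CARD('n) - 1 < 2 ^ (CARD('n) - 1)" by (rule less_exp)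
  then have "CARD('n) \<le> 2 ^ (CARD('n) - 1)" by linarith
  then have "?n \<le> 2 ^ (CARD('n) - 1)" by (metis of_nat_le_iff of_nat_numeral of_nat_power)
  then have "1 / 2 ^ (CARD('n) - 1) \<le> 1 / ?n" using n by (intro divide_left_mono) auto
  then have \<rho>le: "\<rho> \<le> (1 - t) powr (1 / 2 ^ (CARD('n) - 1))" unfolding \<rho>_def using t by (intro powr_mono') auto
  have "(\<Prod>i\<in>UNIV. d i) \<le> 3 * ?n\<^sup>2 * (1 - t) powr (1 / 2 ^ (CARD('n) - 1)) * (2 * ?n) ^ (CARD('n) - 1) * (measure lebesgue Q / ?\<beta>)"
    unfolding pd by (intro mult_mono order_refl \<rho>le vol) (auto simp: \<rho>_def)
  also have "\<dots> = 3 * ?n\<^sup>2 * (2 * ?n) ^ (CARD('n) - 1) / ?\<beta> * (1 - t) powr (1 / 2 ^ (CARD('n) - 1)) * measure lebesgue Q"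
    by simp
  finally have *: "(\<Prod>i\<in>UNIV. d i) \<le> \<dots>" .
  show thesis
  proof (rule that[OF w(1) _ _ *])
    show "d i \<ge> 0" for i using m by (simp add: d_def \<rho>_def)
    fix i x assume x: "x \<in> Q"
    obtain bx where bx: "norm bx \<le> ?n" "x = a + A bx" using x QE by auto
    obtain bq where bq: "norm bq \<le> ?n" "q = a + A bq" using q(1) QE by auto
    show "w i \<bullet> (x - q) \<le> d i"
    proof (cases "i = k")
      case True
      then show ?thesis using \<nu>(3)[OF x] w(2) m by (simp add: d_def pos_le_divide_eq)
    next
      case False
      then show ?thesis using adjoint_diff_inner[OF lin bx(1) bq(1), of "w i" a] bx(2) bq(2) by (simp add: d_def)
    qed
  qed
qed

section \<open>Sections of convex functions with respect to a potential\<close>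

lemma convergent_subsequence_in_compact:
  fixes y :: "nat \<Rightarrow> 'a::metric_space"
  assumes "compact Y" "\<And>k. y k \<in> Y"
  obtains r l where "strict_mono r" "l \<in> Y" "(y \<circ> r) \<longlonglongrightarrow> l"
proof -
  have "\<exists>l\<in>Y. \<exists>r. strict_mono r \<and> (y \<circ> r) \<longlonglongrightarrow> l"
    using assms unfolding compact_def by simp
  then show thesis using that by blast
qed

text \<open>
  In the application \<open>W\<close> is \<open>U_at U V c y0\<close>, \<open>Y\<close> is \<open>closure V\<close>, \<open>\<psi>\<close> is the negative of the modified cost and
  \<open>P q y\<close> is the gradient of \<open>\<psi>\<close> in \<open>q\<close>.
\<close>

locale potential =
  fixes W Y :: "(real^'n) set" and \<psi> :: "real^'n \<Rightarrow> real^'n \<Rightarrow> real" and P :: "real^'n \<Rightarrow> real^'n \<Rightarrow> real^'n"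
    and y0 :: "real^'n" and K :: real
  assumes W: "open W" "convex W" "bounded W" and Y: "compact Y" "y0 \<in> Y"
    and \<psi>_cont: "continuous_on (closure W \<times> Y) (\<lambda>(q, y). \<psi> q y)"
    and \<psi>_y0: "\<And>q. q \<in> closure W \<Longrightarrow> \<psi> q y0 = 0"
    and P_cont: "continuous_on (W \<times> Y) (\<lambda>(q, y). P q y)"
    and P_deriv: "\<And>q y. q \<in> W \<Longrightarrow> y \<in> Y \<Longrightarrow> ((\<lambda>q. \<psi> q y) has_derivative (\<lambda>v. P q y \<bullet> v)) (at q)"
    and P_inj: "\<And>q. q \<in> W \<Longrightarrow> inj_on (P q) Y"
    and P_convex: "\<And>q. q \<in> W \<Longrightarrow> convex (P q ` Y)"
    and max_principle: "\<And>q q0 y y1 y2. q0 \<in> W \<Longrightarrow> q \<in> W \<Longrightarrow> y \<in> Y \<Longrightarrow> y1 \<in> Y \<Longrightarrow> y2 \<in> Y \<Longrightarrow>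
      P q0 y \<in> closed_segment (P q0 y1) (P q0 y2) \<Longrightarrow>
      \<psi> q y - \<psi> q0 y \<le> max (\<psi> q y1 - \<psi> q0 y1) (\<psi> q y2 - \<psi> q0 y2)"
    and quasiconvex: "\<And>q q1 q2 y. q1 \<in> W \<Longrightarrow> q2 \<in> W \<Longrightarrow> y \<in> Y \<Longrightarrow> q \<in> closed_segment q1 q2 \<Longrightarrow>
      \<psi> q y \<le> max (\<psi> q1 y) (\<psi> q2 y)"
    and K: "K \<ge> 0" "\<And>q q' y. q \<in> W \<Longrightarrow> q' \<in> W \<Longrightarrow> y \<in> Y \<Longrightarrow>
      norm (P q y - P q' y) \<le> K * norm (q - q') * norm (P q' y)"
begin

lemma W_closure: "q \<in> W \<Longrightarrow> q \<in> closure W"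
  using closure_subset by blast

lemma compact_closure_W: "compact (closure W)"
  using W(3) by (simp add: compact_closure)

lemma \<psi>_tendsto:
  assumes "qs \<longlonglongrightarrow> q" "ys \<longlonglongrightarrow> y" "\<And>k::nat. qs k \<in> closure W" "\<And>k. ys k \<in> Y" "q \<in> closure W" "y \<in> Y"
  shows "(\<lambda>k. \<psi> (qs k) (ys k)) \<longlonglongrightarrow> \<psi> q y"
proof -
  have "(\<lambda>k. (qs k, ys k)) \<longlonglongrightarrow> (q, y)" using assms(1,2) by (rule tendsto_Pair)
  from continuous_on_tendsto_compose[OF \<psi>_cont this] assms show ?thesis by simp
qed

lemma P_tendsto:
  assumes "qs \<longlonglongrightarrow> q" "ys \<longlonglongrightarrow> y" "\<And>k::nat. qs k \<in> W" "\<And>k. ys k \<in> Y" "q \<in> W" "y \<in> Y"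
  shows "(\<lambda>k. P (qs k) (ys k)) \<longlonglongrightarrow> P q y"
proof -
  have "(\<lambda>k. (qs k, ys k)) \<longlonglongrightarrow> (q, y)" using assms(1,2) by (rule tendsto_Pair)
  from continuous_on_tendsto_compose[OF P_cont this] assms show ?thesis by simp
qed

lemma P_cont1: "q \<in> W \<Longrightarrow> continuous_on Y (P q)"
  by (rule continuous_on_compose2[OF P_cont, of Y "\<lambda>y. (q, y)", simplified]) (auto intro!: continuous_intros)

lemma \<psi>_cont1: "y \<in> Y \<Longrightarrow> continuous_on (closure W) (\<lambda>q. \<psi> q y)"
  by (rule continuous_on_compose2[OF \<psi>_cont, of _ "\<lambda>q. (q, y)", simplified]) (auto intro!: continuous_intros)

lemma \<psi>_cont2: "q \<in> closure W \<Longrightarrow> continuous_on Y (\<lambda>y. \<psi> q y)"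
  by (rule continuous_on_compose2[OF \<psi>_cont, of _ "\<lambda>y. (q, y)", simplified]) (auto intro!: continuous_intros)

lemma P_y0: assumes "q \<in> W" shows "P q y0 = 0"
proof -
  have "((\<lambda>q. \<psi> q y0) has_derivative (\<lambda>v. 0)) (at q)"
    by (rule has_derivative_transform_within_open[OF has_derivative_const W(1) assms]) (use \<psi>_y0 W_closure in auto)
  from has_derivative_unique[OF this P_deriv[OF assms Y(2)]] have "P q y0 \<bullet> P q y0 = 0" by metis
  then show ?thesis by simp
qed

lemma \<psi>_mvt:
  assumes "q \<in> W" "q' \<in> W" "y \<in> Y"
  obtains z where "z \<in> closed_segment q q'" "\<psi> q' y - \<psi> q y = P z y \<bullet> (q' - q)"
proof -
  have seg: "q + t *\<^sub>R (q' - q) \<in> closed_segment q q'" if "t \<in> {0..1}" for t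
    using that by (auto simp: closed_segment_def algebra_simps intro!: exI[of _ t])
  have sub: "closed_segment q q' \<subseteq> W" using assms W(2) by (simp add: closed_segment_subset)
  have "\<exists>t\<in>{0..1::real}. (\<lambda>t. \<psi> (q + t *\<^sub>R (q' - q)) y) 1 - (\<lambda>t. \<psi> (q + t *\<^sub>R (q' - q)) y) 0
      = P (q + t *\<^sub>R (q' - q)) y \<bullet> ((1 - 0) *\<^sub>R (q' - q))"
  proof (rule mvt_very_simple[of 0 1])
    fix t :: real assume t: "0 \<le> t" "t \<le> 1"
    have "((\<lambda>q. \<psi> q y) \<circ> (\<lambda>t. q + t *\<^sub>R (q' - q)) has_derivative
        (\<lambda>v. P (q + t *\<^sub>R (q' - q)) y \<bullet> v) \<circ> (\<lambda>s. s *\<^sub>R (q' - q))) (at t within {0..1})"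
      by (rule diff_chain_within)
        (use t seg[of t] sub assms in \<open>auto intro!: derivative_eq_intros has_derivative_at_withinI[OF P_deriv]\<close>)
    then show "((\<lambda>t. \<psi> (q + t *\<^sub>R (q' - q)) y) has_derivative (\<lambda>s. P (q + t *\<^sub>R (q' - q)) y \<bullet> (s *\<^sub>R (q' - q))))
        (at t within {0..1})" by (simp add: comp_def)
  qed auto
  then obtain t where "t \<in> {0..1}" "\<psi> q' y - \<psi> q y = P (q + t *\<^sub>R (q' - q)) y \<bullet> (q' - q)" by auto
  then show thesis using that seg by blast
qed

end

section \<open>Subdifferentials of functions convex with respect to a potential\<close>

locale potential_convex_fun = potential W Y \<psi> P y0 K
  for W Y :: "(real^'n) set" and \<psi> P y0 K +
  fixes u :: "real^'n \<Rightarrow> real"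
  assumes subdiff_ex: "\<And>q. q \<in> closure W \<Longrightarrow> \<exists>y\<in>Y. \<forall>q'\<in>closure W. u q + \<psi> q' y - \<psi> q y \<le> u q'"
begin

text \<open>Support is required over all of \<open>closure W\<close>, so that the graph is closed up
  to the boundary and images of compact sets are compact. The locale assumption
  \<open>subdiff_ex\<close> makes these sets nonempty at boundary points as well.\<close>

definition sub :: "real^'n \<Rightarrow> (real^'n) set" where
  "sub q = {y \<in> Y. \<forall>q'\<in>closure W. u q + \<psi> q' y - \<psi> q y \<le> u q'}"

lemma sub_nonempty: "q \<in> closure W \<Longrightarrow> sub q \<noteq> {}"
  using subdiff_ex by (auto simp: sub_def)

lemma sub_Y: "y \<in> sub q \<Longrightarrow> y \<in> Y" by (simp add: sub_def)

lemma subD: "y \<in> sub q \<Longrightarrow> q' \<in> closure W \<Longrightarrow> u q + \<psi> q' y - \<psi> q y \<le> u q'" by (simp add: sub_def)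

lemma u_cont: "continuous_on (closure W) u"
  unfolding continuous_on_iff
proof (intro ballI allI impI)
  fix q :: "real^'n" and e :: real assume q: "q \<in> closure W" and e: "0 < e"
  have "uniformly_continuous_on (closure W \<times> Y) (\<lambda>(q, y). \<psi> q y)"
    by (rule compact_uniformly_continuous[OF \<psi>_cont]) (intro compact_Times compact_closure_W Y)
  then obtain d where d: "d > 0" "\<And>q y q' y'. q \<in> closure W \<Longrightarrow> y \<in> Y \<Longrightarrow> q' \<in> closure W \<Longrightarrow> y' \<in> Y \<Longrightarrow>
      dist (q', y') (q, y) < d \<Longrightarrow> dist (\<psi> q' y') (\<psi> q y) < e"
    unfolding uniformly_continuous_on_def using e by force
  show "\<exists>d>0. \<forall>q'\<in>closure W. dist q' q < d \<longrightarrow> dist (u q') (u q) < e"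
  proof (intro exI[of _ d] conjI d ballI impI)
    fix q' assume q': "q' \<in> closure W" "dist q' q < d"
    obtain y y' where y: "y \<in> sub q" "y' \<in> sub q'" using sub_nonempty q q'(1) by blast
    have "dist (\<psi> q' y) (\<psi> q y) < e" "dist (\<psi> q' y') (\<psi> q y') < e"
      using y q q' by (auto intro!: d(2) simp: sub_Y dist_Pair_Pair)
    then show "dist (u q') (u q) < e"
      using subD[OF y(1) q'(1)] subD[OF y(2) q] by (auto simp: dist_real_def abs_if split: if_splits)
  qed
qed

lemma u_tendsto: "qs \<longlonglongrightarrow> q \<Longrightarrow> (\<And>k::nat. qs k \<in> closure W) \<Longrightarrow> q \<in> closure W \<Longrightarrow> (\<lambda>k. u (qs k)) \<longlonglongrightarrow> u q"
  by (rule continuous_on_tendsto_compose[OF u_cont]) auto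

lemma sub_closed_graph:
  assumes "qs \<longlonglongrightarrow> q" "ys \<longlonglongrightarrow> y" "\<And>k::nat. qs k \<in> closure W" "\<And>k. ys k \<in> sub (qs k)"
  shows "q \<in> closure W" "y \<in> sub q"
proof -
  show q: "q \<in> closure W" using assms closed_sequentially[OF closed_closure] by blast
  have yY: "\<And>k. ys k \<in> Y" using assms sub_Y by blast
  then have y: "y \<in> Y" using assms(2) closed_sequentially compact_imp_closed[OF Y(1)] by blast
  show "y \<in> sub q" unfolding sub_def
  proof (clarsimp simp: y)
    fix q' assume q': "q' \<in> closure W"
    have "(\<lambda>k. u (qs k) + \<psi> q' (ys k) - \<psi> (qs k) (ys k)) \<longlonglongrightarrow> u q + \<psi> q' y - \<psi> q y"
      by (intro tendsto_intros u_tendsto \<psi>_tendsto assms yY q q' y)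
    then show "u q + \<psi> q' y - \<psi> q y \<le> u q'"
      by (rule LIMSEQ_le_const2) (use subD[OF assms(4) q'] in auto)
  qed
qed

lemma compact_sub_image:
  assumes "compact Q" "Q \<subseteq> closure W" shows "compact (\<Union>q\<in>Q. sub q)"
  unfolding compact_def
proof (intro allI impI)
  fix f :: "nat \<Rightarrow> real^'n" assume f: "\<forall>n. f n \<in> (\<Union>q\<in>Q. sub q)"
  then have "\<forall>n. \<exists>q. q \<in> Q \<and> f n \<in> sub q" by blast
  from choice[OF this] obtain g where g: "\<And>n. g n \<in> Q" "\<And>n. f n \<in> sub (g n)" by blast
  obtain r q where r: "strict_mono r" "q \<in> Q" "(g \<circ> r) \<longlonglongrightarrow> q"
    by (rule convergent_subsequence_in_compact[OF assms(1) g(1)])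
  have fY: "(f \<circ> r) n \<in> Y" for n using g(2) sub_Y by (simp add: comp_def) blast
  obtain s y where s: "strict_mono s" "y \<in> Y" "((f \<circ> r) \<circ> s) \<longlonglongrightarrow> y"
    by (rule convergent_subsequence_in_compact[OF Y(1) fY])
  have "y \<in> sub q"
    by (rule sub_closed_graph(2)[of "(g \<circ> r) \<circ> s" _ "(f \<circ> r) \<circ> s"])
      (use LIMSEQ_subseq_LIMSEQ[OF r(3) s(1)] s(3) g assms(2) in auto)
  then show "\<exists>l\<in>\<Union>q\<in>Q. sub q. \<exists>r. strict_mono r \<and> (f \<circ> r) \<longlonglongrightarrow> l"
    using r s by (intro bexI[of _ y] exI[of _ "r \<circ> s"]) (auto simp: comp_assoc strict_mono_o)
qed

lemma compact_sub: "q \<in> closure W \<Longrightarrow> compact (sub q)"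
  using compact_sub_image[of "{q}"] by auto

text \<open>By the maximum principle, a supporting function whose gradient at \<open>q\<close> lies
  between two gradients is dominated by the larger of the two corresponding supporting functions.
  This works at points of \<open>W\<close>; continuity carries the inequality to the
  closure.\<close>

lemma convex_P_sub:
  assumes q: "q \<in> W" shows "convex (P q ` sub q)"
  unfolding convex_contains_segment
proof (intro ballI subsetI)
  fix p1 p2 p assume "p1 \<in> P q ` sub q" "p2 \<in> P q ` sub q" and p: "p \<in> closed_segment p1 p2"
  then obtain y1 y2 where y: "y1 \<in> sub q" "y2 \<in> sub q" "p1 = P q y1" "p2 = P q y2" by auto
  then have "p \<in> P q ` Y" using p P_convex[OF q] sub_Y
    by (meson closed_segment_subset imageI subsetD)
  then obtain y where yY: "y \<in> Y" "p = P q y" by auto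
  have W': "u q + \<psi> q' y - \<psi> q y \<le> u q'" if "q' \<in> W" for q'
  proof -
    have "\<psi> q' y - \<psi> q y \<le> max (\<psi> q' y1 - \<psi> q y1) (\<psi> q' y2 - \<psi> q y2)"
      using max_principle[OF q that yY(1)] y p yY sub_Y by blast
    moreover have "\<psi> q' y1 - \<psi> q y1 \<le> u q' - u q" "\<psi> q' y2 - \<psi> q y2 \<le> u q' - u q"
      using subD[OF y(1) W_closure[OF that]] subD[OF y(2) W_closure[OF that]] by auto
    ultimately show ?thesis by linarith
  qed
  have "u q + \<psi> q' y - \<psi> q y \<le> u q'" if "q' \<in> closure W" for q'
  proof -
    have "continuous_on (closure W) (\<lambda>q'. u q + \<psi> q' y - \<psi> q y - u q')"
      by (intro continuous_intros \<psi>_cont1 u_cont yY)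
    from continuous_le_on_closure[OF this that, of 0] show ?thesis using W' by auto
  qed
  then show "p \<in> P q ` sub q" using yY by (auto simp: sub_def)
qed

text \<open>The one-sided derivative of \<open>u\<close> at \<open>q\<close> in direction
  \<open>w\<close> is at most the largest P q y \<bullet> w over subgradients y. If it were not,
  take subgradients at points q + s w with s tending to 0: the mean value theorem bounds their
  slopes from below by \<alpha>, and a limit of them is a subgradient at \<open>q\<close> violating
  the hypothesis.\<close>

lemma directional_bound:
  assumes q: "q \<in> W" and \<alpha>: "\<And>y. y \<in> sub q \<Longrightarrow> P q y \<bullet> w < \<alpha>"
  shows "\<exists>\<delta>>0. \<forall>s. 0 < s \<and> s < \<delta> \<longrightarrow> q + s *\<^sub>R w \<in> W \<and> u (q + s *\<^sub>R w) - u q < \<alpha> * s"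
proof (rule ccontr)
  assume neg: "\<not> ?thesis"
  obtain e where e: "e > 0" "ball q e \<subseteq> W" using W(1) q openE by blast
  define d where "d = e / (norm w + 1)"
  have np: "norm w + 1 > 0" by (simp add: add_nonneg_pos)
  have d: "d > 0" using e np by (simp add: d_def)
  have inW: "q + s *\<^sub>R w \<in> W" if "0 \<le> s" "s < d" for s
  proof -
    have "s * norm w \<le> s * (norm w + 1)" using that by (intro mult_left_mono) auto
    also have "\<dots> < e" using that np by (simp add: d_def field_simps)
    finally show ?thesis using e that by (auto intro!: subsetD[OF e(2)] simp: dist_norm)
  qed
  have "\<exists>s. 0 < s \<and> s < min d (1 / real (Suc k)) \<and> \<not> (u (q + s *\<^sub>R w) - u q < \<alpha> * s)" for k
    using neg[unfolded not_ex, rule_format, of "min d (1 / real (Suc k))"] d inW by auto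
  then obtain s where s: "\<And>k. 0 < s k" "\<And>k. s k < d" "\<And>k. s k < 1 / real (Suc k)"
    "\<And>k. u (q + s k *\<^sub>R w) - u q \<ge> \<alpha> * s k" by (metis min_less_iff_conj not_less)
  have sW: "q + s k *\<^sub>R w \<in> W" for k by (rule inW) (use s(1,2)[of k] in auto)
  have "\<exists>y. y \<in> sub (q + s k *\<^sub>R w)" for k using sub_nonempty[OF W_closure[OF sW]] by blast
  then obtain y where y: "\<And>k. y k \<in> sub (q + s k *\<^sub>R w)" by metis
  have "\<exists>z. z \<in> closed_segment q (q + s k *\<^sub>R w) \<and> \<psi> (q + s k *\<^sub>R w) (y k) - \<psi> q (y k) = P z (y k) \<bullet> (s k *\<^sub>R w)" for k
    using \<psi>_mvt[OF q sW[of k] sub_Y[OF y[of k]]] by (metis add_diff_cancel_left')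
  then obtain z where z: "\<And>k. z k \<in> closed_segment q (q + s k *\<^sub>R w)"
    "\<And>k. \<psi> (q + s k *\<^sub>R w) (y k) - \<psi> q (y k) = P (z k) (y k) \<bullet> (s k *\<^sub>R w)" by metis
  have Pz: "P (z k) (y k) \<bullet> w \<ge> \<alpha>" for k
  proof -
    have "\<alpha> * s k \<le> P (z k) (y k) \<bullet> (s k *\<^sub>R w)"
      using subD[OF y[of k] W_closure[OF q]] s(4)[of k] z(2)[of k] by linarith
    then show ?thesis using s(1)[of k] by (simp add: mult.commute)
  qed
  have zW: "z k \<in> W" for k using z(1) closed_segment_subset[OF q sW W(2)] by blast
  have s0: "s \<longlonglongrightarrow> 0"
    by (rule tendsto_sandwich[OF _ _ tendsto_const LIMSEQ_inverse_real_of_nat])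
      (use s(1,3) in \<open>auto intro!: always_eventually less_imp_le simp: inverse_eq_divide\<close>)
  have sw: "(\<lambda>k. s k *\<^sub>R w) \<longlonglongrightarrow> 0" using tendsto_scaleR[OF s0 tendsto_const[of w]] by simp
  have qs: "(\<lambda>k. q + s k *\<^sub>R w) \<longlonglongrightarrow> q" using tendsto_add[OF tendsto_const[of q] sw] by simp
  have zq: "z \<longlonglongrightarrow> q"
  proof (rule Lim_transform_bound[where g = "\<lambda>k. q + s k *\<^sub>R w - q", THEN LIM_zero_cancel[of z]])
    show "\<forall>\<^sub>F k in sequentially. norm (z k - q) \<le> norm (q + s k *\<^sub>R w - q)"
      using z(1) dist_in_closed_segment[of _ q] by (intro always_eventually) (metis dist_norm norm_minus_commute)
    show "(\<lambda>k. q + s k *\<^sub>R w - q) \<longlonglongrightarrow> 0" using sw by simp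
  qed
  obtain r l where r: "strict_mono r" "l \<in> Y" "(y \<circ> r) \<longlonglongrightarrow> l"
    by (rule convergent_subsequence_in_compact[OF Y(1) sub_Y[OF y]])
  have "l \<in> sub q"
    by (rule sub_closed_graph(2)[of "(\<lambda>k. q + s k *\<^sub>R w) \<circ> r" _ "y \<circ> r"])
      (use LIMSEQ_subseq_LIMSEQ[OF qs r(1)] r(3) y sW W_closure in auto)
  have "(\<lambda>k. P ((z \<circ> r) k) ((y \<circ> r) k)) \<longlonglongrightarrow> P q l"
    by (rule P_tendsto[OF LIMSEQ_subseq_LIMSEQ[OF zq r(1)] r(3)]) (use zW y sub_Y q r in auto)
  then have "(\<lambda>k. P ((z \<circ> r) k) ((y \<circ> r) k) \<bullet> w) \<longlonglongrightarrow> P q l \<bullet> w" by (intro tendsto_intros)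
  then have "\<alpha> \<le> P q l \<bullet> w" by (rule LIMSEQ_le_const) (use Pz in auto)
  then show False using \<alpha>[OF \<open>l \<in> sub q\<close>] by simp
qed

lemma closed_P_sub: "q \<in> W \<Longrightarrow> compact (P q ` sub q)"
  by (intro compact_continuous_image compact_sub W_closure continuous_on_subset[OF P_cont1]) (auto simp: sub_Y)

text \<open>Loeper's local-to-global principle.\<close>

lemma local_min_sub:
  assumes q: "q \<in> W" and y: "y \<in> Y" and e: "e > 0"
    and min: "\<And>q'. q' \<in> ball q e \<Longrightarrow> q' \<in> W \<Longrightarrow> u q - \<psi> q y \<le> u q' - \<psi> q' y"
  shows "y \<in> sub q"
proof (rule ccontr)
  assume "y \<notin> sub q"
  then have "P q y \<notin> P q ` sub q" using P_inj[OF q] y sub_Y by (auto simp: inj_on_def)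
  \<comment> \<open>The separating vector gives a direction, -a, in which \<open>u\<close> falls
    strictly faster to first order than \<psi>(., y), against local minimality of their difference
    at \<open>q\<close>.\<close>
  then obtain a b where ab: "a \<bullet> P q y < b" "\<And>x. x \<in> P q ` sub q \<Longrightarrow> b < a \<bullet> x"
    using separating_hyperplane_closed_point[OF convex_P_sub[OF q] compact_imp_closed[OF closed_P_sub[OF q]]] by blast
  have "P q y' \<bullet> (-a) < - b" if "y' \<in> sub q" for y'
    using ab(2)[OF imageI[OF that]] by (simp add: inner_commute)
  from directional_bound[OF q this] obtain \<delta> where \<delta>: "\<delta> > 0"
    "\<And>s. 0 < s \<Longrightarrow> s < \<delta> \<Longrightarrow> q + s *\<^sub>R (-a) \<in> W \<and> u (q + s *\<^sub>R (-a)) - u q < (-b) * s" by blast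
  have "((\<lambda>s. \<psi> (q + s *\<^sub>R (-a)) y) has_real_derivative (P q y \<bullet> (-a))) (at 0)"
  proof -
    have "((\<lambda>q. \<psi> q y) \<circ> (\<lambda>s. q + s *\<^sub>R (-a)) has_derivative (\<lambda>v. P q y \<bullet> v) \<circ> (\<lambda>s. s *\<^sub>R (-a))) (at 0)"
      by (rule diff_chain_at) (use P_deriv[OF q y] in \<open>auto intro!: derivative_eq_intros\<close>)
    then show ?thesis unfolding has_field_derivative_def comp_def inner_scaleR_right mult_commute_abs .
  qed
  then have "((\<lambda>s. (\<psi> (q + s *\<^sub>R (-a)) y - \<psi> q y) / s) \<longlongrightarrow> P q y \<bullet> (-a)) (at 0)"
    by (simp add: has_field_derivative_iff)
  moreover have "P q y \<bullet> (-a) > - b" using ab(1) by (simp add: inner_commute)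
  ultimately have "\<forall>\<^sub>F s in at 0. (\<psi> (q + s *\<^sub>R (-a)) y - \<psi> q y) / s > - b" by (rule order_tendstoD)
  then obtain \<delta>' where \<delta>': "\<delta>' > 0" "\<And>s. s \<noteq> 0 \<Longrightarrow> \<bar>s\<bar> < \<delta>' \<Longrightarrow> (\<psi> (q + s *\<^sub>R (-a)) y - \<psi> q y) / s > - b"
    by (auto simp: eventually_at)
  define m where "m = min (min \<delta> \<delta>') (e / (norm a + 1))"
  have np: "norm a + 1 > 0" by (simp add: add_nonneg_pos)
  have m: "0 < m" "m \<le> \<delta>" "m \<le> \<delta>'" "m \<le> e / (norm a + 1)"
    using \<delta>(1) \<delta>'(1) e np by (auto simp: m_def)
  define s where "s = m / 2"
  have s: "0 < s" "s < \<delta>" "s < \<delta>'" "s < e / (norm a + 1)"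
    unfolding s_def using m by linarith+
  have "s * norm a \<le> s * (norm a + 1)" using s by (intro mult_left_mono) auto
  also have "\<dots> < e" using s np by (simp add: field_simps)
  finally have "q + s *\<^sub>R (-a) \<in> ball q e" using s by (simp add: dist_norm)
  then have "u q - \<psi> q y \<le> u (q + s *\<^sub>R (-a)) - \<psi> (q + s *\<^sub>R (-a)) y" using \<delta>(2)[OF s(1,2)] min by blast
  moreover have "\<psi> (q + s *\<^sub>R (-a)) y - \<psi> q y > - b * s" using \<delta>'(2)[of s] s by (simp add: field_simps)
  ultimately show False using \<delta>(2)[OF s(1,2)] by linarith
qed

text \<open>The claim is that the ray spanned by \<open>\<nu>\<close> meets the convex compact set
  of subgradients away from 0. The value 0 would make \<open>y0\<close> a subgradient and
  \<open>q0\<close> a global minimum, although \<open>u\<close> is negative at \<open>qm\<close>. If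
  the ray missed the set, a separating vector \<open>a\<close> would have a \<bullet> \<nu> \<le> 0
  while \<open>u\<close> decreases along -a. That leads to points with u < 0 that do not lie below
  \<open>q0\<close> in the direction \<open>\<nu>\<close>.\<close>

lemma section_normal:
  assumes q0: "q0 \<in> W" "u q0 = 0" and neg: "qm \<in> closure W" "u qm < 0" and \<nu>: "\<nu> \<noteq> 0"
    and supp: "\<And>q. q \<in> closure W \<Longrightarrow> u q \<le> 0 \<Longrightarrow> \<nu> \<bullet> q \<le> \<nu> \<bullet> q0"
  obtains y s where "y \<in> sub q0" "s > 0" "P q0 y = s *\<^sub>R \<nu>"
proof -
  let ?R = "{s *\<^sub>R \<nu> | s. s \<ge> 0}"
  have zero: "0 \<notin> P q0 ` sub q0"
  proof
    assume "0 \<in> P q0 ` sub q0"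
    then obtain y where y: "y \<in> sub q0" "P q0 y = P q0 y0" using P_y0[OF q0(1)] by auto
    then have "y = y0" using P_inj[OF q0(1)] Y(2) sub_Y by (auto simp: inj_on_def)
    then show False using subD[OF y(1) neg(1)] \<psi>_y0 W_closure q0 neg by auto
  qed
  have R: "?R = (\<lambda>s. s *\<^sub>R \<nu>) ` {0..}" by auto
  have "?R \<inter> P q0 ` sub q0 \<noteq> {}"
  proof
    assume disj: "?R \<inter> P q0 ` sub q0 = {}"
    have "convex ?R" unfolding R by (rule convex_linear_image) (auto intro: linearI simp: scaleR_add_left)
    moreover have "closed ?R"
      unfolding R by (rule closed_injective_linear_image) (use \<nu> in \<open>auto intro!: linearI injI simp: scaleR_add_left\<close>)
    moreover have "P q0 ` sub q0 \<noteq> {}" using sub_nonempty[OF W_closure[OF q0(1)]] by simp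
    ultimately have "\<exists>a b. (\<forall>x\<in>?R. a \<bullet> x < b) \<and> (\<forall>x\<in>P q0 ` sub q0. b < a \<bullet> x)"
      using separating_hyperplane_closed_compact[OF _ _ convex_P_sub[OF q0(1)] closed_P_sub[OF q0(1)] _ disj] by simp
    then obtain a b where ab': "\<forall>x\<in>?R. a \<bullet> x < b" "\<forall>x\<in>P q0 ` sub q0. b < a \<bullet> x"
      by (elim exE conjE) (rule that)
    note ab = bspec[OF ab'(1)] bspec[OF ab'(2)]
    have "0 \<in> ?R" by (auto intro: exI[of _ 0])
    then have b: "b > 0" using ab(1)[of 0] by simp
    have a\<nu>: "a \<bullet> \<nu> \<le> 0"
    proof (rule ccontr)
      assume "\<not> ?thesis"
      then have "a \<bullet> ((b / (a \<bullet> \<nu>)) *\<^sub>R \<nu>) = b" "b / (a \<bullet> \<nu>) \<ge> 0" using b by auto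
      moreover have "(b / (a \<bullet> \<nu>)) *\<^sub>R \<nu> \<in> ?R" using \<open>b / (a \<bullet> \<nu>) \<ge> 0\<close> by blast
      ultimately show False using ab(1) by fastforce
    qed
    have "P q0 y' \<bullet> (-a) < - b" if "y' \<in> sub q0" for y'
      using ab(2)[OF imageI[OF that]] by (simp add: inner_commute)
    from directional_bound[OF q0(1) this] obtain \<delta> where \<delta>: "\<delta> > 0"
      "\<And>s. 0 < s \<Longrightarrow> s < \<delta> \<Longrightarrow> q0 + s *\<^sub>R (-a) \<in> W \<and> u (q0 + s *\<^sub>R (-a)) - u q0 < (-b) * s" by blast
    define x where "x = q0 + (\<delta> / 2) *\<^sub>R (-a)"
    have x: "x \<in> W" "u x < (- b) * (\<delta> / 2)" using \<delta>(2)[of "\<delta> / 2"] \<delta>(1) q0 by (auto simp: x_def)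
    then have "u x < 0" using b \<delta>(1) by (smt (verit) mult_neg_pos half_gt_zero)
    have "isCont u x"
      by (rule continuous_on_interior[OF u_cont]) (use x(1) W(1) in \<open>meson W_closure interior_maximal subsetD subsetI\<close>)
    then have "\<forall>\<^sub>F z in at x. u z < 0"
      using \<open>u x < 0\<close> unfolding isCont_def by (rule order_tendstoD(2))
    then have "\<forall>\<^sub>F z in nhds x. z \<noteq> x \<longrightarrow> u z < 0" by (simp add: eventually_at_filter)
    then have "\<forall>\<^sub>F z in nhds x. u z < 0" by (rule eventually_mono) (use \<open>u x < 0\<close> in auto)
    moreover have "\<forall>\<^sub>F z in nhds x. z \<in> W" using x(1) W(1) by (rule eventually_nhds_in_open[rotated])
    ultimately have "\<forall>\<^sub>F z in nhds x. u z < 0 \<and> z \<in> W" by (rule eventually_conj)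
    then obtain e where e: "e > 0" "\<And>z. dist z x < e \<Longrightarrow> u z < 0 \<and> z \<in> W" by (auto simp: eventually_nhds_metric)
    \<comment> \<open>The point \<open>x\<close> may lie on the supporting hyperplane itself, so a
      further small push along \<open>\<nu>\<close>, which keeps u < 0, is needed to cross it
      strictly.\<close>
    define z where "z = x + (e / (2 * norm \<nu>)) *\<^sub>R \<nu>"
    have "dist z x < e" using e \<nu> by (simp add: z_def dist_norm)
    then have "\<nu> \<bullet> z \<le> \<nu> \<bullet> q0" using e(2) by (intro supp) (auto intro: W_closure less_imp_le)
    moreover have "\<nu> \<bullet> z = \<nu> \<bullet> q0 - (\<delta> / 2) * (a \<bullet> \<nu>) + e / (2 * norm \<nu>) * (\<nu> \<bullet> \<nu>)"
      by (simp add: z_def x_def inner_add_right inner_diff_right inner_commute)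
    moreover have "e / (2 * norm \<nu>) * (\<nu> \<bullet> \<nu>) > 0" using e \<nu> by simp
    moreover have "(\<delta> / 2) * (a \<bullet> \<nu>) \<le> 0" using \<delta>(1) a\<nu> by (simp add: mult_nonneg_nonpos)
    ultimately show False by linarith
  qed
  then obtain s y where sy: "s \<ge> 0" "y \<in> sub q0" "P q0 y = s *\<^sub>R \<nu>" by auto
  have "s \<noteq> 0"
  proof
    assume "s = 0"
    then have "0 = P q0 y" using sy(3) by simp
    then show False using zero sy(2) by (auto simp: image_iff)
  qed
  then show thesis using sy by (intro that[of y s]) auto
qed

end

text \<open>Supplies the dimensional threshold behind the diameter bound. Multiplying by the
  transposed frame moves the matrix near the identity without changing |det|, and there continuity
  of the determinant suffices.\<close>

lemma det_near_orthonormal: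
  obtains \<eta> where "0 < \<eta>" "\<eta> \<le> 1/2"
    "\<And>w e. orthonormal_frame (w :: 'n \<Rightarrow> real^'n) \<Longrightarrow> (\<And>i. norm (e i) \<le> 2 * \<eta>) \<Longrightarrow> \<bar>det (\<chi> i. w i + e i)\<bar> \<ge> 1/2"
proof -
  let ?n = "real CARD('n)"
  have n: "?n \<ge> 1" by (simp add: Suc_le_eq)
  have "continuous_on UNIV (\<lambda>X::real^'n^'n. det X)" by (intro continuous_on_det continuous_intros)
  then obtain \<delta> where \<delta>: "\<delta> > 0" "\<And>X::real^'n^'n. dist X (mat 1) < \<delta> \<Longrightarrow> dist (det X) (det (mat 1 :: real^'n^'n)) < 1/2"
    unfolding continuous_on_iff by (metis UNIV_I half_gt_zero_iff zero_less_one)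
  \<comment> \<open>Each of the n^2 entries of X - 1 is at most 2 \<eta>, so the norm is at most 2
    n^2 \<eta> \<le> \<delta> / 2.\<close>
  define \<eta> where "\<eta> = min (1/2) (\<delta> / (4 * ?n\<^sup>2))"
  have \<eta>: "0 < \<eta>" "\<eta> \<le> 1/2" "\<eta> \<le> \<delta> / (4 * ?n\<^sup>2)" using \<delta> n by (auto simp: \<eta>_def)
  show thesis
  proof (rule that[OF \<eta>(1,2)])
    fix w e :: "'n \<Rightarrow> real^'n" assume w: "orthonormal_frame w" and e: "\<And>i. norm (e i) \<le> 2 * \<eta>"
    define X where "X = (\<chi> i. w i + e i) ** transpose (\<chi> i. w i)"
    have X: "(X - mat 1) $ i $ j = e i \<bullet> w j" for i j
      using w by (simp add: X_def matrix_matrix_mult_def transpose_def mat_def orthonormal_frame_def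
          inner_vec_def distrib_right sum.distrib)
    have "norm (X - mat 1) \<le> (\<Sum>i\<in>UNIV. norm ((X - mat 1) $ i))"
      unfolding norm_vec_def by (rule L2_set_le_sum) auto
    also have "\<dots> \<le> (\<Sum>i\<in>(UNIV::'n set). \<Sum>j\<in>(UNIV::'n set). 2 * \<eta>)"
    proof (rule sum_mono)
      fix i
      have "norm ((X - mat 1) $ i) \<le> (\<Sum>j\<in>UNIV. \<bar>(X - mat 1) $ i $ j\<bar>)" by (rule norm_le_l1_cart)
      also have "\<dots> \<le> (\<Sum>j\<in>(UNIV::'n set). 2 * \<eta>)"
      proof (rule sum_mono)
        fix j show "\<bar>(X - mat 1) $ i $ j\<bar> \<le> 2 * \<eta>"
          unfolding X using Cauchy_Schwarz_ineq2[of "e i" "w j"] e[of i] w by simp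
      qed
      finally show "norm ((X - mat 1) $ i) \<le> (\<Sum>j\<in>(UNIV::'n set). 2 * \<eta>)" .
    qed
    also have "\<dots> = 2 * ?n\<^sup>2 * \<eta>" by (simp add: power2_eq_square)
    also have "\<dots> \<le> 2 * ?n\<^sup>2 * (\<delta> / (4 * ?n\<^sup>2))" using \<eta>(3) by (intro mult_left_mono) auto
    also have "\<dots> < \<delta>" using \<delta>(1) n by simp
    finally have "dist (det X) 1 < 1/2" using \<delta>(2)[of X] by (simp add: dist_norm)
    then have "\<bar>det X\<bar> \<ge> 1/2" unfolding dist_real_def by arith
    moreover have "\<bar>det X\<bar> = \<bar>det (\<chi> i. w i + e i)\<bar>"
      unfolding X_def using orthonormal_frame_det[OF w] by (simp add: det_mul abs_mult)
    ultimately show "\<bar>det (\<chi> i. w i + e i)\<bar> \<ge> 1/2" by simp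
  qed
qed

section \<open>Supporting functions over a section and the volume comparison\<close>

locale potential_section = potential_convex_fun W Y \<psi> P y0 K u
  for W Y :: "(real^'n) set" and \<psi> P y0 K u +
  fixes Q :: "(real^'n) set" and qt :: "real^'n" and h :: real
  assumes Q_def: "Q = {q \<in> closure W. u q \<le> 0}" and QW: "Q \<subseteq> W"
    and frontier_Q: "\<And>q. q \<in> frontier Q \<Longrightarrow> u q = 0"
    and qt: "qt \<in> Q" "u qt = - h" "h > 0"
    and ball_Q: "\<exists>b r. 0 < r \<and> Q \<subseteq> ball b r \<and> ball b (4 * r) \<subseteq> W"
begin

lemma compact_Q: "compact Q"
proof -
  have "closed (closure W \<inter> u -` {..0})"
    by (rule continuous_closed_preimage[OF u_cont]) auto
  moreover have "Q = closure W \<inter> u -` {..0}" by (auto simp: Q_def)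
  ultimately show ?thesis
    using compact_Int_closed[OF compact_closure_W, of Q] by (simp add: Int_absorb1)
qed

lemma dist_Q: "q \<in> Q \<Longrightarrow> q' \<in> Q \<Longrightarrow> norm (q - q') \<le> diameter Q"
  using diameter_bounded_bound[OF compact_imp_bounded[OF compact_Q]] by (simp add: dist_norm)

lemma frontier_or_interior: "q \<in> Q \<Longrightarrow> u q = 0 \<or> q \<in> interior Q"
  using frontier_Q compact_Q by (auto simp: frontier_def compact_imp_closed)

text \<open>At the farthest point \<open>q0\<close>, \<open>section_normal\<close> yields a
  subgradient \<open>y1\<close> whose supporting function drops by at least \<open>h\<close> from
  \<open>q0\<close> to \<open>qt\<close>. Along the curve with P q0 (y t) = t P q0 y1 the drop
  starts at 0 for \<open>y0\<close>, so by the intermediate value theorem it equals \<open>h\<close>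
  somewhere. The maximum principle with end values at most 0 keeps \<open>q0\<close> maximal on
  \<open>Q\<close>.\<close>

lemma supporting_slide:
  assumes \<nu>: "norm \<nu> = 1"
  obtains q0 y s where "q0 \<in> Q" "\<And>q. q \<in> Q \<Longrightarrow> \<nu> \<bullet> q \<le> \<nu> \<bullet> q0" "y \<in> Y" "\<And>q. q \<in> Q \<Longrightarrow> \<psi> q y \<le> \<psi> q0 y"
    "\<psi> q0 y - \<psi> qt y = h" "s > 0" "P q0 y = s *\<^sub>R \<nu>"
proof -
  have "Q \<noteq> {}" using qt by auto
  moreover have "continuous_on Q (\<lambda>q. \<nu> \<bullet> q)" by (intro continuous_intros)
  ultimately obtain q0 where q0: "q0 \<in> Q" "\<And>q. q \<in> Q \<Longrightarrow> \<nu> \<bullet> q \<le> \<nu> \<bullet> q0"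
    using continuous_attains_sup[OF compact_Q] by meson
  have "q0 \<notin> interior Q"
  proof
    assume "q0 \<in> interior Q"
    then obtain e where e: "e > 0" "cball q0 e \<subseteq> Q" by (auto simp: mem_interior_cball)
    have "q0 + e *\<^sub>R \<nu> \<in> Q" using e \<nu> by (intro subsetD[OF e(2)]) (simp add: dist_norm)
    from q0(2)[OF this] have "e * (\<nu> \<bullet> \<nu>) \<le> 0" by (simp add: inner_add_right)
    then show False using e \<nu> by (simp add: norm_eq_1)
  qed
  then have u0: "u q0 = 0" using frontier_or_interior q0(1) by blast
  have q0W: "q0 \<in> W" using q0 QW by blast
  have qtW: "qt \<in> W" using qt QW by blast
  have "\<nu> \<noteq> 0" using \<nu> by auto
  from section_normal[OF q0W u0 W_closure[OF qtW] _ this] q0(2) qt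
  obtain y1 s1 where y1: "y1 \<in> sub q0" "s1 > 0" "P q0 y1 = s1 *\<^sub>R \<nu>" by (auto simp: Q_def)
  have seg: "t *\<^sub>R P q0 y1 \<in> closed_segment (P q0 y0) (P q0 y1)" if "t \<in> {0..1}" for t
    using that P_y0[OF q0W] by (auto simp: closed_segment_def)
  have inP: "t *\<^sub>R P q0 y1 \<in> P q0 ` Y" if "t \<in> {0..1}" for t
    using seg[OF that] P_convex[OF q0W] Y(2) sub_Y[OF y1(1)] closed_segment_subset[of "P q0 y0" "P q0 ` Y" "P q0 y1"] by blast
  define g where "g = inv_into Y (P q0)"
  define y where "y = (\<lambda>t. g (t *\<^sub>R P q0 y1))"
  have gc: "continuous_on (P q0 ` Y) g"
    unfolding g_def by (rule continuous_on_inv[OF P_cont1[OF q0W] Y(1)]) (simp add: P_inj[OF q0W])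
  have yY: "y t \<in> Y" and Py: "P q0 (y t) = t *\<^sub>R P q0 y1" if "t \<in> {0..1}" for t
    using inP[OF that] by (auto simp: y_def g_def inv_into_into f_inv_into_f)
  have yc: "continuous_on {0..1} y"
    unfolding y_def by (rule continuous_on_compose2[OF gc]) (auto intro!: continuous_intros inP)
  have y_0: "y 0 = y0" using Py[of 0] yY[of 0] Y(2) P_y0[OF q0W] P_inj[OF q0W] by (auto simp: inj_on_def)
  have y_1: "y 1 = y1" using Py[of 1] yY[of 1] sub_Y[OF y1(1)] P_inj[OF q0W] by (auto simp: inj_on_def)
  define F where "F = (\<lambda>t. \<psi> qt (y t) - \<psi> q0 (y t))"
  have Fc: "continuous_on {0..1} F" unfolding F_def
    by (intro continuous_intros continuous_on_compose2[OF \<psi>_cont2 yc] W_closure qtW q0W) (auto intro: yY)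
  have F0: "F 0 = 0" using \<psi>_y0 W_closure qtW q0W by (simp add: F_def y_0)
  have F1: "F 1 \<le> - h" using subD[OF y1(1) W_closure[OF qtW]] u0 qt by (simp add: F_def y_1)
  from IVT2'[of F 1 "-h" 0] F0 F1 Fc qt(3) obtain t where t: "0 \<le> t" "t \<le> 1" "F t = - h" by auto
  have "t \<noteq> 0" using t F0 qt(3) by auto
  then have tpos: "t > 0" using t by simp
  have tI: "t \<in> {0..1}" using t by simp
  show thesis
  proof (rule that[OF q0 yY[OF tI]])
    show "\<psi> q0 (y t) - \<psi> qt (y t) = h" using t by (simp add: F_def)
    show "t * s1 > 0" using tpos y1 by simp
    show "P q0 (y t) = (t * s1) *\<^sub>R \<nu>" using Py[OF tI] y1 by simp
    fix q assume q: "q \<in> Q"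
    then have qW: "q \<in> W" using QW by blast
    have "\<psi> q (y t) - \<psi> q0 (y t) \<le> max (\<psi> q y0 - \<psi> q0 y0) (\<psi> q y1 - \<psi> q0 y1)"
      by (rule max_principle[OF q0W qW yY[OF tI] Y(2) sub_Y[OF y1(1)]]) (use Py[OF tI] seg[OF tI] in simp)
    moreover have "\<psi> q y0 - \<psi> q0 y0 = 0" using \<psi>_y0 W_closure qW q0W by simp
    moreover have "\<psi> q y1 - \<psi> q0 y1 \<le> 0" using subD[OF y1(1) W_closure[OF qW]] u0 q by (simp add: Q_def)
    ultimately show "\<psi> q (y t) \<le> \<psi> q0 (y t)" by linarith
  qed
qed

lemma qt_interior: "qt \<in> interior Q"
  using frontier_or_interior[OF qt(1)] qt by auto

text \<open>This replaces the comparison of a convex function with a cone. Lift \<psi>(., y) until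
  it touches \<open>u\<close> from below over \<open>Q\<close>. If the contact occurs on the
  boundary, where u = 0, the hypothesis on \<open>y\<close> says that \<open>qt\<close> is a contact
  point too, and \<open>qt\<close> is interior. An interior contact is a local minimum, which
  Loeper's principle makes global.\<close>

lemma cone_subset_sub:
  assumes y: "y \<in> Y" and le: "\<And>q. q \<in> Q \<Longrightarrow> \<psi> q y - \<psi> qt y \<le> h"
  shows "\<exists>q\<in>Q. y \<in> sub q"
proof -
  have QcW: "Q \<subseteq> closure W" by (auto simp: Q_def)
  have "Q \<noteq> {}" using qt by auto
  moreover have "continuous_on Q (\<lambda>q. u q - \<psi> q y)"
    by (intro continuous_intros continuous_on_subset[OF u_cont QcW] continuous_on_subset[OF \<psi>_cont1[OF y] QcW])
  ultimately obtain q1 where q1: "q1 \<in> Q" "\<And>q. q \<in> Q \<Longrightarrow> u q1 - \<psi> q1 y \<le> u q - \<psi> q y"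
    using continuous_attains_inf[OF compact_Q] by meson
  obtain q2 where q2: "q2 \<in> interior Q" "\<And>q. q \<in> Q \<Longrightarrow> u q2 - \<psi> q2 y \<le> u q - \<psi> q y"
  proof (cases "q1 \<in> interior Q")
    case True then show thesis using that q1 by blast
  next
    case False
    then have "u q1 = 0" using frontier_or_interior q1 by blast
    then have "u qt - \<psi> qt y \<le> u q1 - \<psi> q1 y" using le[OF q1(1)] qt by simp
    then show thesis using that[OF qt_interior] q1(2) by force
  qed
  obtain e where e: "e > 0" "ball q2 e \<subseteq> Q" using q2(1) by (auto simp: mem_interior)
  have q2Q: "q2 \<in> Q" using q2(1) interior_subset by blast
  have "y \<in> sub q2" by (rule local_min_sub[OF _ y e(1)]) (use q2 q2Q QW e(2) in auto)
  then show ?thesis using q2Q by blast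
qed

text \<open>The relative Lipschitz bound gives |P qt y| \<le> 2s, and |P z y| \<le> 2 |P qt y| for z
  within distance diam(Q) of \<open>qt\<close>; the constant 4 is the product of the two. To bound
  \<open>h\<close> by the width in the direction \<open>\<nu>\<close> rather than by |q0 - qt|, the
  point \<open>q0\<close> is replaced by the foot of \<open>qt\<close> on the supporting hyperplane
  at \<open>q0\<close>.\<close>

lemma slide_estimate:
  assumes \<nu>: "norm \<nu> = 1" and q0: "q0 \<in> Q" "\<And>q. q \<in> Q \<Longrightarrow> \<nu> \<bullet> q \<le> \<nu> \<bullet> q0"
    and y: "y \<in> Y" "\<psi> q0 y - \<psi> qt y = h" and s: "s > 0" "P q0 y = s *\<^sub>R \<nu>"
    and \<eta>: "K * diameter Q \<le> \<eta>" "\<eta> \<le> 1/2"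
  shows "norm ((1 / s) *\<^sub>R P qt y - \<nu>) \<le> 2 * \<eta>" "h \<le> 4 * (\<nu> \<bullet> (q0 - qt)) * s"
proof -
  let ?p = "P qt y"
  have q0W: "q0 \<in> W" and qtW: "qt \<in> W" using q0 qt QW by auto
  have near: "norm (P z y - ?p) \<le> \<eta> * norm ?p" if "z \<in> W" "norm (z - qt) \<le> diameter Q" for z
  proof -
    have "norm (P z y - ?p) \<le> K * norm (z - qt) * norm ?p" by (rule K(2)[OF that(1) qtW y(1)])
    also have "\<dots> \<le> K * diameter Q * norm ?p" using that(2) K(1) by (intro mult_right_mono mult_left_mono) auto
    also have "\<dots> \<le> \<eta> * norm ?p" using \<eta> by (intro mult_right_mono) auto
    finally show ?thesis .
  qed
  have n0: "norm (s *\<^sub>R \<nu> - ?p) \<le> \<eta> * norm ?p" using near[OF q0W dist_Q[OF q0(1) qt(1)]] s by simp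
  have "norm ?p \<le> norm (s *\<^sub>R \<nu>) + norm (s *\<^sub>R \<nu> - ?p)" by (metis norm_minus_commute norm_triangle_sub)
  also have "\<dots> \<le> s + (1/2) * norm ?p"
    using n0 s \<nu> \<eta>(2) mult_right_mono[OF \<eta>(2), of "norm ?p"] by simp
  finally have ps: "norm ?p \<le> 2 * s" by simp
  have \<eta>0: "\<eta> \<ge> 0" using \<eta>(1) K(1) diameter_ge_0[OF compact_imp_bounded[OF compact_Q]] by (meson mult_nonneg_nonneg order_trans)
  have "norm ((1 / s) *\<^sub>R ?p - \<nu>) = norm ((1 / s) *\<^sub>R (?p - s *\<^sub>R \<nu>))" using s by (simp add: scaleR_diff_right)
  also have "\<dots> = norm (s *\<^sub>R \<nu> - ?p) / s" using s by (simp add: norm_minus_commute)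
  also have "\<dots> \<le> \<eta> * (2 * s) / s"
    using n0 ps \<eta>0 s by (intro divide_right_mono) (auto intro: order_trans mult_left_mono)
  finally show "norm ((1 / s) *\<^sub>R ?p - \<nu>) \<le> 2 * \<eta>" using s by simp
  define d where "d = \<nu> \<bullet> (q0 - qt)"
  have d0: "d \<ge> 0" using q0(2)[OF qt(1)] by (simp add: d_def inner_diff_right)
  have dd: "d \<le> diameter Q"
    using norm_cauchy_schwarz[of \<nu> "q0 - qt"] \<nu> dist_Q[OF q0(1) qt(1)] by (simp add: d_def)
  \<comment> \<open>This foot point need not belong to \<open>Q\<close>. If \<open>Q\<close> lies in
    a ball of radius r, then d < 2r, so q' is within 3r of the centre and hence in the
    domain.\<close>
  define q' where "q' = qt + d *\<^sub>R \<nu>"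
  obtain b r where br: "0 < r" "Q \<subseteq> ball b r" "ball b (4 * r) \<subseteq> W" using ball_Q by blast
  have "d \<le> norm (q0 - qt)" using norm_cauchy_schwarz[of \<nu> "q0 - qt"] \<nu> by (simp add: d_def)
  also have "\<dots> \<le> dist q0 b + dist qt b" by (metis dist_norm dist_triangle2)
  also have "\<dots> < r + r"
    by (rule add_strict_mono) (use br(2) q0(1) qt(1) in \<open>auto simp: dist_commute\<close>)
  also have "r + r = 2 * r" by simp
  finally have "d < 2 * r" .
  have "dist q' b \<le> dist q' qt + dist qt b" by (rule dist_triangle)
  also have "\<dots> < 2 * r + r"
    by (rule add_strict_mono) (use \<open>d < 2 * r\<close> br(2) qt(1) \<nu> d0 in \<open>auto simp: q'_def dist_norm norm_minus_commute\<close>)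
  also have "\<dots> \<le> 4 * r" using br(1) by simp
  finally have q'W: "q' \<in> W" using br(3) by (auto simp: dist_commute)
  \<comment> \<open>Sublevel sets of \<psi>(., y) are convex, and the one at \<open>q0\<close> has
    outer normal \<open>\<nu>\<close>. If \<open>q'\<close> had a smaller value, so would a point
    q'' strictly beyond the hyperplane; but \<psi> increases initially on the way from
    \<open>q0\<close> to q'', which contradicts quasiconvexity on that segment.\<close>
  have ge: "\<psi> q0 y \<le> \<psi> q' y"
  proof (rule ccontr)
    assume "\<not> ?thesis"
    then have less: "\<psi> q' y < \<psi> q0 y" by simp
    have "isCont (\<lambda>q. \<psi> q y) q'" using has_derivative_continuous[OF P_deriv[OF q'W y(1)]] .
    then have "isCont (\<lambda>\<rho>. \<psi> (q' + \<rho> *\<^sub>R \<nu>) y) 0"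
      by (intro isCont_o2[where f="\<lambda>\<rho>. q' + \<rho> *\<^sub>R \<nu>" and g="\<lambda>q. \<psi> q y"]) (auto intro!: continuous_intros)
    then have "((\<lambda>\<rho>. \<psi> (q' + \<rho> *\<^sub>R \<nu>) y) \<longlongrightarrow> \<psi> q' y) (at 0)" by (simp add: isCont_def)
    from order_tendstoD(2)[OF this less] have ev1: "\<forall>\<^sub>F \<rho> in at 0. \<psi> (q' + \<rho> *\<^sub>R \<nu>) y < \<psi> q0 y" .
    have "((\<lambda>\<rho>. q' + \<rho> *\<^sub>R \<nu>) \<longlongrightarrow> q' + 0 *\<^sub>R \<nu>) (at 0)" by (intro tendsto_intros)
    then have ev2: "\<forall>\<^sub>F \<rho> in at 0. q' + \<rho> *\<^sub>R \<nu> \<in> W" using W(1) q'W by (auto dest: topological_tendstoD)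
    obtain \<delta> where \<delta>: "\<delta> > 0" "\<And>\<rho>. \<rho> \<noteq> 0 \<Longrightarrow> \<bar>\<rho>\<bar> < \<delta> \<Longrightarrow> \<psi> (q' + \<rho> *\<^sub>R \<nu>) y < \<psi> q0 y \<and> q' + \<rho> *\<^sub>R \<nu> \<in> W"
      using eventually_conj[OF ev1 ev2] by (auto simp: eventually_at)
    define q'' where "q'' = q' + (\<delta> / 2) *\<^sub>R \<nu>"
    have q'': "\<psi> q'' y < \<psi> q0 y" "q'' \<in> W" using \<delta>(2)[of "\<delta> / 2"] \<delta>(1) by (auto simp: q''_def)
    have "\<nu> \<bullet> (q'' - q0) = \<delta> / 2"
      using \<nu> by (simp add: q''_def q'_def d_def inner_diff_right inner_add_right norm_eq_1)
    then have pos: "P q0 y \<bullet> (q'' - q0) > 0" using s \<delta>(1) by simp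
    have "((\<lambda>q. \<psi> q y) \<circ> (\<lambda>t. q0 + t *\<^sub>R (q'' - q0)) has_derivative (\<lambda>v. P q0 y \<bullet> v) \<circ> (\<lambda>t. t *\<^sub>R (q'' - q0))) (at 0)"
      by (rule diff_chain_at) (use P_deriv[OF q0W y(1)] in \<open>auto intro!: derivative_eq_intros\<close>)
    then have "((\<lambda>t. \<psi> (q0 + t *\<^sub>R (q'' - q0)) y) has_real_derivative P q0 y \<bullet> (q'' - q0)) (at 0)"
      unfolding has_field_derivative_def comp_def inner_scaleR_right mult_commute_abs .
    from DERIV_pos_inc_right[OF this pos] obtain e where e: "e > 0"
      "\<And>t. t > 0 \<Longrightarrow> t < e \<Longrightarrow> \<psi> q0 y < \<psi> (q0 + t *\<^sub>R (q'' - q0)) y" by auto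
    define t where "t = min (e / 2) 1"
    have t: "t > 0" "t < e" "t \<le> 1" using e(1) by (auto simp: t_def)
    have "q0 + t *\<^sub>R (q'' - q0) \<in> closed_segment q0 q''"
      using t by (auto simp: closed_segment_def algebra_simps intro!: exI[of _ t])
    from quasiconvex[OF q0W q''(2) y(1) this] e(2)[OF t(1,2)] q''(1) show False by simp
  qed
  obtain z where z: "z \<in> closed_segment qt q'" "\<psi> q' y - \<psi> qt y = P z y \<bullet> (q' - qt)"
    using \<psi>_mvt[OF qtW q'W y(1)] by blast
  have zW: "z \<in> W" using z(1) closed_segment_subset[OF qtW q'W W(2)] by blast
  have "norm (z - qt) \<le> norm (q' - qt)"
    using dist_in_closed_segment[OF z(1)] by (simp add: dist_norm norm_minus_commute)
  also have "\<dots> = d" using \<nu> d0 by (simp add: q'_def)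
  finally have "norm (P z y - ?p) \<le> \<eta> * norm ?p" using near[OF zW] dd by simp
  also have "\<dots> \<le> norm ?p" using \<eta>(2) mult_right_mono[of \<eta> 1 "norm ?p"] by simp
  finally have "norm (P z y) \<le> 2 * norm ?p" using norm_triangle_sub[of "P z y" ?p] by simp
  then have Pz: "norm (P z y) \<le> 4 * s" using ps by simp
  have "h \<le> \<psi> q' y - \<psi> qt y" using ge y(2) by simp
  also have "\<dots> = d * (P z y \<bullet> \<nu>)" unfolding z(2) by (simp add: q'_def)
  also have "P z y \<bullet> \<nu> \<le> 4 * s" using norm_cauchy_schwarz[of "P z y" \<nu>] \<nu> Pz by simp
  then have "d * (P z y \<bullet> \<nu>) \<le> d * (4 * s)" using d0 by (rule mult_left_mono)
  finally show "h \<le> 4 * (\<nu> \<bullet> (q0 - qt)) * s" by (simp add: d_def mult.assoc mult.commute mult.left_commute)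
qed

theorem frame_estimate:
  assumes w: "orthonormal_frame w" and d: "\<And>i x. x \<in> Q \<Longrightarrow> w i \<bullet> (x - qt) \<le> d i"
    and \<eta>: "K * diameter Q \<le> \<eta>" "\<eta> \<le> 1/2"
      "\<And>w e. orthonormal_frame (w :: 'n \<Rightarrow> real^'n) \<Longrightarrow> (\<And>i. norm (e i) \<le> 2 * \<eta>) \<Longrightarrow> \<bar>det (\<chi> i. w i + e i)\<bar> \<ge> 1/2"
    and vol: "\<And>S. compact S \<Longrightarrow> S \<subseteq> Y \<Longrightarrow> convex (P qt ` S) \<Longrightarrow> emeasure lebesgue (P qt ` S) \<le> ennreal g * emeasure lebesgue S"
    and MA: "emeasure lebesgue (\<Union>q\<in>Q. sub q) \<le> ennreal L * emeasure lebesgue Q" and L: "L \<ge> 0" and g: "g \<ge> 0"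
  shows "h ^ CARD('n) \<le> 2 * 4 ^ CARD('n) / simplex_content TYPE('n) * (\<Prod>i\<in>UNIV. d i) * (g * L * measure lebesgue Q)"
proof -
  have qtW: "qt \<in> W" using qt QW by auto
  have QcW: "Q \<subseteq> closure W" by (auto simp: Q_def)
  define S where "S = {y \<in> Y. \<forall>q\<in>Q. \<psi> q y - \<psi> qt y \<le> h}"
  have Smem: "\<exists>s y. y \<in> S \<and> s > 0 \<and> norm ((1 / s) *\<^sub>R P qt y - w i) \<le> 2 * \<eta> \<and> h \<le> 4 * d i * s" for i
  proof -
    have \<nu>: "norm (w i) = 1" using w by simp
    from supporting_slide[OF this] obtain q0 y s where *: "q0 \<in> Q" "\<And>q. q \<in> Q \<Longrightarrow> w i \<bullet> q \<le> w i \<bullet> q0" "y \<in> Y"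
      "\<And>q. q \<in> Q \<Longrightarrow> \<psi> q y \<le> \<psi> q0 y" "\<psi> q0 y - \<psi> qt y = h" "s > 0" "P q0 y = s *\<^sub>R w i" by blast
    have "y \<in> S" using * by (force simp: S_def)
    moreover have "h \<le> 4 * (w i \<bullet> (q0 - qt)) * s" "norm ((1 / s) *\<^sub>R P qt y - w i) \<le> 2 * \<eta>"
      using slide_estimate[OF \<nu> *(1,2,3,5,6,7) \<eta>(1,2)] by auto
    moreover have "4 * (w i \<bullet> (q0 - qt)) * s \<le> 4 * d i * s" using d[OF *(1)] *(6) by (intro mult_right_mono mult_left_mono) auto
    ultimately show ?thesis using *(6) by (intro exI[of _ s] exI[of _ y]) linarith
  qed
  then obtain s y where sy: "\<And>i. y i \<in> S" "\<And>i. s i > 0" "\<And>i. norm ((1 / s i) *\<^sub>R P qt (y i) - w i) \<le> 2 * \<eta>"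
    "\<And>i. h \<le> 4 * d i * s i" by metis
  define e where "e = (\<lambda>i. (1 / s i) *\<^sub>R P qt (y i) - w i)"
  have P_eq: "P qt (y i) = s i *s (w i + e i)" for i
    using sy(2)[of i] by (simp add: e_def scalar_mult_eq_scaleR)
  define v where "v = (\<chi> i. P qt (y i))"
  have "det v = (\<Prod>i\<in>UNIV. s i) * det (\<chi> i. w i + e i)"
    unfolding v_def P_eq by (rule det_rows_mul)
  moreover have "\<bar>det (\<chi> i. w i + e i)\<bar> \<ge> 1/2" by (rule \<eta>(3)[OF w]) (use sy(3) in \<open>simp add: e_def\<close>)
  moreover have sp: "(\<Prod>i\<in>UNIV. s i) > 0" using sy(2) by (simp add: prod_pos)
  ultimately have detv: "(\<Prod>i\<in>UNIV. s i) \<le> 2 * \<bar>det v\<bar>" by (simp add: abs_mult)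
  have "compact S"
  proof -
    have "S = (\<Inter>q\<in>Q. Y \<inter> (\<lambda>y. \<psi> q y - \<psi> qt y) -` {..h})" using qt(1) by (auto simp: S_def)
    moreover have "closed (Y \<inter> (\<lambda>y. \<psi> q y - \<psi> qt y) -` {..h})" if "q \<in> Q" for q
      by (rule continuous_closed_preimage)
        (use that QcW qt(1) Y(1) in \<open>auto intro!: continuous_intros \<psi>_cont2 compact_imp_closed\<close>)
    ultimately have "closed S" by (metis (no_types, lifting) closed_INT)
    then show ?thesis using compact_Int_closed[OF Y(1), of S] by (simp add: S_def Int_absorb1 Collect_conj_eq[symmetric] subset_eq Int_def)
  qed
  have "convex (P qt ` S)"
    unfolding convex_contains_segment
  proof (intro ballI subsetI)
    fix p1 p2 p assume "p1 \<in> P qt ` S" "p2 \<in> P qt ` S" and p: "p \<in> closed_segment p1 p2"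
    then obtain y1 y2 where y12: "y1 \<in> S" "y2 \<in> S" "p1 = P qt y1" "p2 = P qt y2" by auto
    then have "P qt y1 \<in> P qt ` Y" "P qt y2 \<in> P qt ` Y" by (auto simp: S_def)
    then have "closed_segment (P qt y1) (P qt y2) \<subseteq> P qt ` Y"
      by (rule closed_segment_subset[OF _ _ P_convex[OF qtW]])
    then have "p \<in> P qt ` Y" using p y12 by (simp add: subset_iff)
    then obtain y' where y': "y' \<in> Y" "p = P qt y'" by auto
    have "\<psi> q y' - \<psi> qt y' \<le> h" if "q \<in> Q" for q
    proof -
      have "\<psi> q y' - \<psi> qt y' \<le> max (\<psi> q y1 - \<psi> qt y1) (\<psi> q y2 - \<psi> qt y2)"
        by (rule max_principle[OF qtW]) (use that QW y' y12 p in \<open>auto simp: S_def\<close>)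
      then show ?thesis using y12 that by (auto simp: S_def max_def split: if_splits)
    qed
    then show "p \<in> P qt ` S" using y' by (auto simp: S_def)
  qed
  moreover have "0 \<in> P qt ` S"
  proof (rule image_eqI)
    show "0 = P qt y0" using P_y0[OF qtW] by simp
    have "\<psi> q y0 = 0" if "q \<in> Q" for q using \<psi>_y0 QcW that by blast
    then show "y0 \<in> S" using Y(2) qt(1,3) by (auto simp: S_def)
  qed
  ultimately have "convex hull (insert 0 (range (\<lambda>i. 0 + v $ i))) \<subseteq> P qt ` S"
    using sy(1) by (intro hull_minimal) (auto simp: v_def)
  moreover have "compact (P qt ` S)"
    by (rule compact_continuous_image[OF continuous_on_subset[OF P_cont1[OF qtW]] \<open>compact S\<close>]) (auto simp: S_def)
  ultimately have "ennreal (simplex_content TYPE('n) * \<bar>det v\<bar>) \<le> emeasure lebesgue (P qt ` S)"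
    unfolding emeasure_simplex[of 0 v, symmetric] by (intro emeasure_mono) (auto dest: lmeasurable_compact)
  also have "\<dots> \<le> ennreal g * emeasure lebesgue S"
    by (rule vol[OF \<open>compact S\<close> _ \<open>convex (P qt ` S)\<close>]) (auto simp: S_def)
  also have "\<dots> \<le> ennreal g * emeasure lebesgue (\<Union>q\<in>Q. sub q)"
    using cone_subset_sub lmeasurable_compact[OF compact_sub_image[OF compact_Q QcW]]
    by (intro mult_left_mono emeasure_mono) (auto simp: S_def)
  also have "\<dots> \<le> ennreal g * (ennreal L * emeasure lebesgue Q)" by (intro mult_left_mono MA) auto
  also have "emeasure lebesgue Q = ennreal (measure lebesgue Q)"
    using lmeasurable_compact[OF compact_Q] by (simp add: emeasure_eq_measure2)
  also have "ennreal g * (ennreal L * ennreal (measure lebesgue Q)) = ennreal (g * L * measure lebesgue Q)"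
    using g L by (simp add: ennreal_mult mult.assoc)
  finally have "simplex_content TYPE('n) * \<bar>det v\<bar> \<le> g * L * measure lebesgue Q"
    using g L by (simp add: ennreal_le_iff)
  then have det_le: "\<bar>det v\<bar> \<le> g * L * measure lebesgue Q / simplex_content TYPE('n)"
    using simplex_content_pos[where 'n='n] by (simp add: pos_le_divide_eq mult.commute)
  have dpos: "d i \<ge> 0" for i using d[OF qt(1), of i] by simp
  have "h ^ CARD('n) = (\<Prod>i\<in>(UNIV::'n set). h)" by simp
  also have "\<dots> \<le> (\<Prod>i\<in>UNIV. 4 * d i * s i)" using sy(4) qt(3) by (intro prod_mono) auto
  also have "\<dots> = 4 ^ CARD('n) * (\<Prod>i\<in>UNIV. d i) * (\<Prod>i\<in>UNIV. s i)" by (simp add: prod.distrib)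
  also have "\<dots> \<le> 4 ^ CARD('n) * (\<Prod>i\<in>UNIV. d i) * (2 * (g * L * measure lebesgue Q / simplex_content TYPE('n)))"
    using detv det_le dpos by (intro mult_left_mono) (auto intro!: mult_nonneg_nonneg prod_nonneg)
  also have "\<dots> = 2 * 4 ^ CARD('n) / simplex_content TYPE('n) * (\<Prod>i\<in>UNIV. d i) * (g * L * measure lebesgue Q)"
    unfolding divide_inverse by (simp only: ac_simps)
  finally show ?thesis .
qed

end

section \<open>Calculus of \<open>C\<^sup>k\<close> functions\<close>

text \<open>Fixing the direction makes the derivative a scalar function again, so iterated
  derivatives stay within the scope of \<open>Ck_closure\<close>.\<close>

definition dd :: "'a::euclidean_space \<Rightarrow> ('a \<Rightarrow> real) \<Rightarrow> 'a \<Rightarrow> real" where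
  "dd v f x = frechet_derivative f (at x) v"

lemma dd_has_derivative: "f differentiable (at x) \<Longrightarrow> (f has_derivative (\<lambda>v. dd v f x)) (at x)"
  unfolding dd_def by (metis (no_types, lifting) frechet_derivative_works)

lemma dd_eqI: "(f has_derivative f') (at x) \<Longrightarrow> dd v f x = f' v"
  unfolding dd_def by (metis frechet_derivative_at)

lemma dd_scale: "f differentiable (at x) \<Longrightarrow> dd (r *\<^sub>R v) f x = r * dd v f x"
  using linear_cmul[OF has_derivative_linear[OF dd_has_derivative]] by force

lemma dd_sum: "f differentiable (at x) \<Longrightarrow> dd (\<Sum>i\<in>I. g i) f x = (\<Sum>i\<in>I. dd (g i) f x)"
  using linear_sum[OF has_derivative_linear[OF dd_has_derivative]] by force

lemma dd_basis: "f differentiable (at x) \<Longrightarrow> dd v f x = (\<Sum>b\<in>Basis. (v \<bullet> b) * dd b f x)"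
  using dd_sum[of f x "\<lambda>b. (v \<bullet> b) *\<^sub>R b" Basis] by (simp add: euclidean_representation dd_scale)

text \<open>True even without differentiability: functions agreeing near \<open>x\<close> have the
  same set of derivatives there, and \<open>frechet_derivative\<close> makes the same choice from
  the same set.\<close>

lemma dd_cong_open:
  assumes "open S" "x \<in> S" "\<And>y. y \<in> S \<Longrightarrow> f y = g y" shows "dd v f x = dd v g x"
proof -
  have "(f has_derivative f') (at x) \<longleftrightarrow> (g has_derivative f') (at x)" for f'
    using has_derivative_transform_within_open[OF _ assms(1,2), of f f' UNIV g]
      has_derivative_transform_within_open[OF _ assms(1,2), of g f' UNIV f] assms(3) by auto
  then show ?thesis unfolding dd_def frechet_derivative_def by simp
qed

lemma Ck_closure_continuous_ext: "Ck_closure k S f \<Longrightarrow> \<exists>g. continuous_on (closure S) g \<and> (\<forall>x\<in>S. g x = f x)"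
  by (cases k) auto

lemma Ck_closure_differentiable: "Ck_closure (Suc k) S f \<Longrightarrow> x \<in> S \<Longrightarrow> f differentiable (at x)"
  by simp

lemma Ck_closure_continuous_on: "Ck_closure k S f \<Longrightarrow> continuous_on S f"
  using Ck_closure_continuous_ext[of k S f] by (metis closure_subset continuous_on_cong continuous_on_subset)

lemma Ck_closure_cong:
  assumes "open S"
  shows "(\<And>x. x \<in> S \<Longrightarrow> f x = g x) \<Longrightarrow> Ck_closure k S f \<Longrightarrow> Ck_closure k S g"
proof (induction k arbitrary: f g)
  case 0 then show ?case by simp
next
  case (Suc k)
  have "g differentiable (at x)" if "x \<in> S" for x
  proof -
    have "(f has_derivative (\<lambda>v. dd v f x)) (at x)" using Suc.prems(2) that by (intro dd_has_derivative) auto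
    from has_derivative_transform_within_open[OF this assms that Suc.prems(1)] show ?thesis
      by (auto simp: differentiable_def)
  qed
  moreover have "Ck_closure k S (\<lambda>x. frechet_derivative g (at x) b)" if "b \<in> Basis" for b
    by (rule Suc.IH[of "\<lambda>x. frechet_derivative f (at x) b"])
      (use Suc.prems that dd_cong_open[OF assms, of _ f g b] in \<open>auto simp: dd_def\<close>)
  moreover have "\<exists>h. continuous_on (closure S) h \<and> (\<forall>x\<in>S. h x = g x)"
    using Ck_closure_continuous_ext[OF Suc.prems(2)] Suc.prems(1) by auto
  ultimately show ?case by simp
qed

lemma Ck_closure_add:
  assumes "open S"
  shows "Ck_closure k S f \<Longrightarrow> Ck_closure k S g \<Longrightarrow> Ck_closure k S (\<lambda>x. f x + g x)"
proof (induction k arbitrary: f g)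
  case 0
  then obtain f' g' where "continuous_on (closure S) f'" "\<forall>x\<in>S. f' x = f x" "continuous_on (closure S) g'" "\<forall>x\<in>S. g' x = g x"
    by auto
  then show ?case by (auto intro!: exI[of _ "\<lambda>x. f' x + g' x"] continuous_intros)
next
  case (Suc k)
  obtain f' g' where "continuous_on (closure S) f'" "\<forall>x\<in>S. f' x = f x" "continuous_on (closure S) g'" "\<forall>x\<in>S. g' x = g x"
    using Ck_closure_continuous_ext Suc.prems by metis
  then have "\<exists>h. continuous_on (closure S) h \<and> (\<forall>x\<in>S. h x = f x + g x)"
    by (auto intro!: exI[of _ "\<lambda>x. f' x + g' x"] continuous_intros)
  moreover have "Ck_closure k S (\<lambda>x. frechet_derivative (\<lambda>x. f x + g x) (at x) b)" if "b \<in> Basis" for b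
  proof (rule Ck_closure_cong[OF assms])
    show "Ck_closure k S (\<lambda>x. frechet_derivative f (at x) b + frechet_derivative g (at x) b)"
      using Suc that by simp
    fix x assume "x \<in> S"
    then have "((\<lambda>x. f x + g x) has_derivative (\<lambda>v. dd v f x + dd v g x)) (at x)"
      using Suc.prems by (intro has_derivative_add dd_has_derivative) auto
    from dd_eqI[OF this, of b] show "frechet_derivative f (at x) b + frechet_derivative g (at x) b = frechet_derivative (\<lambda>x. f x + g x) (at x) b"
      by (simp add: dd_def)
  qed
  ultimately show ?case using Suc.prems by (auto intro: differentiable_add)
qed

lemma Ck_closure_scale:
  assumes "open S"
  shows "Ck_closure k S f \<Longrightarrow> Ck_closure k S (\<lambda>x. r * f x)"
proof (induction k arbitrary: f)
  case 0
  then obtain f' where "continuous_on (closure S) f'" "\<forall>x\<in>S. f' x = f x" by auto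
  then show ?case by (auto intro!: exI[of _ "\<lambda>x. r * f' x"] continuous_intros)
next
  case (Suc k)
  obtain f' where "continuous_on (closure S) f'" "\<forall>x\<in>S. f' x = f x"
    using Ck_closure_continuous_ext Suc.prems by metis
  then have "\<exists>h. continuous_on (closure S) h \<and> (\<forall>x\<in>S. h x = r * f x)"
    by (auto intro!: exI[of _ "\<lambda>x. r * f' x"] continuous_intros)
  moreover have "Ck_closure k S (\<lambda>x. frechet_derivative (\<lambda>x. r * f x) (at x) b)" if "b \<in> Basis" for b
  proof (rule Ck_closure_cong[OF assms])
    show "Ck_closure k S (\<lambda>x. r * frechet_derivative f (at x) b)"
      using Suc that by simp
    fix x assume "x \<in> S"
    then have "((\<lambda>x. r * f x) has_derivative (\<lambda>v. r * dd v f x)) (at x)"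
      using Suc.prems by (intro has_derivative_mult_right dd_has_derivative) auto
    from dd_eqI[OF this, of b] show "r * frechet_derivative f (at x) b = frechet_derivative (\<lambda>x. r * f x) (at x) b"
      by (simp add: dd_def)
  qed
  ultimately show ?case using Suc.prems by auto
qed

lemma Ck_closure_zero: "Ck_closure k S (\<lambda>x. 0)"
proof (induction k)
  case 0 then show ?case by (auto intro!: exI[of _ "\<lambda>x. 0"])
next
  case (Suc k)
  then show ?case by (auto intro!: exI[of _ "\<lambda>x. 0"])
qed

lemma Ck_closure_sum:
  assumes "open S" "finite I"
  shows "(\<And>i. i \<in> I \<Longrightarrow> Ck_closure k S (g i)) \<Longrightarrow> Ck_closure k S (\<lambda>x. \<Sum>i\<in>I. g i x)"
  using assms(2)
proof (induction I rule: finite_induct)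
  case empty
  then show ?case using Ck_closure_zero by (simp only: sum.empty)
next
  case (insert i I)
  have "Ck_closure k S (\<lambda>x. g i x + (\<Sum>i\<in>I. g i x))"
  proof (rule Ck_closure_add[OF assms(1)])
    show "Ck_closure k S (g i)" by (rule insert.prems) simp
    show "Ck_closure k S (\<lambda>x. \<Sum>i\<in>I. g i x)" by (rule insert.IH) (rule insert.prems, simp)
  qed
  moreover have "(\<lambda>x. \<Sum>i\<in>insert i I. g i x) = (\<lambda>x. g i x + (\<Sum>i\<in>I. g i x))"
    using insert.hyps by simp
  ultimately show ?case by (simp only:)
qed

lemma Ck_closure_dd:
  assumes "open S" "Ck_closure (Suc k) S f"
  shows "Ck_closure k S (dd v f)"
proof (rule Ck_closure_cong[OF assms(1)])
  show "Ck_closure k S (\<lambda>x. \<Sum>b\<in>Basis. (v \<bullet> b) * dd b f x)"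
    by (intro Ck_closure_sum Ck_closure_scale assms(1)) (use assms(2) in \<open>auto simp: dd_def\<close>)
  show "(\<Sum>b\<in>Basis. (v \<bullet> b) * dd b f x) = dd v f x" if "x \<in> S" for x
    using dd_basis[of f x v] assms(2) that by simp
qed

lemma Ck_closure_mono: "Ck_closure (Suc k) S f \<Longrightarrow> Ck_closure k S f"
proof (induction k arbitrary: f)
  case (Suc k)
  from Suc.prems have "(\<exists>g. continuous_on (closure S) g \<and> (\<forall>x\<in>S. g x = f x)) \<and> (\<forall>x\<in>S. f differentiable (at x)) \<and>
    (\<forall>b\<in>Basis. Ck_closure (Suc k) S (\<lambda>x. frechet_derivative f (at x) b))"
    by (rule Ck_closure.simps(2)[THEN iffD1])
  then show ?case using Suc.IH unfolding Ck_closure.simps(2)[of k S f] by blast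
qed simp

lemma Ck_closure_le: "Ck_closure k S f \<Longrightarrow> j \<le> k \<Longrightarrow> Ck_closure j S f"
proof (induction k)
  case (Suc k)
  show ?case
  proof (cases "j = Suc k")
    case False
    then show ?thesis using Suc Ck_closure_mono[of k S f] by (simp del: Ck_closure.simps)
  qed (use Suc in simp)
qed (simp del: Ck_closure.simps)

section \<open>Uniform bounds on derivatives over a bounded domain\<close>

lemma Ck_closure_bounded:
  assumes "bounded S" "Ck_closure k S f"
  obtains B where "B \<ge> 0" "\<And>x. x \<in> S \<Longrightarrow> \<bar>f x\<bar> \<le> B"
proof -
  obtain g where g: "continuous_on (closure S) g" "\<forall>x\<in>S. g x = f x" using Ck_closure_continuous_ext[OF assms(2)] by auto
  have "bounded (g ` closure S)"
    using assms(1) by (intro compact_imp_bounded compact_continuous_image g) (simp add: compact_closure)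
  then obtain B where B: "\<forall>x\<in>closure S. \<bar>g x\<bar> \<le> B" by (auto simp: bounded_iff)
  show thesis
  proof (rule that[of "max 0 B"])
    fix x assume "x \<in> S"
    moreover have "x \<in> closure S" using \<open>x \<in> S\<close> closure_subset by blast
    ultimately show "\<bar>f x\<bar> \<le> max 0 B" using B g(2) by fastforce
  qed simp
qed

lemma dd_bound1:
  assumes "open S" "bounded S" "Ck_closure (Suc k) S f"
  obtains B where "B \<ge> 0" "\<And>x v. x \<in> S \<Longrightarrow> \<bar>dd v f x\<bar> \<le> B * norm v"
proof -
  have "\<exists>B. B \<ge> 0 \<and> (\<forall>x\<in>S. \<bar>dd b f x\<bar> \<le> B)" for b
    using Ck_closure_bounded[OF assms(2) Ck_closure_dd[OF assms(1,3)], of b] by metis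
  then obtain B where B: "\<And>b. B b \<ge> 0" "\<And>b x. x \<in> S \<Longrightarrow> \<bar>dd b f x\<bar> \<le> B b" by metis
  show thesis
  proof (rule that[of "\<Sum>b\<in>Basis. B b"])
    show "(\<Sum>b\<in>Basis. B b) \<ge> 0" using B by (simp add: sum_nonneg)
    fix x v assume x: "x \<in> S"
    have "\<bar>dd v f x\<bar> \<le> (\<Sum>b\<in>Basis. \<bar>(v \<bullet> b) * dd b f x\<bar>)"
      using dd_basis[of f x v] assms(3) x by (simp add: sum_abs)
    also have "\<dots> \<le> (\<Sum>b\<in>Basis. norm v * B b)"
      unfolding abs_mult by (intro sum_mono mult_mono) (auto simp: Basis_le_norm B x)
    finally show "\<bar>dd v f x\<bar> \<le> (\<Sum>b\<in>Basis. B b) * norm v" by (simp add: sum_distrib_left mult.commute)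
  qed
qed

lemma dd_dd_basis:
  assumes "open S" "Ck_closure (Suc (Suc k)) S f" "x \<in> S"
  shows "dd v (dd w f) x = (\<Sum>b\<in>Basis. (w \<bullet> b) * dd v (dd b f) x)"
proof -
  have "dd v (dd w f) x = dd v (\<lambda>x. \<Sum>b\<in>Basis. (w \<bullet> b) * dd b f x) x"
    by (rule dd_cong_open[OF assms(1,3)]) (rule dd_basis[OF Ck_closure_differentiable[OF assms(2)]])
  also have "((\<lambda>x. \<Sum>b\<in>Basis. (w \<bullet> b) * dd b f x) has_derivative (\<lambda>v. \<Sum>b\<in>Basis. (w \<bullet> b) * dd v (dd b f) x)) (at x)"
    by (intro has_derivative_sum has_derivative_mult_right dd_has_derivative
        Ck_closure_differentiable[OF Ck_closure_dd[OF assms(1,2)] assms(3)])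
  note dd_eqI[OF this, of v]
  finally show ?thesis .
qed

lemma dd_bound2:
  assumes "open S" "bounded S" "Ck_closure (Suc (Suc k)) S f"
  obtains B where "B \<ge> 0" "\<And>x v w. x \<in> S \<Longrightarrow> \<bar>dd v (dd w f) x\<bar> \<le> B * norm v * norm w"
proof -
  have "\<exists>B. B \<ge> 0 \<and> (\<forall>x\<in>S. \<forall>v. \<bar>dd v (dd b f) x\<bar> \<le> B * norm v)" for b
    using dd_bound1[OF assms(1,2) Ck_closure_dd[OF assms(1,3)], of b] by metis
  then obtain B where B: "\<And>b. B b \<ge> 0" "\<And>b x v. x \<in> S \<Longrightarrow> \<bar>dd v (dd b f) x\<bar> \<le> B b * norm v" by metis
  show thesis
  proof (rule that[of "\<Sum>b\<in>Basis. B b"])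
    show "(\<Sum>b\<in>Basis. B b) \<ge> 0" using B by (simp add: sum_nonneg)
    fix x v w assume x: "x \<in> S"
    have "\<bar>dd v (dd w f) x\<bar> \<le> (\<Sum>b\<in>Basis. \<bar>(w \<bullet> b) * dd v (dd b f) x\<bar>)"
      unfolding dd_dd_basis[OF assms(1,3) x, of v w] by (rule sum_abs)
    also have "\<dots> \<le> (\<Sum>b\<in>Basis. norm w * (B b * norm v))"
      unfolding abs_mult by (intro sum_mono mult_mono) (auto simp: Basis_le_norm B x)
    also have "\<dots> = (\<Sum>b\<in>Basis. B b) * norm v * norm w"
      by (simp add: sum_distrib_left sum_distrib_right mult.commute mult.left_commute)
    finally show "\<bar>dd v (dd w f) x\<bar> \<le> (\<Sum>b\<in>Basis. B b) * norm v * norm w" .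
  qed
qed

lemma dd_bound3:
  assumes "open S" "bounded S" "Ck_closure (Suc (Suc (Suc k))) S f"
  obtains B where "B \<ge> 0" "\<And>x v w u. x \<in> S \<Longrightarrow> \<bar>dd v (dd w (dd u f)) x\<bar> \<le> B * norm v * norm w * norm u"
proof -
  have "\<exists>B. B \<ge> 0 \<and> (\<forall>x\<in>S. \<forall>v w. \<bar>dd v (dd w (dd b f)) x\<bar> \<le> B * norm v * norm w)" for b
    using dd_bound2[OF assms(1,2) Ck_closure_dd[OF assms(1,3)], of b] by metis
  then obtain B where B: "\<And>b. B b \<ge> 0" "\<And>b x v w. x \<in> S \<Longrightarrow> \<bar>dd v (dd w (dd b f)) x\<bar> \<le> B b * norm v * norm w" by metis
  show thesis
  proof (rule that[of "\<Sum>b\<in>Basis. B b"])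
    show "(\<Sum>b\<in>Basis. B b) \<ge> 0" using B by (simp add: sum_nonneg)
    fix x v w u assume x: "x \<in> S"
    have "dd v (dd w (dd u f)) x = dd v (\<lambda>x. \<Sum>b\<in>Basis. (u \<bullet> b) * dd w (dd b f) x) x"
      by (rule dd_cong_open[OF assms(1) x]) (rule dd_dd_basis[OF assms(1,3)])
    also have "((\<lambda>x. \<Sum>b\<in>Basis. (u \<bullet> b) * dd w (dd b f) x) has_derivative (\<lambda>v. \<Sum>b\<in>Basis. (u \<bullet> b) * dd v (dd w (dd b f)) x)) (at x)"
      by (intro has_derivative_sum has_derivative_mult_right dd_has_derivative
          Ck_closure_differentiable[OF Ck_closure_dd[OF assms(1) Ck_closure_dd[OF assms(1,3)]] x])
    note dd_eqI[OF this]
    finally have "\<bar>dd v (dd w (dd u f)) x\<bar> \<le> (\<Sum>b\<in>Basis. \<bar>(u \<bullet> b) * dd v (dd w (dd b f)) x\<bar>)"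
      by (simp add: sum_abs)
    also have "\<dots> \<le> (\<Sum>b\<in>Basis. norm u * (B b * norm v * norm w))"
      unfolding abs_mult by (intro sum_mono mult_mono) (auto simp: Basis_le_norm B x)
    also have "\<dots> = (\<Sum>b\<in>Basis. B b) * norm v * norm w * norm u"
      by (simp add: sum_distrib_left sum_distrib_right mult.commute mult.left_commute)
    finally show "\<bar>dd v (dd w (dd u f)) x\<bar> \<le> (\<Sum>b\<in>Basis. B b) * norm v * norm w * norm u" .
  qed
qed

section \<open>Derivatives along curves and symmetry of second derivatives\<close>

lemma dd_along_curve:
  assumes "f differentiable (at (z t))" "(z has_vector_derivative z') (at t)"
  shows "((\<lambda>t. f (z t)) has_real_derivative dd z' f (z t)) (at t)"
proof -
  have "(f \<circ> z has_derivative (\<lambda>v. dd v f (z t)) \<circ> (\<lambda>s. s *\<^sub>R z')) (at t)"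
    by (rule diff_chain_at) (use assms dd_has_derivative in \<open>auto simp: has_vector_derivative_def\<close>)
  then show ?thesis
    using assms(1) by (simp add: has_field_derivative_def comp_def dd_scale mult_commute_abs)
qed

text \<open>With \<open>w\<close> the velocity of \<open>z\<close> this is the formula for the
  second derivative of \<open>f\<close> along a curve: a Hessian term and an acceleration
  term.\<close>

lemma dd_along_curve_moving:
  assumes S: "open S" "Ck_closure (Suc (Suc k)) S f" and z: "z t \<in> S" "(z has_vector_derivative z') (at t)"
    and w: "(w has_vector_derivative w') (at t)"
  shows "((\<lambda>t. dd (w t) f (z t)) has_real_derivative dd z' (dd (w t) f) (z t) + dd w' f (z t)) (at t)"
proof -
  have diff: "f differentiable (at x)" if "x \<in> S" for x using Ck_closure_differentiable[OF S(2) that] .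
  have "isCont z t" using z(2) has_vector_derivative_continuous by blast
  then have ev: "\<forall>\<^sub>F s in nhds t. z s \<in> S"
    using S(1) z(1) by (metis isContD eventually_nhds_in_open tendsto_at_iff_tendsto_nhds topological_tendstoD)
  have "((\<lambda>t. \<Sum>b\<in>Basis. (w t \<bullet> b) * dd b f (z t)) has_real_derivative
     (\<Sum>b\<in>Basis. (w t \<bullet> b) * dd z' (dd b f) (z t) + (w' \<bullet> b) * dd b f (z t))) (at t)"
  proof (rule DERIV_sum)
    fix b :: 'a
    have "((\<lambda>t. w t \<bullet> b) has_real_derivative w' \<bullet> b) (at t)"
      using bounded_linear.has_vector_derivative[OF bounded_linear_inner_left w] by (simp add: has_real_derivative_iff_has_vector_derivative)
    moreover have "((\<lambda>t. dd b f (z t)) has_real_derivative dd z' (dd b f) (z t)) (at t)"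
      by (rule dd_along_curve[OF Ck_closure_differentiable[OF Ck_closure_dd[OF S] z(1)] z(2)])
    ultimately show "((\<lambda>t. (w t \<bullet> b) * dd b f (z t)) has_real_derivative
       (w t \<bullet> b) * dd z' (dd b f) (z t) + (w' \<bullet> b) * dd b f (z t)) (at t)"
      by (auto intro!: derivative_eq_intros)
  qed
  also have "(\<Sum>b\<in>Basis. (w t \<bullet> b) * dd z' (dd b f) (z t) + (w' \<bullet> b) * dd b f (z t)) = dd z' (dd (w t) f) (z t) + dd w' f (z t)"
    using dd_dd_basis[OF S z(1), of z' "w t"] dd_basis[OF diff[OF z(1)], of w'] by (simp add: sum.distrib)
  finally show ?thesis
    by (rule DERIV_cong_ev[THEN iffD1, rotated 3])
      (use ev dd_basis[OF diff] in \<open>auto elim: eventually_mono\<close>)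
qed

text \<open>The left side of the identity is symmetric in \<open>v\<close> and \<open>w\<close>,
  whereas the right side is a mixed derivative in a fixed order. Applying it in both orders and
  letting \<open>h\<close> shrink gives \<open>dd_commute\<close>.\<close>

lemma second_difference:
  assumes S: "open S" "Ck_closure (Suc (Suc k)) S f" and h: "h > 0"
    and box_in: "\<forall>s\<in>{0..h}. \<forall>t\<in>{0..h}. x + s *\<^sub>R v + t *\<^sub>R w \<in> S"
  obtains s t where "0 < s" "s < h" "0 < t" "t < h"
    "f (x + h *\<^sub>R v + h *\<^sub>R w) - f (x + h *\<^sub>R v) - f (x + h *\<^sub>R w) + f x = h\<^sup>2 * dd w (dd v f) (x + s *\<^sub>R v + t *\<^sub>R w)"
proof -
  have diff: "f differentiable (at x)" if "x \<in> S" for x using Ck_closure_differentiable[OF S(2) that] .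
  have box: "x + s *\<^sub>R v + t *\<^sub>R w \<in> S" if "0 \<le> s" "s \<le> h" "0 \<le> t" "t \<le> h" for s t
    using box_in that by auto
  define g where "g = (\<lambda>s. f (x + s *\<^sub>R v + h *\<^sub>R w) - f (x + s *\<^sub>R v))"
  have "(g has_real_derivative dd v f (x + s *\<^sub>R v + h *\<^sub>R w) - dd v f (x + s *\<^sub>R v)) (at s)" if "0 \<le> s" "s \<le> h" for s
    unfolding g_def
  proof (rule DERIV_diff)
    show "((\<lambda>s. f (x + s *\<^sub>R v + h *\<^sub>R w)) has_real_derivative dd v f (x + s *\<^sub>R v + h *\<^sub>R w)) (at s)"
      by (rule dd_along_curve[OF diff]) (use box[OF that, of h] h in \<open>auto intro!: derivative_eq_intros\<close>)
    show "((\<lambda>s. f (x + s *\<^sub>R v)) has_real_derivative dd v f (x + s *\<^sub>R v)) (at s)"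
      by (rule dd_along_curve[OF diff]) (use box[OF that, of 0] h in \<open>auto intro!: derivative_eq_intros\<close>)
  qed
  from MVT2[OF h this] obtain s where s: "0 < s" "s < h"
    "g h - g 0 = (h - 0) * (dd v f (x + s *\<^sub>R v + h *\<^sub>R w) - dd v f (x + s *\<^sub>R v))" by auto
  have "((\<lambda>t. dd v f (x + s *\<^sub>R v + t *\<^sub>R w)) has_real_derivative dd w (dd v f) (x + s *\<^sub>R v + t *\<^sub>R w)) (at t)"
    if "0 \<le> t" "t \<le> h" for t
    by (rule dd_along_curve[OF Ck_closure_differentiable[OF Ck_closure_dd[OF S]]])
      (use box[of s t] that s in \<open>auto intro!: derivative_eq_intros\<close>)
  from MVT2[OF h this] obtain t where t: "0 < t" "t < h"
    "dd v f (x + s *\<^sub>R v + h *\<^sub>R w) - dd v f (x + s *\<^sub>R v + 0 *\<^sub>R w) = (h - 0) * dd w (dd v f) (x + s *\<^sub>R v + t *\<^sub>R w)" by blast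
  have "f (x + h *\<^sub>R v + h *\<^sub>R w) - f (x + h *\<^sub>R v) - f (x + h *\<^sub>R w) + f x = g h - g 0"
    by (simp add: g_def)
  also have "\<dots> = h * (h * dd w (dd v f) (x + s *\<^sub>R v + t *\<^sub>R w))"
    using s(3) t(3) by simp
  finally show thesis using that[OF s(1,2) t(1,2)] by (simp add: power2_eq_square mult.assoc)
qed

lemma dd_commute:
  assumes S: "open S" "Ck_closure (Suc (Suc k)) S f" and x: "x \<in> S"
  shows "dd v (dd w f) x = dd w (dd v f) x"
proof (rule ccontr)
  assume ne: "dd v (dd w f) x \<noteq> dd w (dd v f) x"
  define e where "e = \<bar>dd v (dd w f) x - dd w (dd v f) x\<bar> / 2"
  have e: "e > 0" using ne by (simp add: e_def)
  have c: "isCont (dd v (dd w f)) x" "isCont (dd w (dd v f)) x"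
    using Ck_closure_continuous_on[OF Ck_closure_dd[OF S(1) Ck_closure_dd[OF S]]] S(1) x
    by (auto simp: continuous_on_eq_continuous_at)
  obtain d1 where d1: "d1 > 0" "\<And>y. dist y x < d1 \<Longrightarrow> dist (dd v (dd w f) y) (dd v (dd w f) x) < e"
    using c(1) e unfolding continuous_at_eps_delta by (metis dist_commute dist_norm)
  obtain d2 where d2: "d2 > 0" "\<And>y. dist y x < d2 \<Longrightarrow> dist (dd w (dd v f) y) (dd w (dd v f) x) < e"
    using c(2) e unfolding continuous_at_eps_delta by (metis dist_commute dist_norm)
  obtain d3 where d3: "d3 > 0" "ball x d3 \<subseteq> S" using S(1) x openE by blast
  define d where "d = min d1 (min d2 d3)"
  have d: "d > 0" "d \<le> d1" "d \<le> d2" "d \<le> d3" using d1 d2 d3 by (auto simp: d_def)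
  define h where "h = d / (norm v + norm w + 1)"
  have np: "norm v + norm w + 1 > 0" by (simp add: add_nonneg_pos)
  have h: "h > 0" using d np by (simp add: h_def)
  have near: "dist (x + s *\<^sub>R v + t *\<^sub>R w) x < d" if "0 \<le> s" "s \<le> h" "0 \<le> t" "t \<le> h" for s t
  proof -
    have "dist (x + s *\<^sub>R v + t *\<^sub>R w) x \<le> norm (s *\<^sub>R v) + norm (t *\<^sub>R w)"
      by (simp add: dist_norm add.assoc norm_triangle_ineq del: norm_scaleR)
    also have "\<dots> \<le> h * norm v + h * norm w" using that by (simp add: add_mono mult_right_mono)
    also have "\<dots> < h * (norm v + norm w + 1)" using h by (simp add: algebra_simps)
    also have "\<dots> = d" using np by (simp add: h_def)
    finally show ?thesis .
  qed
  have box: "\<forall>s\<in>{0..h}. \<forall>t\<in>{0..h}. x + s *\<^sub>R v + t *\<^sub>R w \<in> S"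
  proof (intro ballI)
    fix s t assume "s \<in> {0..h}" "t \<in> {0..h}"
    then have "dist (x + s *\<^sub>R v + t *\<^sub>R w) x < d3" using near[of s t] d by auto
    then show "x + s *\<^sub>R v + t *\<^sub>R w \<in> S" using d3(2) by (auto simp: dist_commute)
  qed
  have box': "\<forall>s\<in>{0..h}. \<forall>t\<in>{0..h}. x + s *\<^sub>R w + t *\<^sub>R v \<in> S"
    using box by (metis add.assoc add.commute)
  obtain s t where st: "0 < s" "s < h" "0 < t" "t < h"
    "f (x + h *\<^sub>R v + h *\<^sub>R w) - f (x + h *\<^sub>R v) - f (x + h *\<^sub>R w) + f x = h\<^sup>2 * dd w (dd v f) (x + s *\<^sub>R v + t *\<^sub>R w)"
    by (rule second_difference[OF S h box])
  obtain s' t' where st': "0 < s'" "s' < h" "0 < t'" "t' < h"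
    "f (x + h *\<^sub>R w + h *\<^sub>R v) - f (x + h *\<^sub>R w) - f (x + h *\<^sub>R v) + f x = h\<^sup>2 * dd v (dd w f) (x + s' *\<^sub>R w + t' *\<^sub>R v)"
    by (rule second_difference[OF S h box'])
  have "h\<^sup>2 * dd w (dd v f) (x + s *\<^sub>R v + t *\<^sub>R w) = h\<^sup>2 * dd v (dd w f) (x + s' *\<^sub>R w + t' *\<^sub>R v)"
    unfolding st(5)[symmetric] st'(5)[symmetric] by (simp add: add.assoc add.commute add.left_commute)
  then have eq: "dd w (dd v f) (x + s *\<^sub>R v + t *\<^sub>R w) = dd v (dd w f) (x + t' *\<^sub>R v + s' *\<^sub>R w)"
    using h by (simp add: add.assoc add.commute add.left_commute)
  have "dist (dd w (dd v f) (x + s *\<^sub>R v + t *\<^sub>R w)) (dd w (dd v f) x) < e"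
    using near[of s t] st d by (intro d2(2)) auto
  moreover have "dist (dd v (dd w f) (x + t' *\<^sub>R v + s' *\<^sub>R w)) (dd v (dd w f) x) < e"
    using near[of t' s'] st' d by (intro d1(2)) auto
  ultimately have "\<bar>dd v (dd w f) x - dd w (dd v f) x\<bar> < e + e"
    unfolding eq dist_real_def by linarith
  then show False by (simp add: e_def)
qed

section \<open>Curves straightened by a diffeomorphism\<close>

lemma has_vector_derivative_iff_quotient:
  "(f has_vector_derivative D) (at t) \<longleftrightarrow> ((\<lambda>s. (f s - f t) /\<^sub>R (s - t)) \<longlongrightarrow> D) (at t)"
proof -
  have "norm ((f s - f t) - (s - t) *\<^sub>R D) / norm (s - t) = norm ((f s - f t) /\<^sub>R (s - t) - D)" if "s \<noteq> t" for s
  proof -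
    have "(f s - f t) /\<^sub>R (s - t) - D = ((f s - f t) - (s - t) *\<^sub>R D) /\<^sub>R (s - t)"
      using that by (simp add: scaleR_diff_right)
    then show ?thesis by (simp add: divide_inverse mult.commute)
  qed
  then have "((\<lambda>s. norm ((f s - f t) - (s - t) *\<^sub>R D) / norm (s - t)) \<longlongrightarrow> 0) (at t) \<longleftrightarrow>
    ((\<lambda>s. norm ((f s - f t) /\<^sub>R (s - t) - D)) \<longlongrightarrow> 0) (at t)"
    by (intro tendsto_cong) (auto simp: eventually_at_filter)
  then show ?thesis
    unfolding has_vector_derivative_def has_derivative_iff_norm tendsto_norm_zero_iff
    by (simp add: bounded_linear_scaleR_left Lim_null[of _ D])
qed

text \<open>Differentiates the solution \<xi> of a linear system whose inverse matrix
  \<open>N\<close> is merely continuous. The difference quotient of \<xi> equals -N(t) applied to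
  the difference quotient of M(.) \<xi>(t0), in which the vector is frozen, so only \<open>M\<close>
  has to be differentiable.\<close>

lemma solution_curve_derivative:
  fixes N :: "real \<Rightarrow> ((real^'n) \<Rightarrow>\<^sub>L (real^'n))" and M :: "real \<Rightarrow> real^'n^'n"
  assumes ev: "\<forall>\<^sub>F t in nhds t0. M t *v \<xi> t = \<eta> \<and> (\<forall>w. blinfun_apply (N t) (M t *v w) = w)"
    and N: "isCont N t0" and M: "((\<lambda>t. M t *v \<xi> t0) has_vector_derivative m) (at t0)"
  shows "(\<xi> has_vector_derivative - blinfun_apply (N t0) m) (at t0)"
proof -
  have at0: "M t0 *v \<xi> t0 = \<eta>" using eventually_nhds_x_imp_x[OF ev] by simp
  have "((\<lambda>t. (M t *v \<xi> t0 - M t0 *v \<xi> t0) /\<^sub>R (t - t0)) \<longlongrightarrow> m) (at t0)"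
    using M by (simp add: has_vector_derivative_iff_quotient)
  then have "((\<lambda>t. - blinfun_apply (N t) ((M t *v \<xi> t0 - M t0 *v \<xi> t0) /\<^sub>R (t - t0))) \<longlongrightarrow> - blinfun_apply (N t0) m) (at t0)"
    using N by (intro tendsto_intros) (simp add: isCont_def)
  moreover have "\<forall>\<^sub>F t in at t0. - blinfun_apply (N t) ((M t *v \<xi> t0 - M t0 *v \<xi> t0) /\<^sub>R (t - t0)) = (\<xi> t - \<xi> t0) /\<^sub>R (t - t0)"
  proof -
    have "\<forall>\<^sub>F t in at t0. M t *v \<xi> t = \<eta> \<and> (\<forall>w. blinfun_apply (N t) (M t *v w) = w)"
      using ev by (simp add: eventually_nhds_conv_at)
    then show ?thesis
    proof (rule eventually_mono)
      fix t assume t: "M t *v \<xi> t = \<eta> \<and> (\<forall>w. blinfun_apply (N t) (M t *v w) = w)"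
      have "blinfun_apply (N t) (M t *v \<xi> t0 - M t0 *v \<xi> t0) = blinfun_apply (N t) (M t *v (\<xi> t0 - \<xi> t))"
        using t at0 by (simp add: matrix_vector_mult_diff_distrib)
      also have "\<dots> = \<xi> t0 - \<xi> t" using t by blast
      finally show "- blinfun_apply (N t) ((M t *v \<xi> t0 - M t0 *v \<xi> t0) /\<^sub>R (t - t0)) = (\<xi> t - \<xi> t0) /\<^sub>R (t - t0)"
        by (simp add: blinfun.scaleR_right flip: scaleR_minus_right)
    qed
  qed
  ultimately have "((\<lambda>t. (\<xi> t - \<xi> t0) /\<^sub>R (t - t0)) \<longlongrightarrow> - blinfun_apply (N t0) m) (at t0)"
    by (rule Lim_transform_eventually)
  then show ?thesis by (simp add: has_vector_derivative_iff_quotient)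
qed

text \<open>The hypothesis gives derivatives of the inverse relative to the range only. By
  invariance of domain the image of the open set is open, so there they are ordinary derivatives,
  and the chain rule in both orders shows that they invert \<open>M\<close>.\<close>

lemma inverse_derivative:
  fixes F1 :: "real^'n \<Rightarrow> real^'n"
  assumes \<Omega>: "open \<Omega>" and diffeo: "diffeo_onto_range (closure \<Omega>) F1"
    and der_all: "\<forall>y\<in>\<Omega>. (F1 has_derivative (\<lambda>w. M y *v w)) (at y)"
  shows "\<exists>g' :: real^'n \<Rightarrow> ((real^'n) \<Rightarrow>\<^sub>L (real^'n)). open (F1 ` \<Omega>) \<and> continuous_on (F1 ` closure \<Omega>) g' \<and>
    (\<forall>q\<in>F1 ` \<Omega>. (inv_into (closure \<Omega>) F1 has_derivative blinfun_apply (g' q)) (at q)) \<and>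
    (\<forall>y\<in>\<Omega>. \<forall>w. blinfun_apply (g' (F1 y)) (M y *v w) = w) \<and>
    (\<forall>y\<in>\<Omega>. \<forall>w. M y *v (blinfun_apply (g' (F1 y)) w) = w)"
proof -
  let ?G = "inv_into (closure \<Omega>) F1"
  note der = der_all[rule_format]
  have sub: "\<Omega> \<subseteq> closure \<Omega>" by (rule closure_subset)
  have inj: "inj_on F1 (closure \<Omega>)" using diffeo by (simp add: diffeo_onto_range_def)
  have cont: "continuous_on \<Omega> F1" by (rule has_derivative_continuous_on) (rule has_derivative_at_withinI[OF der])
  have op: "open (F1 ` \<Omega>)" by (rule invariance_of_domain[OF cont \<Omega> inj_on_subset[OF inj sub]])
  obtain g' :: "real^'n \<Rightarrow> ((real^'n) \<Rightarrow>\<^sub>L (real^'n))" where g': "continuous_on (F1 ` closure \<Omega>) g'"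
    "\<And>q. q \<in> F1 ` closure \<Omega> \<Longrightarrow> (?G has_derivative blinfun_apply (g' q)) (at q within F1 ` closure \<Omega>)"
    using diffeo unfolding diffeo_onto_range_def C1_on_def by blast
  have derG: "(?G has_derivative blinfun_apply (g' q)) (at q)" if "q \<in> F1 ` \<Omega>" for q
  proof -
    have "(?G has_derivative blinfun_apply (g' q)) (at q within F1 ` \<Omega>)"
      by (rule has_derivative_subset[OF g'(2)]) (use that sub in auto)
    then show ?thesis using at_within_open[OF that op] by simp
  qed
  have GF: "?G (F1 y) = y" if "y \<in> \<Omega>" for y using inj sub that by (simp add: subsetD)
  have 1: "blinfun_apply (g' (F1 y)) (M y *v w) = w" if y: "y \<in> \<Omega>" for y w
  proof -
    have "(?G \<circ> F1 has_derivative blinfun_apply (g' (F1 y)) \<circ> (\<lambda>w. M y *v w)) (at y)"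
      by (rule diff_chain_at[OF der[OF y] derG]) (use y in simp)
    moreover have "(?G \<circ> F1 has_derivative (\<lambda>w. w)) (at y)"
      by (rule has_derivative_transform_within_open[OF has_derivative_ident \<Omega> y]) (simp add: GF)
    ultimately have "blinfun_apply (g' (F1 y)) \<circ> (\<lambda>w. M y *v w) = (\<lambda>w. w)" by (rule has_derivative_unique)
    then show ?thesis by (auto simp: fun_eq_iff)
  qed
  have 2: "M y *v (blinfun_apply (g' (F1 y)) w) = w" if y: "y \<in> \<Omega>" for y w
  proof -
    have "(F1 \<circ> ?G has_derivative (\<lambda>w. M y *v w) \<circ> blinfun_apply (g' (F1 y))) (at (F1 y))"
      by (rule diff_chain_at[OF derG]) (use y der[OF y] GF in auto)
    moreover have "(F1 \<circ> ?G has_derivative (\<lambda>w. w)) (at (F1 y))"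
      by (rule has_derivative_transform_within_open[OF has_derivative_ident op]) (use y GF in auto)
    ultimately have "(\<lambda>w. M y *v w) \<circ> blinfun_apply (g' (F1 y)) = (\<lambda>w. w)" by (rule has_derivative_unique)
    then show ?thesis by (auto simp: fun_eq_iff)
  qed
  show ?thesis using op g'(1) derG 1 2 by (intro exI[of _ g']) simp
qed

text \<open>The inverse is only C^1, yet the curve it makes of a line is twice differentiable: its
  velocity solves M y' = \<eta>, and \<open>M\<close> is differentiable because \<open>F1\<close> is
  twice differentiable. The local bounds on y' and y'' are what later turns smallness of a first
  derivative into a differential inequality.\<close>

lemma inverse_line:
  fixes F1 :: "real^'n \<Rightarrow> real^'n" and p \<eta> :: "real^'n"
  assumes \<Omega>: "open \<Omega>" and diffeo: "diffeo_onto_range (closure \<Omega>) F1"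
    and der_all: "\<forall>y\<in>\<Omega>. (F1 has_derivative (\<lambda>w. M y *v w)) (at y)"
    and der2_all: "\<forall>y\<in>\<Omega>. \<forall>w. ((\<lambda>y. M y *v w) has_derivative (\<lambda>v. \<Gamma> y v w)) (at y)"
    and bound: "\<forall>y\<in>\<Omega>. \<forall>v w. norm (\<Gamma> y v w) \<le> B * norm v * norm w"
  defines "T \<equiv> {t. p + t *\<^sub>R \<eta> \<in> F1 ` \<Omega>}"
  shows "open T \<and> (\<exists>y y' y''. \<forall>t\<in>T. y t \<in> \<Omega> \<and> F1 (y t) = p + t *\<^sub>R \<eta> \<and>
    (y has_vector_derivative y' t) (at t) \<and> (y' has_vector_derivative y'' t) (at t) \<and> M (y t) *v y' t = \<eta> \<and>
    (\<exists>e>0. \<exists>C. \<forall>s. \<bar>s - t\<bar> < e \<longrightarrow> s \<in> T \<and> norm (y' s) \<le> C \<and> norm (y'' s) \<le> C))"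
proof -
  from inverse_derivative[OF \<Omega> diffeo der_all]
  obtain g' :: "real^'n \<Rightarrow> ((real^'n) \<Rightarrow>\<^sub>L (real^'n))" where g'0: "open (F1 ` \<Omega>) \<and> continuous_on (F1 ` closure \<Omega>) g' \<and>
    (\<forall>q\<in>F1 ` \<Omega>. (inv_into (closure \<Omega>) F1 has_derivative blinfun_apply (g' q)) (at q)) \<and>
    (\<forall>y\<in>\<Omega>. \<forall>w. blinfun_apply (g' (F1 y)) (M y *v w) = w) \<and>
    (\<forall>y\<in>\<Omega>. \<forall>w. M y *v (blinfun_apply (g' (F1 y)) w) = w)" by (rule exE)
  then have g': "open (F1 ` \<Omega>)" "continuous_on (F1 ` closure \<Omega>) g'"
    "\<And>q. q \<in> F1 ` \<Omega> \<Longrightarrow> (inv_into (closure \<Omega>) F1 has_derivative blinfun_apply (g' q)) (at q)"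
    "\<And>y w. y \<in> \<Omega> \<Longrightarrow> blinfun_apply (g' (F1 y)) (M y *v w) = w"
    "\<And>y w. y \<in> \<Omega> \<Longrightarrow> M y *v (blinfun_apply (g' (F1 y)) w) = w" by (simp_all only: bex_simps ball_simps) (use g'0 in blast)+
  note der2 = der2_all[rule_format]
  define L where "L = (\<lambda>t::real. p + t *\<^sub>R \<eta>)"
  have Lc: "continuous_on A L" for A unfolding L_def by (intro continuous_intros)
  have T: "T = L -` (F1 ` \<Omega>)" by (auto simp: T_def L_def)
  have opT: "open T" unfolding T by (rule open_vimage[OF g'(1) Lc])
  define y where "y = (\<lambda>t. inv_into (closure \<Omega>) F1 (L t))"
  have yF: "y t \<in> \<Omega> \<and> F1 (y t) = L t" if t: "t \<in> T" for t
  proof -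
    obtain z where z: "z \<in> \<Omega>" "L t = F1 z" using t T by auto
    moreover have "inv_into (closure \<Omega>) F1 (F1 z) = z"
      using diffeo z(1) closure_subset[of \<Omega>] by (auto simp: diffeo_onto_range_def)
    ultimately show ?thesis by (simp add: y_def)
  qed
  define N where "N = (\<lambda>t. g' (L t))"
  have Nc: "continuous_on T N" unfolding N_def
    by (rule continuous_on_compose2[OF g'(2) Lc]) (use T closure_subset in blast)
  define y' where "y' = (\<lambda>t. blinfun_apply (N t) \<eta>)"
  have y'c: "continuous_on T y'" unfolding y'_def by (intro continuous_intros Nc)
  have dy: "(y has_vector_derivative y' t) (at t)" if t: "t \<in> T" for t
  proof -
    have "(L has_derivative (\<lambda>s. s *\<^sub>R \<eta>)) (at t)" unfolding L_def by (auto intro!: derivative_eq_intros)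
    moreover have "(inv_into (closure \<Omega>) F1 has_derivative blinfun_apply (g' (L t))) (at (L t))"
      by (rule g'(3)) (use t T in auto)
    ultimately have "(inv_into (closure \<Omega>) F1 \<circ> L has_derivative blinfun_apply (g' (L t)) \<circ> (\<lambda>s. s *\<^sub>R \<eta>)) (at t)"
      by (rule diff_chain_at)
    then show ?thesis
      by (simp add: has_vector_derivative_def y_def y'_def N_def comp_def blinfun.scaleR_right)
  qed
  have My: "M (y t) *v y' t = \<eta>" and NM: "blinfun_apply (N t) (M (y t) *v w) = w" if t: "t \<in> T" for t w
    using yF[OF t] g'(4,5)[of "y t"] by (simp_all add: y'_def N_def)
  define y'' where "y'' = (\<lambda>t. - blinfun_apply (N t) (\<Gamma> (y t) (y' t) (y' t)))"
  have dy': "(y' has_vector_derivative y'' t) (at t)" if t: "t \<in> T" for t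
    unfolding y''_def
  proof (rule solution_curve_derivative[where M = "\<lambda>t. M (y t)" and \<eta> = \<eta>])
    show "\<forall>\<^sub>F s in nhds t. M (y s) *v y' s = \<eta> \<and> (\<forall>w. blinfun_apply (N s) (M (y s) *v w) = w)"
      using eventually_nhds_in_open[OF opT t] by (rule eventually_mono) (use My NM in auto)
    show "isCont N t" using Nc opT t by (simp add: continuous_on_eq_continuous_at)
    have yt: "y t \<in> \<Omega>" using yF[OF t] by simp
    have "((\<lambda>y. M y *v y' t) \<circ> y has_derivative (\<lambda>v. \<Gamma> (y t) v (y' t)) \<circ> (\<lambda>s. s *\<^sub>R y' t)) (at t)"
      by (rule diff_chain_at) (use dy[OF t] der2[OF yt] in \<open>auto simp: has_vector_derivative_def\<close>)
    moreover have "\<Gamma> (y t) (r *\<^sub>R y' t) (y' t) = r *\<^sub>R \<Gamma> (y t) (y' t) (y' t)" for r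
      using linear_cmul[OF has_derivative_linear[OF der2[OF yt, of "y' t"]]] by simp
    ultimately show "((\<lambda>s. M (y s) *v y' t) has_vector_derivative \<Gamma> (y t) (y' t) (y' t)) (at t)"
      by (simp add: has_vector_derivative_def comp_def)
  qed
  have loc: "\<exists>e>0. \<exists>C. \<forall>s. \<bar>s - t\<bar> < e \<longrightarrow> s \<in> T \<and> norm (y' s) \<le> C \<and> norm (y'' s) \<le> C" if t: "t \<in> T" for t
  proof -
    obtain e where e: "e > 0" "cball t e \<subseteq> T" using opT t open_contains_cball by blast
    have "compact (y' ` cball t e)" "compact (N ` cball t e)"
      by (intro compact_continuous_image continuous_on_subset[OF y'c e(2)] continuous_on_subset[OF Nc e(2)] compact_cball)+
    then have "bounded (y' ` cball t e)" "bounded (N ` cball t e)" by (simp_all only: compact_imp_bounded)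
    then obtain C1 C2 where "\<forall>s\<in>cball t e. norm (y' s) \<le> C1" "\<forall>s\<in>cball t e. norm (N s) \<le> C2"
      unfolding bounded_iff by auto
    then have C: "\<And>s. s \<in> cball t e \<Longrightarrow> norm (y' s) \<le> C1" "\<And>s. s \<in> cball t e \<Longrightarrow> norm (N s) \<le> C2" by auto
    have "\<forall>s. \<bar>s - t\<bar> < e \<longrightarrow> s \<in> T \<and> norm (y' s) \<le> max C1 (C2 * (\<bar>B\<bar> * C1 * C1)) \<and> norm (y'' s) \<le> max C1 (C2 * (\<bar>B\<bar> * C1 * C1))"
    proof (intro conjI allI impI)
      fix s assume "\<bar>s - t\<bar> < e"
      then have s: "s \<in> cball t e" by (simp add: dist_real_def)
      then show sT: "s \<in> T" using e by blast
      show "norm (y' s) \<le> max C1 (C2 * (\<bar>B\<bar> * C1 * C1))" using C(1)[OF s] by simp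
      have C1: "C1 \<ge> 0" and C2: "C2 \<ge> 0" using C[OF s] norm_ge_zero order_trans by blast+
      have "norm (\<Gamma> (y s) (y' s) (y' s)) \<le> B * norm (y' s) * norm (y' s)" using bound yF[OF sT] by blast
      also have "\<dots> \<le> \<bar>B\<bar> * C1 * C1" using C(1)[OF s] C1 by (intro mult_mono) auto
      finally have \<Gamma>: "norm (\<Gamma> (y s) (y' s) (y' s)) \<le> \<bar>B\<bar> * C1 * C1" .
      have "norm (y'' s) \<le> norm (N s) * norm (\<Gamma> (y s) (y' s) (y' s))"
        unfolding y''_def by (simp add: norm_blinfun)
      also have "\<dots> \<le> C2 * (\<bar>B\<bar> * C1 * C1)" using C(2)[OF s] \<Gamma> C2 by (intro mult_mono) auto
      finally show "norm (y'' s) \<le> max C1 (C2 * (\<bar>B\<bar> * C1 * C1))" by simp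
    qed
    then have "\<exists>C. \<forall>s. \<bar>s - t\<bar> < e \<longrightarrow> s \<in> T \<and> norm (y' s) \<le> C \<and> norm (y'' s) \<le> C"
      by (rule exI[of _ "max C1 (C2 * (\<bar>B\<bar> * C1 * C1))"])
    with e(1) have "0 < e \<and> (\<exists>C. \<forall>s. \<bar>s - t\<bar> < e \<longrightarrow> s \<in> T \<and> norm (y' s) \<le> C \<and> norm (y'' s) \<le> C)" by (rule conjI)
    then show ?thesis by (rule exI)
  qed
  have "y t \<in> \<Omega> \<and> F1 (y t) = p + t *\<^sub>R \<eta> \<and>
    (y has_vector_derivative y' t) (at t) \<and> (y' has_vector_derivative y'' t) (at t) \<and> M (y t) *v y' t = \<eta> \<and>
    (\<exists>e>0. \<exists>C. \<forall>s. \<bar>s - t\<bar> < e \<longrightarrow> s \<in> T \<and> norm (y' s) \<le> C \<and> norm (y'' s) \<le> C)" if t: "t \<in> T" for t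
    using yF[OF t] dy[OF t] dy'[OF t] My[OF t] loc[OF t] by (simp only: L_def simp_thms)
  then show ?thesis using opT by (intro conjI exI[of _ y] exI[of _ y'] exI[of _ y''] ballI) simp_all
qed

text \<open>Condition (B3) is phrased with the total operator \<open>deriv\<close>. Its second
  iterate at 0 depends on \<open>deriv\<close> at all nearby points, hence the hypothesis on an
  interval.\<close>

lemma deriv_deriv_eq:
  assumes "r > 0" "\<And>t. \<bar>t\<bar> < r \<Longrightarrow> (h has_real_derivative h1 t) (at t)" "(h1 has_real_derivative h2) (at 0)"
  shows "deriv h 0 = h1 0" "(deriv ^^ 2) h 0 = h2"
proof -
  show "deriv h 0 = h1 0" using assms by (intro DERIV_imp_deriv) auto
  have "\<forall>\<^sub>F t in nhds 0. \<bar>t\<bar> < r"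
    using assms(1) by (auto simp: eventually_nhds_metric dist_real_def)
  then have "\<forall>\<^sub>F t in nhds 0. deriv h t = h1 t"
    by (rule eventually_mono) (use assms(2) DERIV_imp_deriv in blast)
  then have "deriv (deriv h) 0 = deriv h1 0" by (intro deriv_cong_ev) auto
  then show "(deriv ^^ 2) h 0 = h2" using DERIV_imp_deriv[OF assms(3)] by (simp add: numeral_2_eq_2)
qed

text \<open>
  A one-dimensional maximum principle. At the last interior maximum, \<open>f' = 0\<close>, and the differential
  inequality propagates \<open>f' < 0\<close> back from nearby points on the right.
\<close>

lemma quasiconvex_of_local_inequality:
  fixes f f1 f2 :: "real \<Rightarrow> real"
  assumes f: "\<And>t. t \<in> {0..1} \<Longrightarrow> (f has_real_derivative f1 t) (at t)"
    "\<And>t. t \<in> {0..1} \<Longrightarrow> (f1 has_real_derivative f2 t) (at t)"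
    and loc: "\<And>t. 0 < t \<Longrightarrow> t < 1 \<Longrightarrow> f1 t = 0 \<Longrightarrow> \<exists>e>0. \<exists>C. \<forall>s. \<bar>s - t\<bar> < e \<longrightarrow> - C * \<bar>f1 s\<bar> \<le> f2 s"
    and t: "t \<in> {0..1}"
  shows "f t \<le> max (f 0) (f 1)"
proof (rule ccontr)
  assume neg: "\<not> ?thesis"
  have contf: "continuous_on {0..1} f" using f(1) DERIV_isCont continuous_at_imp_continuous_on by blast
  have contf1: "continuous_on {0..1} f1" using f(2) DERIV_isCont continuous_at_imp_continuous_on by blast
  obtain tm where tm: "tm \<in> {0..1}" "\<And>s. s \<in> {0..1} \<Longrightarrow> f s \<le> f tm"
    using continuous_attains_sup[OF compact_Icc _ contf] by (metis atLeastAtMost_iff empty_iff t)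
  have max_gt: "f tm > max (f 0) (f 1)" using tm(2)[OF t] neg by linarith
  \<comment> \<open>The set of maximum points. Its last element is taken so that \<open>f\<close> is
    strictly smaller to the right, which yields a nearby point with negative derivative.\<close>
  define A where "A = {0..1} \<inter> f -` {f tm..}"
  have "compact A"
    unfolding A_def using continuous_closed_preimage[OF contf closed_atLeastAtMost closed_atLeast]
    by (metis Int_lower1 closed_Int_compact compact_Icc compact_Int_closed inf.absorb_iff2)
  moreover have "A \<noteq> {}" using tm by (auto simp: A_def)
  ultimately obtain a where a: "a \<in> A" "\<And>s. s \<in> A \<Longrightarrow> s \<le> a"
    using compact_attains_sup by metis
  have fa: "f a = f tm" "a \<in> {0..1}" using a(1) tm(2) by (auto simp: A_def intro: antisym)
  then have a01: "0 < a" "a < 1" using max_gt by (auto simp: less_le)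
  have less: "f s < f a" if "a < s" "s \<le> 1" for s
    using a(2)[of s] that tm(2)[of s] fa a01 by (force simp: A_def)
  have f1a: "f1 a = 0"
  proof (rule DERIV_local_max[OF f(1)[OF fa(2)]])
    show "0 < min a (1 - a)" using a01 by simp
    show "\<forall>y. \<bar>a - y\<bar> < min a (1 - a) \<longrightarrow> f y \<le> f a"
    proof (intro allI impI)
      fix y assume "\<bar>a - y\<bar> < min a (1 - a)"
      then have "y \<in> {0..1}" by (auto simp: abs_if split: if_splits)
      then show "f y \<le> f a" using tm(2) fa by simp
    qed
  qed
  obtain e C where e: "e > 0" "\<And>s. \<bar>s - a\<bar> < e \<Longrightarrow> - C * \<bar>f1 s\<bar> \<le> f2 s" using loc[OF a01 f1a] by blast
  define b where "b = a + min (e / 2) (1 - a)"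
  have b: "a < b" "b \<le> 1" "b - a < e" using e(1) a01 by (auto simp: b_def)
  obtain z where z: "a < z" "z < b" "f b - f a = (b - a) * f1 z"
    using MVT2[OF b(1), of f f1] f(1) b a01 by auto
  have "(b - a) * f1 z < 0" using less[OF b(1,2)] z(3) by simp
  then have f1z: "f1 z < 0" using b by (simp add: mult_less_0_iff)
  define A' where "A' = {a..z} \<inter> f1 -` {0..}"
  have "compact A'"
  proof -
    have "closed A'" unfolding A'_def
      by (rule continuous_closed_preimage[OF continuous_on_subset[OF contf1]]) (use a01 z b in auto)
    then show ?thesis by (metis A'_def Int_lower1 closed_Int_compact compact_Icc inf.absorb_iff2 inf_commute)
  qed
  moreover have "a \<in> A'" using z f1a by (simp add: A'_def)
  then have "A' \<noteq> {}" by blast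
  ultimately obtain d where d: "d \<in> A'" "\<And>s. s \<in> A' \<Longrightarrow> s \<le> d" using compact_attains_sup by metis
  have d': "a \<le> d" "d < z" "f1 d \<ge> 0" using d(1) f1z by (auto simp: A'_def less_le)
  have neg1: "f1 s < 0" if "d < s" "s \<le> z" for s
    using d(2)[of s] that d' by (force simp: A'_def)
  \<comment> \<open>An integrating factor. Where f1 < 0 the inequality reads f2 \<ge> C f1, so
    \<open>k\<close> is nondecreasing; but it would have to pass from a nonnegative value at
    \<open>d\<close> to a negative one at \<open>z\<close>.\<close>
  define k where "k = (\<lambda>s. f1 s * exp (- (C * s)))"
  have "k d \<le> k z"
  proof (rule DERIV_nonneg_imp_increasing_open[of d z k])
    show "d \<le> z" using d' by simp
    show "continuous_on {d..z} k" unfolding k_def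
      by (intro continuous_intros continuous_on_subset[OF contf1]) (use d' z b a01 in auto)
    fix s assume s: "d < s" "s < z"
    have "(k has_real_derivative (f2 s - C * f1 s) * exp (- (C * s))) (at s)"
      unfolding k_def using f(2)[of s] s d' z b a01 by (auto intro!: derivative_eq_intros simp: algebra_simps)
    moreover have "- C * \<bar>f1 s\<bar> \<le> f2 s" using s d' z b by (intro e(2)) auto
    then have "f2 s - C * f1 s \<ge> 0" using neg1[of s] s by simp
    ultimately show "\<exists>y. (k has_real_derivative y) (at s) \<and> 0 \<le> y" by (metis exp_ge_zero mult_nonneg_nonneg)
  qed
  moreover have "k d \<ge> 0" using d' by (simp add: k_def)
  moreover have "k z < 0" using f1z by (simp add: k_def mult_neg_pos)
  ultimately show False by linarith
qed

section \<open>The cost function\<close>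

text \<open>Conditions (B1) and (B2) quantify over a pair of points, so extracting the statement
  about one variable requires a point for the other. This is what nonemptiness supplies. The empty
  cases are settled separately in the final proof.\<close>

locale cost_domain =
  fixes U V :: "(real^'n) set" and c :: "'n cost"
  assumes B0: "B0 U V c" and B1: "B1 U V c" and B2: "B2 U V c" and B3: "B3 U V c"
    and ne: "U \<noteq> {}" "V \<noteq> {}"
begin

definition F :: "(real^'n) \<times> (real^'n) \<Rightarrow> real" where "F = (\<lambda>(x, y). c x y)"

lemma F_eq: "c x y = F (x, y)" by (simp add: F_def)

lemma open_U: "open U" and open_V: "open V" and bounded_U: "bounded U" and bounded_V: "bounded V"
  and cont_c: "continuous_on (closure U \<times> closure V) F"
  using B0 by (simp_all add: B0_def F_def)

lemma open_UV: "open (U \<times> V)" and bounded_UV: "bounded (U \<times> V)"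
  by (simp_all add: open_U open_V open_Times bounded_U bounded_V bounded_Times)

lemma C4: "Ck_closure (Suc (Suc (Suc (Suc 0)))) (U \<times> V) F"
  using B0 by (simp add: B0_def F_def eval_nat_numeral del: Ck_closure.simps)

lemma C3: "Ck_closure (Suc (Suc (Suc 0))) (U \<times> V) F" and C2: "Ck_closure (Suc (Suc 0)) (U \<times> V) F"
  by (rule Ck_closure_le[OF C4], simp)+

lemma C3_dd: "Ck_closure (Suc (Suc (Suc 0))) (U \<times> V) (dd v F)"
  by (rule Ck_closure_dd[OF open_UV C4])

lemma C2_dd: "Ck_closure (Suc (Suc 0)) (U \<times> V) (dd v F)"
  by (rule Ck_closure_dd[OF open_UV C3])

lemma C2_dd_dd: "Ck_closure (Suc (Suc 0)) (U \<times> V) (dd v (dd w F))"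
  by (rule Ck_closure_dd[OF open_UV C3_dd])

lemma F_diff: "z \<in> U \<times> V \<Longrightarrow> F differentiable (at z)"
  by (rule Ck_closure_differentiable[OF C4])

lemma dd_F_diff: "z \<in> U \<times> V \<Longrightarrow> dd v F differentiable (at z)"
  by (rule Ck_closure_differentiable[OF C3_dd])

lemma dd_dd_F_diff: "z \<in> U \<times> V \<Longrightarrow> dd v (dd w F) differentiable (at z)"
  by (rule Ck_closure_differentiable[OF C2_dd_dd])

lemma derivative_in_x:
  assumes "f differentiable (at (x, y))" shows "((\<lambda>x'. f (x', y)) has_derivative (\<lambda>v. dd (v, 0) f (x, y))) (at x)"
proof -
  have "((\<lambda>x'. (x', y)) has_derivative (\<lambda>v. (v, 0))) (at x)" by (auto intro!: derivative_eq_intros)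
  from diff_chain_at[OF this dd_has_derivative[OF assms]] show ?thesis by (simp add: comp_def)
qed

lemma derivative_in_y:
  assumes "f differentiable (at (x, y))" shows "((\<lambda>y'. f (x, y')) has_derivative (\<lambda>w. dd (0, w) f (x, y))) (at y)"
proof -
  have "((\<lambda>y'. (x, y')) has_derivative (\<lambda>w. (0, w))) (at y)" by (auto intro!: derivative_eq_intros)
  from diff_chain_at[OF this dd_has_derivative[OF assms]] show ?thesis by (simp add: comp_def)
qed

lemma grad_inner:
  assumes "(f has_derivative f') (at x)" shows "grad f x \<bullet> v = f' v"
proof -
  have "f' v = f' (\<Sum>i\<in>UNIV. v $ i *s axis i 1)" by (simp add: basis_expansion)
  also have "\<dots> = (\<Sum>i\<in>UNIV. v $ i * f' (axis i 1))"
    using has_derivative_linear[OF assms] by (simp add: linear_sum scalar_mult_eq_scaleR linear_cmul)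
  finally show ?thesis
    using frechet_derivative_at[OF assms] by (simp add: grad_def inner_vec_def mult.commute)
qed

lemma Dx_inner: assumes "x \<in> U" "y \<in> V" shows "Dx U V c x y \<bullet> v = dd (v, 0) F (x, y)"
proof -
  have "Dx U V c x y = grad (\<lambda>x'. F (x', y)) x" using assms by (simp add: Dx_def closure_ext_def F_eq)
  then show ?thesis using grad_inner[OF derivative_in_x[OF F_diff]] assms by simp
qed

lemma Dy_inner: assumes "x \<in> U" "y \<in> V" shows "Dy U V c x y \<bullet> w = dd (0, w) F (x, y)"
proof -
  have "Dy U V c x y = grad (\<lambda>y'. F (x, y')) y" using assms by (simp add: Dy_def closure_ext_def F_eq)
  then show ?thesis using grad_inner[OF derivative_in_y[OF F_diff]] assms by simp
qed

abbreviation H :: "real^'n \<Rightarrow> real^'n \<Rightarrow> real^'n^'n" where "H \<equiv> mixed_hessian c"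

lemma H_entry:
  assumes "x \<in> U" "y \<in> V" shows "H x y $ i $ j = dd (axis i 1, 0) (dd (0, axis j 1) F) (x, y)"
proof -
  have eq: "frechet_derivative (\<lambda>y'. c x' y') (at y) (axis j 1) = dd (0, axis j 1) F (x', y)" if "x' \<in> U" for x'
  proof -
    have "(x', y) \<in> U \<times> V" using that assms(2) by simp
    then have "((\<lambda>y'. F (x', y')) has_derivative (\<lambda>w. dd (0, w) F (x', y))) (at y)"
      by (rule derivative_in_y[OF F_diff])
    from fun_cong[OF frechet_derivative_at[OF this], of "axis j 1"] show ?thesis by (simp add: F_def)
  qed
  have "((\<lambda>x'. frechet_derivative (\<lambda>y'. c x' y') (at y) (axis j 1)) has_derivative (\<lambda>v. dd (v, 0) (dd (0, axis j 1) F) (x, y))) (at x)"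
  proof (rule has_derivative_transform_within_open[OF derivative_in_x[OF dd_F_diff] open_U assms(1)])
    show "(x, y) \<in> U \<times> V" using assms by simp
    show "dd (0, axis j 1) F (x', y) = frechet_derivative (\<lambda>y'. c x' y') (at y) (axis j 1)" if "x' \<in> U" for x'
      by (rule eq[OF that, symmetric])
  qed
  from fun_cong[OF frechet_derivative_at[OF this], of "axis i 1"] show ?thesis by (simp add: mixed_hessian_def)
qed

lemma dd_pair_expand_x:
  assumes "f differentiable (at z)" shows "dd (v, 0) f z = (\<Sum>i\<in>UNIV. v $ i * dd (axis i 1, 0) f (z :: (real^'n) \<times> (real^'n)))"
proof -
  have "(v, 0 :: real^'n) = (\<Sum>i\<in>UNIV. v $ i *\<^sub>R (axis i 1, 0))"
  proof (rule prod_eqI)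
    show "fst (v, 0 :: real^'n) = fst (\<Sum>i\<in>UNIV. v $ i *\<^sub>R (axis i 1, 0 :: real^'n))"
      using basis_expansion[of v] by (simp add: fst_sum scalar_mult_eq_scaleR)
  qed (simp add: snd_sum)
  then have "dd (v, 0) f z = dd (\<Sum>i\<in>UNIV. v $ i *\<^sub>R (axis i 1, 0)) f z" by (simp only:)
  also have "\<dots> = (\<Sum>i\<in>UNIV. dd (v $ i *\<^sub>R (axis i 1, 0)) f z)" by (rule dd_sum[OF assms])
  finally show ?thesis by (simp only: dd_scale[OF assms])
qed

lemma dd_pair_expand_y:
  assumes "f differentiable (at z)" shows "dd (0, w) f z = (\<Sum>i\<in>UNIV. w $ i * dd (0, axis i 1) f (z :: (real^'n) \<times> (real^'n)))"
proof -
  have "(0 :: real^'n, w) = (\<Sum>i\<in>UNIV. w $ i *\<^sub>R (0, axis i 1))"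
  proof (rule prod_eqI)
    show "snd (0 :: real^'n, w) = snd (\<Sum>i\<in>UNIV. w $ i *\<^sub>R (0 :: real^'n, axis i 1))"
      using basis_expansion[of w] by (simp add: snd_sum scalar_mult_eq_scaleR)
  qed (simp add: fst_sum)
  then have "dd (0, w) f z = dd (\<Sum>i\<in>UNIV. w $ i *\<^sub>R (0, axis i 1)) f z" by (simp only:)
  also have "\<dots> = (\<Sum>i\<in>UNIV. dd (w $ i *\<^sub>R (0, axis i 1)) f z)" by (rule dd_sum[OF assms])
  finally show ?thesis by (simp only: dd_scale[OF assms])
qed

lemma H_bilinear:
  assumes "x \<in> U" "y \<in> V" shows "v \<bullet> (H x y *v w) = dd (v, 0) (dd (0, w) F) (x, y)"
proof -
  have z: "(x, y) \<in> U \<times> V" using assms by simp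
  have "dd (v, 0) (dd (0, w) F) (x, y) = dd (0, w) (dd (v, 0) F) (x, y)"
    by (rule dd_commute[OF open_UV C2 z])
  also have "\<dots> = (\<Sum>j\<in>UNIV. w $ j * dd (0, axis j 1) (dd (v, 0) F) (x, y))"
    by (rule dd_pair_expand_y[OF dd_F_diff[OF z]])
  also have "\<dots> = (\<Sum>j\<in>UNIV. w $ j * (\<Sum>i\<in>UNIV. v $ i * H x y $ i $ j))"
  proof (rule sum.cong[OF refl])
    fix j
    have "dd (0, axis j 1) (dd (v, 0) F) (x, y) = dd (v, 0) (dd (0, axis j 1) F) (x, y)"
      by (rule dd_commute[OF open_UV C2 z])
    also have "\<dots> = (\<Sum>i\<in>UNIV. v $ i * H x y $ i $ j)"
      unfolding H_entry[OF assms] by (rule dd_pair_expand_x[OF dd_F_diff[OF z]])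
    finally show "w $ j * dd (0, axis j 1) (dd (v, 0) F) (x, y) = w $ j * (\<Sum>i\<in>UNIV. v $ i * H x y $ i $ j)" by simp
  qed
  also have "\<dots> = (\<Sum>i\<in>UNIV. v $ i * (\<Sum>j\<in>UNIV. H x y $ i $ j * w $ j))"
    unfolding sum_distrib_left by (rule trans[OF sum.swap]) (intro sum.cong refl, simp)
  finally show ?thesis by (simp add: inner_vec_def matrix_vector_mult_def)
qed

lemma H_transpose_bilinear:
  assumes "x \<in> U" "y \<in> V" shows "w \<bullet> (transpose (H x y) *v v) = dd (v, 0) (dd (0, w) F) (x, y)"
  using H_bilinear[OF assms, of v w] by (metis dot_lmul_matrix inner_commute transpose_matrix_vector transpose_transpose)

lemma minus_mult_vec: "(- M) *v w = - (M *v w)" for M :: "real^'n^'n"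
  using matrix_vector_mult_diff_rdistrib[of 0 M w] by simp

lemma vector_derivative_by_components:
  fixes f f' :: "real^'n \<Rightarrow> real^'n"
  assumes "\<And>i. ((\<lambda>x. f x \<bullet> axis i 1) has_derivative (\<lambda>v. f' v \<bullet> axis i (1::real))) (at x)"
  shows "(f has_derivative f') (at x)"
  unfolding has_derivative_componentwise_within[of f f' x UNIV]
proof
  fix b :: "real^'n" assume "b \<in> Basis"
  then obtain i where "b = axis i 1" by (auto simp: Basis_vec_def)
  then show "((\<lambda>x. f x \<bullet> b) has_derivative (\<lambda>x. f' x \<bullet> b)) (at x)" using assms by simp
qed

lemma Dx_derivative_y:
  assumes "x \<in> U" "y \<in> V" shows "((\<lambda>y. - Dx U V c x y) has_derivative (\<lambda>w. (- H x y) *v w)) (at y)"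
proof (rule vector_derivative_by_components)
  fix i
  have "((\<lambda>y. - dd (axis i 1, 0) F (x, y)) has_derivative (\<lambda>w. - dd (0, w) (dd (axis i 1, 0) F) (x, y))) (at y)"
    by (intro has_derivative_minus derivative_in_y dd_F_diff) (use assms in simp)
  moreover have "- dd (0, w) (dd (axis i 1, 0) F) (x, y) = ((- H x y) *v w) \<bullet> axis i 1" for w
    using H_bilinear[OF assms, of "axis i 1" w] dd_commute[OF open_UV C2, of "(x, y)" "(axis i 1, 0)" "(0, w)"] assms
    by (simp add: inner_commute minus_mult_vec)
  then have "(\<lambda>w. - dd (0, w) (dd (axis i 1, 0) F) (x, y)) = (\<lambda>w. ((- H x y) *v w) \<bullet> axis i 1)"
    by (rule ext)
  ultimately have *: "((\<lambda>y. - dd (axis i 1, 0) F (x, y)) has_derivative (\<lambda>w. ((- H x y) *v w) \<bullet> axis i 1)) (at y)"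
    by (rule has_derivative_eq_rhs)
  show "((\<lambda>y. - Dx U V c x y \<bullet> axis i 1) has_derivative (\<lambda>w. ((- H x y) *v w) \<bullet> axis i 1)) (at y)"
    by (rule has_derivative_transform_within_open[OF * open_V assms(2)]) (simp add: Dx_inner assms(1))
qed

lemma Dy_derivative_x:
  assumes "x \<in> U" "y \<in> V" shows "((\<lambda>x. - Dy U V c x y) has_derivative (\<lambda>v. (- transpose (H x y)) *v v)) (at x)"
proof (rule vector_derivative_by_components)
  fix i
  have "((\<lambda>x. - dd (0, axis i 1) F (x, y)) has_derivative (\<lambda>v. - dd (v, 0) (dd (0, axis i 1) F) (x, y))) (at x)"
    by (intro has_derivative_minus derivative_in_x dd_F_diff) (use assms in simp)
  moreover have "- dd (v, 0) (dd (0, axis i 1) F) (x, y) = ((- transpose (H x y)) *v v) \<bullet> axis i 1" for v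
    using H_transpose_bilinear[OF assms, of "axis i 1" v]
    by (simp add: inner_commute minus_mult_vec)
  then have "(\<lambda>v. - dd (v, 0) (dd (0, axis i 1) F) (x, y)) = (\<lambda>v. ((- transpose (H x y)) *v v) \<bullet> axis i 1)"
    by (rule ext)
  ultimately have *: "((\<lambda>x. - dd (0, axis i 1) F (x, y)) has_derivative (\<lambda>v. ((- transpose (H x y)) *v v) \<bullet> axis i 1)) (at x)"
    by (rule has_derivative_eq_rhs)
  show "((\<lambda>x. - Dy U V c x y \<bullet> axis i 1) has_derivative (\<lambda>v. ((- transpose (H x y)) *v v) \<bullet> axis i 1)) (at x)"
    by (rule has_derivative_transform_within_open[OF * open_U assms(1)]) (simp add: Dy_inner assms(2))
qed

lemma U_closure: "x \<in> U \<Longrightarrow> x \<in> closure U" and V_closure: "y \<in> V \<Longrightarrow> y \<in> closure V"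
  by (rule subsetD[OF closure_subset], assumption)+

lemma diffeo_y: "x \<in> closure U \<Longrightarrow> diffeo_onto_range (closure V) (\<lambda>y. - Dx U V c x y)"
  and diffeo_x: "y \<in> closure V \<Longrightarrow> diffeo_onto_range (closure U) (\<lambda>x. - Dy U V c x y)"
proof -
  obtain x0 y0 where "x0 \<in> U" "y0 \<in> V" using ne by auto
  then have 0: "x0 \<in> closure U" "y0 \<in> closure V" by (simp_all add: U_closure V_closure)
  show "x \<in> closure U \<Longrightarrow> diffeo_onto_range (closure V) (\<lambda>y. - Dx U V c x y)"
    using B1[unfolded B1_def] 0(2) by simp
  show "y \<in> closure V \<Longrightarrow> diffeo_onto_range (closure U) (\<lambda>x. - Dy U V c x y)"
    using B1[unfolded B1_def] 0(1) by simp
qed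

lemma Dx_inj: "x \<in> closure U \<Longrightarrow> y \<in> closure V \<Longrightarrow> y' \<in> closure V \<Longrightarrow> Dx U V c x y = Dx U V c x y' \<Longrightarrow> y = y'"
  using diffeo_y[of x] unfolding diffeo_onto_range_def inj_on_def by simp

lemma Dy_inj: "y \<in> closure V \<Longrightarrow> x \<in> closure U \<Longrightarrow> x' \<in> closure U \<Longrightarrow> Dy U V c x y = Dy U V c x' y \<Longrightarrow> x = x'"
  using diffeo_x[of y] unfolding diffeo_onto_range_def inj_on_def by simp

text \<open>A diffeomorphism with differentiable inverse has an injective derivative; this is how
  (B1) yields nondegeneracy of the mixed Hessian in the interior.\<close>

lemma H_inj: assumes "x \<in> U" "y \<in> V" "H x y *v w = 0" shows "w = 0"
proof -
  have "\<forall>y\<in>V. ((\<lambda>y. - Dx U V c x y) has_derivative (\<lambda>w. (- H x y) *v w)) (at y)"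
    by (intro ballI Dx_derivative_y assms(1))
  from inverse_derivative[OF open_V diffeo_y[OF U_closure[OF assms(1)]] this] obtain g' :: "real^'n \<Rightarrow> ((real^'n) \<Rightarrow>\<^sub>L (real^'n))"
    where "\<forall>y\<in>V. \<forall>w. blinfun_apply (g' (- Dx U V c x y)) ((- H x y) *v w) = w" by (elim exE conjE) (rule that)
  then have "blinfun_apply (g' (- Dx U V c x y)) ((- H x y) *v w) = w" using assms(2) by simp
  then show ?thesis using assms(3) by (simp add: minus_mult_vec blinfun.zero_right)
qed

lemma third_bound: obtains B where "B \<ge> 0"
  "\<forall>z\<in>U \<times> V. \<forall>v w u. \<bar>dd v (dd w (dd u F)) z\<bar> \<le> B * norm v * norm w * norm u"
  using dd_bound3[OF open_UV bounded_UV C3] by metis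

text \<open>These are the c-segments with respect to \<open>x\<close>. Convexity of the range in
  (B2) later ensures that \<open>T\<close> contains [0, 1] whenever the two end points come from
  V.\<close>

lemma y_curve:
  fixes p \<eta> :: "real^'n"
  assumes x: "x \<in> U"
  defines "T \<equiv> {t. p + t *\<^sub>R \<eta> \<in> V_at U V c x}"
  shows "open T \<and> (\<exists>y y' y''. \<forall>t\<in>T. y t \<in> V \<and> - Dx U V c x (y t) = p + t *\<^sub>R \<eta> \<and>
    (y has_vector_derivative y' t) (at t) \<and> (y' has_vector_derivative y'' t) (at t) \<and> (- H x (y t)) *v y' t = \<eta> \<and>
    (\<exists>e>0. \<exists>C. \<forall>s. \<bar>s - t\<bar> < e \<longrightarrow> s \<in> T \<and> norm (y' s) \<le> C \<and> norm (y'' s) \<le> C))"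
proof -
  obtain B where B: "B \<ge> 0" "\<forall>z\<in>U \<times> V. \<forall>v w u. \<bar>dd v (dd w (dd u F)) z\<bar> \<le> B * norm v * norm w * norm u"
    by (rule third_bound)
  define \<Gamma> where "\<Gamma> = (\<lambda>y v w. \<chi> i. - dd (0, v) (dd (0, w) (dd (axis i 1, 0) F)) (x, y))"
  have "((\<lambda>y. (- H x y) *v w) has_derivative (\<lambda>v. \<Gamma> y v w)) (at y)" if y: "y \<in> V" for y w
  proof (rule vector_derivative_by_components)
    fix i
    have "((\<lambda>y. - dd (0, w) (dd (axis i 1, 0) F) (x, y)) has_derivative (\<lambda>v. - dd (0, v) (dd (0, w) (dd (axis i 1, 0) F)) (x, y))) (at y)"
      by (intro has_derivative_minus derivative_in_y dd_dd_F_diff) (use x y in simp)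
    then have *: "((\<lambda>y. - dd (0, w) (dd (axis i 1, 0) F) (x, y)) has_derivative (\<lambda>v. \<Gamma> y v w \<bullet> axis i 1)) (at y)"
      by (simp add: \<Gamma>_def inner_axis)
    show "((\<lambda>y. ((- H x y) *v w) \<bullet> axis i 1) has_derivative (\<lambda>v. \<Gamma> y v w \<bullet> axis i 1)) (at y)"
      by (rule has_derivative_transform_within_open[OF * open_V y])
        (use H_bilinear[OF x, of _ "axis i 1" w] dd_commute[OF open_UV C2, of _ "(axis i 1, 0)" "(0, w)"] x in \<open>simp add: minus_mult_vec inner_commute\<close>)
  qed
  then have 1: "\<forall>y\<in>V. \<forall>w. ((\<lambda>y. (- H x y) *v w) has_derivative (\<lambda>v. \<Gamma> y v w)) (at y)" by (intro ballI allI)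
  have 2: "\<forall>y\<in>V. \<forall>v w. norm (\<Gamma> y v w) \<le> (real CARD('n) * B) * norm v * norm w"
  proof (intro ballI allI)
    fix y v w assume y: "y \<in> V"
    have "norm (\<Gamma> y v w) \<le> (\<Sum>i\<in>UNIV. \<bar>\<Gamma> y v w $ i\<bar>)" by (rule norm_le_l1_cart)
    also have "\<dots> \<le> (\<Sum>i\<in>(UNIV :: 'n set). B * norm v * norm w)"
    proof (rule sum_mono)
      fix i
      have "\<bar>dd (0, v) (dd (0, w) (dd (axis i 1, 0) F)) (x, y)\<bar> \<le> B * norm (0 :: real^'n, v) * norm (0 :: real^'n, w) * norm (axis i (1::real), 0 :: real^'n)"
        using x y by (intro B(2)[rule_format]) simp
      then show "\<bar>\<Gamma> y v w $ i\<bar> \<le> B * norm v * norm w" by (simp add: \<Gamma>_def norm_Pair)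
    qed
    finally show "norm (\<Gamma> y v w) \<le> (real CARD('n) * B) * norm v * norm w" by simp
  qed
  have 0: "\<forall>y\<in>V. ((\<lambda>y. - Dx U V c x y) has_derivative (\<lambda>w. (- H x y) *v w)) (at y)"
    by (intro ballI Dx_derivative_y x)
  from inverse_line[OF open_V diffeo_y[OF U_closure[OF x]] 0 1 2, of p \<eta>]
  show ?thesis unfolding T_def V_at_def .
qed

lemma x_curve:
  fixes p \<eta> :: "real^'n"
  assumes y: "y \<in> V"
  defines "T \<equiv> {t. p + t *\<^sub>R \<eta> \<in> U_at U V c y}"
  shows "open T \<and> (\<exists>x x' x''. \<forall>t\<in>T. x t \<in> U \<and> - Dy U V c (x t) y = p + t *\<^sub>R \<eta> \<and>
    (x has_vector_derivative x' t) (at t) \<and> (x' has_vector_derivative x'' t) (at t) \<and> (- transpose (H (x t) y)) *v x' t = \<eta> \<and>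
    (\<exists>e>0. \<exists>C. \<forall>s. \<bar>s - t\<bar> < e \<longrightarrow> s \<in> T \<and> norm (x' s) \<le> C \<and> norm (x'' s) \<le> C))"
proof -
  obtain B where B: "B \<ge> 0" "\<forall>z\<in>U \<times> V. \<forall>v w u. \<bar>dd v (dd w (dd u F)) z\<bar> \<le> B * norm v * norm w * norm u"
    by (rule third_bound)
  define \<Gamma> where "\<Gamma> = (\<lambda>x v w. \<chi> i. - dd (v, 0) (dd (w, 0) (dd (0, axis i 1) F)) (x, y))"
  have "((\<lambda>x. (- transpose (H x y)) *v w) has_derivative (\<lambda>v. \<Gamma> x v w)) (at x)" if x: "x \<in> U" for x w
  proof (rule vector_derivative_by_components)
    fix i
    have "((\<lambda>x. - dd (w, 0) (dd (0, axis i 1) F) (x, y)) has_derivative (\<lambda>v. - dd (v, 0) (dd (w, 0) (dd (0, axis i 1) F)) (x, y))) (at x)"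
      by (intro has_derivative_minus derivative_in_x dd_dd_F_diff) (use x y in simp)
    then have *: "((\<lambda>x. - dd (w, 0) (dd (0, axis i 1) F) (x, y)) has_derivative (\<lambda>v. \<Gamma> x v w \<bullet> axis i 1)) (at x)"
      by (simp add: \<Gamma>_def inner_axis)
    show "((\<lambda>x. ((- transpose (H x y)) *v w) \<bullet> axis i 1) has_derivative (\<lambda>v. \<Gamma> x v w \<bullet> axis i 1)) (at x)"
      by (rule has_derivative_transform_within_open[OF * open_U x])
        (use H_transpose_bilinear[OF _ y, of _ "axis i 1" w] in \<open>simp add: minus_mult_vec inner_commute\<close>)
  qed
  then have 1: "\<forall>x\<in>U. \<forall>w. ((\<lambda>x. (- transpose (H x y)) *v w) has_derivative (\<lambda>v. \<Gamma> x v w)) (at x)" by (intro ballI allI)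
  have 2: "\<forall>x\<in>U. \<forall>v w. norm (\<Gamma> x v w) \<le> (real CARD('n) * B) * norm v * norm w"
  proof (intro ballI allI)
    fix x v w assume x: "x \<in> U"
    have "norm (\<Gamma> x v w) \<le> (\<Sum>i\<in>UNIV. \<bar>\<Gamma> x v w $ i\<bar>)" by (rule norm_le_l1_cart)
    also have "\<dots> \<le> (\<Sum>i\<in>(UNIV :: 'n set). B * norm v * norm w)"
    proof (rule sum_mono)
      fix i
      have "\<bar>dd (v, 0) (dd (w, 0) (dd (0, axis i 1) F)) (x, y)\<bar> \<le> B * norm (v, 0 :: real^'n) * norm (w, 0 :: real^'n) * norm (0 :: real^'n, axis i (1::real))"
        using x y by (intro B(2)[rule_format]) simp
      then show "\<bar>\<Gamma> x v w $ i\<bar> \<le> B * norm v * norm w" by (simp add: \<Gamma>_def norm_Pair)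
    qed
    finally show "norm (\<Gamma> x v w) \<le> (real CARD('n) * B) * norm v * norm w" by simp
  qed
  have 0: "\<forall>x\<in>U. ((\<lambda>x. - Dy U V c x y) has_derivative (\<lambda>w. (- transpose (H x y)) *v w)) (at x)"
    by (intro ballI Dy_derivative_x y)
  from inverse_line[OF open_U diffeo_x[OF V_closure[OF y]] 0 1 2, of p \<eta>]
  show ?thesis unfolding T_def U_at_def .
qed

end

section \<open>The maximum principle\<close>

context cost_domain
begin

lemma F_pair: "F (x, y) = c x y" by (simp add: F_def)

lemma along_x:
  assumes "Ck_closure (Suc (Suc 0)) (U \<times> V) f" "x s \<in> U" "y \<in> V"
    and x: "(x has_vector_derivative x1) (at s)" "(x' has_vector_derivative x2) (at s)" "x' s = x1"
  shows "((\<lambda>s. f (x s, y)) has_real_derivative dd (x1, 0) f (x s, y)) (at s)"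
    "((\<lambda>s. dd (x' s, 0) f (x s, y)) has_real_derivative dd (x1, 0) (dd (x1, 0) f) (x s, y) + dd (x2, 0) f (x s, y)) (at s)"
proof -
  have z: "(x s, y) \<in> U \<times> V" using assms by simp
  have dz: "((\<lambda>s. (x s, y)) has_vector_derivative (x1, 0)) (at s)"
    by (rule has_vector_derivative_Pair[OF x(1) has_vector_derivative_const])
  have dw: "((\<lambda>s. (x' s, 0 :: real^'n)) has_vector_derivative (x2, 0)) (at s)"
    by (rule has_vector_derivative_Pair[OF x(2) has_vector_derivative_const])
  show "((\<lambda>s. f (x s, y)) has_real_derivative dd (x1, 0) f (x s, y)) (at s)"
    by (rule dd_along_curve[OF Ck_closure_differentiable[OF assms(1) z] dz])
  show "((\<lambda>s. dd (x' s, 0) f (x s, y)) has_real_derivative dd (x1, 0) (dd (x1, 0) f) (x s, y) + dd (x2, 0) f (x s, y)) (at s)"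
    using dd_along_curve_moving[OF open_UV assms(1) z dz dw] x(3) by simp
qed

lemma along_y:
  assumes "Ck_closure (Suc (Suc 0)) (U \<times> V) f" "x \<in> U" "y t \<in> V"
    and y: "(y has_vector_derivative y1) (at t)" "(y' has_vector_derivative y2) (at t)" "y' t = y1"
  shows "((\<lambda>t. f (x, y t)) has_real_derivative dd (0, y1) f (x, y t)) (at t)"
    "((\<lambda>t. dd (0, y' t) f (x, y t)) has_real_derivative dd (0, y1) (dd (0, y1) f) (x, y t) + dd (0, y2) f (x, y t)) (at t)"
proof -
  have z: "(x, y t) \<in> U \<times> V" using assms by simp
  have dz: "((\<lambda>t. (x, y t)) has_vector_derivative (0, y1)) (at t)"
    by (rule has_vector_derivative_Pair[OF has_vector_derivative_const y(1)])
  have dw: "((\<lambda>t. (0 :: real^'n, y' t)) has_vector_derivative (0, y2)) (at t)"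
    by (rule has_vector_derivative_Pair[OF has_vector_derivative_const y(2)])
  show "((\<lambda>t. f (x, y t)) has_real_derivative dd (0, y1) f (x, y t)) (at t)"
    by (rule dd_along_curve[OF Ck_closure_differentiable[OF assms(1) z] dz])
  show "((\<lambda>t. dd (0, y' t) f (x, y t)) has_real_derivative dd (0, y1) (dd (0, y1) f) (x, y t) + dd (0, y2) f (x, y t)) (at t)"
    using dd_along_curve_moving[OF open_UV assms(1) z dz dw] y(3) by simp
qed

lemma has_vector_derivative_rescale:
  assumes "(f has_vector_derivative D) (at (a + k * t))"
  shows "((\<lambda>t. f (a + k * t)) has_vector_derivative k *\<^sub>R D) (at t)"
proof -
  have "((\<lambda>t. a + k * t) has_real_derivative k) (at t)" by (auto intro!: derivative_eq_intros)
  then have "((\<lambda>t. a + k * t) has_vector_derivative k) (at t)" by (simp add: has_real_derivative_iff_has_vector_derivative)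
  from vector_diff_chain_at[OF this assms] show ?thesis by (simp add: comp_def)
qed

text \<open>
  Condition (B3) in the form in which it is used: the \<open>y\<close>-curve through \<open>y\<close> may be any one with the
  prescribed velocity, since the second-order term of the curve enters linearly in \<open>D\<^sub>yc(x(s), y)\<close>,
  which is affine in \<open>s\<close>.
\<close>

lemma cross_curvature:
  assumes y: "y \<in> V" and T: "open T" "s \<in> T"
    and x: "\<forall>s\<in>T. x s \<in> U \<and> - Dy U V c (x s) y = p + s *\<^sub>R b \<and>
        (x has_vector_derivative x' s) (at s) \<and> (x' has_vector_derivative x'' s) (at s)"
    and orth: "b \<bullet> e = 0"
  shows "dd (x' s, 0) (dd (x' s, 0) (dd (0, e) (dd (0, e) F))) (x s, y) + dd (x'' s, 0) (dd (0, e) (dd (0, e) F)) (x s, y) \<le> 0"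
proof -
  define A where "A = dd (0, e) (dd (0, e) F)"
  have CA: "Ck_closure (Suc (Suc 0)) (U \<times> V) A" unfolding A_def by (rule C2_dd_dd)
  define X where "X = x s"
  have XU: "X \<in> U" using x T by (simp add: X_def)
  define q where "q = - Dx U V c X y"
  \<comment> \<open>Chosen so that the c-segment through \<open>y\<close> has velocity
    \<open>e\<close> at parameter 0.\<close>
  define \<eta> where "\<eta> = - (H X y *v e)"
  define T' where "T' = {t. q + t *\<^sub>R \<eta> \<in> V_at U V c X}"
  have yc: "open T' \<and> (\<exists>z z' z''. \<forall>t\<in>T'. z t \<in> V \<and> - Dx U V c X (z t) = q + t *\<^sub>R \<eta> \<and>
    (z has_vector_derivative z' t) (at t) \<and> (z' has_vector_derivative z'' t) (at t) \<and> (- H X (z t)) *v z' t = \<eta> \<and>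
    (\<exists>e>0. \<exists>C. \<forall>s. \<bar>s - t\<bar> < e \<longrightarrow> s \<in> T' \<and> norm (z' s) \<le> C \<and> norm (z'' s) \<le> C))"
    unfolding T'_def by (rule y_curve[OF XU])
  then obtain z z' z'' where z: "\<forall>t\<in>T'. z t \<in> V \<and> - Dx U V c X (z t) = q + t *\<^sub>R \<eta> \<and>
    (z has_vector_derivative z' t) (at t) \<and> (z' has_vector_derivative z'' t) (at t) \<and> (- H X (z t)) *v z' t = \<eta> \<and>
    (\<exists>e>0. \<exists>C. \<forall>s. \<bar>s - t\<bar> < e \<longrightarrow> s \<in> T' \<and> norm (z' s) \<le> C \<and> norm (z'' s) \<le> C)"
    by (elim exE conjE) (rule that)
  have "0 \<in> T'" using y by (auto simp: T'_def q_def V_at_def)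
  have z0: "z 0 = y"
    by (rule Dx_inj[OF U_closure[OF XU]]) (use z \<open>0 \<in> T'\<close> y in \<open>auto simp: q_def intro: V_closure\<close>)
  have z'0: "z' 0 = e"
  proof -
    have "(- H X y) *v z' 0 = - (H X y *v e)" using z \<open>0 \<in> T'\<close> z0 by (auto simp: \<eta>_def)
    then have "H X y *v (z' 0 - e) = 0" by (simp add: minus_mult_vec matrix_vector_mult_diff_distrib)
    from H_inj[OF XU y this] show ?thesis by simp
  qed
  obtain r1 where r1: "r1 > 0" "ball 0 r1 \<subseteq> T'" using yc \<open>0 \<in> T'\<close> openE by blast
  obtain r2 where r2: "r2 > 0" "ball s r2 \<subseteq> T" using T openE by blast
  \<comment> \<open>Condition (B3) demands curves on all of [-1, 1], but the curves at hand exist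
    only near their base points. Slowing both down by \<open>k\<close> makes them defined for |t| <
    2, an open interval around [-1, 1]; the resulting factors k^2 cancel at the end.\<close>
  define k where "k = min r1 r2 / 2"
  have k: "k > 0" "2 * k \<le> r1" "2 * k \<le> r2" using r1 r2 by (auto simp: k_def)
  have kT': "0 + k * t \<in> T'" and kT: "s + k * t \<in> T" if "\<bar>t\<bar> < 2" for t
  proof -
    have "\<bar>k * t\<bar> < 2 * k" using that k(1) by (simp add: abs_mult)
    then show "0 + k * t \<in> T'" "s + k * t \<in> T" using r1(2) r2(2) k by (auto simp: subset_eq dist_real_def)
  qed
  define xx where "xx = (\<lambda>t. x (s + k * t))"
  define yy where "yy = (\<lambda>t. z (0 + k * t))"
  define yy' where "yy' = (\<lambda>t. k *\<^sub>R z' (0 + k * t))"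
  define xx' where "xx' = (\<lambda>t. k *\<^sub>R x' (s + k * t))"
  have xxU: "xx t \<in> U" and yyV: "yy t \<in> V" if "\<bar>t\<bar> < 2" for t
    using x z kT[OF that] kT'[OF that] by (auto simp: xx_def yy_def)
  have dyy: "(yy has_vector_derivative yy' t) (at t)" "(yy' has_vector_derivative k *\<^sub>R k *\<^sub>R z'' (0 + k * t)) (at t)" if "\<bar>t\<bar> < 2" for t
  proof -
    have a: "(z has_vector_derivative z' (0 + k * t)) (at (0 + k * t))" "(z' has_vector_derivative z'' (0 + k * t)) (at (0 + k * t))"
      using bspec[OF z kT'[OF that]] by blast+
    show "(yy has_vector_derivative yy' t) (at t)"
      unfolding yy_def yy'_def by (rule has_vector_derivative_rescale[OF a(1)])
    show "(yy' has_vector_derivative k *\<^sub>R k *\<^sub>R z'' (0 + k * t)) (at t)"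
      unfolding yy'_def by (rule bounded_linear.has_vector_derivative[OF bounded_linear_scaleR_right has_vector_derivative_rescale[OF a(2)]])
  qed
  have dxx: "(xx has_vector_derivative xx' t) (at t)" "(xx' has_vector_derivative k *\<^sub>R k *\<^sub>R x'' (s + k * t)) (at t)" if "\<bar>t\<bar> < 2" for t
  proof -
    have a: "(x has_vector_derivative x' (s + k * t)) (at (s + k * t))" "(x' has_vector_derivative x'' (s + k * t)) (at (s + k * t))"
      using bspec[OF x kT[OF that]] by blast+
    show "(xx has_vector_derivative xx' t) (at t)"
      unfolding xx_def xx'_def by (rule has_vector_derivative_rescale[OF a(1)])
    show "(xx' has_vector_derivative k *\<^sub>R k *\<^sub>R x'' (s + k * t)) (at t)"
      unfolding xx'_def by (rule bounded_linear.has_vector_derivative[OF bounded_linear_scaleR_right has_vector_derivative_rescale[OF a(2)]])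
  qed
  have yy0: "yy 0 = y" "yy' 0 = k *\<^sub>R e" by (simp_all add: yy_def yy'_def z0 z'0)
  have xx0: "xx 0 = X" "xx' 0 = k *\<^sub>R x' s" by (simp_all add: xx_def xx'_def X_def)
  have Dyx: "Dy U V c (xx t) y = - (p + (s + k * t) *\<^sub>R b)" if "\<bar>t\<bar> < 2" for t
    using x kT[OF that] by (metis add.inverse_inverse xx_def)
  have Dxy: "Dx U V c X (yy t) = - (q + (k * t) *\<^sub>R \<eta>)" if "\<bar>t\<bar> < 2" for t
    using z kT'[OF that] by (metis add.inverse_inverse add.left_neutral yy_def)
  define Z where "Z = k *\<^sub>R k *\<^sub>R z'' 0"
  have first: "deriv (\<lambda>t. c (xx \<sigma>) (yy t)) 0 = dd (0, k *\<^sub>R e) F (xx \<sigma>, y)"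
    and second: "(deriv ^^ 2) (\<lambda>t. c (xx \<sigma>) (yy t)) 0 = dd (0, k *\<^sub>R e) (dd (0, k *\<^sub>R e) F) (xx \<sigma>, y) + dd (0, Z) F (xx \<sigma>, y)"
    if \<sigma>: "\<bar>\<sigma>\<bar> < 2" for \<sigma>
  proof -
    have d1: "((\<lambda>t. c (xx \<sigma>) (yy t)) has_real_derivative dd (0, yy' t) F (xx \<sigma>, yy t)) (at t)" if "\<bar>t\<bar> < 2" for t
    proof -
      have "((\<lambda>t. F (xx \<sigma>, yy t)) has_real_derivative dd (0, yy' t) F (xx \<sigma>, yy t)) (at t)"
        by (rule along_y(1)[OF C2 xxU[OF \<sigma>] yyV[OF that] dyy[OF that] refl])
      then show ?thesis by (simp only: F_pair)
    qed
    have d2: "((\<lambda>t. dd (0, yy' t) F (xx \<sigma>, yy t)) has_real_derivative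
       dd (0, k *\<^sub>R e) (dd (0, k *\<^sub>R e) F) (xx \<sigma>, y) + dd (0, Z) F (xx \<sigma>, y)) (at 0)"
      using along_y(2)[OF C2 xxU[OF \<sigma>] yyV dyy(1) dyy(2) refl, of 0] yy0 by (simp add: Z_def)
    show "deriv (\<lambda>t. c (xx \<sigma>) (yy t)) 0 = dd (0, k *\<^sub>R e) F (xx \<sigma>, y)"
      using deriv_deriv_eq(1)[of 2, OF _ d1 d2] yy0 by simp
    show "(deriv ^^ 2) (\<lambda>t. c (xx \<sigma>) (yy t)) 0 = dd (0, k *\<^sub>R e) (dd (0, k *\<^sub>R e) F) (xx \<sigma>, y) + dd (0, Z) F (xx \<sigma>, y)"
      using deriv_deriv_eq(2)[of 2, OF _ d1 d2] by simp
  qed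
  \<comment> \<open>Along the x-curve every derivative of the cost in \<open>y\<close> at the fixed
    \<open>y\<close> is affine in \<sigma>. For w = k e the slope vanishes by orthogonality, so the
    side condition of (B3) holds. For w = Z, the acceleration, the term is killed by the second
    derivative in \<sigma>.\<close>
  have Fy: "dd (0, w) F (xx \<sigma>, y) = - (w \<bullet> (p + s *\<^sub>R b)) - \<sigma> * (k * (w \<bullet> b))" if "\<bar>\<sigma>\<bar> < 2" for \<sigma> w
    using Dy_inner[OF xxU[OF that] y, of w] Dyx[OF that] by (simp add: inner_commute inner_add_right algebra_simps)
  have ev: "\<forall>\<^sub>F \<sigma> in nhds (0::real). \<bar>\<sigma>\<bar> < 2"
    by (auto simp: eventually_nhds_metric dist_real_def intro!: exI[of _ 2])
  have mixed: "deriv (\<lambda>\<sigma>. deriv (\<lambda>t. c (xx \<sigma>) (yy t)) 0) 0 = 0"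
  proof -
    have "\<forall>\<^sub>F \<sigma> in nhds 0. deriv (\<lambda>t. c (xx \<sigma>) (yy t)) 0 = - ((k *\<^sub>R e) \<bullet> (p + s *\<^sub>R b))"
      using ev by (rule eventually_mono) (use orth in \<open>simp add: first Fy inner_commute\<close>)
    then have "deriv (\<lambda>\<sigma>. deriv (\<lambda>t. c (xx \<sigma>) (yy t)) 0) 0 = deriv (\<lambda>\<sigma>::real. - ((k *\<^sub>R e) \<bullet> (p + s *\<^sub>R b))) 0"
      by (rule deriv_cong_ev) simp
    then show ?thesis by simp
  qed
  have kk: "dd (0, k *\<^sub>R e) (dd (0, k *\<^sub>R e) F) z = k\<^sup>2 * A z" if "z \<in> U \<times> V" for z
  proof -
    have ke: "(0 :: real^'n, k *\<^sub>R e) = k *\<^sub>R (0, e)" by simp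
    have "dd (k *\<^sub>R (0, e)) (dd (k *\<^sub>R (0, e)) F) z = k * dd (0, e) (dd (k *\<^sub>R (0, e)) F) z"
      by (rule dd_scale[OF dd_F_diff[OF that]])
    also have "dd (0, e) (dd (k *\<^sub>R (0, e)) F) z = dd (k *\<^sub>R (0, e)) (dd (0, e) F) z"
      by (rule dd_commute[OF open_UV C2 that])
    also have "\<dots> = k * A z" unfolding A_def by (rule dd_scale[OF dd_F_diff[OF that]])
    finally show ?thesis by (simp add: power2_eq_square)
  qed
  define g where "g = (\<lambda>\<sigma>. k\<^sup>2 * A (xx \<sigma>, y) + (- (Z \<bullet> (p + s *\<^sub>R b)) - \<sigma> * (k * (Z \<bullet> b))))"
  have secondg: "(deriv ^^ 2) (\<lambda>t. c (xx \<sigma>) (yy t)) 0 = g \<sigma>" if "\<bar>\<sigma>\<bar> < 2" for \<sigma>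
    unfolding second[OF that] g_def using kk[of "(xx \<sigma>, y)"] xxU[OF that] y Fy[OF that] by simp
  define g1 where "g1 = (\<lambda>\<sigma>. k\<^sup>2 * dd (xx' \<sigma>, 0) A (xx \<sigma>, y) - k * (Z \<bullet> b))"
  define S where "S = dd (x' s, 0) (dd (x' s, 0) A) (X, y) + dd (x'' s, 0) A (X, y)"
  have dg: "(g has_real_derivative g1 \<sigma>) (at \<sigma>)" if "\<bar>\<sigma>\<bar> < 2" for \<sigma>
    unfolding g_def g1_def
    by (rule derivative_eq_intros along_x(1)[where f=A, OF CA xxU[OF that] y dxx[OF that] refl] refl | simp)+
  have "((\<lambda>\<sigma>. dd (xx' \<sigma>, 0) A (xx \<sigma>, y)) has_real_derivative
      dd (xx' 0, 0) (dd (xx' 0, 0) A) (xx 0, y) + dd (k *\<^sub>R k *\<^sub>R x'' s, 0) A (xx 0, y)) (at 0)"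
    using along_x(2)[OF CA xxU y dxx(1) dxx(2) refl, of 0] by simp
  moreover have "dd (xx' 0, 0) (dd (xx' 0, 0) A) (xx 0, y) + dd (k *\<^sub>R k *\<^sub>R x'' s, 0) A (xx 0, y) = k\<^sup>2 * S"
  proof -
    have zz: "(X, y) \<in> U \<times> V" using XU y by simp
    have e1: "(k *\<^sub>R x' s, 0 :: real^'n) = k *\<^sub>R (x' s, 0)" "(k *\<^sub>R k *\<^sub>R x'' s, 0 :: real^'n) = k\<^sup>2 *\<^sub>R (x'' s, 0)"
      by (simp_all add: power2_eq_square)
    have "dd (k *\<^sub>R (x' s, 0)) (dd (k *\<^sub>R (x' s, 0)) A) (X, y) = k * dd (x' s, 0) (dd (k *\<^sub>R (x' s, 0)) A) (X, y)"
      by (rule dd_scale[OF Ck_closure_differentiable[OF Ck_closure_dd[OF open_UV CA] zz]])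
    also have "dd (x' s, 0) (dd (k *\<^sub>R (x' s, 0)) A) (X, y) = dd (k *\<^sub>R (x' s, 0)) (dd (x' s, 0) A) (X, y)"
      by (rule dd_commute[OF open_UV CA zz])
    also have "\<dots> = k * dd (x' s, 0) (dd (x' s, 0) A) (X, y)"
      by (rule dd_scale[OF Ck_closure_differentiable[OF Ck_closure_dd[OF open_UV CA] zz]])
    finally have "dd (k *\<^sub>R (x' s, 0)) (dd (k *\<^sub>R (x' s, 0)) A) (X, y) = k\<^sup>2 * dd (x' s, 0) (dd (x' s, 0) A) (X, y)"
      by (simp add: power2_eq_square)
    moreover have "dd (k\<^sup>2 *\<^sub>R (x'' s, 0)) A (X, y) = k\<^sup>2 * dd (x'' s, 0) A (X, y)"
      by (rule dd_scale[OF Ck_closure_differentiable[OF CA zz]])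
    ultimately show ?thesis unfolding xx0 e1 S_def by (simp add: distrib_left)
  qed
  ultimately have "((\<lambda>\<sigma>. dd (xx' \<sigma>, 0) A (xx \<sigma>, y)) has_real_derivative k\<^sup>2 * S) (at 0)" by simp
  then have dg1: "(g1 has_real_derivative k\<^sup>2 * (k\<^sup>2 * S)) (at 0)"
    unfolding g1_def by (auto intro!: derivative_eq_intros)
  have fourth: "(deriv ^^ 2) (\<lambda>\<sigma>. (deriv ^^ 2) (\<lambda>t. c (xx \<sigma>) (yy t)) 0) 0 = k\<^sup>2 * (k\<^sup>2 * S)"
  proof -
    have cong: "\<forall>\<^sub>F \<sigma> in nhds \<tau>. (deriv ^^ 2) (\<lambda>t. c (xx \<sigma>) (yy t)) 0 = g \<sigma>" if "\<bar>\<tau>\<bar> < 2" for \<tau>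
    proof -
      have "\<forall>\<^sub>F \<sigma> in nhds \<tau>. \<sigma> \<in> {-2<..<2}" by (rule eventually_nhds_in_open) (use that in auto)
      then show ?thesis by (rule eventually_mono) (auto intro!: secondg)
    qed
    have "((\<lambda>\<sigma>. (deriv ^^ 2) (\<lambda>t. c (xx \<sigma>) (yy t)) 0) has_real_derivative g1 \<sigma>) (at \<sigma>)" if "\<bar>\<sigma>\<bar> < 2" for \<sigma>
      using DERIV_cong_ev[OF refl cong[OF that] refl, of "g1 \<sigma>"] dg[OF that] by simp
    from deriv_deriv_eq(2)[of 2, OF _ this dg1] show ?thesis by simp
  qed
  have "- (deriv ^^ 2) (\<lambda>\<sigma>. (deriv ^^ 2) (\<lambda>t. c (xx \<sigma>) (yy t)) 0) 0 \<ge> 0"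
  proof (rule B3[unfolded B3_def, rule_format])
    have b: "\<bar>t\<bar> < 2" if "t \<in> {-1..1}" for t :: real using that by auto
    have "(Dy U V c (xx t) (yy 0), Dx U V c (xx 0) (yy t)) = (- (p + s *\<^sub>R b), - q) + t *\<^sub>R (- (k *\<^sub>R b), - (k *\<^sub>R \<eta>))"
      if "t \<in> {-1..1}" for t
      unfolding yy0 xx0 Dyx[OF b[OF that]] Dxy[OF b[OF that]] by (simp add: algebra_simps)
    then have "\<exists>a b. \<forall>t\<in>{-1..1}. (Dy U V c (xx t) (yy 0), Dx U V c (xx 0) (yy t)) = a + t *\<^sub>R b" by blast
    moreover have "\<forall>t\<in>{-1..1}. xx t \<in> closure U \<and> yy t \<in> closure V"
      using xxU yyV b U_closure V_closure by simp
    ultimately show "(\<forall>t\<in>{-1..1}. xx t \<in> closure U \<and> yy t \<in> closure V) \<and>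
      (\<exists>a b. \<forall>t\<in>{-1..1}. (Dy U V c (xx t) (yy 0), Dx U V c (xx 0) (yy t)) = a + t *\<^sub>R b) \<and>
      deriv (\<lambda>\<sigma>. deriv (\<lambda>t. c (xx \<sigma>) (yy t)) 0) 0 = 0" using mixed by simp
  qed
  then have "k\<^sup>2 * (k\<^sup>2 * S) \<le> 0" unfolding fourth by simp
  then have "S \<le> 0" using k(1) by (simp add: mult_le_0_iff)
  then show ?thesis unfolding S_def A_def X_def .
qed

text \<open>The second derivative of \<open>c x\<close> along a curve through \<open>y\<close> with
  velocity \<open>e\<close> and acceleration \<open>a\<close>.\<close>

definition Hess :: "real^'n \<Rightarrow> real^'n \<Rightarrow> real^'n \<Rightarrow> real^'n \<Rightarrow> real" where
  "Hess e a x y = dd (0, e) (dd (0, e) F) (x, y) + dd (0, a) F (x, y)"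

text \<open>Join \<open>x0\<close> to \<open>x1\<close> by the curve that is straight as seen from Y
  = y t and let g(s) be minus \<open>Hess\<close> along it. The hypothesis \<open>crit\<close> says
  that the segment is orthogonal to the velocity of the y-curve, so \<open>cross_curvature\<close>
  makes \<open>g\<close> convex. Its derivative at 0 vanishes because the y-curve is straight as
  seen from \<open>x0\<close>. Hence g 0 \<le> g 1.\<close>

lemma second_derivative_at_critical:
  assumes x01: "x0 \<in> U" "x1 \<in> U" and T: "open T" "t \<in> T"
    and y: "\<forall>t\<in>T. y t \<in> V \<and> - Dx U V c x0 (y t) = p + t *\<^sub>R \<eta> \<and>
        (y has_vector_derivative y' t) (at t) \<and> (y' has_vector_derivative y'' t) (at t)"
    and crit: "dd (0, y' t) F (x0, y t) = dd (0, y' t) F (x1, y t)"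
  shows "Hess (y' t) (y'' t) x1 (y t) \<le> Hess (y' t) (y'' t) x0 (y t)"
proof -
  define Y where "Y = y t"
  define e where "e = y' t"
  define a where "a = y'' t"
  have YV: "Y \<in> V" using y T by (simp add: Y_def)
  define b0 where "b0 = - Dy U V c x0 Y"
  define b where "b = - Dy U V c x1 Y - b0"
  define T' where "T' = {s. b0 + s *\<^sub>R b \<in> U_at U V c Y}"
  have xc: "open T' \<and> (\<exists>x x' x''. \<forall>s\<in>T'. x s \<in> U \<and> - Dy U V c (x s) Y = b0 + s *\<^sub>R b \<and>
    (x has_vector_derivative x' s) (at s) \<and> (x' has_vector_derivative x'' s) (at s) \<and> (- transpose (H (x s) Y)) *v x' s = b \<and>
    (\<exists>e>0. \<exists>C. \<forall>t. \<bar>t - s\<bar> < e \<longrightarrow> t \<in> T' \<and> norm (x' t) \<le> C \<and> norm (x'' t) \<le> C))"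
    unfolding T'_def by (rule x_curve[OF YV])
  then obtain x x' x'' where x0: "\<forall>s\<in>T'. x s \<in> U \<and> - Dy U V c (x s) Y = b0 + s *\<^sub>R b \<and>
    (x has_vector_derivative x' s) (at s) \<and> (x' has_vector_derivative x'' s) (at s) \<and> (- transpose (H (x s) Y)) *v x' s = b \<and>
    (\<exists>e>0. \<exists>C. \<forall>t. \<bar>t - s\<bar> < e \<longrightarrow> t \<in> T' \<and> norm (x' t) \<le> C \<and> norm (x'' t) \<le> C)"
    by (elim exE conjE) (rule that)
  have x: "\<forall>s\<in>T'. x s \<in> U \<and> - Dy U V c (x s) Y = b0 + s *\<^sub>R b \<and>
    (x has_vector_derivative x' s) (at s) \<and> (x' has_vector_derivative x'' s) (at s)" using x0 by blast
  have I: "s \<in> T'" if "s \<in> {0..1}" for s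
  proof -
    have cv: "convex (U_at U V c Y)" using B2 x01(1) YV U_closure V_closure unfolding B2_def by blast
    have "b0 \<in> U_at U V c Y" "b0 + b \<in> U_at U V c Y" using x01 by (auto simp: b0_def b_def U_at_def)
    from convexD[OF cv this, of "1 - s" s] that show ?thesis by (simp add: T'_def algebra_simps)
  qed
  have ends: "x 0 = x0" "x 1 = x1"
    by (rule Dy_inj[OF V_closure[OF YV]], use x I[of 0] I[of 1] x01 U_closure in \<open>auto simp: b0_def b_def\<close>)+
  have orth: "b \<bullet> e = 0"
    using Dy_inner[OF x01(1) YV, of e] Dy_inner[OF x01(2) YV, of e] crit
    by (simp add: b_def b0_def inner_diff_left Y_def e_def)
  define A where "A = dd (0, e) (dd (0, e) F)"
  have CA: "Ck_closure (Suc (Suc 0)) (U \<times> V) A" unfolding A_def by (rule C2_dd_dd)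
  define g where "g = (\<lambda>s. - Hess e a (x s) Y)"
  define g1 where "g1 = (\<lambda>s. - dd (x' s, 0) A (x s, Y) + a \<bullet> b)"
  have geq: "g s = - A (x s, Y) + a \<bullet> (b0 + s *\<^sub>R b)" if "s \<in> T'" for s
  proof -
    have xs: "x s \<in> U" "- Dy U V c (x s) Y = b0 + s *\<^sub>R b" using x that by blast+
    have "dd (0, a) F (x s, Y) = - (a \<bullet> (- Dy U V c (x s) Y))"
      using Dy_inner[OF xs(1) YV, of a] by (simp add: inner_commute)
    then show ?thesis unfolding g_def Hess_def A_def xs(2) by simp
  qed
  have dg: "(g has_real_derivative g1 s) (at s)" if s: "s \<in> T'" for s
  proof -
    have "((\<lambda>s. A (x s, Y)) has_real_derivative dd (x' s, 0) A (x s, Y)) (at s)"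
      using x s by (intro along_x(1)[OF CA _ YV _ _ refl]) auto
    then have "((\<lambda>s. - A (x s, Y) + a \<bullet> (b0 + s *\<^sub>R b)) has_real_derivative g1 s) (at s)"
      unfolding g1_def inner_add_right inner_scaleR_right by (auto intro!: derivative_eq_intros)
    moreover have "\<forall>\<^sub>F s in nhds s. g s = - A (x s, Y) + a \<bullet> (b0 + s *\<^sub>R b)"
      by (rule eventually_mono[OF eventually_nhds_in_open[of T' s]]) (use xc s geq in auto)
    ultimately show ?thesis by (subst DERIV_cong_ev[OF refl _ refl])
  qed
  have dg1: "\<exists>d. (g1 has_real_derivative d) (at s) \<and> 0 \<le> d" if s: "s \<in> T'" for s
  proof -
    have "((\<lambda>s. dd (x' s, 0) A (x s, Y)) has_real_derivative dd (x' s, 0) (dd (x' s, 0) A) (x s, Y) + dd (x'' s, 0) A (x s, Y)) (at s)"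
      using x s by (intro along_x(2)[OF CA _ YV _ _ refl]) auto
    then have "(g1 has_real_derivative - (dd (x' s, 0) (dd (x' s, 0) A) (x s, Y) + dd (x'' s, 0) A (x s, Y))) (at s)"
      unfolding g1_def by (auto intro!: derivative_eq_intros)
    moreover have "dd (x' s, 0) (dd (x' s, 0) A) (x s, Y) + dd (x'' s, 0) A (x s, Y) \<le> 0"
      unfolding A_def using xc s by (intro cross_curvature[OF YV _ s x orth]) simp
    ultimately show ?thesis by (intro exI conjI) auto
  qed
  \<comment> \<open>Since Dx c(x0, y(t)) is affine in t, its second derivative in t is zero. By
    symmetry of derivatives, its component along v = x' 0 is the derivative of \<open>Hess\<close>
    in \<open>x\<close> at \<open>x0\<close>.\<close>
  have g10: "g1 0 = 0"
  proof -
    define v where "v = x' 0"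
    have xY: "(x0, Y) \<in> U \<times> V" using x01 YV by simp
    have "((\<lambda>s. dd (0, a) F (x s, Y)) has_real_derivative dd (v, 0) (dd (0, a) F) (x0, Y)) (at 0)"
      using along_x(1)[where x=x and s=0 and ?x1.0="x' 0" and x'=x' and ?x2.0="x'' 0", OF C2_dd _ YV _ _ refl] x I[of 0] ends by (auto simp: v_def)
    moreover have "((\<lambda>s. dd (0, a) F (x s, Y)) has_real_derivative - (a \<bullet> b)) (at 0)"
    proof -
      have "\<forall>\<^sub>F s in nhds 0. dd (0, a) F (x s, Y) = - (a \<bullet> b0 + s * (a \<bullet> b))"
      proof (rule eventually_mono[OF eventually_nhds_in_open[of T' 0]])
        fix s assume s: "s \<in> T'"
        have xs: "x s \<in> U" "- Dy U V c (x s) Y = b0 + s *\<^sub>R b" using x s by blast+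
        have "dd (0, a) F (x s, Y) = - (a \<bullet> (- Dy U V c (x s) Y))"
          using Dy_inner[OF xs(1) YV, of a] by (simp add: inner_commute)
        then show "dd (0, a) F (x s, Y) = - (a \<bullet> b0 + s * (a \<bullet> b))" unfolding xs(2) by (simp add: inner_add_right)
      qed (use xc I[of 0] in auto)
      moreover have "((\<lambda>s. - (a \<bullet> b0 + s * (a \<bullet> b))) has_real_derivative - (a \<bullet> b)) (at 0)"
        by (auto intro!: derivative_eq_intros)
      ultimately show ?thesis by (subst DERIV_cong_ev[OF refl _ refl])
    qed
    ultimately have ab: "dd (v, 0) (dd (0, a) F) (x0, Y) = - (a \<bullet> b)" by (rule DERIV_unique)
    define k where "k = dd (v, 0) F"
    have Ck: "Ck_closure (Suc (Suc 0)) (U \<times> V) k" unfolding k_def by (rule C2_dd)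
    have k1: "dd (0, y' \<tau>) k (x0, y \<tau>) = - (\<eta> \<bullet> v)" if "\<tau> \<in> T" for \<tau>
    proof -
      have "((\<lambda>\<tau>. k (x0, y \<tau>)) has_real_derivative dd (0, y' \<tau>) k (x0, y \<tau>)) (at \<tau>)"
        using y that by (intro along_y(1)[OF Ck x01(1) _ _ _ refl]) auto
      moreover have "((\<lambda>\<tau>. k (x0, y \<tau>)) has_real_derivative - (\<eta> \<bullet> v)) (at \<tau>)"
      proof -
        have "\<forall>\<^sub>F \<tau> in nhds \<tau>. k (x0, y \<tau>) = - (p \<bullet> v + \<tau> * (\<eta> \<bullet> v))"
        proof (rule eventually_mono[OF eventually_nhds_in_open[OF T(1) that]])
          fix \<tau> assume s: "\<tau> \<in> T"
          have ys: "y \<tau> \<in> V" "- Dx U V c x0 (y \<tau>) = p + \<tau> *\<^sub>R \<eta>" using y s by blast+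
          have "k (x0, y \<tau>) = - ((- Dx U V c x0 (y \<tau>)) \<bullet> v)" using Dx_inner[OF x01(1) ys(1), of v] by (simp add: k_def)
          then show "k (x0, y \<tau>) = - (p \<bullet> v + \<tau> * (\<eta> \<bullet> v))" unfolding ys(2) by (simp add: inner_add_left)
        qed
        moreover have "((\<lambda>\<tau>. - (p \<bullet> v + \<tau> * (\<eta> \<bullet> v))) has_real_derivative - (\<eta> \<bullet> v)) (at \<tau>)"
          by (auto intro!: derivative_eq_intros)
        ultimately show ?thesis by (subst DERIV_cong_ev[OF refl _ refl])
      qed
      ultimately show ?thesis by (rule DERIV_unique)
    qed
    have "((\<lambda>\<tau>. dd (0, y' \<tau>) k (x0, y \<tau>)) has_real_derivative dd (0, e) (dd (0, e) k) (x0, Y) + dd (0, a) k (x0, Y)) (at t)"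
      using along_y(2)[where y=y and t=t and ?y1.0="y' t" and y'=y' and ?y2.0="y'' t", OF Ck x01(1) _ _ _ refl] y T by (auto simp: e_def a_def Y_def)
    moreover have "((\<lambda>\<tau>. dd (0, y' \<tau>) k (x0, y \<tau>)) has_real_derivative 0) (at t)"
    proof -
      have "\<forall>\<^sub>F \<tau> in nhds t. dd (0, y' \<tau>) k (x0, y \<tau>) = - (\<eta> \<bullet> v)"
        by (rule eventually_mono[OF eventually_nhds_in_open[OF T]]) (rule k1)
      then show ?thesis by (subst DERIV_cong_ev[OF refl _ refl]) auto
    qed
    ultimately have kk: "dd (0, e) (dd (0, e) k) (x0, Y) + dd (0, a) k (x0, Y) = 0" by (rule DERIV_unique)
    have "dd (v, 0) A (x0, Y) = dd (0, e) (dd (v, 0) (dd (0, e) F)) (x0, Y)"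
      unfolding A_def by (rule dd_commute[OF open_UV C2_dd xY])
    also have "\<dots> = dd (0, e) (dd (0, e) k) (x0, Y)"
      unfolding k_def by (rule dd_cong_open[OF open_UV xY]) (rule dd_commute[OF open_UV C2])
    also have "\<dots> = - dd (0, a) k (x0, Y)" using kk by simp
    also have "dd (0, a) k (x0, Y) = dd (v, 0) (dd (0, a) F) (x0, Y)"
      unfolding k_def by (rule dd_commute[OF open_UV C2 xY])
    finally show ?thesis using ab ends by (simp add: g1_def v_def)
  qed
  have g1pos: "g1 s \<ge> 0" if "s \<in> {0..1}" for s
  proof -
    have "g1 0 \<le> g1 s" by (rule DERIV_nonneg_imp_nondecreasing) (use that I dg1 in auto)
    then show ?thesis using g10 by simp
  qed
  have "g 0 \<le> g 1" by (rule DERIV_nonneg_imp_nondecreasing) (use I dg g1pos in auto)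
  then show ?thesis by (simp add: g_def ends e_def a_def Y_def)
qed

lemma dd_dd_jointly_continuous:
  assumes z: "z0 \<in> U \<times> V" and tz: "(z \<longlongrightarrow> z0) G" and tw: "(w \<longlongrightarrow> w0) G"
  shows "((\<lambda>t. dd v (dd (w t) F) (z t)) \<longlongrightarrow> dd v (dd w0 F) z0) G"
proof -
  have "((\<lambda>t. \<Sum>b\<in>Basis. (w t \<bullet> b) * dd v (dd b F) (z t)) \<longlongrightarrow> (\<Sum>b\<in>Basis. (w0 \<bullet> b) * dd v (dd b F) z0)) G"
  proof (intro tendsto_sum tendsto_mult tendsto_inner tw tendsto_const)
    fix b
    have "isCont (dd v (dd b F)) z0"
      using Ck_closure_continuous_on[OF C2_dd_dd, of v b] z unfolding continuous_on_eq_continuous_at[OF open_UV] by (rule bspec)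
    then show "((\<lambda>t. dd v (dd b F) (z t)) \<longlongrightarrow> dd v (dd b F) z0) G" by (rule isCont_tendsto_compose[OF _ tz])
  qed
  moreover have "\<forall>\<^sub>F t in G. (\<Sum>b\<in>Basis. (w t \<bullet> b) * dd v (dd b F) (z t)) = dd v (dd (w t) F) (z t)"
    by (rule eventually_mono[OF topological_tendstoD[OF tz open_UV z]]) (rule dd_dd_basis[OF open_UV C2, symmetric])
  ultimately have "((\<lambda>t. dd v (dd (w t) F) (z t)) \<longlongrightarrow> (\<Sum>b\<in>Basis. (w0 \<bullet> b) * dd v (dd b F) z0)) G"
    by (rule Lim_transform_eventually)
  then show ?thesis using dd_dd_basis[OF open_UV C2 z, of v w0] by simp
qed

text \<open>
  Loeper's maximum principle. Where \<open>f'\<close> is small, moving \<open>x\<close> by \<open>O(\<bar>f'\<bar>)\<close> makes the first derivative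
  vanish, so that \<open>f'' \<ge> - C \<bar>f'\<bar>\<close>.
\<close>

lemma max_principle_interior:
  assumes x0: "x0 \<in> U" and x: "x \<in> U" and ys: "y \<in> V" "y1 \<in> V" "y2 \<in> V"
    and seg: "Dx U V c x0 y \<in> closed_segment (Dx U V c x0 y1) (Dx U V c x0 y2)"
  shows "c x0 y - c x y \<le> max (c x0 y1 - c x y1) (c x0 y2 - c x y2)"
proof (cases "y1 = y2")
  case True
  then have "Dx U V c x0 y = Dx U V c x0 y1" using seg by simp
  then have "y = y1" by (rule Dx_inj[OF U_closure[OF x0] V_closure[OF ys(1)] V_closure[OF ys(2)]])
  then show ?thesis by simp
next
  case False
  define p where "p = - Dx U V c x0 y1"
  define \<eta> where "\<eta> = - Dx U V c x0 y2 - p"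
  have \<eta>: "\<eta> \<noteq> 0"
  proof
    assume "\<eta> = 0"
    then have "Dx U V c x0 y1 = Dx U V c x0 y2" by (simp add: \<eta>_def p_def)
    from Dx_inj[OF U_closure[OF x0] V_closure[OF ys(2)] V_closure[OF ys(3)] this] show False using False by simp
  qed
  obtain \<theta> where \<theta>: "0 \<le> \<theta>" "\<theta> \<le> 1" "Dx U V c x0 y = (1 - \<theta>) *\<^sub>R Dx U V c x0 y1 + \<theta> *\<^sub>R Dx U V c x0 y2"
    using seg by (auto simp: closed_segment_def)
  define T where "T = {t. p + t *\<^sub>R \<eta> \<in> V_at U V c x0}"
  have yc: "open T \<and> (\<exists>z z' z''. \<forall>t\<in>T. z t \<in> V \<and> - Dx U V c x0 (z t) = p + t *\<^sub>R \<eta> \<and>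
    (z has_vector_derivative z' t) (at t) \<and> (z' has_vector_derivative z'' t) (at t) \<and> (- H x0 (z t)) *v z' t = \<eta> \<and>
    (\<exists>e>0. \<exists>C. \<forall>s. \<bar>s - t\<bar> < e \<longrightarrow> s \<in> T \<and> norm (z' s) \<le> C \<and> norm (z'' s) \<le> C))"
    unfolding T_def by (rule y_curve[OF x0])
  then have opT: "open T" by blast
  from yc obtain z z' z'' where z: "\<forall>t\<in>T. z t \<in> V \<and> - Dx U V c x0 (z t) = p + t *\<^sub>R \<eta> \<and>
    (z has_vector_derivative z' t) (at t) \<and> (z' has_vector_derivative z'' t) (at t) \<and> (- H x0 (z t)) *v z' t = \<eta> \<and>
    (\<exists>e>0. \<exists>C. \<forall>s. \<bar>s - t\<bar> < e \<longrightarrow> s \<in> T \<and> norm (z' s) \<le> C \<and> norm (z'' s) \<le> C)"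
    by (elim exE conjE) (rule that)
  have zV: "z t \<in> V" and zD: "- Dx U V c x0 (z t) = p + t *\<^sub>R \<eta>"
    and dz: "(z has_vector_derivative z' t) (at t)" and dz': "(z' has_vector_derivative z'' t) (at t)"
    and zH: "(- H x0 (z t)) *v z' t = \<eta>" if "t \<in> T" for t
    using bspec[OF z that] by blast+
  have z4: "\<forall>t\<in>T. z t \<in> V \<and> - Dx U V c x0 (z t) = p + t *\<^sub>R \<eta> \<and>
    (z has_vector_derivative z' t) (at t) \<and> (z' has_vector_derivative z'' t) (at t)"
    by (intro ballI conjI zV zD dz dz')
  have I: "s \<in> T" if "s \<in> {0..1}" for s
  proof -
    have cv: "convex (V_at U V c x0)" using B2 U_closure[OF x0] V_closure[OF ys(1)] by (simp add: B2_def)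
    have "p \<in> V_at U V c x0" "p + \<eta> \<in> V_at U V c x0" using ys by (auto simp: p_def \<eta>_def V_at_def)
    from convexD[OF cv this, of "1 - s" s] that show ?thesis by (simp add: T_def algebra_simps)
  qed
  have zeq: "z s = y'" if "s \<in> {0..1}" "y' \<in> V" "- Dx U V c x0 y' = p + s *\<^sub>R \<eta>" for s y'
  proof (rule Dx_inj[OF U_closure[OF x0] V_closure[OF zV[OF I[OF that(1)]]] V_closure[OF that(2)]])
    have "- Dx U V c x0 (z s) = - Dx U V c x0 y'" unfolding zD[OF I[OF that(1)]] that(3) ..
    then show "Dx U V c x0 (z s) = Dx U V c x0 y'" by simp
  qed
  have z0: "z 0 = y1" and z1: "z 1 = y2"
    by (rule zeq, use ys in \<open>auto simp: p_def \<eta>_def\<close>)+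
  have z\<theta>: "z \<theta> = y"
    by (rule zeq) (use \<theta> ys in \<open>auto simp: p_def \<eta>_def algebra_simps\<close>)
  define f where "f = (\<lambda>t. F (x0, z t) - F (x, z t))"
  define f1 where "f1 = (\<lambda>t. dd (0, z' t) F (x0, z t) - dd (0, z' t) F (x, z t))"
  define f2 where "f2 = (\<lambda>t. Hess (z' t) (z'' t) x0 (z t) - Hess (z' t) (z'' t) x (z t))"
  have df: "(f has_real_derivative f1 t) (at t)" if "t \<in> T" for t
    unfolding f_def f1_def
    by (intro DERIV_diff along_y(1)[OF C2 _ zV[OF that] dz[OF that] dz'[OF that] refl] x0 x)
  have df1: "(f1 has_real_derivative f2 t) (at t)" if "t \<in> T" for t
    unfolding f1_def f2_def Hess_def
    by (intro DERIV_diff along_y(2)[OF C2 _ zV[OF that] dz[OF that] dz'[OF that] refl] x0 x)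
  obtain B3 where B3: "B3 \<ge> 0" "\<forall>z\<in>U \<times> V. \<forall>v w u. \<bar>dd v (dd w (dd u F)) z\<bar> \<le> B3 * norm v * norm w * norm u"
    by (rule third_bound)
  obtain B2 where B2: "B2 \<ge> 0" "\<forall>z\<in>U \<times> V. \<forall>v w. \<bar>dd v (dd w F) z\<bar> \<le> B2 * norm v * norm w"
    using dd_bound2[OF open_UV bounded_UV C2] by metis
  have loc: "\<exists>e>0. \<exists>C. \<forall>s. \<bar>s - t\<bar> < e \<longrightarrow> - C * \<bar>f1 s\<bar> \<le> f2 s" if t: "0 < t" "t < 1" "f1 t = 0" for t
  proof -
    have tT: "t \<in> T" using I t by simp
    have "z' t \<noteq> 0" using zH[OF tT] \<eta> by auto
    then have un: "H x (z t) *v z' t \<noteq> 0" using H_inj[OF x zV[OF tT]] by blast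
    define u where "u = H x (z t) *v z' t"
    \<comment> \<open>Moving \<open>x\<close> in this direction changes the first derivative along
      the y-curve at unit rate; \<open>D\<close> is that rate, equal to 1 at (0, t) and above 1/2
      nearby. The vector \<open>u\<close> is nonzero by nondegeneracy of the mixed Hessian.\<close>
    define v where "v = u /\<^sub>R (u \<bullet> u)"
    have vu: "v \<bullet> u = 1" using un by (simp add: v_def u_def)
    define D where "D = (\<lambda>rs. dd (v, 0) (dd (0, z' (snd rs)) F) (x + fst rs *\<^sub>R v, z (snd rs)))"
    have "D (0, t) = 1" using H_bilinear[OF x zV[OF tT], of v "z' t"] vu by (simp add: D_def u_def)
    have contz: "isCont z t" "isCont z' t" using dz[OF tT] dz'[OF tT] has_vector_derivative_continuous by blast+
    have tz: "((\<lambda>rs. z (snd rs)) \<longlongrightarrow> z t) (nhds (0 :: real, t))" and tz': "((\<lambda>rs. z' (snd rs)) \<longlongrightarrow> z' t) (nhds (0 :: real, t))"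
      using isCont_tendsto_compose[OF contz(1), of snd "nhds (0 :: real, t)"] isCont_tendsto_compose[OF contz(2), of snd "nhds (0 :: real, t)"]
        tendsto_snd[OF filterlim_ident[of "nhds (0 :: real, t)"]] by (simp_all add: filterlim_ident)
    have tx: "((\<lambda>rs. x + fst rs *\<^sub>R v) \<longlongrightarrow> x) (nhds (0 :: real, t))"
      using tendsto_add[OF tendsto_const tendsto_scaleR[OF tendsto_fst[OF filterlim_ident[of "nhds (0 :: real, t)"]] tendsto_const], of x v] by simp
    have "(D \<longlongrightarrow> dd (v, 0) (dd (0, z' t) F) (x, z t)) (nhds (0, t))"
      unfolding D_def by (intro dd_dd_jointly_continuous tendsto_Pair tx tz tz' tendsto_const) (use x zV[OF tT] in simp)
    then have "(D \<longlongrightarrow> 1) (nhds (0, t))" using \<open>D (0, t) = 1\<close> by (simp add: D_def)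
    then have ev1: "\<forall>\<^sub>F rs in nhds (0, t). 1/2 < D rs" by (rule order_tendstoD) simp
    have ev2: "\<forall>\<^sub>F rs in nhds (0, t). x + fst rs *\<^sub>R v \<in> U" by (rule topological_tendstoD[OF tx open_U x])
    have ev3: "\<forall>\<^sub>F rs in nhds (0 :: real, t). snd rs \<in> T"
      by (rule topological_tendstoD[OF tendsto_snd[OF filterlim_ident]]) (use opT tT in auto)
    obtain e where e: "e > 0" "\<And>rs. dist rs (0, t) < e \<Longrightarrow> 1/2 < D rs \<and> x + fst rs *\<^sub>R v \<in> U \<and> snd rs \<in> T"
      using eventually_conj[OF ev1 eventually_conj[OF ev2 ev3]] unfolding eventually_nhds_metric by auto
    define \<rho> where "\<rho> = e / 2"
    have \<rho>: "\<rho> > 0" using e by (simp add: \<rho>_def)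
    have near: "1/2 < D (r, s)" "x + r *\<^sub>R v \<in> U" "s \<in> T" if "\<bar>r\<bar> < \<rho>" "\<bar>s - t\<bar> < \<rho>" for r s
    proof -
      have "dist (r, s) (0, t) \<le> \<bar>r\<bar> + \<bar>s - t\<bar>"
        using sqrt_sum_squares_le_sum_abs[of r "s - t"] by (simp add: dist_Pair_Pair dist_real_def)
      then have "dist (r, s) (0, t) < e" using that by (simp add: \<rho>_def)
      from e(2)[OF this] show "1/2 < D (r, s)" "x + r *\<^sub>R v \<in> U" "s \<in> T" by auto
    qed
    obtain e1 C1 where e1: "e1 > 0" "\<forall>s. \<bar>s - t\<bar> < e1 \<longrightarrow> s \<in> T \<and> norm (z' s) \<le> C1 \<and> norm (z'' s) \<le> C1"
      using bspec[OF z tT] by blast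
    have C1: "C1 \<ge> 0" using e1 order_trans[OF norm_ge_zero, of "z' t" C1] by auto
    have "isCont f1 t" using df1[OF tT] by (rule DERIV_isCont)
    then have "(f1 \<longlongrightarrow> f1 t) (nhds t)" unfolding isCont_def tendsto_at_iff_tendsto_nhds .
    then have "(f1 \<longlongrightarrow> 0) (nhds t)" unfolding t(3) .
    from tendstoD[OF this, of "\<rho> / 4"] have "\<forall>\<^sub>F s in nhds t. dist (f1 s) 0 < \<rho> / 4" using \<rho> by simp
    then obtain e2 where e2: "e2 > 0" "\<And>s. \<bar>s - t\<bar> < e2 \<Longrightarrow> \<bar>f1 s\<bar> < \<rho> / 4"
      unfolding eventually_nhds_metric dist_real_def by auto
    define Cb where "Cb = B3 * norm v * C1 * C1 + B2 * norm v * C1"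
    have Cb: "Cb \<ge> 0" using B3(1) B2(1) C1 by (simp add: Cb_def)
    define \<epsilon> where "\<epsilon> = min \<rho> (min e1 e2)"
    have "- (2 * Cb) * \<bar>f1 s\<bar> \<le> f2 s" if s: "\<bar>s - t\<bar> < \<epsilon>" for s
    proof -
      have ss: "\<bar>s - t\<bar> < \<rho>" "\<bar>s - t\<bar> < e1" "\<bar>s - t\<bar> < e2" using s by (auto simp: \<epsilon>_def)
      have sT: "s \<in> T" and bz: "norm (z' s) \<le> C1" "norm (z'' s) \<le> C1" using e1(2) ss(2) by blast+
      \<comment> \<open>As a function of the displacement r, the first derivative decreases at a
        rate of at least 1/2, so it reaches zero within distance 2 |f1 s|.\<close>
      define R where "R = 2 * \<bar>f1 s\<bar>"
      have R: "R \<ge> 0" "R < \<rho>" using e2(2)[OF ss(3)] \<rho> by (auto simp: R_def)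
      define \<phi> where "\<phi> = (\<lambda>r. dd (0, z' s) F (x0, z s) - dd (0, z' s) F (x + r *\<^sub>R v, z s))"
      have line: "((\<lambda>r. x + r *\<^sub>R v) has_vector_derivative v) (at r)" for r
        by (auto intro!: derivative_eq_intros simp: has_vector_derivative_def)
      have dphi: "(\<phi> has_real_derivative - D (r, s)) (at r)" if "\<bar>r\<bar> < \<rho>" for r
      proof -
        have "((\<lambda>r. dd (0, z' s) F (x + r *\<^sub>R v, z s)) has_real_derivative D (r, s)) (at r)"
          unfolding D_def fst_conv snd_conv
          by (rule along_x(1)[OF C2_dd near(2)[OF that ss(1)] zV[OF sT] line has_vector_derivative_const refl])
        then show ?thesis unfolding \<phi>_def by (auto intro!: derivative_eq_intros)
      qed
      have mono: "\<phi> r2 \<le> \<phi> r1 - (r2 - r1) / 2" if "r1 \<le> r2" "- \<rho> < r1" "r2 < \<rho>" for r1 r2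
      proof -
        have "\<phi> r2 + r2 / 2 \<le> \<phi> r1 + r1 / 2"
        proof (rule DERIV_nonpos_imp_nonincreasing[OF that(1)])
          fix r assume "r1 \<le> r" "r \<le> r2"
          then have r: "\<bar>r\<bar> < \<rho>" using that by auto
          show "\<exists>y. ((\<lambda>r. \<phi> r + r / 2) has_real_derivative y) (at r) \<and> y \<le> 0"
            using dphi[OF r] near(1)[OF r ss(1)]
            by (intro exI[of _ "- D (r, s) + 1 / 2"]) (auto intro!: derivative_eq_intros)
        qed
        then show ?thesis by (simp add: diff_divide_distrib)
      qed
      have \<phi>0: "\<phi> 0 = f1 s" by (simp add: \<phi>_def f1_def)
      have "\<phi> R \<le> 0" "0 \<le> \<phi> (- R)"
        using mono[of 0 R] mono[of "- R" 0] R \<rho> \<phi>0 by (auto simp: R_def)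
      moreover have "continuous_on {- R..R} \<phi>"
        using R by (intro continuous_at_imp_continuous_on ballI DERIV_isCont[OF dphi]) auto
      ultimately obtain r where r: "- R \<le> r" "r \<le> R" "\<phi> r = 0"
        using IVT2'[of \<phi> R 0 "- R"] R by auto
      then have rr: "\<bar>r\<bar> \<le> R" "\<bar>r\<bar> < \<rho>" using R by auto
      \<comment> \<open>At the displaced point the first derivative vanishes, so the second-order
        comparison applies exactly. Returning to \<open>x\<close> costs at most Cb times the
        displacement, that is 2 Cb |f1 s|.\<close>
      have crit: "Hess (z' s) (z'' s) (x + r *\<^sub>R v) (z s) \<le> Hess (z' s) (z'' s) x0 (z s)"
        by (rule second_derivative_at_critical[OF x0 near(2)[OF rr(2) ss(1)] opT sT z4]) (use r(3) in \<open>simp add: \<phi>_def\<close>)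
      define h where "h = (\<lambda>r. Hess (z' s) (z'' s) (x + r *\<^sub>R v) (z s))"
      define h' where "h' = (\<lambda>r. dd (v, 0) (dd (0, z' s) (dd (0, z' s) F)) (x + r *\<^sub>R v, z s) + dd (v, 0) (dd (0, z'' s) F) (x + r *\<^sub>R v, z s))"
      have "norm (h r - h 0) \<le> Cb * norm (r - 0)"
      proof (rule field_differentiable_bound[of "{- \<rho><..<\<rho>}" h h'])
        fix q assume "q \<in> {- \<rho><..<\<rho>}"
        then have q: "\<bar>q\<bar> < \<rho>" by auto
        have "(h has_real_derivative h' q) (at q)"
          unfolding h_def h'_def Hess_def
          by (intro DERIV_add along_x(1)[OF C2_dd_dd near(2)[OF q ss(1)] zV[OF sT] line has_vector_derivative_const refl]
             along_x(1)[OF C2_dd near(2)[OF q ss(1)] zV[OF sT] line has_vector_derivative_const refl])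
        then show "(h has_field_derivative h' q) (at q within {- \<rho><..<\<rho>})" by (rule DERIV_subset) simp
        have zq: "(x + q *\<^sub>R v, z s) \<in> U \<times> V" using near(2)[OF q ss(1)] zV[OF sT] by simp
        have "\<bar>h' q\<bar> \<le> \<bar>dd (v, 0) (dd (0, z' s) (dd (0, z' s) F)) (x + q *\<^sub>R v, z s)\<bar> + \<bar>dd (v, 0) (dd (0, z'' s) F) (x + q *\<^sub>R v, z s)\<bar>"
          unfolding h'_def by (rule abs_triangle_ineq)
        also have "\<dots> \<le> B3 * norm (v, 0 :: real^'n) * norm (0 :: real^'n, z' s) * norm (0 :: real^'n, z' s) + B2 * norm (v, 0 :: real^'n) * norm (0 :: real^'n, z'' s)"
          by (intro add_mono B3(2)[rule_format] B2(2)[rule_format] zq)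
        also have "\<dots> \<le> Cb" unfolding Cb_def norm_Pair
          using B3(1) B2(1) bz C1 by (auto intro!: add_mono mult_mono mult_nonneg_nonneg)
        finally show "norm (h' q) \<le> Cb" by simp
      qed (use rr \<rho> in auto)
      then have "h r - h 0 \<ge> - (Cb * \<bar>r\<bar>)" by (simp add: abs_le_iff)
      moreover have "Cb * \<bar>r\<bar> \<le> Cb * R" using rr Cb by (intro mult_left_mono) auto
      moreover have "f2 s \<ge> h r - h 0" using crit by (simp add: f2_def h_def)
      ultimately show ?thesis by (simp add: R_def)
    qed
    moreover have "\<epsilon> > 0" using \<rho> e1 e2 by (simp add: \<epsilon>_def)
    ultimately show ?thesis by blast
  qed
  have "f \<theta> \<le> max (f 0) (f 1)"
    by (rule quasiconvex_of_local_inequality[of f f1 f2]) (use df df1 I loc \<theta> in auto)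
  then show ?thesis unfolding f_def z0 z1 z\<theta> by (simp only: F_pair)
qed

text \<open>
  The dual statement. If it failed at \<open>x0\<close>, then after moving \<open>y\<close> slightly the derivative at \<open>t = 0\<close> of the
  maximum principle along the segment from \<open>y0\<close> to \<open>y\<close> would have opposite strict signs at \<open>x1\<close> and \<open>x2\<close>.
\<close>

lemma quasiconvex_interior:
  assumes xs: "x0 \<in> U" "x1 \<in> U" "x2 \<in> U" and ys: "y0 \<in> V" "y \<in> V"
    and seg: "Dy U V c x0 y0 \<in> closed_segment (Dy U V c x1 y0) (Dy U V c x2 y0)"
  shows "c x0 y0 - c x0 y \<le> max (c x1 y0 - c x1 y) (c x2 y0 - c x2 y)"
proof (rule ccontr)
  assume neg: "\<not> ?thesis"
  define b where "b = Dy U V c x2 y0 - Dy U V c x1 y0"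
  obtain \<theta> where \<theta>: "0 \<le> \<theta>" "\<theta> \<le> 1" "Dy U V c x0 y0 = (1 - \<theta>) *\<^sub>R Dy U V c x1 y0 + \<theta> *\<^sub>R Dy U V c x2 y0"
    using seg by (auto simp: closed_segment_def)
  have d10: "Dy U V c x1 y0 - Dy U V c x0 y0 = - (\<theta> *\<^sub>R b)" and d20: "Dy U V c x2 y0 - Dy U V c x0 y0 = (1 - \<theta>) *\<^sub>R b"
    unfolding \<theta>(3) b_def by (simp_all add: algebra_simps)
  have \<theta>01: "\<theta> \<noteq> 0" "\<theta> \<noteq> 1"
  proof -
    show "\<theta> \<noteq> 0"
    proof
      assume "\<theta> = 0"
      then have "Dy U V c x1 y0 = Dy U V c x0 y0" using d10 by simp
      then have "x1 = x0" by (rule Dy_inj[OF V_closure[OF ys(1)] U_closure[OF xs(2)] U_closure[OF xs(1)]])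
      then show False using neg by simp
    qed
    show "\<theta> \<noteq> 1"
    proof
      assume "\<theta> = 1"
      then have "Dy U V c x2 y0 = Dy U V c x0 y0" using d20 by simp
      then have "x2 = x0" by (rule Dy_inj[OF V_closure[OF ys(1)] U_closure[OF xs(3)] U_closure[OF xs(1)]])
      then show False using neg by simp
    qed
  qed
  have b0: "b \<noteq> 0"
  proof
    assume "b = 0"
    then have "Dy U V c x1 y0 = Dy U V c x0 y0" using d10 by simp
      then have "x1 = x0" by (rule Dy_inj[OF V_closure[OF ys(1)] U_closure[OF xs(2)] U_closure[OF xs(1)]])
    then show False using neg by simp
  qed
  define gap where "gap = (\<lambda>x y'. (c x0 y0 - c x0 y') - (c x y0 - c x y'))"
  have gapc: "isCont (gap x) y" if "x \<in> U" for x
  proof -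
    have "isCont (\<lambda>y'. F (x', y')) y" if "x' \<in> U" for x'
      by (rule has_derivative_continuous[OF derivative_in_y[OF F_diff]]) (use that ys in simp)
    then have "isCont (\<lambda>y'. c x' y') y" if "x' \<in> U" for x' using that by (simp only: F_pair)
    from this[OF that] this[OF xs(1)] show ?thesis unfolding gap_def by (intro continuous_intros)
  qed
  have "gap x1 y > 0" "gap x2 y > 0" using neg by (auto simp: gap_def)
  then have ev: "\<forall>\<^sub>F y' in nhds y. gap x1 y' > 0 \<and> gap x2 y' > 0 \<and> y' \<in> V"
    using order_tendstoD(1)[OF gapc[OF xs(2), unfolded isCont_def tendsto_at_iff_tendsto_nhds]]
      order_tendstoD(1)[OF gapc[OF xs(3), unfolded isCont_def tendsto_at_iff_tendsto_nhds]]
    by (intro eventually_conj eventually_nhds_in_open open_V ys)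
  \<comment> \<open>The last clause says that the c-segment from \<open>y0\<close> to
    \<open>y'\<close>, as seen from \<open>x0\<close>, starts with a velocity not orthogonal to
    \<open>b\<close>. If \<open>y\<close> itself fails this, a small move of \<open>y\<close>
    repairs it, while the strict gaps survive by continuity.\<close>
  have "\<exists>y'. y' \<in> V \<and> gap x1 y' > 0 \<and> gap x2 y' > 0 \<and>
     (\<exists>N. (\<forall>w. N *v (H x0 y0 *v w) = w \<and> H x0 y0 *v (N *v w) = w) \<and> b \<bullet> (N *v (Dx U V c x0 y' - Dx U V c x0 y0)) \<noteq> 0)"
  proof -
    have "inj ((*v) (H x0 y0))"
    proof (rule injI)
      fix u w assume "H x0 y0 *v u = H x0 y0 *v w"
      then have "H x0 y0 *v (u - w) = 0" by (simp add: matrix_vector_mult_diff_distrib)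
      then show "u = w" using H_inj[OF xs(1) ys(1)] by force
    qed
    then have "invertible (H x0 y0)" using matrix_left_invertible_injective invertible_left_inverse by blast
    then obtain N where "N ** H x0 y0 = mat 1" "H x0 y0 ** N = mat 1" by (auto simp: invertible_def)
    then have N: "N *v (H x0 y0 *v w) = w" "H x0 y0 *v (N *v w) = w" for w by (simp_all add: matrix_vector_mul_assoc)
    obtain e where e: "e > 0" "\<And>y'. dist y' y < e \<Longrightarrow> gap x1 y' > 0 \<and> gap x2 y' > 0 \<and> y' \<in> V"
      using ev unfolding eventually_nhds_metric by auto
    show ?thesis
    proof (cases "b \<bullet> (N *v (Dx U V c x0 y - Dx U V c x0 y0)) = 0")
      case False
      then show ?thesis using e N ys by (intro exI[of _ y] conjI exI[of _ N]) auto
    next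
      case True
      \<comment> \<open>Moving along this line by t adds t H b to the gradient difference, and
        \<open>N\<close> turns this into t b. The inner product that vanished at \<open>y\<close>
        thus becomes t |b|^2.\<close>
      define \<eta> where "\<eta> = - (H x0 y0 *v b)"
      define p where "p = - Dx U V c x0 y"
      define T where "T = {t. p + t *\<^sub>R \<eta> \<in> V_at U V c x0}"
      have yc: "open T \<and> (\<exists>z z' z''. \<forall>t\<in>T. z t \<in> V \<and> - Dx U V c x0 (z t) = p + t *\<^sub>R \<eta> \<and>
        (z has_vector_derivative z' t) (at t) \<and> (z' has_vector_derivative z'' t) (at t) \<and> (- H x0 (z t)) *v z' t = \<eta> \<and>
        (\<exists>e>0. \<exists>C. \<forall>s. \<bar>s - t\<bar> < e \<longrightarrow> s \<in> T \<and> norm (z' s) \<le> C \<and> norm (z'' s) \<le> C))"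
        unfolding T_def by (rule y_curve[OF xs(1)])
      then obtain z z' z'' where z: "\<forall>t\<in>T. z t \<in> V \<and> - Dx U V c x0 (z t) = p + t *\<^sub>R \<eta> \<and>
        (z has_vector_derivative z' t) (at t) \<and> (z' has_vector_derivative z'' t) (at t) \<and> (- H x0 (z t)) *v z' t = \<eta> \<and>
        (\<exists>e>0. \<exists>C. \<forall>s. \<bar>s - t\<bar> < e \<longrightarrow> s \<in> T \<and> norm (z' s) \<le> C \<and> norm (z'' s) \<le> C)"
        by (elim exE conjE) (rule that)
      have T0: "0 \<in> T" using ys by (auto simp: T_def p_def V_at_def)
      have z0: "z 0 = y"
        by (rule Dx_inj[OF U_closure[OF xs(1)]]) (use bspec[OF z T0] ys in \<open>auto simp: p_def intro: V_closure\<close>)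
      have "isCont z 0" using bspec[OF z T0] has_vector_derivative_continuous by blast
      then have "(z \<longlongrightarrow> z 0) (nhds 0)" unfolding isCont_def tendsto_at_iff_tendsto_nhds .
      then have "(z \<longlongrightarrow> y) (nhds 0)" unfolding z0 .
      from tendstoD[OF this e(1)] have "\<forall>\<^sub>F t in nhds 0. dist (z t) y < e" .
      moreover have "\<forall>\<^sub>F t in nhds 0. t \<in> T" using yc T0 by (intro eventually_nhds_in_open) auto
      ultimately have "\<forall>\<^sub>F t in nhds 0. dist (z t) y < e \<and> t \<in> T" by (rule eventually_conj)
      then obtain d where d: "d > 0" "\<And>t. dist t 0 < d \<Longrightarrow> dist (z t) y < e \<and> t \<in> T"
        unfolding eventually_nhds_metric by auto
      define t where "t = d / 2"
      have t: "t > 0" "dist (z t) y < e" "t \<in> T" using d(1) d(2)[of t] by (auto simp: t_def)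
      have "- Dx U V c x0 (z t) = p + t *\<^sub>R \<eta>" using bspec[OF z t(3)] by blast
      then have "Dx U V c x0 (z t) = - (p + t *\<^sub>R \<eta>)" by (metis add.inverse_inverse)
      then have "Dx U V c x0 (z t) - Dx U V c x0 y0 = (Dx U V c x0 y - Dx U V c x0 y0) + t *\<^sub>R (H x0 y0 *v b)"
        by (simp add: p_def \<eta>_def)
      then have "N *v (Dx U V c x0 (z t) - Dx U V c x0 y0) = N *v (Dx U V c x0 y - Dx U V c x0 y0) + t *\<^sub>R b"
        by (simp only: matrix_vector_right_distrib matrix_vector_mult_scaleR N)
      then have "b \<bullet> (N *v (Dx U V c x0 (z t) - Dx U V c x0 y0)) = t * (b \<bullet> b)"
        using True by (simp add: inner_add_right)
      then have "b \<bullet> (N *v (Dx U V c x0 (z t) - Dx U V c x0 y0)) \<noteq> 0" using t(1) b0 by simp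
      then show ?thesis using e(2)[OF t(2)] N by (intro exI[of _ "z t"] conjI exI[of _ N]) auto
    qed
  qed
  then obtain y' N where y': "y' \<in> V" "gap x1 y' > 0" "gap x2 y' > 0"
    and N: "\<forall>w. N *v (H x0 y0 *v w) = w \<and> H x0 y0 *v (N *v w) = w"
    and \<kappa>: "b \<bullet> (N *v (Dx U V c x0 y' - Dx U V c x0 y0)) \<noteq> 0" by blast
  define p where "p = - Dx U V c x0 y0"
  define \<eta> where "\<eta> = - Dx U V c x0 y' - p"
  define T where "T = {t. p + t *\<^sub>R \<eta> \<in> V_at U V c x0}"
  have yc: "open T \<and> (\<exists>z z' z''. \<forall>t\<in>T. z t \<in> V \<and> - Dx U V c x0 (z t) = p + t *\<^sub>R \<eta> \<and>
    (z has_vector_derivative z' t) (at t) \<and> (z' has_vector_derivative z'' t) (at t) \<and> (- H x0 (z t)) *v z' t = \<eta> \<and>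
    (\<exists>e>0. \<exists>C. \<forall>s. \<bar>s - t\<bar> < e \<longrightarrow> s \<in> T \<and> norm (z' s) \<le> C \<and> norm (z'' s) \<le> C))"
    unfolding T_def by (rule y_curve[OF xs(1)])
  then obtain z z' z'' where z: "\<forall>t\<in>T. z t \<in> V \<and> - Dx U V c x0 (z t) = p + t *\<^sub>R \<eta> \<and>
    (z has_vector_derivative z' t) (at t) \<and> (z' has_vector_derivative z'' t) (at t) \<and> (- H x0 (z t)) *v z' t = \<eta> \<and>
    (\<exists>e>0. \<exists>C. \<forall>s. \<bar>s - t\<bar> < e \<longrightarrow> s \<in> T \<and> norm (z' s) \<le> C \<and> norm (z'' s) \<le> C)"
    by (elim exE conjE) (rule that)
  have I: "s \<in> T" if "s \<in> {0..1}" for s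
  proof -
    have cv: "convex (V_at U V c x0)" using B2 U_closure[OF xs(1)] V_closure[OF ys(1)] by (simp add: B2_def)
    have "p \<in> V_at U V c x0" "p + \<eta> \<in> V_at U V c x0" using ys y' by (auto simp: p_def \<eta>_def V_at_def)
    from convexD[OF cv this, of "1 - s" s] that show ?thesis by (simp add: T_def algebra_simps)
  qed
  have T0: "0 \<in> T" using I by simp
  have z0: "z 0 = y0"
    by (rule Dx_inj[OF U_closure[OF xs(1)]]) (use bspec[OF z T0] ys in \<open>auto simp: p_def intro: V_closure\<close>)
  have z'0: "z' 0 = N *v (Dx U V c x0 y' - Dx U V c x0 y0)"
  proof -
    have "(- H x0 y0) *v z' 0 = \<eta>" using bspec[OF z T0] z0 by simp
    then have "H x0 y0 *v z' 0 = - \<eta>" by (simp add: minus_mult_vec) (metis add.inverse_inverse)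
    also have "- \<eta> = Dx U V c x0 y' - Dx U V c x0 y0" by (simp add: \<eta>_def p_def)
    finally show ?thesis using N by metis
  qed
  \<comment> \<open>A positive gap means that c(x0, .) - c(x, .) is smaller at the end
    \<open>y'\<close> of the y-curve than at its start \<open>y0\<close>. By the maximum principle
    it never exceeds the initial value, so its initial derivative is not positive.\<close>
  have sign: "(Dy U V c x0 y0 - Dy U V c x y0) \<bullet> z' 0 \<le> 0" if x: "x \<in> U" "gap x y' > 0" for x
  proof (rule ccontr)
    assume "\<not> ?thesis"
    then have pos: "(Dy U V c x0 y0 - Dy U V c x y0) \<bullet> z' 0 > 0" by simp
    define f where "f = (\<lambda>t. F (x0, z t) - F (x, z t))"
    have dz: "(z has_vector_derivative z' 0) (at 0)" "z 0 \<in> V" using bspec[OF z T0] by blast+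
    have "(f has_real_derivative dd (0, z' 0) F (x0, z 0) - dd (0, z' 0) F (x, z 0)) (at 0)"
      unfolding f_def by (intro DERIV_diff along_y(1)[OF C2 _ dz(2) dz(1) has_vector_derivative_const refl] xs x)
    moreover have "dd (0, z' 0) F (x0, z 0) - dd (0, z' 0) F (x, z 0) = (Dy U V c x0 y0 - Dy U V c x y0) \<bullet> z' 0"
      using Dy_inner[OF xs(1) ys(1)] Dy_inner[OF x(1) ys(1)] z0 by (simp add: inner_diff_left)
    ultimately have "(f has_real_derivative (Dy U V c x0 y0 - Dy U V c x y0) \<bullet> z' 0) (at 0)" by simp
    from DERIV_pos_inc_right[OF this pos] obtain d where d: "d > 0" "\<And>h. h > 0 \<Longrightarrow> h < d \<Longrightarrow> f 0 < f (0 + h)" by blast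
    define t where "t = min (d / 2) 1"
    have t: "t > 0" "t < d" "t \<in> {0..1}" using d(1) by (auto simp: t_def)
    have zt: "z t \<in> V" "- Dx U V c x0 (z t) = p + t *\<^sub>R \<eta>" using bspec[OF z I[OF t(3)]] by blast+
    have "Dx U V c x0 (z t) = - (p + t *\<^sub>R \<eta>)" using zt(2) by (metis add.inverse_inverse)
    also have "\<dots> = (1 - t) *\<^sub>R Dx U V c x0 y0 + t *\<^sub>R Dx U V c x0 y'" by (simp add: p_def \<eta>_def algebra_simps)
    finally have "Dx U V c x0 (z t) \<in> closed_segment (Dx U V c x0 y0) (Dx U V c x0 y')"
      using t(3) by (auto simp: closed_segment_def)
    from max_principle_interior[OF xs(1) x(1) zt(1) ys(1) y'(1) this]
    have "f t \<le> max (f 0) (c x0 y' - c x y')" unfolding f_def F_pair z0 .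
    moreover have "c x0 y' - c x y' < f 0" using x(2) unfolding gap_def f_def F_pair z0 by simp
    ultimately show False using d(2)[OF t(1,2)] by simp
  qed
  have e1: "Dy U V c x0 y0 - Dy U V c x1 y0 = \<theta> *\<^sub>R b" using arg_cong[OF d10, of uminus] by simp
  have e2: "Dy U V c x0 y0 - Dy U V c x2 y0 = - ((1 - \<theta>) *\<^sub>R b)" using arg_cong[OF d20, of uminus] by simp
  have "\<theta> * (b \<bullet> z' 0) \<le> 0" using sign[OF xs(2) y'(2)] unfolding e1 by simp
  moreover have "0 \<le> (1 - \<theta>) * (b \<bullet> z' 0)" using sign[OF xs(3) y'(3)] unfolding e2 by simp
  ultimately have "b \<bullet> z' 0 = 0" using \<theta> \<theta>01 by (auto simp: mult_le_0_iff zero_le_mult_iff)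
  then show False using \<kappa> z'0 by simp
qed

end

section \<open>Extension to the closure\<close>

lemma tendsto_matrix_vector_mult:
  fixes A :: "'b \<Rightarrow> real^'n^'m"
  assumes "(A \<longlongrightarrow> A0) G" "(w \<longlongrightarrow> w0) G" shows "((\<lambda>t. A t *v w t) \<longlongrightarrow> A0 *v w0) G"
  unfolding matrix_vector_mult_def by (intro tendsto_intros assms)

lemma continuous_on_matrix_vector_mult:
  fixes A :: "'b::topological_space \<Rightarrow> real^'n^'m"
  assumes "continuous_on S A" "continuous_on S w" shows "continuous_on S (\<lambda>t. A t *v w t)"
  using assms unfolding continuous_on_def by (blast intro: tendsto_matrix_vector_mult)

lemma closure_ext_eq:
  fixes f :: "'a::metric_space \<Rightarrow> 'b::t2_space"
  assumes g: "continuous_on (closure S) g" "\<And>x. x \<in> S \<Longrightarrow> g x = f x" and p: "p \<in> closure S"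
  shows "closure_ext S f p = g p"
proof (cases "p \<in> S")
  case True
  then show ?thesis by (simp add: closure_ext_def g(2))
next
  case False
  have "(g \<longlongrightarrow> g p) (at p within closure S)" using g(1) p by (simp add: continuous_on_def)
  then have "(g \<longlongrightarrow> g p) (at p within S)" by (rule tendsto_within_subset[OF _ closure_subset])
  moreover have "\<forall>\<^sub>F x in at p within S. g x = f x" by (simp add: eventually_at_filter g(2))
  ultimately have "(f \<longlongrightarrow> g p) (at p within S)" by (rule Lim_transform_eventually)
  moreover have "\<not> trivial_limit (at p within S)"
    using False p by (simp add: trivial_limit_within islimpt_in_closure)
  ultimately show ?thesis using False by (simp add: closure_ext_def tendsto_Lim)
qed

lemma closure_ext_continuous:
  fixes f :: "'a::metric_space \<Rightarrow> 'b::t2_space"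
  assumes g: "continuous_on (closure S) g" "\<And>x. x \<in> S \<Longrightarrow> g x = f x"
  shows "continuous_on (closure S) (closure_ext S f)"
  using g(1) closure_ext_eq[OF g] by (simp cong: continuous_on_cong)

lemma closure_ext_vec_continuous:
  fixes f :: "'a::euclidean_space \<Rightarrow> real^'n"
  assumes "\<And>i. Ck_closure 0 S (\<lambda>x. f x $ i)"
  shows "continuous_on (closure S) (closure_ext S f)"
proof -
  have "\<forall>i. \<exists>g. continuous_on (closure S) g \<and> (\<forall>x\<in>S. g x = f x $ i)" using assms by simp
  then obtain g where g: "\<And>i. continuous_on (closure S) (g i)" "\<And>i x. x \<in> S \<Longrightarrow> g i x = f x $ i" by metis
  show ?thesis
    by (rule closure_ext_continuous[of _ "\<lambda>x. \<chi> i. g i x"]) (auto intro!: continuous_on_vec_lambda g simp: g vec_eq_iff)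
qed

lemma closure_ext_matrix_continuous:
  fixes f :: "'a::euclidean_space \<Rightarrow> real^'n^'m"
  assumes "\<And>i j. Ck_closure 0 S (\<lambda>x. f x $ i $ j)"
  shows "continuous_on (closure S) (closure_ext S f)"
proof -
  have "\<forall>i j. \<exists>g. continuous_on (closure S) g \<and> (\<forall>x\<in>S. g x = f x $ i $ j)" using assms by simp
  then obtain g where g: "\<And>i j. continuous_on (closure S) (g i j)" "\<And>i j x. x \<in> S \<Longrightarrow> g i j x = f x $ i $ j" by metis
  show ?thesis
    by (rule closure_ext_continuous[of _ "\<lambda>x. \<chi> i j. g i j x"]) (auto intro!: continuous_on_vec_lambda g simp: g vec_eq_iff)
qed

lemma closure_image_compact:
  fixes f :: "'a::euclidean_space \<Rightarrow> 'b::euclidean_space"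
  assumes "bounded S" "continuous_on (closure S) f" shows "closure (f ` S) = f ` closure S"
proof
  have "compact (f ` closure S)" using assms by (intro compact_continuous_image) (auto simp: compact_closure)
  then show "closure (f ` S) \<subseteq> f ` closure S"
    by (intro closure_minimal compact_imp_closed image_mono closure_subset)
  show "f ` closure S \<subseteq> closure (f ` S)" by (rule image_closure_subset[OF assms(2)]) (auto simp: closure_subset)
qed

text \<open>The derivative of the inverse is bounded on the compact range, and because the range is
  convex the mean value inequality turns this into a Lipschitz bound; the domain itself may be far
  from convex.\<close>

lemma diffeo_inverse_lipschitz:
  fixes f :: "'a::euclidean_space \<Rightarrow> 'b::euclidean_space"
  assumes "diffeo_onto_range S f" "compact S" "convex (f ` S)" "continuous_on S f"
  obtains L where "L > 0" "\<And>x y. x \<in> S \<Longrightarrow> y \<in> S \<Longrightarrow> norm (x - y) \<le> L * norm (f x - f y)"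
proof -
  let ?g = "inv_into S f"
  have inj: "inj_on f S" using assms(1) by (simp add: diffeo_onto_range_def)
  obtain g' :: "'b \<Rightarrow> ('b \<Rightarrow>\<^sub>L 'a)" where g': "continuous_on (f ` S) g'"
    "\<And>q. q \<in> f ` S \<Longrightarrow> (?g has_derivative blinfun_apply (g' q)) (at q within f ` S)"
    using assms(1) unfolding diffeo_onto_range_def C1_on_def by blast
  have "compact (g' ` f ` S)" by (intro compact_continuous_image g' assms)
  then obtain B where B: "\<And>q. q \<in> f ` S \<Longrightarrow> norm (g' q) \<le> B"
    using compact_imp_bounded bounded_iff by (metis image_eqI)
  have "norm (x - y) \<le> max B 1 * norm (f x - f y)" if "x \<in> S" "y \<in> S" for x y
  proof -
    have "norm (?g (f x) - ?g (f y)) \<le> max B 1 * norm (f x - f y)"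
      by (rule differentiable_bound[OF assms(3) g'(2)]) (use that B in \<open>auto simp: norm_blinfun.rep_eq[symmetric] intro: order_trans[OF B]\<close>)
    then show ?thesis using that inj by simp
  qed
  then show thesis by (intro that[of "max B 1"]) auto
qed

text \<open>The uniform lower bound on |A w| replaces continuity of matrix inversion: |p t - p0| is
  at most |g t - A t p0| / \<kappa>, which tends to zero.\<close>

lemma tendsto_linear_solution:
  fixes A :: "'b \<Rightarrow> real^'n^'n"
  assumes \<kappa>: "\<kappa> > 0" "\<forall>\<^sub>F t in G. \<forall>w. \<kappa> * norm w \<le> norm (A t *v w)" and p: "\<forall>\<^sub>F t in G. A t *v p t = g t" "A0 *v p0 = g0"
    and lim: "(A \<longlongrightarrow> A0) G" "(g \<longlongrightarrow> g0) G"
  shows "(p \<longlongrightarrow> p0) G"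
proof -
  have "((\<lambda>t. norm (g t - A t *v p0) / \<kappa>) \<longlongrightarrow> norm (g0 - A0 *v p0) / \<kappa>) G"
    using \<kappa>(1) by (intro tendsto_intros lim tendsto_matrix_vector_mult) auto
  then have "((\<lambda>t. norm (g t - A t *v p0) / \<kappa>) \<longlongrightarrow> 0) G" using p(2) by simp
  moreover have "\<forall>\<^sub>F t in G. norm (p t - p0) \<le> norm (g t - A t *v p0) / \<kappa>"
    using \<kappa>(2) p(1)
  proof eventually_elim
    case (elim t)
    have "\<kappa> * norm (p t - p0) \<le> norm (A t *v (p t - p0))" using elim(1) by blast
    then show ?case using \<kappa>(1) elim(2) by (simp add: matrix_vector_mult_diff_distrib field_simps)
  qed
  ultimately have "((\<lambda>t. p t - p0) \<longlongrightarrow> 0) G" by (rule Lim_null_comparison[rotated])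
  then show ?thesis by (simp add: LIM_zero_iff)
qed

context cost_domain
begin

section \<open>Derivatives on the closure and uniform nondegeneracy\<close>

lemma closure_UV: "closure (U \<times> V) = closure U \<times> closure V" by (rule closure_Times)

lemma compact_U: "compact (closure U)" and compact_V: "compact (closure V)"
  by (simp_all add: compact_closure bounded_U bounded_V)

lemma grad_x_component: "(x, y) \<in> U \<times> V \<Longrightarrow> grad (\<lambda>x'. c x' y) x $ i = dd (axis i 1, 0) F (x, y)"
  using Dx_inner[of x y "axis i 1"] by (simp add: Dx_def closure_ext_def inner_axis)

lemma grad_y_component: "(x, y) \<in> U \<times> V \<Longrightarrow> grad (\<lambda>y'. c x y') y $ i = dd (0, axis i 1) F (x, y)"
  using Dy_inner[of x y "axis i 1"] by (simp add: Dy_def closure_ext_def inner_axis)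

lemma Dx_cont: "continuous_on (closure U \<times> closure V) (\<lambda>(x, y). Dx U V c x y)"
proof -
  have "continuous_on (closure (U \<times> V)) (closure_ext (U \<times> V) (\<lambda>(x, y). grad (\<lambda>x'. c x' y) x))"
  proof (rule closure_ext_vec_continuous)
    fix i
    show "Ck_closure 0 (U \<times> V) (\<lambda>z. (case z of (x, y) \<Rightarrow> grad (\<lambda>x'. c x' y) x) $ i)"
      by (rule Ck_closure_cong[OF open_UV _ Ck_closure_le[OF C3_dd[of "(axis i 1, 0)"]]]) (auto simp: grad_x_component)
  qed
  then show ?thesis unfolding closure_UV by (rule continuous_on_eq) (auto simp: Dx_def)
qed

lemma Dy_cont: "continuous_on (closure U \<times> closure V) (\<lambda>(x, y). Dy U V c x y)"
proof -
  have "continuous_on (closure (U \<times> V)) (closure_ext (U \<times> V) (\<lambda>(x, y). grad (\<lambda>y'. c x y') y))"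
  proof (rule closure_ext_vec_continuous)
    fix i
    show "Ck_closure 0 (U \<times> V) (\<lambda>z. (case z of (x, y) \<Rightarrow> grad (\<lambda>y'. c x y') y) $ i)"
      by (rule Ck_closure_cong[OF open_UV _ Ck_closure_le[OF C3_dd[of "(0, axis i 1)"]]]) (auto simp: grad_y_component)
  qed
  then show ?thesis unfolding closure_UV by (rule continuous_on_eq) (auto simp: Dy_def)
qed

definition Hb :: "real^'n \<Rightarrow> real^'n \<Rightarrow> real^'n^'n" where
  "Hb x y = closure_ext (U \<times> V) (\<lambda>(x, y). H x y) (x, y)"

lemma Hb_eq: "x \<in> U \<Longrightarrow> y \<in> V \<Longrightarrow> Hb x y = H x y" by (simp add: Hb_def closure_ext_def)

lemma Hb_cont: "continuous_on (closure U \<times> closure V) (\<lambda>(x, y). Hb x y)"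
proof -
  have "continuous_on (closure (U \<times> V)) (closure_ext (U \<times> V) (\<lambda>(x, y). H x y))"
  proof (rule closure_ext_matrix_continuous)
    fix i j
    show "Ck_closure 0 (U \<times> V) (\<lambda>z. (case z of (x, y) \<Rightarrow> H x y) $ i $ j)"
      by (rule Ck_closure_cong[OF open_UV _ Ck_closure_le[OF C2_dd_dd[of "(axis i 1, 0)" "(0, axis j 1)"]]]) (auto simp: H_entry)
  qed
  then show ?thesis unfolding closure_UV by (rule continuous_on_eq) (auto simp: Hb_def)
qed

lemma closure_tendsto:
  assumes cont: "continuous_on (closure U \<times> closure V) (\<lambda>(x, y). f x y)"
    and lim: "(x \<longlongrightarrow> x0) G" "(y \<longlongrightarrow> y0) G" and x0: "x0 \<in> closure U" "y0 \<in> closure V"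
    and ev: "\<forall>\<^sub>F t in G. x t \<in> closure U \<and> y t \<in> closure V"
  shows "((\<lambda>t. f (x t) (y t)) \<longlongrightarrow> f x0 y0) G"
  using continuous_on_tendsto_compose[OF cont tendsto_Pair[OF lim]] x0 ev by simp

lemma c_cont: "continuous_on (closure U \<times> closure V) (\<lambda>(x, y). c x y)"
  using cont_c by (simp add: F_def)

lemma cont_section_x:
  assumes "continuous_on (closure U \<times> closure V) (\<lambda>(x, y). f x y)" "y \<in> closure V" shows "continuous_on (closure U) (\<lambda>x. f x y)"
  unfolding continuous_on_def by (intro ballI closure_tendsto[OF assms(1)] tendsto_ident_at tendsto_const assms(2))
    (auto simp: eventually_at_filter assms(2))

lemma cont_section_y:
  assumes "continuous_on (closure U \<times> closure V) (\<lambda>(x, y). f x y)" "x \<in> closure U" shows "continuous_on (closure V) (\<lambda>y. f x y)"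
  unfolding continuous_on_def by (intro ballI closure_tendsto[OF assms(1)] tendsto_ident_at tendsto_const assms(2))
    (auto simp: eventually_at_filter assms(2))

lemma range_convex_y: assumes x: "x \<in> closure U" shows "convex ((\<lambda>y. - Dx U V c x y) ` closure V)"
proof -
  have "closure (V_at U V c x) = (\<lambda>y. - Dx U V c x y) ` closure V"
    unfolding V_at_def by (intro closure_image_compact bounded_V continuous_on_minus cont_section_y Dx_cont x)
  moreover obtain y where "y \<in> V" using ne by auto
  then have "convex (V_at U V c x)" using B2 x V_closure by (auto simp: B2_def)
  ultimately show ?thesis using convex_closure by metis
qed

lemma U_at_convex: "y \<in> closure V \<Longrightarrow> convex (U_at U V c y)"
  and V_at_convex: "x \<in> closure U \<Longrightarrow> convex (V_at U V c x)"
proof -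
  obtain x0 y0 where "x0 \<in> U" "y0 \<in> V" using ne by auto
  then have "x0 \<in> closure U" "y0 \<in> closure V" by (simp_all add: U_closure V_closure)
  then show "y \<in> closure V \<Longrightarrow> convex (U_at U V c y)" "x \<in> closure U \<Longrightarrow> convex (V_at U V c x)"
    using B2 by (auto simp: B2_def)
qed

lemma Dx_inverse_lipschitz:
  assumes x: "x \<in> closure U"
  obtains L where "L > 0" "\<And>y y'. y \<in> closure V \<Longrightarrow> y' \<in> closure V \<Longrightarrow> norm (y - y') \<le> L * norm (Dx U V c x y - Dx U V c x y')"
proof -
  have "continuous_on (closure V) (\<lambda>y. - Dx U V c x y)" by (intro continuous_on_minus cont_section_y Dx_cont x)
  from diffeo_inverse_lipschitz[OF diffeo_y[OF x] compact_V range_convex_y[OF x] this]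
  obtain L where L: "L > 0" "\<And>y y'. y \<in> closure V \<Longrightarrow> y' \<in> closure V \<Longrightarrow> norm (y - y') \<le> L * norm (- Dx U V c x y - - Dx U V c x y')"
    by blast
  have "norm (- Dx U V c x y - - Dx U V c x y') = norm (Dx U V c x y - Dx U V c x y')" for y y'
    using norm_minus_commute[of "Dx U V c x y"] by simp
  with L show thesis by (intro that[of L]) auto
qed

text \<open>
  If this failed, the extended Hessian would annihilate a unit vector \<open>ws\<close> at some \<open>(xs, ys)\<close> of the closure, and
  short steps from points near \<open>ys\<close> in the direction \<open>ws\<close> would contradict that \<open>Dx xs\<close> has a Lipschitz inverse.
\<close>

lemma H_lower_bound: "\<exists>\<kappa>>0. \<forall>x\<in>U. \<forall>y\<in>V. \<forall>w. \<kappa> * norm w \<le> norm (H x y *v w)"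
proof (rule ccontr)
  assume neg: "\<not> ?thesis"
  have "\<exists>x y w. x \<in> U \<and> y \<in> V \<and> norm w = 1 \<and> norm (H x y *v w) < inverse (real (Suc k))" for k
  proof -
    obtain x y w where *: "x \<in> U" "y \<in> V" "norm (H x y *v w) < inverse (real (Suc k)) * norm w"
      using neg by (metis inverse_positive_iff_positive not_le of_nat_0_less_iff zero_less_Suc)
    have w0: "norm w > 0" using * by (metis mult_zero_right norm_ge_zero norm_zero not_less zero_less_norm_iff)
    have "norm (H x y *v (w /\<^sub>R norm w)) = norm (H x y *v w) / norm w"
      using w0 by (simp add: matrix_vector_mult_scaleR divide_inverse mult.commute)
    also have "\<dots> < inverse (real (Suc k))" using * w0 by (simp add: pos_divide_less_eq)
    finally show ?thesis using * w0 by (intro exI[of _ x] exI[of _ y] exI[of _ "w /\<^sub>R norm w"]) auto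
  qed
  then obtain x y w where s: "\<And>k. x k \<in> U" "\<And>k. y k \<in> V" "\<And>k. norm (w k) = 1" "\<And>k. norm (H (x k) (y k) *v w k) < inverse (real (Suc k))"
    by metis
  have "compact (closure U \<times> closure V \<times> sphere (0 :: real^'n) 1)" by (intro compact_Times compact_U compact_V compact_sphere)
  moreover have "(x k, y k, w k) \<in> closure U \<times> closure V \<times> sphere (0 :: real^'n) 1" for k
    using s U_closure V_closure by simp
  ultimately obtain r l where r: "strict_mono r" "l \<in> closure U \<times> closure V \<times> sphere (0 :: real^'n) 1"
    "((\<lambda>k. (x k, y k, w k)) \<circ> r) \<longlonglongrightarrow> l" by (rule convergent_subsequence_in_compact)
  obtain xs ys ws where l: "l = (xs, ys, ws)" by (cases l) auto
  have xs: "xs \<in> closure U" and ys: "ys \<in> closure V" and ws: "norm ws = 1" using r(2) by (auto simp: l)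
  have lim: "(\<lambda>k. x (r k)) \<longlonglongrightarrow> xs" "(\<lambda>k. y (r k)) \<longlonglongrightarrow> ys" "(\<lambda>k. w (r k)) \<longlonglongrightarrow> ws"
    using tendsto_fst[OF r(3)] tendsto_fst[OF tendsto_snd[OF r(3)]] tendsto_snd[OF tendsto_snd[OF r(3)]] by (simp_all add: l comp_def)
  have "(\<lambda>k. Hb (x (r k)) (y (r k)) *v w (r k)) \<longlonglongrightarrow> Hb xs ys *v ws"
    by (intro tendsto_matrix_vector_mult closure_tendsto[OF Hb_cont] lim xs ys) (simp add: s U_closure V_closure)
  moreover have "(\<lambda>k. Hb (x (r k)) (y (r k)) *v w (r k)) \<longlonglongrightarrow> 0"
  proof (rule Lim_null_comparison)
    have "(\<lambda>k. inverse (real (Suc k))) \<longlonglongrightarrow> 0" by (rule LIMSEQ_inverse_real_of_nat)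
    from LIMSEQ_subseq_LIMSEQ[OF this r(1)] show "(\<lambda>k. inverse (real (Suc (r k)))) \<longlonglongrightarrow> 0" by (simp add: comp_def)
    show "\<forall>\<^sub>F k in sequentially. norm (Hb (x (r k)) (y (r k)) *v w (r k)) \<le> inverse (real (Suc (r k)))"
      using s(4) by (intro always_eventually allI) (simp add: Hb_eq s less_imp_le)
  qed
  ultimately have zero: "Hb xs ys *v ws = 0" by (rule LIMSEQ_unique)
  obtain L where L: "L > 0" "\<And>y y'. y \<in> closure V \<Longrightarrow> y' \<in> closure V \<Longrightarrow> norm (y - y') \<le> L * norm (Dx U V c xs y - Dx U V c xs y')"
    by (rule Dx_inverse_lipschitz[OF xs]) blast
  \<comment> \<open>Half of what the Lipschitz constant allows: a step of length \<open>s\<close>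
    that changes the gradient by at most \<delta> s would give s \<le> L \<delta> s = s / 2.\<close>
  define \<delta> where "\<delta> = 1 / (2 * L)"
  have \<delta>: "\<delta> > 0" using L by (simp add: \<delta>_def)
  have "continuous_on (closure U \<times> closure V) (\<lambda>(x, y). Hb x y *v ws)"
    using continuous_on_matrix_vector_mult[OF Hb_cont continuous_on_const, of ws] by (simp add: case_prod_unfold)
  then obtain \<rho> where \<rho>: "\<rho> > 0" "\<And>z. z \<in> closure U \<times> closure V \<Longrightarrow> dist z (xs, ys) < \<rho> \<Longrightarrow> norm (Hb (fst z) (snd z) *v ws) < \<delta>"
    using xs ys \<delta> unfolding continuous_on_iff by (fastforce simp: zero dist_norm case_prod_unfold)
  \<comment> \<open>The limit \<open>ys\<close> may lie on the boundary, and V need not contain any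
    segment starting there. The short step therefore starts at an interior point close to
    \<open>ys\<close>, for which a whole segment in direction \<open>ws\<close> stays in V.\<close>
  obtain y' where y': "y' \<in> V" "dist y' ys < \<rho> / 4"
    using ys \<rho>(1) unfolding closure_approachable by (meson divide_pos_pos zero_less_numeral)
  obtain s0 where s0: "s0 > 0" "ball y' s0 \<subseteq> V" using open_V y' openE by blast
  define s where "s = min (s0 / 2) (\<rho> / 4)"
  have s': "s > 0" using s0 \<rho> by (simp add: s_def)
  have inV: "y' + \<tau> *\<^sub>R ws \<in> V" "dist (y' + \<tau> *\<^sub>R ws) ys < \<rho> / 2" if "0 \<le> \<tau>" "\<tau> \<le> s" for \<tau>
  proof -
    have "dist y' (y' + \<tau> *\<^sub>R ws) = \<tau>" using that ws by (simp add: dist_norm)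
    moreover have "\<tau> < s0" "\<tau> \<le> \<rho> / 4" using that s0(1) by (auto simp: s_def)
    ultimately show "y' + \<tau> *\<^sub>R ws \<in> V" "dist (y' + \<tau> *\<^sub>R ws) ys < \<rho> / 2"
      using s0(2) y'(2) dist_triangle[of "y' + \<tau> *\<^sub>R ws" ys y'] by (auto simp: dist_commute)
  qed
  have bound: "norm (Dx U V c x (y' + s *\<^sub>R ws) - Dx U V c x y') \<le> \<delta> * s" if x: "x \<in> U" "dist x xs < \<rho> / 4" for x
  proof -
    have der: "((\<lambda>\<tau>. - Dx U V c x (y' + \<tau> *\<^sub>R ws)) has_vector_derivative (- H x (y' + \<tau> *\<^sub>R ws)) *v ws) (at \<tau>)"
      if "0 \<le> \<tau>" "\<tau> \<le> s" for \<tau>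
    proof -
      have "((\<lambda>\<tau>. y' + \<tau> *\<^sub>R ws) has_derivative (\<lambda>h. h *\<^sub>R ws)) (at \<tau>)" by (auto intro!: derivative_eq_intros)
      from diff_chain_at[OF this Dx_derivative_y[OF x(1) inV(1)[OF that]]]
      show ?thesis by (simp add: has_vector_derivative_def comp_def matrix_vector_mult_scaleR)
    qed
    have "norm (- Dx U V c x (y' + s *\<^sub>R ws) - - Dx U V c x (y' + 0 *\<^sub>R ws)) \<le> \<delta> * s - \<delta> * 0"
    proof (rule differentiable_bound_general[OF s'])
      show "continuous_on {0..s} (\<lambda>\<tau>. - Dx U V c x (y' + \<tau> *\<^sub>R ws))"
        by (intro continuous_at_imp_continuous_on ballI has_vector_derivative_continuous[OF der]) auto
      show "continuous_on {0..s} (\<lambda>\<tau>. \<delta> * \<tau>)" by (intro continuous_intros)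
      fix \<tau> assume \<tau>: "0 < \<tau>" "\<tau> < s"
      show "((\<lambda>\<tau>. - Dx U V c x (y' + \<tau> *\<^sub>R ws)) has_vector_derivative (- H x (y' + \<tau> *\<^sub>R ws)) *v ws) (at \<tau>)"
        using der \<tau> by simp
      show "((\<lambda>\<tau>. \<delta> * \<tau>) has_vector_derivative \<delta>) (at \<tau>)"
        unfolding has_real_derivative_iff_has_vector_derivative[symmetric] by (auto intro!: derivative_eq_intros)
      have v: "y' + \<tau> *\<^sub>R ws \<in> V" "dist (y' + \<tau> *\<^sub>R ws) ys < \<rho> / 2" using inV \<tau> by auto
      have "dist (x, y' + \<tau> *\<^sub>R ws) (xs, ys) \<le> dist x xs + dist (y' + \<tau> *\<^sub>R ws) ys"
        by (simp add: dist_Pair_Pair sqrt_sum_squares_le_sum)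
      then have "dist (x, y' + \<tau> *\<^sub>R ws) (xs, ys) < \<rho>" using x v \<rho>(1) by simp
      then have "norm (Hb x (y' + \<tau> *\<^sub>R ws) *v ws) < \<delta>" using \<rho>(2)[of "(x, y' + \<tau> *\<^sub>R ws)"] x(1) v(1) U_closure V_closure by simp
      then show "norm ((- H x (y' + \<tau> *\<^sub>R ws)) *v ws) \<le> \<delta>" using x v by (simp add: Hb_eq minus_mult_vec)
    qed
    then show ?thesis by (simp add: norm_minus_commute)
  qed
  have yV: "y' + s *\<^sub>R ws \<in> closure V" "y' \<in> closure V" using inV(1)[of s] s' y' V_closure by auto
  have "(\<lambda>k. norm (Dx U V c (x (r k)) (y' + s *\<^sub>R ws) - Dx U V c (x (r k)) y')) \<longlonglongrightarrow> norm (Dx U V c xs (y' + s *\<^sub>R ws) - Dx U V c xs y')"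
    by (intro tendsto_norm tendsto_diff closure_tendsto[OF Dx_cont] lim tendsto_const xs yV) (auto simp: s U_closure yV)
  moreover have "\<forall>\<^sub>F k in sequentially. norm (Dx U V c (x (r k)) (y' + s *\<^sub>R ws) - Dx U V c (x (r k)) y') \<le> \<delta> * s"
  proof -
    have "\<forall>\<^sub>F k in sequentially. dist (x (r k)) xs < \<rho> / 4" using tendstoD[OF lim(1), of "\<rho> / 4"] \<rho>(1) by simp
    then show ?thesis by (rule eventually_mono) (rule bound[OF s(1)])
  qed
  ultimately have "norm (Dx U V c xs (y' + s *\<^sub>R ws) - Dx U V c xs y') \<le> \<delta> * s"
    by (rule tendsto_upperbound) simp
  then have "L * norm (Dx U V c xs (y' + s *\<^sub>R ws) - Dx U V c xs y') \<le> L * (\<delta> * s)" using L(1) by (intro mult_left_mono) auto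
  moreover have "norm (y' + s *\<^sub>R ws - y') \<le> L * norm (Dx U V c xs (y' + s *\<^sub>R ws) - Dx U V c xs y')" by (rule L(2)[OF yV])
  moreover have "norm (y' + s *\<^sub>R ws - y') = s" using ws s' by simp
  ultimately have "s \<le> L * (\<delta> * s)" by linarith
  also have "\<dots> = s / 2" using L(1) by (simp add: \<delta>_def)
  finally show False using s' by simp
qed

lemma Hb_lower_bound:
  assumes "\<forall>x\<in>U. \<forall>y\<in>V. \<forall>w. \<kappa> * norm w \<le> norm (H x y *v w)" and x: "x \<in> closure U" and y: "y \<in> closure V"
  shows "\<kappa> * norm w \<le> norm (Hb x y *v w)"
proof -
  have "\<kappa> * norm w \<le> norm (case (x, y) of (x, y) \<Rightarrow> Hb x y *v w)"
  proof (rule continuous_ge_on_closure[where f = "\<lambda>z. norm (case z of (x, y) \<Rightarrow> Hb x y *v w)" and S = "U \<times> V"])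
    show "continuous_on (closure (U \<times> V)) (\<lambda>z. norm (case z of (x, y) \<Rightarrow> Hb x y *v w))"
      unfolding closure_UV using continuous_on_norm[OF continuous_on_matrix_vector_mult[OF Hb_cont continuous_on_const, of w]]
      by (simp add: case_prod_unfold)
    show "(x, y) \<in> closure (U \<times> V)" using x y by (simp add: closure_UV)
    show "\<kappa> * norm w \<le> norm (case z of (x, y) \<Rightarrow> Hb x y *v w)" if "z \<in> U \<times> V" for z
      using that assms(1) by (auto simp: Hb_eq)
  qed
  then show ?thesis by simp
qed

lemma Hb_invertible: assumes "x \<in> closure U" "y \<in> closure V" shows "invertible (Hb x y)"
proof -
  obtain \<kappa> where \<kappa>: "\<kappa> > 0" "\<forall>x\<in>U. \<forall>y\<in>V. \<forall>w. \<kappa> * norm w \<le> norm (H x y *v w)" using H_lower_bound by blast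
  have "inj ((*v) (Hb x y))"
  proof (rule injI)
    fix u w assume "Hb x y *v u = Hb x y *v w"
    then have "Hb x y *v (u - w) = 0" by (simp add: matrix_vector_mult_diff_distrib)
    then have "\<kappa> * norm (u - w) \<le> 0" using Hb_lower_bound[OF \<kappa>(2) assms, of "u - w"] by simp
    then show "u = w" using \<kappa>(1) by (simp add: mult_le_0_iff)
  qed
  then show ?thesis using matrix_left_invertible_injective invertible_left_inverse by blast
qed

lemma transpose_lower_bound:
  fixes A :: "real^'n^'n"
  assumes \<kappa>: "\<kappa> > 0" "\<And>w. \<kappa> * norm w \<le> norm (A *v w)" shows "\<kappa> * norm v \<le> norm (transpose A *v v)"
proof -
  have "inj ((*v) A)"
  proof (rule injI)
    fix u w assume "A *v u = A *v w"
    then have "A *v (u - w) = 0" by (simp add: matrix_vector_mult_diff_distrib)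
    then have "\<kappa> * norm (u - w) \<le> 0" using \<kappa>(2)[of "u - w"] by simp
    then show "u = w" using \<kappa>(1) by (simp add: mult_le_0_iff)
  qed
  then have "surj ((*v) A)" by (metis linear_injective_imp_surjective matrix_vector_mul_linear)
  then obtain w where w: "v = A *v w" by (metis surjD)
  have "norm v * norm v = v \<bullet> (A *v w)" using w by (simp add: power2_norm_eq_inner flip: power2_eq_square)
  also have "\<dots> = (transpose A *v v) \<bullet> w" by (simp add: dot_lmul_matrix)
  also have "\<dots> \<le> norm (transpose A *v v) * norm w" by (rule norm_cauchy_schwarz)
  finally have "\<kappa> * (norm v * norm v) \<le> norm (transpose A *v v) * (\<kappa> * norm w)" using \<kappa>(1) by (simp add: mult_left_mono)
  also have "\<dots> \<le> norm (transpose A *v v) * norm v" using \<kappa>(2)[of w] w by (intro mult_left_mono) auto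
  finally have "norm v * (\<kappa> * norm v) \<le> norm v * norm (transpose A *v v)" by (simp add: mult.commute mult.left_commute)
  then show ?thesis by (cases "v = 0") auto
qed

text \<open>Points \<open>ys k\<close> of V approach \<open>y\<close>, and by uniform continuity of
  \<open>g\<close> on the compact closure the derivatives converge uniformly near \<open>x\<close>,
  so the limit may be differentiated.\<close>

lemma closure_derivative_x:
  assumes f: "continuous_on (closure U \<times> closure V) (\<lambda>(x, y). f x y)" and g: "continuous_on (closure U \<times> closure V) (\<lambda>(x, y). g x y :: real^'n)"
    and der: "\<forall>x\<in>U. \<forall>y\<in>V. ((\<lambda>x. f x y :: real) has_derivative (\<lambda>v. g x y \<bullet> v)) (at x)"
    and x: "x \<in> U" and y: "y \<in> closure V"
  shows "((\<lambda>x. f x y) has_derivative (\<lambda>v. g x y \<bullet> v)) (at x)"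
proof -
  obtain r where r: "r > 0" "ball x r \<subseteq> U" using open_U x openE by blast
  obtain ys where ys: "\<And>k. ys k \<in> V" "ys \<longlonglongrightarrow> y" using y unfolding closure_sequential by blast
  have uc: "uniformly_continuous_on (closure U \<times> closure V) (\<lambda>(x, y). g x y)"
    by (intro compact_uniformly_continuous g compact_Times compact_U compact_V)
  have lim: "(\<lambda>k. f x' (ys k)) \<longlonglongrightarrow> f x' y" if "x' \<in> ball x r" for x'
    by (rule closure_tendsto[OF f tendsto_const ys(2)]) (use that r y ys U_closure V_closure in auto)
  have "\<exists>h. \<forall>x'\<in>ball x r. (\<lambda>k. f x' (ys k)) \<longlonglongrightarrow> h x' \<and> (h has_derivative (\<lambda>v. g x' y \<bullet> v)) (at x' within ball x r)"
  proof (rule has_derivative_sequence[of "ball x r" "\<lambda>k x. f x (ys k)" "\<lambda>k x v. g x (ys k) \<bullet> v" "\<lambda>x v. g x y \<bullet> v" x])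
    show "((\<lambda>x. f x (ys k)) has_derivative (\<lambda>v. g x' (ys k) \<bullet> v)) (at x' within ball x r)" if "x' \<in> ball x r" for k x'
      using der that r ys by (blast intro: has_derivative_at_withinI)
    show "(\<lambda>k. f x (ys k)) \<longlonglongrightarrow> f x y" using lim r(1) by simp
    fix e :: real assume e: "e > 0"
    then obtain d where d: "d > 0" "\<And>z z'. z \<in> closure U \<times> closure V \<Longrightarrow> z' \<in> closure U \<times> closure V \<Longrightarrow> dist z' z < d \<Longrightarrow>
      dist ((\<lambda>(x, y). g x y) z') ((\<lambda>(x, y). g x y) z) < e" using uc unfolding uniformly_continuous_on_def by meson
    have "\<forall>\<^sub>F k in sequentially. dist (ys k) y < d" using tendstoD[OF ys(2) d(1)] .
    then show "\<forall>\<^sub>F k in sequentially. \<forall>x'\<in>ball x r. \<forall>v. norm (g x' (ys k) \<bullet> v - g x' y \<bullet> v) \<le> e * norm v"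
    proof (rule eventually_mono, intro ballI allI)
      fix k x' v assume k: "dist (ys k) y < d" and x': "x' \<in> ball x r"
      have "x' \<in> closure U" using x' r U_closure by blast
      then have "norm (g x' (ys k) - g x' y) < e" using d(2)[of "(x', y)" "(x', ys k)"] k y ys V_closure by (simp add: dist_norm dist_Pair_Pair)
      then show "norm (g x' (ys k) \<bullet> v - g x' y \<bullet> v) \<le> e * norm v"
        using Cauchy_Schwarz_ineq2[of "g x' (ys k) - g x' y" v] by (simp add: inner_diff_left) (meson less_imp_le mult_right_mono norm_ge_zero order_trans)
    qed
  qed (use r in auto)
  then obtain h where h: "\<And>x'. x' \<in> ball x r \<Longrightarrow> (\<lambda>k. f x' (ys k)) \<longlonglongrightarrow> h x'" "(h has_derivative (\<lambda>v. g x y \<bullet> v)) (at x within ball x r)"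
    using r(1) by (metis centre_in_ball)
  have eq: "h x' = f x' y" if "x' \<in> ball x r" for x' using LIMSEQ_unique[OF h(1) lim] that by blast
  have "(h has_derivative (\<lambda>v. g x y \<bullet> v)) (at x)" using h(2) at_within_open[of x "ball x r"] r(1) by simp
  then show ?thesis by (rule has_derivative_transform_within_open[of _ _ _ _ "ball x r"]) (use r eq in auto)
qed

lemma c_derivative_x:
  assumes "x \<in> U" "y \<in> closure V" shows "((\<lambda>x. c x y) has_derivative (\<lambda>v. Dx U V c x y \<bullet> v)) (at x)"
proof (rule closure_derivative_x[OF c_cont Dx_cont _ assms], intro ballI)
  fix x y assume *: "x \<in> U" "y \<in> V"
  then have "((\<lambda>x. F (x, y)) has_derivative (\<lambda>v. dd (v, 0) F (x, y))) (at x)" by (intro derivative_in_x F_diff) simp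
  then show "((\<lambda>x. c x y) has_derivative (\<lambda>v. Dx U V c x y \<bullet> v)) (at x)" using * by (simp add: F_pair Dx_inner)
qed

lemma Dy_derivative_x_closure:
  assumes "x \<in> U" "y \<in> closure V" shows "((\<lambda>x. - Dy U V c x y) has_derivative (\<lambda>v. (- transpose (Hb x y)) *v v)) (at x)"
proof (rule vector_derivative_by_components)
  fix i
  have entry: "((- transpose (Hb x y)) *v v) \<bullet> axis i 1 = (- (Hb x y *v axis i 1)) \<bullet> v" for x y v
    by (simp add: minus_mult_vec) (metis dot_lmul_matrix inner_commute transpose_matrix_vector transpose_transpose)
  have "((\<lambda>x. - Dy U V c x y \<bullet> axis i 1) has_derivative (\<lambda>v. (- (Hb x y *v axis i 1)) \<bullet> v)) (at x)"
  proof (rule closure_derivative_x[OF _ _ _ assms], goal_cases)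
    case 1
    show ?case using continuous_on_inner[OF continuous_on_minus[OF Dy_cont] continuous_on_const, of "axis i 1"]
      by (simp add: case_prod_unfold)
  next
    case 2
    show ?case using continuous_on_minus[OF continuous_on_matrix_vector_mult[OF Hb_cont continuous_on_const, of "axis i 1"]]
      by (simp add: case_prod_unfold)
  next
    case 3
    show ?case
    proof (intro ballI)
      fix x y assume *: "x \<in> U" "y \<in> V"
      have "((\<lambda>x. - Dy U V c x y \<bullet> axis i 1) has_derivative (\<lambda>v. ((- transpose (H x y)) *v v) \<bullet> axis i 1)) (at x)"
        using has_derivative_inner_left[OF Dy_derivative_x[OF *], of "axis i 1"] by simp
      then show "((\<lambda>x. - Dy U V c x y \<bullet> axis i 1) has_derivative (\<lambda>v. (- (Hb x y *v axis i 1)) \<bullet> v)) (at x)"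
        using entry[of x y] * by (simp add: Hb_eq)
    qed
  qed
  then show "((\<lambda>x. - Dy U V c x y \<bullet> axis i 1) has_derivative (\<lambda>v. ((- transpose (Hb x y)) *v v) \<bullet> axis i 1)) (at x)"
    unfolding entry .
qed

end

section \<open>Relative Lipschitz bound for the gradient; the maximum principles on the
  closure\<close>

context cost_domain
begin

lemma matrix_inv_vector:
  assumes "invertible (A :: real^'n^'n)" shows "matrix_inv A *v (A *v w) = w" "A *v (matrix_inv A *v w) = w"
proof -
  have "A ** matrix_inv A = mat 1 \<and> matrix_inv A ** A = mat 1"
    unfolding matrix_inv_def by (rule someI_ex) (use assms in \<open>simp add: invertible_def\<close>)
  then show "matrix_inv A *v (A *v w) = w" "A *v (matrix_inv A *v w) = w" by (simp_all add: matrix_vector_mul_assoc)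
qed

text \<open>The gradient in \<open>q\<close> of minus the modified cost at \<open>y0\<close>,
  written in the variable \<open>x\<close>. The extended Hessian \<open>Hb\<close> keeps it
  meaningful for \<open>y0\<close> on the boundary, and it vanishes at y = y0 by
  construction.\<close>

definition slope :: "real^'n \<Rightarrow> real^'n \<Rightarrow> real^'n \<Rightarrow> real^'n" where
  "slope y0 x y = matrix_inv (Hb x y0) *v (Dx U V c x y - Dx U V c x y0)"

lemma Hb_slope:
  assumes "x \<in> closure U" "y0 \<in> closure V" shows "Hb x y0 *v slope y0 x y = Dx U V c x y - Dx U V c x y0"
  unfolding slope_def by (rule matrix_inv_vector(2)[OF Hb_invertible[OF assms]])

lemma slope_tendsto:
  assumes lim: "(x \<longlongrightarrow> x1) G" "(y \<longlongrightarrow> y1) G" "(z \<longlongrightarrow> z1) G" and cl: "x1 \<in> closure U" "y1 \<in> closure V" "z1 \<in> closure V"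
    and ev: "\<forall>\<^sub>F t in G. x t \<in> closure U \<and> y t \<in> closure V \<and> z t \<in> closure V"
  shows "((\<lambda>t. slope (z t) (x t) (y t)) \<longlongrightarrow> slope z1 x1 y1) G"
proof -
  obtain \<kappa> where \<kappa>: "\<kappa> > 0" "\<forall>x\<in>U. \<forall>y\<in>V. \<forall>w. \<kappa> * norm w \<le> norm (H x y *v w)" using H_lower_bound by blast
  have ev2: "\<forall>\<^sub>F t in G. x t \<in> closure U \<and> y t \<in> closure V" "\<forall>\<^sub>F t in G. x t \<in> closure U \<and> z t \<in> closure V"
    using ev by (auto elim: eventually_mono)
  show ?thesis
  proof (rule tendsto_linear_solution[OF \<kappa>(1)])
    show "\<forall>\<^sub>F t in G. \<forall>w. \<kappa> * norm w \<le> norm (Hb (x t) (z t) *v w)"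
      using ev2(2) by (rule eventually_mono) (simp add: Hb_lower_bound[OF \<kappa>(2)])
    show "\<forall>\<^sub>F t in G. Hb (x t) (z t) *v slope (z t) (x t) (y t) = Dx U V c (x t) (y t) - Dx U V c (x t) (z t)"
      using ev2(2) by (rule eventually_mono) (simp add: Hb_slope)
    show "((\<lambda>t. Hb (x t) (z t)) \<longlongrightarrow> Hb x1 z1) G" by (rule closure_tendsto[OF Hb_cont lim(1,3) cl(1,3) ev2(2)])
    show "((\<lambda>t. Dx U V c (x t) (y t) - Dx U V c (x t) (z t)) \<longlongrightarrow> Dx U V c x1 y1 - Dx U V c x1 z1) G"
      by (intro tendsto_diff closure_tendsto[OF Dx_cont lim(1,3) cl(1,3) ev2(2)] closure_tendsto[OF Dx_cont lim(1,2) cl(1,2) ev2(1)])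
  qed (rule Hb_slope[OF cl(1,3)])
qed

text \<open>
  With \<open>p = slope y0 x y\<close>, \<open>p' = slope y0 x' y\<close> and \<open>e = H x y0 (p - p')\<close>, the quantity \<open>\<bar>e\<bar>\<^sup>2\<close> is the increment of
  \<open>\<phi>\<close> along the curve from \<open>x'\<close> to \<open>x\<close> that is straight in the coordinate \<open>q\<close>; the difference of second
  derivatives at \<open>y\<close> and \<open>y0\<close> in \<open>\<phi>'\<close> is estimated along the \<open>y\<close>-curve that is straight as seen from \<open>x'\<close>. In this
  way neither \<open>U\<close> nor \<open>V\<close> has to be convex.
\<close>

lemma slope_lipschitz_interior:
  "\<exists>K\<ge>0. \<forall>x\<in>U. \<forall>x'\<in>U. \<forall>y0\<in>V. \<forall>y\<in>V.
    norm (slope y0 x y - slope y0 x' y) \<le> K * norm (Dy U V c x y0 - Dy U V c x' y0) * norm (slope y0 x' y)"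
proof -
  obtain \<kappa> where \<kappa>: "\<kappa> > 0" "\<forall>x\<in>U. \<forall>y\<in>V. \<forall>w. \<kappa> * norm w \<le> norm (H x y *v w)" using H_lower_bound by blast
  obtain B3 where B3: "B3 \<ge> 0" "\<forall>z\<in>U \<times> V. \<forall>v w u. \<bar>dd v (dd w (dd u F)) z\<bar> \<le> B3 * norm v * norm w * norm u"
    by (rule third_bound)
  obtain B2 where B2: "B2 \<ge> 0" "\<forall>z\<in>U \<times> V. \<forall>v w. \<bar>dd v (dd w F) z\<bar> \<le> B2 * norm v * norm w"
    using dd_bound2[OF open_UV bounded_UV C2] by metis
  \<comment> \<open>One factor 1/\<kappa> bounds the speed of the x-curve and another recovers p -
    p' from \<open>e\<close>. The summand B2/\<kappa> comes from the length of the y-curve, at most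
    |G| / \<kappa> with |G| \<le> B2 |p'|, and the summand 1 from the term containing p'
    itself.\<close>
  define K where "K = B3 * (B2 / \<kappa> + 1) / \<kappa>\<^sup>2"
  have "norm (slope y0 x y - slope y0 x' y) \<le> K * norm (Dy U V c x y0 - Dy U V c x' y0) * norm (slope y0 x' y)"
    if x: "x \<in> U" "x' \<in> U" and y: "y0 \<in> V" "y \<in> V" for x x' y0 y
  proof -
    define p where "p = slope y0 x y"
    define p' where "p' = slope y0 x' y"
    have Hp: "H x y0 *v p = Dx U V c x y - Dx U V c x y0" "H x' y0 *v p' = Dx U V c x' y - Dx U V c x' y0"
      using Hb_slope x y U_closure V_closure unfolding p_def p'_def by (metis Hb_eq)+
    define \<Delta> where "\<Delta> = Dy U V c x y0 - Dy U V c x' y0"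
    define G where "G = Dx U V c x' y - Dx U V c x' y0"
    have G: "norm G \<le> B2 * norm p'"
    proof -
      have "norm G * norm G = G \<bullet> (H x' y0 *v p')" using Hp(2) by (simp add: G_def power2_norm_eq_inner flip: power2_eq_square)
      also have "\<dots> \<le> B2 * norm (G, 0 :: real^'n) * norm (0 :: real^'n, p')"
        unfolding H_bilinear[OF x(2) y(1)] by (rule order_trans[OF abs_ge_self B2(2)[rule_format]]) (use x y in simp)
      finally have "norm G * norm G \<le> norm G * (B2 * norm p')" by (simp add: norm_Pair mult.commute mult.left_commute)
      then show ?thesis using B2(1) by (cases "G = 0") auto
    qed
    define q where "q = - Dy U V c x' y0"
    define T where "T = {t. q + t *\<^sub>R (- \<Delta>) \<in> U_at U V c y0}"
    have "open T \<and> (\<exists>X X' X''. \<forall>t\<in>T. X t \<in> U \<and> - Dy U V c (X t) y0 = q + t *\<^sub>R (- \<Delta>) \<and>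
      (X has_vector_derivative X' t) (at t) \<and> (X' has_vector_derivative X'' t) (at t) \<and> (- transpose (H (X t) y0)) *v X' t = - \<Delta> \<and>
      (\<exists>e>0. \<exists>C. \<forall>s. \<bar>s - t\<bar> < e \<longrightarrow> s \<in> T \<and> norm (X' s) \<le> C \<and> norm (X'' s) \<le> C))"
      unfolding T_def by (rule x_curve[OF y(1)])
    then obtain X X' X'' where X: "\<forall>t\<in>T. X t \<in> U \<and> - Dy U V c (X t) y0 = q + t *\<^sub>R (- \<Delta>) \<and>
      (X has_vector_derivative X' t) (at t) \<and> (X' has_vector_derivative X'' t) (at t) \<and> (- transpose (H (X t) y0)) *v X' t = - \<Delta> \<and>
      (\<exists>e>0. \<exists>C. \<forall>s. \<bar>s - t\<bar> < e \<longrightarrow> s \<in> T \<and> norm (X' s) \<le> C \<and> norm (X'' s) \<le> C)"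
      by (elim exE conjE) (rule that)
    have T: "t \<in> T" if "0 \<le> t" "t \<le> 1" for t
    proof -
      have m: "q \<in> U_at U V c y0" "q - \<Delta> \<in> U_at U V c y0" using x by (auto simp: U_at_def q_def \<Delta>_def)
      from convexD[OF U_at_convex[OF V_closure[OF y(1)]] m, of "1 - t" t] that
      show ?thesis by (simp add: T_def algebra_simps)
    qed
    have XU: "X t \<in> U" and XD: "- Dy U V c (X t) y0 = q + t *\<^sub>R (- \<Delta>)" and dX: "(X has_vector_derivative X' t) (at t)"
      and HX: "(- transpose (H (X t) y0)) *v X' t = - \<Delta>" if "0 \<le> t" "t \<le> 1" for t
      using bspec[OF X T[OF that]] by blast+
    have X0: "X 0 = x'"
      by (rule Dy_inj[OF V_closure[OF y(1)] U_closure[OF XU] U_closure[OF x(2)]]) (use XD[of 0] in \<open>auto simp: q_def\<close>)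
    have X1: "X 1 = x"
    proof (rule Dy_inj[OF V_closure[OF y(1)] U_closure[OF XU] U_closure[OF x(1)]])
      have "- Dy U V c (X 1) y0 = - Dy U V c x y0" using XD[of 1] by (simp add: q_def \<Delta>_def)
      then show "Dy U V c (X 1) y0 = Dy U V c x y0" by simp
    qed simp_all
    have X': "norm (X' t) \<le> norm \<Delta> / \<kappa>" if "0 \<le> t" "t \<le> 1" for t
    proof -
      have "\<kappa> * norm (X' t) \<le> norm (transpose (H (X t) y0) *v X' t)"
        by (rule transpose_lower_bound[OF \<kappa>(1)]) (use \<kappa>(2) XU[OF that] y in blast)
      also have "transpose (H (X t) y0) *v X' t = \<Delta>" using HX[OF that] by (simp add: minus_mult_vec)
      finally show ?thesis using \<kappa>(1) by (simp add: field_simps)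
    qed
    define q2 where "q2 = - Dx U V c x' y0"
    define T2 where "T2 = {t. q2 + t *\<^sub>R (- G) \<in> V_at U V c x'}"
    have "open T2 \<and> (\<exists>Y Y' Y''. \<forall>t\<in>T2. Y t \<in> V \<and> - Dx U V c x' (Y t) = q2 + t *\<^sub>R (- G) \<and>
      (Y has_vector_derivative Y' t) (at t) \<and> (Y' has_vector_derivative Y'' t) (at t) \<and> (- H x' (Y t)) *v Y' t = - G \<and>
      (\<exists>e>0. \<exists>C. \<forall>s. \<bar>s - t\<bar> < e \<longrightarrow> s \<in> T2 \<and> norm (Y' s) \<le> C \<and> norm (Y'' s) \<le> C))"
      unfolding T2_def by (rule y_curve[OF x(2)])
    then obtain Y Y' Y'' where Y: "\<forall>t\<in>T2. Y t \<in> V \<and> - Dx U V c x' (Y t) = q2 + t *\<^sub>R (- G) \<and>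
      (Y has_vector_derivative Y' t) (at t) \<and> (Y' has_vector_derivative Y'' t) (at t) \<and> (- H x' (Y t)) *v Y' t = - G \<and>
      (\<exists>e>0. \<exists>C. \<forall>s. \<bar>s - t\<bar> < e \<longrightarrow> s \<in> T2 \<and> norm (Y' s) \<le> C \<and> norm (Y'' s) \<le> C)"
      by (elim exE conjE) (rule that)
    have T2: "t \<in> T2" if "0 \<le> t" "t \<le> 1" for t
    proof -
      have m: "q2 \<in> V_at U V c x'" "q2 - G \<in> V_at U V c x'" using y by (auto simp: V_at_def q2_def G_def)
      from convexD[OF V_at_convex[OF U_closure[OF x(2)]] m, of "1 - t" t] that
      show ?thesis by (simp add: T2_def algebra_simps)
    qed
    have YV: "Y t \<in> V" and YD: "- Dx U V c x' (Y t) = q2 + t *\<^sub>R (- G)" and dY: "(Y has_vector_derivative Y' t) (at t)"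
      and HY: "(- H x' (Y t)) *v Y' t = - G" if "0 \<le> t" "t \<le> 1" for t
      using bspec[OF Y T2[OF that]] by blast+
    have Y0: "Y 0 = y0"
      by (rule Dx_inj[OF U_closure[OF x(2)] V_closure[OF YV] V_closure[OF y(1)]]) (use YD[of 0] in \<open>auto simp: q2_def\<close>)
    have Y1: "Y 1 = y"
    proof (rule Dx_inj[OF U_closure[OF x(2)] V_closure[OF YV] V_closure[OF y(2)]])
      have "- Dx U V c x' (Y 1) = - Dx U V c x' y" using YD[of 1] by (simp add: q2_def G_def)
      then show "Dx U V c x' (Y 1) = Dx U V c x' y" by simp
    qed simp_all
    have Y': "norm (Y' t) \<le> norm G / \<kappa>" if "0 \<le> t" "t \<le> 1" for t
    proof -
      have "\<kappa> * norm (Y' t) \<le> norm (H x' (Y t) *v Y' t)" using \<kappa>(2) YV[OF that] x by blast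
      also have "H x' (Y t) *v Y' t = G" using HY[OF that] by (simp add: minus_mult_vec)
      finally show ?thesis using \<kappa>(1) by (simp add: field_simps)
    qed
    define e where "e = H x y0 *v (p - p')"
    define M where "M = (norm \<Delta> / \<kappa>) * (B3 * norm e * (norm G / \<kappa> + norm p'))"
    \<comment> \<open>This is where the bound becomes relative: the difference is integrated along a
      y-curve of length at most |G| / \<kappa>, and \<open>G\<close> is controlled by p'.\<close>
    have diff: "\<bar>dd (v, 0) (dd (e, 0) F) (z, y) - dd (v, 0) (dd (e, 0) F) (z, y0)\<bar> \<le> B3 * (norm G / \<kappa>) * norm v * norm e"
      if z: "z \<in> U" for z v
    proof -
      define f where "f = (\<lambda>s. dd (v, 0) (dd (e, 0) F) (z, Y s))"
      have "norm (f 1 - f 0) \<le> B3 * (norm G / \<kappa>) * norm v * norm e * norm (1 - 0 :: real)"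
      proof (rule field_differentiable_bound[of "{0..1}" f "\<lambda>s. dd (0, Y' s) (dd (v, 0) (dd (e, 0) F)) (z, Y s)"])
        fix s :: real assume "s \<in> {0..1}"
        then have s: "0 \<le> s" "s \<le> 1" by auto
        have "(f has_real_derivative dd (0, Y' s) (dd (v, 0) (dd (e, 0) F)) (z, Y s)) (at s)"
          unfolding f_def by (rule along_y(1)[OF C2_dd_dd z YV[OF s] dY[OF s] has_vector_derivative_const refl])
        then show "(f has_field_derivative dd (0, Y' s) (dd (v, 0) (dd (e, 0) F)) (z, Y s)) (at s within {0..1})"
          by (rule DERIV_subset) simp
        have "\<bar>dd (0, Y' s) (dd (v, 0) (dd (e, 0) F)) (z, Y s)\<bar> \<le> B3 * norm (0 :: real^'n, Y' s) * norm (v, 0 :: real^'n) * norm (e, 0 :: real^'n)"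
          using z YV[OF s] by (intro B3(2)[rule_format]) simp
        also have "\<dots> \<le> B3 * (norm G / \<kappa>) * norm v * norm e"
          unfolding norm_Pair using Y'[OF s] B3(1) \<kappa>(1) by (intro mult_mono mult_nonneg_nonneg) auto
        finally show "norm (dd (0, Y' s) (dd (v, 0) (dd (e, 0) F)) (z, Y s)) \<le> B3 * (norm G / \<kappa>) * norm v * norm e" by simp
      qed auto
      then show ?thesis by (simp add: f_def Y0 Y1)
    qed
    define \<phi> where "\<phi> = (\<lambda>t. dd (e, 0) F (X t, y) - dd (e, 0) F (X t, y0) - dd (e, 0) (dd (0, p') F) (X t, y0))"
    define \<phi>' where "\<phi>' = (\<lambda>t. dd (X' t, 0) (dd (e, 0) F) (X t, y) - dd (X' t, 0) (dd (e, 0) F) (X t, y0)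
      - dd (X' t, 0) (dd (e, 0) (dd (0, p') F)) (X t, y0))"
    have "norm (\<phi> 1 - \<phi> 0) \<le> M * norm (1 - 0 :: real)"
    proof (rule field_differentiable_bound[of "{0..1}" \<phi> \<phi>'])
      fix t :: real assume "t \<in> {0..1}"
      then have t: "0 \<le> t" "t \<le> 1" by auto
      have "(\<phi> has_real_derivative \<phi>' t) (at t)"
        unfolding \<phi>_def \<phi>'_def
        by (intro DERIV_diff along_x(1)[OF C2_dd XU[OF t] _ dX[OF t] has_vector_derivative_const refl]
            along_x(1)[OF C2_dd_dd XU[OF t] _ dX[OF t] has_vector_derivative_const refl] y)
      then show "(\<phi> has_field_derivative \<phi>' t) (at t within {0..1})" by (rule DERIV_subset) simp
      have "\<bar>\<phi>' t\<bar> \<le> B3 * (norm G / \<kappa>) * norm (X' t) * norm e + B3 * norm (X' t, 0 :: real^'n) * norm (e, 0 :: real^'n) * norm (0 :: real^'n, p')"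
        unfolding \<phi>'_def using XU[OF t] y by (intro order_trans[OF abs_triangle_ineq4] add_mono diff B3(2)[rule_format]) auto
      also have "\<dots> = norm (X' t) * (B3 * norm e * (norm G / \<kappa> + norm p'))" by (simp add: norm_Pair algebra_simps)
      also have "\<dots> \<le> (norm \<Delta> / \<kappa>) * (B3 * norm e * (norm G / \<kappa> + norm p'))"
        using X'[OF t] B3(1) \<kappa>(1) by (intro mult_right_mono) auto
      finally show "norm (\<phi>' t) \<le> M" by (simp add: M_def)
    qed auto
    moreover have "\<phi> 0 = 0"
    proof -
      have "\<phi> 0 = e \<bullet> (Dx U V c x' y - Dx U V c x' y0 - H x' y0 *v p')"
        unfolding \<phi>_def X0 H_bilinear[OF x(2) y(1), symmetric] Dx_inner[OF x(2) y(1), symmetric] Dx_inner[OF x(2) y(2), symmetric]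
        by (simp add: inner_diff_right inner_commute)
      then show ?thesis using Hp(2) by simp
    qed
    moreover have "\<phi> 1 = norm e * norm e"
    proof -
      have "\<phi> 1 = e \<bullet> (Dx U V c x y - Dx U V c x y0 - H x y0 *v p')"
        unfolding \<phi>_def X1 H_bilinear[OF x(1) y(1), symmetric] Dx_inner[OF x(1) y(1), symmetric] Dx_inner[OF x(1) y(2), symmetric]
        by (simp add: inner_diff_right inner_commute)
      also have "\<dots> = e \<bullet> e" by (simp add: Hp(1)[symmetric] e_def matrix_vector_mult_diff_distrib)
      finally show ?thesis by (simp add: power2_norm_eq_inner flip: power2_eq_square)
    qed
    ultimately have "norm e * norm e \<le> M" by simp
    then have "norm e * norm e \<le> norm e * (B3 * (norm \<Delta> / \<kappa>) * (norm G / \<kappa> + norm p'))"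
      unfolding M_def by (simp only: mult.commute mult.left_commute mult.assoc)
    moreover have "B3 * (norm \<Delta> / \<kappa>) * (norm G / \<kappa> + norm p') \<ge> 0" using B3(1) \<kappa>(1) by auto
    ultimately have "norm e \<le> B3 * (norm \<Delta> / \<kappa>) * (norm G / \<kappa> + norm p')" 
      by (metis mult_left_le_imp_le norm_ge_zero order_le_less)
    also have "\<dots> \<le> B3 * (norm \<Delta> / \<kappa>) * (B2 * norm p' / \<kappa> + norm p')"
      using G B3(1) \<kappa>(1) by (intro mult_left_mono add_mono divide_right_mono) auto
    also have "\<dots> = \<kappa> * (K * norm \<Delta> * norm p')" using \<kappa>(1) by (simp add: K_def field_simps power2_eq_square)
    finally have "\<kappa> * norm (p - p') \<le> \<kappa> * (K * norm \<Delta> * norm p')"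
      using \<kappa>(2) x y unfolding e_def by (meson order_trans)
    then show ?thesis using \<kappa>(1) by (simp add: p_def p'_def \<Delta>_def)
  qed
  moreover have "K \<ge> 0" using B3(1) B2(1) \<kappa>(1) by (simp add: K_def)
  ultimately show ?thesis by blast
qed

text \<open>The constant does not depend on \<open>y0\<close>, so the smallness condition on the
  diameter will depend on the cost alone.\<close>

lemma slope_lipschitz:
  obtains K where "K \<ge> 0" "\<forall>x\<in>U. \<forall>x'\<in>U. \<forall>y0\<in>closure V. \<forall>y\<in>closure V.
    norm (slope y0 x y - slope y0 x' y) \<le> K * norm (Dy U V c x y0 - Dy U V c x' y0) * norm (slope y0 x' y)"
proof -
  obtain K where K: "K \<ge> 0" "\<forall>x\<in>U. \<forall>x'\<in>U. \<forall>y0\<in>V. \<forall>y\<in>V.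
    norm (slope y0 x y - slope y0 x' y) \<le> K * norm (Dy U V c x y0 - Dy U V c x' y0) * norm (slope y0 x' y)"
    using slope_lipschitz_interior by blast
  have "norm (slope y0 x y - slope y0 x' y) \<le> K * norm (Dy U V c x y0 - Dy U V c x' y0) * norm (slope y0 x' y)"
    if x: "x \<in> U" "x' \<in> U" and y: "y0 \<in> closure V" "y \<in> closure V" for x x' y0 y
  proof -
    obtain z where z: "\<And>k. z k \<in> V" "z \<longlonglongrightarrow> y0" using y(1) unfolding closure_sequential by blast
    obtain ys where ys: "\<And>k. ys k \<in> V" "ys \<longlonglongrightarrow> y" using y(2) unfolding closure_sequential by blast
    show ?thesis
    proof (rule LIMSEQ_le)
      show "(\<lambda>k. norm (slope (z k) x (ys k) - slope (z k) x' (ys k))) \<longlonglongrightarrow> norm (slope y0 x y - slope y0 x' y)"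
        by (intro tendsto_norm tendsto_diff slope_tendsto tendsto_const z ys y U_closure x) (simp_all add: z ys x U_closure V_closure)
      show "(\<lambda>k. K * norm (Dy U V c x (z k) - Dy U V c x' (z k)) * norm (slope (z k) x' (ys k))) \<longlonglongrightarrow>
        K * norm (Dy U V c x y0 - Dy U V c x' y0) * norm (slope y0 x' y)"
        by (intro tendsto_mult tendsto_norm tendsto_diff slope_tendsto closure_tendsto[OF Dy_cont] tendsto_const z ys y U_closure x)
          (simp_all add: z ys x U_closure V_closure)
      show "\<exists>N. \<forall>k\<ge>N. norm (slope (z k) x (ys k) - slope (z k) x' (ys k)) \<le>
        K * norm (Dy U V c x (z k) - Dy U V c x' (z k)) * norm (slope (z k) x' (ys k))"
        using K(2) x z ys by blast
    qed
  qed
  with K(1) show thesis by (intro that[of K] ballI)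
qed

text \<open>Approximate the two end points from V and form intermediate points with the same ratio
  \<theta>, which lie in V because the range in (B2) is convex. A subsequence converges, and
  injectivity of Dx c(x0, .) on the closure identifies its limit with \<open>y\<close>.\<close>

lemma max_principle_closure:
  assumes x: "x0 \<in> U" "x \<in> U" and ys: "y \<in> closure V" "y1 \<in> closure V" "y2 \<in> closure V"
    and seg: "Dx U V c x0 y \<in> closed_segment (Dx U V c x0 y1) (Dx U V c x0 y2)"
  shows "c x0 y - c x y \<le> max (c x0 y1 - c x y1) (c x0 y2 - c x y2)"
proof -
  obtain \<theta> where \<theta>: "0 \<le> \<theta>" "\<theta> \<le> 1" "Dx U V c x0 y = (1 - \<theta>) *\<^sub>R Dx U V c x0 y1 + \<theta> *\<^sub>R Dx U V c x0 y2"
    using seg by (auto simp: closed_segment_def)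
  obtain a where a: "\<And>k. a k \<in> V" "a \<longlonglongrightarrow> y1" using ys(2) unfolding closure_sequential by blast
  obtain b where b: "\<And>k. b k \<in> V" "b \<longlonglongrightarrow> y2" using ys(3) unfolding closure_sequential by blast
  have "\<exists>z. z \<in> V \<and> Dx U V c x0 z = (1 - \<theta>) *\<^sub>R Dx U V c x0 (a k) + \<theta> *\<^sub>R Dx U V c x0 (b k)" for k
  proof -
    have m: "- Dx U V c x0 (a k) \<in> V_at U V c x0" "- Dx U V c x0 (b k) \<in> V_at U V c x0" using a b by (auto simp: V_at_def)
    have "(1 - \<theta>) *\<^sub>R (- Dx U V c x0 (a k)) + \<theta> *\<^sub>R (- Dx U V c x0 (b k)) \<in> V_at U V c x0"
      using convexD[OF V_at_convex[OF U_closure[OF x(1)]] m, of "1 - \<theta>" \<theta>] \<theta> by simp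
    then obtain z where z: "z \<in> V" "(1 - \<theta>) *\<^sub>R (- Dx U V c x0 (a k)) + \<theta> *\<^sub>R (- Dx U V c x0 (b k)) = - Dx U V c x0 z"
      unfolding V_at_def by blast
    from arg_cong[OF z(2), of uminus] have "Dx U V c x0 z = (1 - \<theta>) *\<^sub>R Dx U V c x0 (a k) + \<theta> *\<^sub>R Dx U V c x0 (b k)" by (simp add: add.commute)
    with z(1) show ?thesis by blast
  qed
  then obtain z where z: "\<And>k. z k \<in> V" "\<And>k. Dx U V c x0 (z k) = (1 - \<theta>) *\<^sub>R Dx U V c x0 (a k) + \<theta> *\<^sub>R Dx U V c x0 (b k)" by metis
  obtain r l where r: "strict_mono r" "l \<in> closure V" "(z \<circ> r) \<longlonglongrightarrow> l"
    by (rule convergent_subsequence_in_compact[OF compact_V]) (rule V_closure[OF z(1)])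
  have zr: "(\<lambda>k. z (r k)) \<longlonglongrightarrow> l" and ar: "(\<lambda>k. a (r k)) \<longlonglongrightarrow> y1" and br: "(\<lambda>k. b (r k)) \<longlonglongrightarrow> y2"
    using r(3) LIMSEQ_subseq_LIMSEQ[OF a(2) r(1)] LIMSEQ_subseq_LIMSEQ[OF b(2) r(1)] by (simp_all add: comp_def)
  have "(\<lambda>k. Dx U V c x0 (z (r k))) \<longlonglongrightarrow> Dx U V c x0 l"
    by (intro closure_tendsto[OF Dx_cont] tendsto_const zr U_closure x r) (simp add: U_closure x V_closure z)
  moreover have "(\<lambda>k. (1 - \<theta>) *\<^sub>R Dx U V c x0 (a (r k)) + \<theta> *\<^sub>R Dx U V c x0 (b (r k))) \<longlonglongrightarrow> (1 - \<theta>) *\<^sub>R Dx U V c x0 y1 + \<theta> *\<^sub>R Dx U V c x0 y2"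
    by (intro tendsto_add tendsto_scaleR closure_tendsto[OF Dx_cont] tendsto_const ar br U_closure x ys) (simp_all add: U_closure x V_closure a b)
  ultimately have "Dx U V c x0 l = Dx U V c x0 y" unfolding z(2) \<theta>(3)[symmetric] by (rule LIMSEQ_unique)
  then have "l = y" by (rule Dx_inj[OF U_closure[OF x(1)] r(2) ys(1)])
  with zr have zr: "(\<lambda>k. z (r k)) \<longlonglongrightarrow> y" by simp
  show ?thesis
  proof (rule LIMSEQ_le)
    show "(\<lambda>k. c x0 (z (r k)) - c x (z (r k))) \<longlonglongrightarrow> c x0 y - c x y"
      by (intro tendsto_diff closure_tendsto[OF c_cont] tendsto_const zr U_closure x ys) (simp_all add: U_closure x V_closure z)
    show "(\<lambda>k. max (c x0 (a (r k)) - c x (a (r k))) (c x0 (b (r k)) - c x (b (r k)))) \<longlonglongrightarrow> max (c x0 y1 - c x y1) (c x0 y2 - c x y2)"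
      by (intro tendsto_max tendsto_diff closure_tendsto[OF c_cont] tendsto_const ar br U_closure x ys) (simp_all add: U_closure x V_closure a b)
    have "c x0 (z k) - c x (z k) \<le> max (c x0 (a k) - c x (a k)) (c x0 (b k) - c x (b k))" for k
      by (rule max_principle_interior[OF x z(1) a(1) b(1)]) (use z(2) \<theta> in \<open>auto simp: closed_segment_def\<close>)
    then show "\<exists>N. \<forall>k\<ge>N. c x0 (z (r k)) - c x (z (r k)) \<le> max (c x0 (a (r k)) - c x (a (r k))) (c x0 (b (r k)) - c x (b (r k)))" by blast
  qed
qed

text \<open>Replacing \<open>y0\<close> by a nearby point of V changes which curves in U are
  straight, so the middle point has to move along with it. Its limit is recognised by injectivity of
  Dy c(., y0).\<close>

lemma quasiconvex_closure:
  assumes xs: "x0 \<in> U" "x1 \<in> U" "x2 \<in> U" and ys: "y0 \<in> closure V" "y \<in> closure V"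
    and seg: "Dy U V c x0 y0 \<in> closed_segment (Dy U V c x1 y0) (Dy U V c x2 y0)"
  shows "c x0 y0 - c x0 y \<le> max (c x1 y0 - c x1 y) (c x2 y0 - c x2 y)"
proof -
  obtain \<theta> where \<theta>: "0 \<le> \<theta>" "\<theta> \<le> 1" "Dy U V c x0 y0 = (1 - \<theta>) *\<^sub>R Dy U V c x1 y0 + \<theta> *\<^sub>R Dy U V c x2 y0"
    using seg by (auto simp: closed_segment_def)
  obtain a where a: "\<And>k. a k \<in> V" "a \<longlonglongrightarrow> y0" using ys(1) unfolding closure_sequential by blast
  obtain b where b: "\<And>k. b k \<in> V" "b \<longlonglongrightarrow> y" using ys(2) unfolding closure_sequential by blast
  have "\<exists>z. z \<in> U \<and> Dy U V c z (a k) = (1 - \<theta>) *\<^sub>R Dy U V c x1 (a k) + \<theta> *\<^sub>R Dy U V c x2 (a k)" for k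
  proof -
    have m: "- Dy U V c x1 (a k) \<in> U_at U V c (a k)" "- Dy U V c x2 (a k) \<in> U_at U V c (a k)" using xs by (auto simp: U_at_def)
    have "(1 - \<theta>) *\<^sub>R (- Dy U V c x1 (a k)) + \<theta> *\<^sub>R (- Dy U V c x2 (a k)) \<in> U_at U V c (a k)"
      using convexD[OF U_at_convex[OF V_closure[OF a(1)]] m, of "1 - \<theta>" \<theta>] \<theta> by simp
    then obtain z where z: "z \<in> U" "(1 - \<theta>) *\<^sub>R (- Dy U V c x1 (a k)) + \<theta> *\<^sub>R (- Dy U V c x2 (a k)) = - Dy U V c z (a k)"
      unfolding U_at_def by blast
    from arg_cong[OF z(2), of uminus] have "Dy U V c z (a k) = (1 - \<theta>) *\<^sub>R Dy U V c x1 (a k) + \<theta> *\<^sub>R Dy U V c x2 (a k)" by (simp add: add.commute)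
    with z(1) show ?thesis by blast
  qed
  then obtain z where z: "\<And>k. z k \<in> U" "\<And>k. Dy U V c (z k) (a k) = (1 - \<theta>) *\<^sub>R Dy U V c x1 (a k) + \<theta> *\<^sub>R Dy U V c x2 (a k)" by metis
  obtain r l where r: "strict_mono r" "l \<in> closure U" "(z \<circ> r) \<longlonglongrightarrow> l"
    by (rule convergent_subsequence_in_compact[OF compact_U]) (rule U_closure[OF z(1)])
  have zr: "(\<lambda>k. z (r k)) \<longlonglongrightarrow> l" and ar: "(\<lambda>k. a (r k)) \<longlonglongrightarrow> y0" and br: "(\<lambda>k. b (r k)) \<longlonglongrightarrow> y"
    using r(3) LIMSEQ_subseq_LIMSEQ[OF a(2) r(1)] LIMSEQ_subseq_LIMSEQ[OF b(2) r(1)] by (simp_all add: comp_def)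
  have "(\<lambda>k. Dy U V c (z (r k)) (a (r k))) \<longlonglongrightarrow> Dy U V c l y0"
    by (intro closure_tendsto[OF Dy_cont] zr ar ys r) (simp add: U_closure V_closure z a)
  moreover have "(\<lambda>k. (1 - \<theta>) *\<^sub>R Dy U V c x1 (a (r k)) + \<theta> *\<^sub>R Dy U V c x2 (a (r k))) \<longlonglongrightarrow> (1 - \<theta>) *\<^sub>R Dy U V c x1 y0 + \<theta> *\<^sub>R Dy U V c x2 y0"
    by (intro tendsto_add tendsto_scaleR closure_tendsto[OF Dy_cont] tendsto_const ar U_closure xs ys) (simp_all add: U_closure xs V_closure a)
  ultimately have "Dy U V c l y0 = Dy U V c x0 y0" unfolding z(2) \<theta>(3)[symmetric] by (rule LIMSEQ_unique)
  then have "l = x0" by (rule Dy_inj[OF ys(1) r(2) U_closure[OF xs(1)]])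
  with zr have zr: "(\<lambda>k. z (r k)) \<longlonglongrightarrow> x0" by simp
  show ?thesis
  proof (rule LIMSEQ_le)
    show "(\<lambda>k. c (z (r k)) (a (r k)) - c (z (r k)) (b (r k))) \<longlonglongrightarrow> c x0 y0 - c x0 y"
      by (intro tendsto_diff closure_tendsto[OF c_cont] zr ar br U_closure xs ys) (simp_all add: U_closure V_closure z a b)
    show "(\<lambda>k. max (c x1 (a (r k)) - c x1 (b (r k))) (c x2 (a (r k)) - c x2 (b (r k)))) \<longlonglongrightarrow> max (c x1 y0 - c x1 y) (c x2 y0 - c x2 y)"
      by (intro tendsto_max tendsto_diff closure_tendsto[OF c_cont] tendsto_const ar br U_closure xs ys) (simp_all add: U_closure xs V_closure a b)
    have "c (z k) (a k) - c (z k) (b k) \<le> max (c x1 (a k) - c x1 (b k)) (c x2 (a k) - c x2 (b k))" for k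
      by (rule quasiconvex_interior[OF z(1) xs(2,3) a(1) b(1)]) (use z(2) \<theta> in \<open>auto simp: closed_segment_def\<close>)
    then show "\<exists>N. \<forall>k\<ge>N. c (z (r k)) (a (r k)) - c (z (r k)) (b (r k)) \<le> max (c x1 (a (r k)) - c x1 (b (r k))) (c x2 (a (r k)) - c x2 (b (r k)))" by blast
  qed
qed

end

section \<open>The modified cost\<close>

text \<open>An essential supremum bounds a continuous function at every point of an open set: the
  points where the bound is exceeded form an open null set, which is empty.\<close>

lemma le_esssup_on_open:
  fixes f :: "'a::euclidean_space \<Rightarrow> real"
  assumes S: "S \<in> sets borel" and G: "open G" "G \<subseteq> S" and f: "continuous_on G f" and g: "\<forall>z\<in>G. g z = ennreal (f z)" and z: "z \<in> G"
  shows "g z \<le> esssup (restrict_space lborel S) g"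
proof (rule ccontr)
  define e where "e = esssup (restrict_space lborel S) g"
  define N where "N = {z \<in> G. e < ennreal (f z)}"
  assume "\<not> ?thesis"
  then have zN: "z \<in> N" using g z by (simp add: N_def e_def)
  have "open N"
  proof -
    have "continuous_on G (\<lambda>z. ennreal (f z))" by (rule continuous_on_ennreal[OF f])
    from continuous_on_open_vimage[OF G(1), THEN iffD1, OF this, rule_format, of "{e<..}"]
    have "open ((\<lambda>z. ennreal (f z)) -` {e<..} \<inter> G)" by simp
    moreover have "(\<lambda>z. ennreal (f z)) -` {e<..} \<inter> G = N" by (auto simp: N_def)
    ultimately show ?thesis by simp
  qed
  have "AE z in restrict_space lborel S. g z \<le> e" unfolding e_def by (rule esssup_AE)
  then have "AE z in lborel. z \<in> S \<longrightarrow> g z \<le> e" using S by (simp add: AE_restrict_space_iff)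
  then have "AE z in lborel. z \<notin> N" by (rule AE_mp) (use G g in \<open>auto simp: N_def\<close>)
  then have "N \<in> null_sets lborel" using \<open>open N\<close> by (subst (asm) AE_iff_null_sets[symmetric]) auto
  then have "N \<in> null_sets lebesgue" by (rule null_sets_completionI)
  then have "negligible N" by (simp add: negligible_iff_null_sets)
  then show False using open_not_negligible[OF \<open>open N\<close>] zN by blast
qed

locale cost_domain_at = cost_domain U V c for U V :: "(real^'n) set" and c :: "'n cost" +
  fixes y0 :: "real^'n"
  assumes y0: "y0 \<in> closure V"
begin

abbreviation W :: "(real^'n) set" where "W \<equiv> U_at U V c y0"
abbreviation X :: "real^'n \<Rightarrow> real^'n" where "X \<equiv> x_of U V c y0"
abbreviation ct :: "'n cost" where "ct \<equiv> modified_cost U V c y0"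

definition \<psi> :: "real^'n \<Rightarrow> real^'n \<Rightarrow> real" where "\<psi> q y = c (X q) y0 - c (X q) y"
definition P :: "real^'n \<Rightarrow> real^'n \<Rightarrow> real^'n" where "P q y = slope y0 (X q) y"

lemma ct_\<psi>: "ct q y = - \<psi> q y" by (simp add: modified_cost_def \<psi>_def)

lemma cont_Dy: "continuous_on (closure U) (\<lambda>x. - Dy U V c x y0)"
  by (intro continuous_on_minus cont_section_x Dy_cont y0)

lemma closure_W: "closure W = (\<lambda>x. - Dy U V c x y0) ` closure U"
  unfolding U_at_def by (rule closure_image_compact[OF bounded_U cont_Dy])

lemma inj_Dy: "inj_on (\<lambda>x. - Dy U V c x y0) (closure U)"
  using diffeo_x[OF y0] by (simp add: diffeo_onto_range_def)

lemma X_Dy: "x \<in> closure U \<Longrightarrow> X (- Dy U V c x y0) = x"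
  unfolding x_of_def by (rule inv_into_f_f[OF inj_Dy])

lemma Dy_X: "q \<in> closure W \<Longrightarrow> - Dy U V c (X q) y0 = q" "q \<in> closure W \<Longrightarrow> X q \<in> closure U"
  by (auto simp: closure_W X_Dy)

lemma X_U: "q \<in> W \<Longrightarrow> X q \<in> U"
  by (auto simp: U_at_def X_Dy U_closure)

lemma W_closure: "q \<in> W \<Longrightarrow> q \<in> closure W" by (rule subsetD[OF closure_subset])

lemma X_cont: "continuous_on (closure W) X"
  unfolding closure_W x_of_def 
  by (rule continuous_on_inv[OF cont_Dy compact_U]) (simp add: inv_into_f_f[OF inj_Dy])

lemma X_tendsto: "(q \<longlongrightarrow> q1) G \<Longrightarrow> q1 \<in> closure W \<Longrightarrow> \<forall>\<^sub>F t in G. q t \<in> closure W \<Longrightarrow> ((\<lambda>t. X (q t)) \<longlongrightarrow> X q1) G"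
  by (rule continuous_on_tendsto_compose[OF X_cont])

abbreviation Hi :: "real^'n \<Rightarrow> real^'n^'n" where "Hi q \<equiv> matrix_inv (Hb (X q) y0)"

lemma transpose_mult: "(transpose A *v v) \<bullet> w = v \<bullet> (A *v w)" for A :: "real^'n^'n"
  by (metis dot_lmul_matrix transpose_matrix_vector)

text \<open>Differentiating q = - Dy c(X q, y0) gives minus the transposed mixed Hessian at
  \<open>y0\<close>, whose inverse is the stated derivative. Since \<open>y0\<close> may be a
  boundary point, the Hessian is the extended one.\<close>

lemma open_W: "open W" and X_derivative: "q \<in> W \<Longrightarrow> (X has_derivative (\<lambda>v. - (transpose (Hi q) *v v))) (at q)"
proof -
  have "\<forall>x\<in>U. ((\<lambda>x. - Dy U V c x y0) has_derivative (\<lambda>v. (- transpose (Hb x y0)) *v v)) (at x)"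
    by (intro ballI Dy_derivative_x_closure y0)
  from inverse_derivative[OF open_U diffeo_x[OF y0] this, folded U_at_def x_of_def]
  obtain g' :: "real^'n \<Rightarrow> ((real^'n) \<Rightarrow>\<^sub>L (real^'n))" where g': "open W \<and> continuous_on ((\<lambda>x. - Dy U V c x y0) ` closure U) g' \<and>
    (\<forall>q\<in>W. (X has_derivative blinfun_apply (g' q)) (at q)) \<and>
    (\<forall>x\<in>U. \<forall>w. blinfun_apply (g' (- Dy U V c x y0)) ((- transpose (Hb x y0)) *v w) = w) \<and>
    (\<forall>x\<in>U. \<forall>w. (- transpose (Hb x y0)) *v (blinfun_apply (g' (- Dy U V c x y0)) w) = w)"
    by (elim exE) (rule that)
  note g = conjunct1[OF g'] conjunct1[OF conjunct2[OF conjunct2[OF g']]] conjunct1[OF conjunct2[OF conjunct2[OF conjunct2[OF g']]]]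
  show "open W" by (rule g(1))
  assume q: "q \<in> W"
  have "blinfun_apply (g' q) v = - (transpose (Hi q) *v v)" for v
  proof -
    have "transpose (Hb (X q) y0) *v (transpose (Hi q) *v v) = v"
    proof (rule vector_eq_ldot[THEN iffD1], rule allI)
      fix w
      show "w \<bullet> (transpose (Hb (X q) y0) *v (transpose (Hi q) *v v)) = w \<bullet> v"
        using matrix_inv_vector(1)[OF Hb_invertible[OF U_closure[OF X_U[OF q]] y0]] by (simp only: inner_commute[of w] transpose_mult)
    qed
    then have "(- transpose (Hb (X q) y0)) *v (- (transpose (Hi q) *v v)) = v"
      using matrix_vector_mult_scaleR[of "transpose (Hb (X q) y0)" "-1" "transpose (Hi q) *v v"] by (simp add: minus_mult_vec)
    with g(3)[rule_format, OF X_U[OF q], of "- (transpose (Hi q) *v v)"] show ?thesis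
      using Dy_X(1)[OF W_closure[OF q]] by simp
  qed
  then have "blinfun_apply (g' q) = (\<lambda>v. - (transpose (Hi q) *v v))" by (rule ext)
  with g(2) q show "(X has_derivative (\<lambda>v. - (transpose (Hi q) *v v))) (at q)" by metis
qed

lemma Hb_P: "q \<in> closure W \<Longrightarrow> Hb (X q) y0 *v P q y = Dx U V c (X q) y - Dx U V c (X q) y0"
  unfolding P_def by (rule Hb_slope[OF Dy_X(2) y0])

lemma P_derivative_y:
  assumes q: "q \<in> W" and y: "y \<in> V"
  shows "(P q has_derivative (\<lambda>w. (Hi q ** H (X q) y) *v w)) (at y)"
proof -
  have 1: "((\<lambda>y. - (Hi q *v (- Dx U V c (X q) y))) has_derivative (\<lambda>w. - (Hi q *v ((- H (X q) y) *v w)))) (at y)"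
    by (intro has_derivative_minus bounded_linear.has_derivative[OF matrix_vector_mul_bounded_linear] Dx_derivative_y X_U q y)
  have neg: "Hi q *v (- v) = - (Hi q *v v)" for v
    using matrix_vector_mult_scaleR[of "Hi q" "-1" v] by simp
  have 2: "P q = (\<lambda>y. - (Hi q *v (- Dx U V c (X q) y)) - Hi q *v Dx U V c (X q) y0)"
    by (simp add: fun_eq_iff P_def slope_def matrix_vector_mult_diff_distrib neg)
  show ?thesis unfolding 2
    by (rule has_derivative_eq_rhs[OF has_derivative_diff[OF 1 has_derivative_const]])
      (simp add: minus_mult_vec neg matrix_vector_mul_assoc)
qed

lemma mixed_hessian_ct:
  assumes q: "q \<in> W" and y: "y \<in> V"
  shows "mixed_hessian ct q y = - (Hi q ** H (X q) y)"
proof -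
  have "mixed_hessian ct q y $ i $ j = (- (Hi q ** H (X q) y)) $ i $ j" for i j
  proof -
    have eq: "frechet_derivative (\<lambda>y'. ct q' y') (at y) (axis j 1) = dd (0, axis j 1) F (X q', y)" if "q' \<in> W" for q'
    proof -
      have "(X q', y) \<in> U \<times> V" using X_U[OF that] y by simp
      then have "((\<lambda>y'. F (X q', y') - c (X q') y0) has_derivative (\<lambda>w. dd (0, w) F (X q', y) - 0)) (at y)"
        by (intro has_derivative_diff derivative_in_y[OF F_diff] has_derivative_const)
      from fun_cong[OF frechet_derivative_at[OF this], of "axis j 1"] show ?thesis by (simp add: F_def modified_cost_def)
    qed
    have z: "(X q, y) \<in> U \<times> V" using X_U[OF q] y by simp
    have "((\<lambda>q. dd (0, axis j 1) F (X q, y)) has_derivative (\<lambda>v. dd (- (transpose (Hi q) *v v), 0) (dd (0, axis j 1) F) (X q, y))) (at q)"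
      using diff_chain_at[OF X_derivative[OF q] derivative_in_x[OF dd_F_diff[OF z]]] by (simp add: comp_def)
    then have "((\<lambda>q'. frechet_derivative (\<lambda>y'. ct q' y') (at y) (axis j 1)) has_derivative (\<lambda>v. dd (- (transpose (Hi q) *v v), 0) (dd (0, axis j 1) F) (X q, y))) (at q)"
      by (rule has_derivative_transform_within_open[OF _ open_W q]) (rule eq[symmetric])
    from fun_cong[OF frechet_derivative_at[OF this], of "axis i 1"]
    have "mixed_hessian ct q y $ i $ j = dd (- (transpose (Hi q) *v axis i 1), 0) (dd (0, axis j 1) F) (X q, y)"
      by (simp add: mixed_hessian_def)
    also have "\<dots> = - (axis i 1 \<bullet> (Hi q *v (H (X q) y *v axis j 1)))"
      unfolding H_bilinear[OF X_U[OF q] y, symmetric] by (simp only: inner_minus_left transpose_mult)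
    also have "\<dots> = (- (Hi q ** H (X q) y)) $ i $ j"
      unfolding matrix_vector_mul_assoc by (simp add: inner_axis' matrix_vector_mult_basis column_def)
    finally show ?thesis .
  qed
  then show ?thesis by (simp add: vec_eq_iff)
qed

text \<open>The Jacobian of P q at \<open>y\<close>, which is also the absolute determinant of the
  mixed Hessian of the modified cost, in a form that is continuous up to the boundary.\<close>

definition J :: "real^'n \<Rightarrow> real^'n \<Rightarrow> real" where
  "J q y = \<bar>det (Hb (X q) y)\<bar> / \<bar>det (Hb (X q) y0)\<bar>"

lemma det_Hb: "x \<in> closure U \<Longrightarrow> y \<in> closure V \<Longrightarrow> det (Hb x y) \<noteq> 0"
  using Hb_invertible by (simp add: invertible_det_nz)

lemma det_uminus_abs: "\<bar>det (- A)\<bar> = \<bar>det A\<bar>" for A :: "real^'n^'n"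
proof -
  have "- A = (- mat 1) ** A" by (simp add: matrix_eq matrix_vector_mul_assoc[symmetric] minus_mult_vec)
  moreover have "\<bar>det (- mat 1 :: real^'n^'n)\<bar> = 1"
  proof -
    have "(- mat 1) ** (- mat 1) = (mat 1 :: real^'n^'n)"
      by (simp add: matrix_eq matrix_vector_mul_assoc[symmetric] minus_mult_vec)
    then have "det (- mat 1 :: real^'n^'n) * det (- mat 1 :: real^'n^'n) = 1" by (metis det_mul det_I)
    then show ?thesis by (auto simp: square_eq_1_iff)
  qed
  ultimately show ?thesis by (metis abs_mult det_mul mult_1)
qed

lemma det_Hi: assumes "q \<in> closure W" shows "det (Hi q) = 1 / det (Hb (X q) y0)"
proof -
  have "Hi q ** Hb (X q) y0 = mat 1"
    using matrix_inv_vector(1)[OF Hb_invertible[OF Dy_X(2)[OF assms] y0]] by (simp add: matrix_eq matrix_vector_mul_assoc[symmetric])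
  then have "det (Hi q) * det (Hb (X q) y0) = 1" by (metis det_mul det_I)
  then show ?thesis using det_Hb[OF Dy_X(2)[OF assms] y0] by (simp add: field_simps)
qed

lemma det_P: assumes "q \<in> W" "y \<in> V" shows "\<bar>det (Hi q ** H (X q) y)\<bar> = J q y"
  using det_Hi[OF W_closure[OF assms(1)]] Hb_eq[OF X_U[OF assms(1)] assms(2)] by (simp add: det_mul abs_mult J_def)

lemma det_ct: assumes "q \<in> W" "y \<in> V" shows "\<bar>det (mixed_hessian ct q y)\<bar> = J q y"
  unfolding mixed_hessian_ct[OF assms] det_uminus_abs by (rule det_P[OF assms])

lemma J_cont: "continuous_on (closure W \<times> closure V) (\<lambda>(q, y). J q y)"
  unfolding continuous_on_def
proof
  fix z assume z: "z \<in> closure W \<times> closure V"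
  obtain q y where zq: "z = (q, y)" "q \<in> closure W" "y \<in> closure V" using z by auto
  let ?G = "at z within closure W \<times> closure V"
  have lim: "(fst \<longlongrightarrow> q) ?G" "(snd \<longlongrightarrow> y) ?G"
    using tendsto_fst[OF tendsto_ident_at] tendsto_snd[OF tendsto_ident_at] zq(1) by (metis fst_conv, metis snd_conv)
  have ev: "\<forall>\<^sub>F t in ?G. t \<in> closure W \<times> closure V" by (simp add: eventually_at_filter)
  have evq: "\<forall>\<^sub>F t in ?G. fst t \<in> closure W" using ev by (rule eventually_mono) auto
  have limX: "((\<lambda>t. X (fst t)) \<longlongrightarrow> X q) ?G" by (rule X_tendsto[OF lim(1) zq(2) evq])
  have evs: "\<forall>\<^sub>F t in ?G. X (fst t) \<in> closure U \<and> snd t \<in> closure V" "\<forall>\<^sub>F t in ?G. X (fst t) \<in> closure U \<and> y0 \<in> closure V"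
    using ev y0 by (auto elim!: eventually_mono simp: Dy_X)
  have detc: "continuous_on UNIV (\<lambda>A :: real^'n^'n. det A)" by (intro continuous_on_det continuous_intros)
  have detl: "(A \<longlongrightarrow> A0) ?G \<Longrightarrow> ((\<lambda>t. det (A t)) \<longlongrightarrow> det A0) ?G" for A and A0 :: "real^'n^'n"
    using continuous_on_tendsto_compose[OF detc] by simp
  have "((\<lambda>t. J (fst t) (snd t)) \<longlongrightarrow> J q y) ?G"
    unfolding J_def
    by (intro tendsto_divide tendsto_rabs detl closure_tendsto[OF Hb_cont limX lim(2) _ _ evs(1)] closure_tendsto[OF Hb_cont limX tendsto_const _ _ evs(2)] Dy_X zq y0)
      (simp add: det_Hb Dy_X zq y0)
  then show "((\<lambda>(q, y). J q y) \<longlongrightarrow> (case z of (q, y) \<Rightarrow> J q y)) ?G" by (simp add: zq(1) case_prod_unfold)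
qed

lemma \<psi>_deriv:
  assumes q: "q \<in> W" and y: "y \<in> closure V" shows "((\<lambda>q. \<psi> q y) has_derivative (\<lambda>v. P q y \<bullet> v)) (at q)"
proof -
  have "((\<lambda>q. c (X q) y') has_derivative (\<lambda>v. Dx U V c (X q) y' \<bullet> (- (transpose (Hi q) *v v)))) (at q)" if "y' \<in> closure V" for y'
    using diff_chain_at[OF X_derivative[OF q] c_derivative_x[OF X_U[OF q] that]] by (simp add: comp_def)
  from has_derivative_diff[OF this[OF y0] this[OF y]]
  have "((\<lambda>q. \<psi> q y) has_derivative (\<lambda>v. Dx U V c (X q) y0 \<bullet> (- (transpose (Hi q) *v v)) - Dx U V c (X q) y \<bullet> (- (transpose (Hi q) *v v)))) (at q)"
    unfolding \<psi>_def .
  moreover have "Dx U V c (X q) y0 \<bullet> (- (transpose (Hi q) *v v)) - Dx U V c (X q) y \<bullet> (- (transpose (Hi q) *v v)) = P q y \<bullet> v" for v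
  proof -
    have "P q y \<bullet> v = v \<bullet> (Hi q *v (Dx U V c (X q) y - Dx U V c (X q) y0))" by (simp add: P_def slope_def inner_commute)
    also have "\<dots> = (transpose (Hi q) *v v) \<bullet> (Dx U V c (X q) y - Dx U V c (X q) y0)" by (simp only: transpose_mult)
    finally show ?thesis by (simp add: inner_diff_right inner_commute)
  qed
  ultimately show ?thesis by simp
qed

lemma P_inj: "q \<in> closure W \<Longrightarrow> inj_on (P q) (closure V)"
proof (rule inj_onI)
  fix y y' assume q: "q \<in> closure W" and y: "y \<in> closure V" "y' \<in> closure V" "P q y = P q y'"
  then have "Dx U V c (X q) y = Dx U V c (X q) y'" using Hb_P[OF q, of y] Hb_P[OF q, of y'] by simp
  then show "y = y'" by (rule Dx_inj[OF Dy_X(2)[OF q] y(1,2)])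
qed

lemma P_image_convex:
  assumes "convex ((\<lambda>y. - Dx U V c (X q) y) ` S)" shows "convex (P q ` S)"
proof -
  have neg: "Hi q *v (- v) = - (Hi q *v v)" for v
    using matrix_vector_mult_scaleR[of "Hi q" "-1" v] by simp
  have "linear (\<lambda>v. - (Hi q *v v))" by (intro linear_compose_neg matrix_vector_mul_linear)
  from convex_translation[OF convex_linear_image[OF this assms], of "- (Hi q *v Dx U V c (X q) y0)"]
  show ?thesis by (simp add: image_image P_def slope_def matrix_vector_mult_diff_distrib neg)
qed

lemma P_cont: "continuous_on (closure W \<times> closure V) (\<lambda>(q, y). P q y)"
  unfolding continuous_on_def
proof
  fix z assume z: "z \<in> closure W \<times> closure V"
  obtain q y where zq: "z = (q, y)" "q \<in> closure W" "y \<in> closure V" using z by auto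
  let ?G = "at z within closure W \<times> closure V"
  have lim: "(fst \<longlongrightarrow> q) ?G" "(snd \<longlongrightarrow> y) ?G"
    using tendsto_fst[OF tendsto_ident_at] tendsto_snd[OF tendsto_ident_at] zq(1) by (metis fst_conv, metis snd_conv)
  have ev: "\<forall>\<^sub>F t in ?G. t \<in> closure W \<times> closure V" by (simp add: eventually_at_filter)
  have evq: "\<forall>\<^sub>F t in ?G. fst t \<in> closure W" using ev by (rule eventually_mono) auto
  have evs: "\<forall>\<^sub>F t in ?G. X (fst t) \<in> closure U \<and> snd t \<in> closure V \<and> y0 \<in> closure V"
    using ev y0 by (auto elim!: eventually_mono simp: Dy_X)
  have "((\<lambda>t. P (fst t) (snd t)) \<longlongrightarrow> P q y) ?G"
    unfolding P_def by (rule slope_tendsto[OF X_tendsto[OF lim(1) zq(2) evq] lim(2) tendsto_const Dy_X(2)[OF zq(2)] zq(3) y0 evs])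
  then show "((\<lambda>(q, y). P q y) \<longlongrightarrow> (case z of (q, y) \<Rightarrow> P q y)) ?G" by (simp add: zq(1) case_prod_unfold)
qed

lemma \<psi>_cont: "continuous_on (closure W \<times> closure V) (\<lambda>(q, y). \<psi> q y)"
proof -
  have X: "continuous_on (closure W \<times> closure V) (\<lambda>z. X (fst z))"
    by (rule continuous_on_compose2[OF X_cont]) (auto intro: continuous_intros)
  have "continuous_on (closure W \<times> closure V) (\<lambda>z. (\<lambda>(x, y). c x y) (X (fst z), y0) - (\<lambda>(x, y). c x y) (X (fst z), snd z))"
    by (intro continuous_on_diff continuous_on_compose2[OF c_cont] continuous_on_Pair X continuous_on_const continuous_on_snd continuous_on_id)
      (auto simp: Dy_X y0)
  then show ?thesis by (simp add: \<psi>_def case_prod_unfold)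
qed

lemma max_principle_W:
  assumes q: "q0 \<in> W" "q \<in> W" and y: "y \<in> closure V" "y1 \<in> closure V" "y2 \<in> closure V"
    and seg: "P q0 y \<in> closed_segment (P q0 y1) (P q0 y2)"
  shows "\<psi> q y - \<psi> q0 y \<le> max (\<psi> q y1 - \<psi> q0 y1) (\<psi> q y2 - \<psi> q0 y2)"
proof -
  let ?D = "Dx U V c (X q0)"
  obtain \<theta> where \<theta>: "0 \<le> \<theta>" "\<theta> \<le> 1" "P q0 y = (1 - \<theta>) *\<^sub>R P q0 y1 + \<theta> *\<^sub>R P q0 y2"
    using seg by (auto simp: closed_segment_def)
  have "?D y - ?D y0 = Hb (X q0) y0 *v P q0 y" by (rule Hb_P[OF W_closure[OF q(1)], symmetric])
  also have "\<dots> = (1 - \<theta>) *\<^sub>R (Hb (X q0) y0 *v P q0 y1) + \<theta> *\<^sub>R (Hb (X q0) y0 *v P q0 y2)"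
    by (simp only: \<theta>(3) matrix_vector_right_distrib matrix_vector_mult_scaleR)
  also have "\<dots> = (1 - \<theta>) *\<^sub>R (?D y1 - ?D y0) + \<theta> *\<^sub>R (?D y2 - ?D y0)" by (simp only: Hb_P[OF W_closure[OF q(1)]])
  finally have "?D y = (1 - \<theta>) *\<^sub>R ?D y1 + \<theta> *\<^sub>R ?D y2" by (simp add: algebra_simps)
  then have "?D y \<in> closed_segment (?D y1) (?D y2)" using \<theta> by (auto simp: closed_segment_def)
  from max_principle_closure[OF X_U[OF q(1)] X_U[OF q(2)] y this] show ?thesis by (simp add: \<psi>_def max_def split: if_splits)
qed

lemma quasiconvex_W:
  assumes q: "q1 \<in> W" "q2 \<in> W" and y: "y \<in> closure V" and seg: "q \<in> closed_segment q1 q2"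
  shows "\<psi> q y \<le> max (\<psi> q1 y) (\<psi> q2 y)"
proof -
  have "closed_segment q1 q2 \<subseteq> W" by (rule closed_segment_subset[OF q U_at_convex[OF y0]])
  then have qW: "q \<in> W" using seg by blast
  have D: "Dy U V c (X q') y0 = - q'" if "q' \<in> W" for q' using Dy_X(1)[OF W_closure[OF that]] by (metis add.inverse_inverse)
  obtain \<theta> where \<theta>: "0 \<le> \<theta>" "\<theta> \<le> 1" "q = (1 - \<theta>) *\<^sub>R q1 + \<theta> *\<^sub>R q2" using seg by (auto simp: closed_segment_def)
  have "- q = (1 - \<theta>) *\<^sub>R (- q1) + \<theta> *\<^sub>R (- q2)" by (simp add: \<theta>(3))
  then have "- q \<in> closed_segment (- q1) (- q2)" using \<theta> unfolding closed_segment_def by blast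
  then have "Dy U V c (X q) y0 \<in> closed_segment (Dy U V c (X q1) y0) (Dy U V c (X q2) y0)" by (simp only: D qW q)
  from quasiconvex_closure[OF X_U[OF qW] X_U[OF q(1)] X_U[OF q(2)] y0 y this] show ?thesis by (simp add: \<psi>_def)
qed

lemma potential_modified_cost:
  assumes K: "K \<ge> 0" "\<forall>x\<in>U. \<forall>x'\<in>U. \<forall>y0\<in>closure V. \<forall>y\<in>closure V.
    norm (slope y0 x y - slope y0 x' y) \<le> K * norm (Dy U V c x y0 - Dy U V c x' y0) * norm (slope y0 x' y)"
  shows "potential W (closure V) \<psi> P y0 K"
proof
  show "open W" "convex W" "compact (closure V)" "y0 \<in> closure V" "K \<ge> 0"
    by (rule open_W, rule U_at_convex[OF y0], rule compact_V, rule y0, rule K(1))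
  have "compact (closure W)" unfolding closure_W by (rule compact_continuous_image[OF cont_Dy compact_U])
  then show "bounded W" by (meson bounded_subset closure_subset compact_imp_bounded)
  show "continuous_on (closure W \<times> closure V) (\<lambda>(q, y). \<psi> q y)" by (rule \<psi>_cont)
  show "continuous_on (W \<times> closure V) (\<lambda>(q, y). P q y)"
    by (rule continuous_on_subset[OF P_cont]) (use W_closure in blast)
  show "\<psi> q y0 = 0" for q by (simp add: \<psi>_def)
  show "((\<lambda>q. \<psi> q y) has_derivative (\<lambda>v. P q y \<bullet> v)) (at q)" if "q \<in> W" "y \<in> closure V" for q y by (rule \<psi>_deriv[OF that])
  show "inj_on (P q) (closure V)" if "q \<in> W" for q by (rule P_inj[OF W_closure[OF that]])
  show "convex (P q ` closure V)" if "q \<in> W" for q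
    by (rule P_image_convex[OF range_convex_y[OF Dy_X(2)[OF W_closure[OF that]]]])
  show "\<psi> q y - \<psi> q0 y \<le> max (\<psi> q y1 - \<psi> q0 y1) (\<psi> q y2 - \<psi> q0 y2)"
    if "q0 \<in> W" "q \<in> W" "y \<in> closure V" "y1 \<in> closure V" "y2 \<in> closure V" "P q0 y \<in> closed_segment (P q0 y1) (P q0 y2)" for q q0 y y1 y2
    by (rule max_principle_W[OF that])
  show "\<psi> q y \<le> max (\<psi> q1 y) (\<psi> q2 y)" if "q1 \<in> W" "q2 \<in> W" "y \<in> closure V" "q \<in> closed_segment q1 q2" for q q1 q2 y
    by (rule quasiconvex_W[OF that])
  show "norm (P q y - P q' y) \<le> K * norm (q - q') * norm (P q' y)" if "q \<in> W" "q' \<in> W" "y \<in> closure V" for q q' y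
  proof -
    have D: "Dy U V c (X q') y0 = - q'" if "q' \<in> W" for q' using Dy_X(1)[OF W_closure[OF that]] by (metis add.inverse_inverse)
    have "norm (Dy U V c (X q) y0 - Dy U V c (X q') y0) = norm (q - q')" unfolding D[OF that(1)] D[OF that(2)] using norm_minus_commute[of q q'] by simp
    then show ?thesis using K(2)[rule_format, OF X_U[OF that(1)] X_U[OF that(2)] y0 that(3)] by (simp add: P_def)
  qed
qed

lemma P_volume:
  assumes q: "q \<in> W" and g: "\<forall>y\<in>V. J q y \<le> g" and S: "compact S" "S \<subseteq> closure V"
  shows "emeasure lebesgue (P q ` S) \<le> ennreal g * emeasure lebesgue S"
proof -
  have cP: "continuous_on (closure V) (P q)"
  proof -
    have "continuous_on (closure V) (\<lambda>y. (\<lambda>(q, y). P q y) (q, y))"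
      by (rule continuous_on_compose2[OF P_cont]) (auto intro!: continuous_intros W_closure q)
    then show ?thesis by simp
  qed
  have inj: "inj_on (P q) (closure V)" by (rule P_inj[OF W_closure[OF q]])
  have VS: "V \<subseteq> closure V" by (rule closure_subset)
  define C where "C = P q ` V"
  have "open C" unfolding C_def
    by (rule invariance_of_domain[OF continuous_on_subset[OF cP VS] open_V inj_on_subset[OF inj VS]])
  have "convex C" unfolding C_def using V_at_convex[OF Dy_X(2)[OF W_closure[OF q]]] by (intro P_image_convex) (simp add: V_at_def)
  have clC: "closure C = P q ` closure V" unfolding C_def by (rule closure_image_compact[OF bounded_V cP])
  have "negligible (frontier C)" by (rule negligible_convex_frontier[OF \<open>convex C\<close>])
  moreover have "P q ` (S - V) \<subseteq> frontier C"
  proof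
    fix p assume "p \<in> P q ` (S - V)"
    then obtain y where y: "y \<in> S" "y \<notin> V" "p = P q y" by blast
    have "p \<notin> C"
    proof
      assume "p \<in> C"
      then obtain y' where "y' \<in> V" "P q y = P q y'" unfolding C_def y(3) by blast
      then have "y = y'" using inj_onD[OF inj, of y y'] y(1) S(2) VS by blast
      then show False using \<open>y' \<in> V\<close> y(2) by simp
    qed
    moreover have "p \<in> closure C" unfolding clC y(3) using y(1) S(2) by blast
    ultimately show "p \<in> frontier C" unfolding frontier_def interior_open[OF \<open>open C\<close>] by blast
  qed
  ultimately have null: "P q ` (S - V) \<in> null_sets lebesgue"
    using negligible_subset negligible_iff_null_sets by blast
  have comp: "compact (P q ` S)" "compact (P q ` (S - V))"
    using compact_diff[OF S(1) open_V] S by (auto intro!: compact_continuous_image continuous_on_subset[OF cP])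
  have split: "P q ` S = P q ` (S \<inter> V) \<union> P q ` (S - V)" by blast
  have "P q ` (S \<inter> V) = P q ` S - P q ` (S - V)"
    using inj_on_image_set_diff[OF inj, of S "S - V"] S(2) by (simp add: Diff_Diff_Int subset_iff)
  then have borel: "P q ` (S \<inter> V) \<in> sets borel" using comp by (simp add: sets.Diff borel_closed compact_imp_closed)
  have "emeasure lebesgue (P q ` S) = emeasure lebesgue (P q ` (S \<inter> V))"
    unfolding split by (rule emeasure_Un_null_set[OF _ null]) (use borel in simp)
  also have "\<dots> \<le> ennreal g * emeasure lebesgue (S \<inter> V)"
  proof (rule emeasure_differentiable_image_le[OF _ _ borel])
    show "S \<inter> V \<in> sets borel" using S(1) open_V by (simp add: borel_closed compact_imp_closed sets.Int)
    show "bounded (S \<inter> V)" using S(1) compact_imp_bounded by (auto intro: bounded_Int)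
    show "(P q has_derivative (\<lambda>w. (Hi q ** H (X q) y) *v w)) (at y)" if "y \<in> S \<inter> V" for y
      by (rule P_derivative_y[OF q]) (use that in simp)
    have "continuous_on (S \<inter> V) (\<lambda>y. det (Hi q) * det (Hb (X q) y))"
      by (intro continuous_on_mult continuous_on_const continuous_on_det continuous_on_component continuous_on_subset[OF cont_section_y[OF Hb_cont]])
        (use VS U_closure[OF X_U[OF q]] in auto)
    then show "continuous_on (S \<inter> V) (\<lambda>y. det (matrix ((*v) (Hi q ** H (X q) y))))"
      by (rule continuous_on_eq) (simp add: det_mul Hb_eq[OF X_U[OF q]])
    show "\<bar>det (matrix ((*v) (Hi q ** H (X q) y)))\<bar> \<le> g" if "y \<in> S \<inter> V" for y
      using g that det_P[OF q, of y] by simp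
  qed
  also have "\<dots> \<le> ennreal g * emeasure lebesgue S"
    by (intro mult_left_mono emeasure_mono) (use S(1) in \<open>auto simp: compact_imp_closed borel_closed\<close>)
  finally show ?thesis .
qed

end

section \<open>Convex functions in the modified coordinates and the constants \<gamma>\<close>

context cost_domain
begin

text \<open>The supremum defining the double transform is attained up to 1/(k+1) at some y_k, and a
  limit point of these in the compact set closure V supports \<open>u\<close> at \<open>x\<close>.
  The transform may be infinite a priori; the strict inequality for y_k rules out the harmful
  case.\<close>

lemma subdifferential_exists:
  assumes u: "c_convex (closure U) (closure V) c u" and x: "x \<in> closure U"
  shows "\<exists>y\<in>closure V. \<forall>x'\<in>closure U. u x + c x y - c x' y \<le> u x'"
proof -
  define us where "us = c_star_transform (closure U) c (\<lambda>x'. ereal (u x'))"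
  have us: "ereal (- c x' y - u x') \<le> us y" if "x' \<in> closure U" for x' y
    using SUP_upper[OF that, of "\<lambda>x'. - ereal (c x' y) - ereal (u x')"] by (simp add: us_def c_star_transform_def)
  have "\<exists>y. y \<in> closure V \<and> (\<forall>x'\<in>closure U. u x + c x y - c x' y \<le> u x' + inverse (real (Suc k)))" for k
  proof -
    have "ereal (u x - inverse (real (Suc k))) < ereal (u x)" by simp
    also have "ereal (u x) = (SUP y\<in>closure V. - ereal (c x y) - us y)"
      using u x by (simp add: c_convex_def c_transform_def us_def)
    finally obtain y where y: "y \<in> closure V" "ereal (u x - inverse (real (Suc k))) < - ereal (c x y) - us y"
      unfolding less_SUP_iff by blast
    have "u x + c x y - c x' y \<le> u x' + inverse (real (Suc k))" if x': "x' \<in> closure U" for x'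
      using us[OF x', of y] y(2) by (cases "us y") auto
    with y(1) show ?thesis by blast
  qed
  then obtain y where y: "\<And>k. y k \<in> closure V" "\<And>k x'. x' \<in> closure U \<Longrightarrow> u x + c x (y k) - c x' (y k) \<le> u x' + inverse (real (Suc k))"
    by metis
  obtain r l where r: "strict_mono r" "l \<in> closure V" "(y \<circ> r) \<longlonglongrightarrow> l"
    by (rule convergent_subsequence_in_compact[OF compact_V y(1)])
  have yr: "(\<lambda>k. y (r k)) \<longlonglongrightarrow> l" using r(3) by (simp add: comp_def)
  have "u x + c x l - c x' l \<le> u x'" if x': "x' \<in> closure U" for x'
  proof (rule LIMSEQ_le)
    show "(\<lambda>k. u x + c x (y (r k)) - c x' (y (r k))) \<longlonglongrightarrow> u x + c x l - c x' l"
      by (intro tendsto_diff tendsto_add closure_tendsto[OF c_cont] tendsto_const yr x x' r(2)) (simp_all add: x x' y)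
    have "(\<lambda>k. inverse (real (Suc k))) \<longlonglongrightarrow> 0" by (rule LIMSEQ_inverse_real_of_nat)
    from tendsto_add[OF tendsto_const LIMSEQ_subseq_LIMSEQ[OF this r(1)], of "u x'"]
    show "(\<lambda>k. u x' + inverse (real (Suc (r k)))) \<longlonglongrightarrow> u x'" by (simp add: comp_def)
    show "\<exists>N. \<forall>k\<ge>N. u x + c x (y (r k)) - c x' (y (r k)) \<le> u x' + inverse (real (Suc (r k)))"
      using y(2)[OF x'] by blast
  qed
  with r(2) show ?thesis by blast
qed

end

text \<open>A supporting function at a point of the segment is quasiconvex, hence at one of the two
  end points it is at least as large as at the point. There it lies below \<open>u\<close>, which is
  nonpositive.\<close>

lemma (in potential_convex_fun) sublevel_convex:
  assumes "{q \<in> closure W. u q \<le> 0} \<subseteq> W" shows "convex {q \<in> closure W. u q \<le> 0}"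
proof (rule convexI)
  fix q1 q2 :: "real^'n" and a b :: real
  assume q: "q1 \<in> {q \<in> closure W. u q \<le> 0}" "q2 \<in> {q \<in> closure W. u q \<le> 0}" and ab: "0 \<le> a" "0 \<le> b" "a + b = 1"
  have qW: "q1 \<in> W" "q2 \<in> W" using assms q by blast+
  define p where "p = a *\<^sub>R q1 + b *\<^sub>R q2"
  have a: "a = 1 - b" using ab by simp
  have seg: "p \<in> closed_segment q1 q2" unfolding closed_segment_def p_def a using ab by auto
  have p: "p \<in> closure W" using convexD[OF W(2) qW ab] W_closure by (simp add: p_def)
  from subdiff_ex[OF p] obtain y where y: "y \<in> Y" "\<forall>q'\<in>closure W. u p + \<psi> q' y - \<psi> p y \<le> u q'" by blast
  have "\<psi> p y \<le> max (\<psi> q1 y) (\<psi> q2 y)" by (rule quasiconvex[OF qW y(1) seg])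
  moreover have "u p + \<psi> q1 y - \<psi> p y \<le> 0" "u p + \<psi> q2 y - \<psi> p y \<le> 0" using y(2) q by force+
  ultimately have "u p \<le> 0" by linarith
  then show "a *\<^sub>R q1 + b *\<^sub>R q2 \<in> {q \<in> closure W. u q \<le> 0}" using p by (simp add: p_def)
qed

context cost_domain_at
begin

lemma modified_fun_subdifferential:
  assumes u: "c_convex (closure U) (closure V) c u" and q: "q \<in> closure W"
  shows "\<exists>y\<in>closure V. \<forall>q'\<in>closure W. modified_fun U V c y0 u q + \<psi> q' y - \<psi> q y \<le> modified_fun U V c y0 u q'"
proof -
  obtain y where y: "y \<in> closure V" "\<forall>x'\<in>closure U. u (X q) + c (X q) y - c x' y \<le> u x'"
    using subdifferential_exists[OF u Dy_X(2)[OF q]] by blast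
  have "modified_fun U V c y0 u q + \<psi> q' y - \<psi> q y \<le> modified_fun U V c y0 u q'" if "q' \<in> closure W" for q'
    using y(2)[rule_format, OF Dy_X(2)[OF that]] by (simp add: modified_fun_def \<psi>_def)
  with y(1) show ?thesis by blast
qed

text \<open>Removes extended reals: a sum of three terms that is zero forces the transform to be
  finite, and the equation then says that the supremum is attained at \<open>q\<close>.\<close>

lemma c_subdiff_eq:
  assumes q: "q \<in> closure W"
  shows "c_subdiff (closure W) (closure V) ct v q = {y \<in> closure V. \<forall>q'\<in>closure W. v q + \<psi> q' y - \<psi> q y \<le> v q'}"
proof -
  have "ereal (v q) + c_star_transform (closure W) ct (\<lambda>x'. ereal (v x')) y + ereal (ct q y) = 0 \<longleftrightarrow>
    (\<forall>q'\<in>closure W. v q + \<psi> q' y - \<psi> q y \<le> v q')" for y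
  proof -
    define s where "s = c_star_transform (closure W) ct (\<lambda>x'. ereal (v x')) y"
    have s: "s = (SUP q'\<in>closure W. ereal (\<psi> q' y - v q'))"
      by (simp add: s_def c_star_transform_def ct_\<psi>)
    have up: "ereal (\<psi> q' y - v q') \<le> s" if "q' \<in> closure W" for q' unfolding s by (rule SUP_upper[OF that])
    have "ereal (v q) + s + ereal (ct q y) = 0 \<longleftrightarrow> s = ereal (\<psi> q y - v q)"
      by (cases s) (auto simp: ct_\<psi>)
    also have "\<dots> \<longleftrightarrow> (\<forall>q'\<in>closure W. v q + \<psi> q' y - \<psi> q y \<le> v q')"
    proof
      assume "s = ereal (\<psi> q y - v q)"
      then show "\<forall>q'\<in>closure W. v q + \<psi> q' y - \<psi> q y \<le> v q'" using up by (force simp: algebra_simps)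
    next
      assume *: "\<forall>q'\<in>closure W. v q + \<psi> q' y - \<psi> q y \<le> v q'"
      have "s \<le> ereal (\<psi> q y - v q)" unfolding s by (rule SUP_least) (use * in \<open>force simp: algebra_simps\<close>)
      then show "s = ereal (\<psi> q y - v q)" using up[OF q] by (rule antisym)
    qed
    finally show ?thesis unfolding s_def .
  qed
  then show ?thesis unfolding c_subdiff_def by simp
qed

text \<open>An essential supremum over Q \<times> V controls single values only at interior points
  of \<open>Q\<close>. That is enough, since the Jacobian is needed at a point where the function is
  negative, and such points are interior.\<close>

lemma le_gamma:
  assumes Q: "Q \<in> sets borel" "Q \<subseteq> W" and q: "q \<in> interior Q" and y: "y \<in> V"
  shows "ennreal (J q y) \<le> gamma_plus ct (Q \<times> V)"
proof -
  have Qi: "interior Q \<subseteq> Q" by (rule interior_subset)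
  let ?g = "\<lambda>(x, y). ennreal \<bar>det (mixed_hessian ct x y)\<bar>"
  have "?g (q, y) \<le> esssup (restrict_space lborel (Q \<times> V)) ?g"
  proof (rule le_esssup_on_open[of _ "interior Q \<times> V" "\<lambda>(q, y). J q y"])
    show "Q \<times> V \<in> sets borel" using Q open_V by (intro borel_Times) auto
    show "open (interior Q \<times> V)" by (intro open_Times open_interior open_V)
    show "interior Q \<times> V \<subseteq> Q \<times> V" using Qi by blast
    show "continuous_on (interior Q \<times> V) (\<lambda>(q, y). J q y)"
      by (rule continuous_on_subset[OF J_cont]) (use Q Qi W_closure V_closure in blast)
    show "\<forall>z\<in>interior Q \<times> V. ?g z = ennreal ((\<lambda>(q, y). J q y) z)" using Q Qi by (auto simp: det_ct)
    show "(q, y) \<in> interior Q \<times> V" using q y by simp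
  qed
  then show ?thesis using det_ct[of q y] q y Q Qi by (auto simp: gamma_plus_def)
qed

lemma gamma_measurable:
  assumes Q: "Q \<in> sets borel" "Q \<subseteq> W"
  shows "(\<lambda>(q, y). ennreal \<bar>det (mixed_hessian ct q y)\<bar>) \<in> borel_measurable (restrict_space lborel (Q \<times> V))"
proof -
  have "continuous_on (Q \<times> V) (\<lambda>z. ennreal (case z of (q, y) \<Rightarrow> J q y))"
    by (intro continuous_on_ennreal continuous_on_subset[OF J_cont]) (use Q W_closure V_closure in blast)
  then have "(\<lambda>z. ennreal (case z of (q, y) \<Rightarrow> J q y)) \<in> borel_measurable (restrict_space borel (Q \<times> V))"
    by (rule borel_measurable_continuous_on_restrict)
  moreover have "sets (restrict_space lborel (Q \<times> V)) = sets (restrict_space (borel :: ((real^'n) \<times> (real^'n)) measure) (Q \<times> V))"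
    by (rule sets_restrict_space_cong) simp
  ultimately have "(\<lambda>z. ennreal (case z of (q, y) \<Rightarrow> J q y)) \<in> borel_measurable (restrict_space lborel (Q \<times> V))"
    by (simp cong: measurable_cong_sets)
  then show ?thesis
    by (rule measurable_cong[THEN iffD1, rotated]) (use Q in \<open>auto simp: space_restrict_space det_ct\<close>)
qed

lemma gamma_finite:
  assumes Q: "Q \<in> sets borel" "Q \<subseteq> W" shows "gamma_plus ct (Q \<times> V) < \<infinity>"
proof -
  have "compact (closure W)" unfolding closure_W by (rule compact_continuous_image[OF cont_Dy compact_U])
  then have "compact ((\<lambda>(q, y). J q y) ` (closure W \<times> closure V))"
    by (intro compact_continuous_image J_cont compact_Times compact_V)
  then obtain B where B: "\<forall>z\<in>(\<lambda>(q, y). J q y) ` (closure W \<times> closure V). norm z \<le> B"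
    using compact_imp_bounded bounded_iff by blast
  have "gamma_plus ct (Q \<times> V) \<le> ennreal B"
    unfolding gamma_plus_def
  proof (rule esssup_I[OF gamma_measurable[OF Q]], rule AE_I2)
    fix z assume "z \<in> space (restrict_space lborel (Q \<times> V))"
    then obtain q y where z: "z = (q, y)" "q \<in> W" "y \<in> V" using Q by (auto simp: space_restrict_space)
    have "norm (J q y) \<le> B" using B z W_closure V_closure by blast
    then show "(case z of (q, y) \<Rightarrow> ennreal \<bar>det (mixed_hessian ct q y)\<bar>) \<le> ennreal B"
      by (simp add: z det_ct ennreal_leI)
  qed
  also have "\<dots> < \<infinity>" by simp
  finally show ?thesis .
qed

text \<open>\<open>J\<close> is a quotient of the determinants of the mixed Hessian at (X q, y) and
  at (X q, y0). The first is a value in the interior; the second may belong to a boundary point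
  \<open>y0\<close>, so its reciprocal is bounded as a limit of interior values.\<close>

lemma gamma_le:
  assumes Q: "Q \<in> sets borel" "Q \<subseteq> W"
  shows "gamma_plus ct (Q \<times> V) \<le> gamma_plus c (U \<times> V) * gamma_minus c (U \<times> V)"
proof -
  have HbUV: "continuous_on (U \<times> V) (\<lambda>z. \<bar>det (case z of (x, y) \<Rightarrow> Hb x y)\<bar>)"
    by (intro continuous_on_rabs continuous_on_det continuous_on_component continuous_on_subset[OF Hb_cont])
      (use U_closure V_closure in blast)
  have plus: "ennreal \<bar>det (H x y)\<bar> \<le> gamma_plus c (U \<times> V)" if "x \<in> U" "y \<in> V" for x y
  proof -
    let ?g = "\<lambda>(x, y). ennreal \<bar>det (H x y)\<bar>"
    have "?g (x, y) \<le> esssup (restrict_space lborel (U \<times> V)) ?g"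
      by (rule le_esssup_on_open[OF _ open_UV order_refl HbUV]) (use that open_UV in \<open>auto simp: Hb_eq\<close>)
    then show ?thesis by (simp add: gamma_plus_def)
  qed
  have minus: "ennreal (1 / \<bar>det (H x y)\<bar>) \<le> gamma_minus c (U \<times> V)" if "x \<in> U" "y \<in> V" for x y
  proof -
    let ?g = "\<lambda>(x, y). inverse (ennreal \<bar>det (H x y)\<bar>)"
    have nz: "det (H x y) \<noteq> 0" if "x \<in> U" "y \<in> V" for x y
      using det_Hb[OF U_closure[OF that(1)] V_closure[OF that(2)]] that by (simp add: Hb_eq)
    have "continuous_on (U \<times> V) (\<lambda>z. 1 / \<bar>det (case z of (x, y) \<Rightarrow> Hb x y)\<bar>)"
      by (intro continuous_on_divide HbUV continuous_on_const) (auto simp: det_Hb U_closure V_closure)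
    from le_esssup_on_open[OF _ open_UV order_refl this, of ?g "(x, y)"]
    have "?g (x, y) \<le> esssup (restrict_space lborel (U \<times> V)) ?g"
      using that open_UV by (auto simp: Hb_eq nz inverse_ennreal inverse_eq_divide)
    then show ?thesis using nz[OF that] by (simp add: gamma_minus_def inverse_ennreal inverse_eq_divide)
  qed
  have minus': "ennreal (1 / \<bar>det (Hb x y0)\<bar>) \<le> gamma_minus c (U \<times> V)" if x: "x \<in> U" for x
  proof -
    obtain z where z: "\<And>k. z k \<in> V" "z \<longlonglongrightarrow> y0" using y0 unfolding closure_sequential by blast
    have lim: "(\<lambda>k. Hb x (z k)) \<longlonglongrightarrow> Hb x y0"
      by (rule closure_tendsto[OF Hb_cont tendsto_const z(2)]) (simp_all add: x y0 z U_closure V_closure)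
    have detc: "continuous_on UNIV (\<lambda>A :: real^'n^'n. det A)" by (intro continuous_on_det continuous_intros)
    have limd: "(\<lambda>k. det (Hb x (z k))) \<longlonglongrightarrow> det (Hb x y0)"
      by (rule continuous_on_tendsto_compose[OF detc lim]) simp_all
    have nz: "\<bar>det (Hb x y0)\<bar> \<noteq> 0" using det_Hb[OF U_closure[OF x] y0] by simp
    have "(\<lambda>k. ennreal (1 / \<bar>det (Hb x (z k))\<bar>)) \<longlonglongrightarrow> ennreal (1 / \<bar>det (Hb x y0)\<bar>)"
      by (rule tendsto_ennrealI[OF tendsto_divide[OF tendsto_const tendsto_rabs[OF limd] nz]])
    moreover have "\<forall>\<^sub>F k in sequentially. ennreal (1 / \<bar>det (Hb x (z k))\<bar>) \<le> gamma_minus c (U \<times> V)"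
      using minus[OF x z(1)] by (simp add: Hb_eq[OF x z(1)])
    ultimately show ?thesis by (rule tendsto_upperbound) simp
  qed
  show ?thesis
    unfolding gamma_plus_def[of ct]
  proof (rule esssup_I[OF gamma_measurable[OF Q]], rule AE_I2)
    fix z assume "z \<in> space (restrict_space lborel (Q \<times> V))"
    then obtain q y where z: "z = (q, y)" "q \<in> W" "y \<in> V" using Q by (auto simp: space_restrict_space)
    have "ennreal (J q y) = ennreal \<bar>det (H (X q) y)\<bar> * ennreal (1 / \<bar>det (Hb (X q) y0)\<bar>)"
      using z by (simp add: J_def Hb_eq X_U flip: ennreal_mult)
    also have "\<dots> \<le> gamma_plus c (U \<times> V) * gamma_minus c (U \<times> V)"
      by (intro mult_mono plus minus' X_U z) auto
    finally show "(case z of (q, y) \<Rightarrow> ennreal \<bar>det (mixed_hessian ct q y)\<bar>) \<le> gamma_plus c (U \<times> V) * gamma_minus c (U \<times> V)"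
      by (simp add: z det_ct)
  qed
qed

text \<open>Passes from the locale of potentials to the cost itself. A real number \<open>g\<close>
  stands for the finite \<gamma>, and the estimate is left open in the frame \<open>w\<close> and
  the widths \<open>d\<close>, so that the boundary estimate and the estimate of the infimum can
  insert different frames.\<close>

lemma section_frame_estimate:
  fixes u :: "real^'n \<Rightarrow> real"
  defines "ut \<equiv> modified_fun U V c y0 u" and "Q \<equiv> {q \<in> closure W. modified_fun U V c y0 u q \<le> 0}"
  assumes K: "K \<ge> 0" "\<forall>x\<in>U. \<forall>x'\<in>U. \<forall>y0\<in>closure V. \<forall>y\<in>closure V.
    norm (slope y0 x y - slope y0 x' y) \<le> K * norm (Dy U V c x y0 - Dy U V c x' y0) * norm (slope y0 x' y)"
    and u: "c_convex (closure U) (closure V) c u"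
    and lam: "lam > 0" and QW: "Q \<subseteq> W" and MA: "c_MA_le (closure W) (closure V) ct ut (1 / lam) Q"
    and bd: "\<forall>q\<in>frontier Q. ut q = 0" and ball: "\<exists>b r. 0 < r \<and> Q \<subseteq> ball b r \<and> ball b (4 * r) \<subseteq> W"
    and \<eta>: "K * diameter Q \<le> \<eta>" "\<eta> \<le> 1/2"
      "\<forall>w e. orthonormal_frame (w :: 'n \<Rightarrow> real^'n) \<longrightarrow> (\<forall>i. norm (e i) \<le> 2 * \<eta>) \<longrightarrow> \<bar>det (\<chi> i. w i + e i)\<bar> \<ge> 1/2"
  shows "\<exists>g. gamma_plus ct (Q \<times> V) = ennreal g \<and> g \<ge> 0 \<and> compact Q \<and> convex Q \<and> continuous_on Q ut \<and>
    (\<forall>q\<in>Q. ut q < 0 \<longrightarrow> q \<in> interior Q) \<and>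
    (\<forall>q\<in>Q. ut q < 0 \<longrightarrow> (\<forall>w d. orthonormal_frame (w :: 'n \<Rightarrow> real^'n) \<longrightarrow> (\<forall>i. \<forall>x\<in>Q. w i \<bullet> (x - q) \<le> d i) \<longrightarrow>
      (- ut q) ^ CARD('n) \<le> 2 * 4 ^ CARD('n) / simplex_content TYPE('n) * (\<Prod>i\<in>UNIV. d i) * (g * (1 / lam) * measure lebesgue Q)))"
proof -
  have pot: "potential W (closure V) \<psi> P y0 K" by (rule potential_modified_cost[OF K])
  have fn: "potential_convex_fun W (closure V) \<psi> P y0 K ut"
    unfolding potential_convex_fun_def potential_convex_fun_axioms_def ut_def
    using pot modified_fun_subdifferential[OF u] by blast
  note u_cont = potential_convex_fun.u_cont[OF fn]
  have Qdef: "Q = {q \<in> closure W. ut q \<le> 0}" by (simp add: Q_def ut_def)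
  have cu: "continuous_on Q ut" by (rule continuous_on_subset[OF u_cont]) (auto simp: Qdef)
  have Qeq: "Q = closure W \<inter> ut -` {..0}" by (auto simp: Qdef)
  have "closed Q" unfolding Qeq by (rule continuous_closed_preimage[OF u_cont]) auto
  then have "compact (closure W \<inter> Q)" by (rule compact_Int_closed[OF potential.compact_closure_W[OF pot]])
  moreover have "closure W \<inter> Q = Q" unfolding Qeq by blast
  ultimately have cQ: "compact Q" by simp
  have Qb: "Q \<in> sets borel" using \<open>closed Q\<close> by (rule borel_closed)
  have cvx: "convex Q" unfolding Qdef by (rule potential_convex_fun.sublevel_convex[OF fn]) (use QW in \<open>simp add: Qdef\<close>)
  define g where "g = enn2real (gamma_plus ct (Q \<times> V))"
  have g: "gamma_plus ct (Q \<times> V) = ennreal g" "g \<ge> 0" using gamma_finite[OF Qb QW] by (simp_all add: g_def)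
  have sec: "potential_section W (closure V) \<psi> P y0 K ut Q q (- ut q)" if "q \<in> Q" "ut q < 0" for q
    unfolding potential_section_def potential_section_axioms_def
    by (intro conjI allI impI fn Qdef QW ball that bspec[OF bd]) (use that in auto)
  have int: "q \<in> interior Q" if "q \<in> Q" "ut q < 0" for q by (rule potential_section.qt_interior[OF sec[OF that]])
  have MA': "emeasure lebesgue (\<Union>q\<in>Q. potential_convex_fun.sub W (closure V) \<psi> ut q) \<le> ennreal (1 / lam) * emeasure lebesgue Q"
  proof -
    have "potential_convex_fun.sub W (closure V) \<psi> ut q = c_subdiff (closure W) (closure V) ct ut q" if "q \<in> Q" for q
      unfolding potential_convex_fun.sub_def[OF fn] by (rule c_subdiff_eq[symmetric]) (use that in \<open>simp add: Qdef\<close>)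
    then have "(\<Union>q\<in>Q. potential_convex_fun.sub W (closure V) \<psi> ut q) = (\<Union>q\<in>Q. c_subdiff (closure W) (closure V) ct ut q)"
      by (intro SUP_cong refl)
    moreover have "emeasure lebesgue (\<Union>q\<in>Q. c_subdiff (closure W) (closure V) ct ut q) \<le> ennreal (1 / lam) * emeasure lebesgue Q"
      using MA Qb unfolding c_MA_le_def c_MA_measure_def by blast
    ultimately show ?thesis by (simp only:)
  qed
  have est: "(- ut q) ^ CARD('n) \<le> 2 * 4 ^ CARD('n) / simplex_content TYPE('n) * (\<Prod>i\<in>UNIV. d i) * (g * (1 / lam) * measure lebesgue Q)"
    if q: "q \<in> Q" "ut q < 0" and w: "orthonormal_frame (w :: 'n \<Rightarrow> real^'n)" and d: "\<And>i x. x \<in> Q \<Longrightarrow> w i \<bullet> (x - q) \<le> d i" for q w d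
  proof (rule potential_section.frame_estimate[OF sec[OF q] w d \<eta>(1,2) \<eta>(3)[rule_format]])
    fix S assume S: "compact S" "S \<subseteq> closure V"
    have qW: "q \<in> W" using q QW by blast
    have "J q y \<le> g" if "y \<in> V" for y
      using le_gamma[OF Qb QW int[OF q] that] g by simp
    then show "emeasure lebesgue (P q ` S) \<le> ennreal g * emeasure lebesgue S"
      by (intro P_volume[OF qW _ S]) blast
  qed (use MA' lam g in auto)
  show ?thesis using g cQ cvx cu int est by (intro exI[of _ g] conjI ballI allI impI) blast+
qed

end

section \<open>Choice of the constants and the two final estimates\<close>

theorem theorem6p11:
  shows "\<exists>C>0. \<forall>(U :: (real^'n) set) (V :: (real^'n) set) (c :: 'n cost).
    B0 U V c \<and> B1 U V c \<and> B2 U V c \<and> B3 U V c \<longrightarrow>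
    (\<exists>\<epsilon>>0. \<forall>y0\<in>closure V. \<forall>u. c_convex (closure U) (closure V) c u \<longrightarrow>
      (let Uy = U_at U V c y0;
           ct = modified_cost U V c y0;
           ut = modified_fun U V c y0 u;
           Q = {q \<in> closure Uy. ut q \<le> 0};
           \<gamma> = gamma_plus ct (Q \<times> V)
       in \<forall>lam>0.
            Q \<subseteq> Uy \<and>
            c_MA_le (closure Uy) (closure V) ct ut (1 / lam) Q \<and>
            (\<forall>q\<in>frontier Q. ut q = 0) \<and>
            (\<exists>b r. 0 < r \<and> Q \<subseteq> ball b r \<and> ball b (4 * r) \<subseteq> Uy) \<and>
            diameter Q \<le> \<epsilon> \<longrightarrow>
            (\<forall>a E t q. john_ellipsoid Q a E \<and> 1 / (2 * real CARD('n)) < t \<and> t \<le> 1 \<and>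
               q \<in> Q \<and> q \<in> dilation a t (frontier Q) \<longrightarrow>
               ennreal (\<bar>ut q\<bar> ^ CARD('n))
                 \<le> ennreal C * (\<gamma> / ennreal lam)
                   * ennreal ((1 - t) powr (1 / 2 ^ (CARD('n) - 1)))
                   * ennreal ((measure lebesgue Q)\<^sup>2)) \<and>
            \<gamma> \<le> gamma_plus c (U \<times> V) * gamma_minus c (U \<times> V) \<and>
            ennreal (\<bar>INF q\<in>Q. ut q\<bar> ^ CARD('n) / (measure lebesgue Q)\<^sup>2)
              \<le> ennreal C * (\<gamma> / ennreal lam)))"
proof -
  let ?n = "CARD('n)"
  \<comment> \<open>\<open>A\<close> comes from the volume comparison, \<open>C1\<close> from the
    frame adapted to a boundary point and \<open>C2\<close> from the singular frame. All three
    depend on n only, and their combination \<open>C\<close> serves both estimates.\<close>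
  define A where "A = 2 * 4 ^ ?n / simplex_content TYPE('n)"
  define C1 where "C1 = 3 * real ?n ^ 2 * (2 * real ?n) ^ (?n - 1) / measure lebesgue (cball (0 :: real^'n) 1)"
  define C2 where "C2 = (2 * real ?n) ^ ?n / simplex_content TYPE('n)"
  define C where "C = A * (C1 + C2)"
  have A: "A > 0" and C2: "C2 > 0" using simplex_content_pos[where 'n = 'n] by (simp_all add: A_def C2_def)
  have C1: "C1 \<ge> 0" by (simp add: C1_def)
  have C: "C > 0" using A C1 C2 by (simp add: C_def)
  have AC: "A * C1 \<le> C" "A * C2 \<le> C" using A C1 C2 by (simp_all add: C_def algebra_simps)
  obtain \<eta> where \<eta>: "0 < \<eta>" "\<eta> \<le> 1/2"
    "\<forall>w e. orthonormal_frame (w :: 'n \<Rightarrow> real^'n) \<longrightarrow> (\<forall>i. norm (e i) \<le> 2 * \<eta>) \<longrightarrow> \<bar>det (\<chi> i. w i + e i)\<bar> \<ge> 1/2"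
    by (rule det_near_orthonormal, rule that, assumption, assumption) blast
  have "\<exists>\<epsilon>>0. \<forall>y0\<in>closure V. \<forall>u. c_convex (closure U) (closure V) c u \<longrightarrow>
      (let Uy = U_at U V c y0;
           ct = modified_cost U V c y0;
           ut = modified_fun U V c y0 u;
           Q = {q \<in> closure Uy. ut q \<le> 0};
           \<gamma> = gamma_plus ct (Q \<times> V)
       in \<forall>lam>0.
            Q \<subseteq> Uy \<and>
            c_MA_le (closure Uy) (closure V) ct ut (1 / lam) Q \<and>
            (\<forall>q\<in>frontier Q. ut q = 0) \<and>
            (\<exists>b r. 0 < r \<and> Q \<subseteq> ball b r \<and> ball b (4 * r) \<subseteq> Uy) \<and>
            diameter Q \<le> \<epsilon> \<longrightarrow>
            (\<forall>a E t q. john_ellipsoid Q a E \<and> 1 / (2 * real CARD('n)) < t \<and> t \<le> 1 \<and>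
               q \<in> Q \<and> q \<in> dilation a t (frontier Q) \<longrightarrow>
               ennreal (\<bar>ut q\<bar> ^ CARD('n))
                 \<le> ennreal C * (\<gamma> / ennreal lam)
                   * ennreal ((1 - t) powr (1 / 2 ^ (CARD('n) - 1)))
                   * ennreal ((measure lebesgue Q)\<^sup>2)) \<and>
            \<gamma> \<le> gamma_plus c (U \<times> V) * gamma_minus c (U \<times> V) \<and>
            ennreal (\<bar>INF q\<in>Q. ut q\<bar> ^ CARD('n) / (measure lebesgue Q)\<^sup>2)
              \<le> ennreal C * (\<gamma> / ennreal lam))"
    if B: "B0 U V c" "B1 U V c" "B2 U V c" "B3 U V c" for U V :: "(real^'n) set" and c :: "'n cost"
  \<comment> \<open>If V is empty there is no \<open>y0\<close>, and if U is empty the image of U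
    cannot contain a ball of positive radius; either way nothing is left to prove.\<close>
  proof (cases "U = {} \<or> V = {}")
    case True
    then have "U_at U V c y0 = {} \<or> closure V = {}" for y0 by (auto simp: U_at_def)
    moreover have "ball b (4 * r) \<noteq> {}" if "0 < r" for b :: "real^'n" and r :: real using that by simp
    ultimately show ?thesis unfolding Let_def by (intro exI[of _ 1]) (metis empty_iff subset_empty zero_less_one)
  next
    case False
    interpret cost_domain U V c using B False by unfold_locales auto
    obtain K where K: "K \<ge> 0" "\<forall>x\<in>U. \<forall>x'\<in>U. \<forall>y0\<in>closure V. \<forall>y\<in>closure V.
      norm (slope y0 x y - slope y0 x' y) \<le> K * norm (Dy U V c x y0 - Dy U V c x' y0) * norm (slope y0 x' y)"
      by (rule slope_lipschitz)
    \<comment> \<open>The smallness threshold: it gives K diam(Q) \<le> \<eta>, and K + 1 in place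
      of \<open>K\<close> keeps the quotient defined when K = 0.\<close>
    define \<epsilon> where "\<epsilon> = \<eta> / (K + 1)"
    have \<epsilon>: "\<epsilon> > 0" using \<eta>(1) K(1) by (simp add: \<epsilon>_def)
    show ?thesis unfolding Let_def
    proof (intro exI[of _ \<epsilon>] conjI[OF \<epsilon>] ballI allI impI, elim conjE)
      fix y0 u lam
      assume y0: "y0 \<in> closure V" and u: "c_convex (closure U) (closure V) c u" and lam: "(0::real) < lam"
      define W where "W = U_at U V c y0"
      define ct where "ct = modified_cost U V c y0"
      define ut where "ut = modified_fun U V c y0 u"
      define Q where "Q = {q \<in> closure W. ut q \<le> 0}"
      note folds = W_def[symmetric] ct_def[symmetric] ut_def[symmetric] Q_def[symmetric]
      assume "{q \<in> closure (U_at U V c y0). modified_fun U V c y0 u q \<le> 0} \<subseteq> U_at U V c y0"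
        and "c_MA_le (closure (U_at U V c y0)) (closure V) (modified_cost U V c y0) (modified_fun U V c y0 u) (1 / lam)
          {q \<in> closure (U_at U V c y0). modified_fun U V c y0 u q \<le> 0}"
        and "\<forall>q\<in>frontier {q \<in> closure (U_at U V c y0). modified_fun U V c y0 u q \<le> 0}. modified_fun U V c y0 u q = 0"
        and "\<exists>b r. 0 < r \<and> {q \<in> closure (U_at U V c y0). modified_fun U V c y0 u q \<le> 0} \<subseteq> ball b r \<and> ball b (4 * r) \<subseteq> U_at U V c y0"
        and "diameter {q \<in> closure (U_at U V c y0). modified_fun U V c y0 u q \<le> 0} \<le> \<epsilon>"
      then have hyp: "Q \<subseteq> W" "c_MA_le (closure W) (closure V) ct ut (1 / lam) Q" "\<forall>q\<in>frontier Q. ut q = 0"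
        "\<exists>b r. 0 < r \<and> Q \<subseteq> ball b r \<and> ball b (4 * r) \<subseteq> W" and diam: "diameter Q \<le> \<epsilon>"
        unfolding folds by (simp_all only:)
      interpret at: cost_domain_at U V c y0 using y0 by unfold_locales
      have "K * diameter Q \<le> K * \<epsilon>" using diam K(1) by (rule mult_left_mono)
      also have "\<dots> \<le> \<eta>" using K(1) \<eta>(1) by (simp add: \<epsilon>_def field_simps)
      finally have diam': "K * diameter Q \<le> \<eta>" .
      have "\<exists>g. gamma_plus ct (Q \<times> V) = ennreal g \<and> g \<ge> 0 \<and> compact Q \<and> convex Q \<and> continuous_on Q ut \<and>
        (\<forall>q\<in>Q. ut q < 0 \<longrightarrow> q \<in> interior Q) \<and>
        (\<forall>q\<in>Q. ut q < 0 \<longrightarrow> (\<forall>w d. orthonormal_frame (w :: 'n \<Rightarrow> real^'n) \<longrightarrow> (\<forall>i. \<forall>x\<in>Q. w i \<bullet> (x - q) \<le> d i) \<longrightarrow>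
          (- ut q) ^ ?n \<le> A * (\<Prod>i\<in>UNIV. d i) * (g * (1 / lam) * measure lebesgue Q)))"
        unfolding A_def Q_def ut_def ct_def W_def
        by (rule at.section_frame_estimate[OF K u lam]) (use hyp diam' \<eta> in \<open>simp_all only: Q_def ut_def ct_def W_def\<close>)
      then obtain g where g: "gamma_plus ct (Q \<times> V) = ennreal g" "g \<ge> 0" and Q: "compact Q" "convex Q" "continuous_on Q ut"
        and int: "\<forall>q\<in>Q. ut q < 0 \<longrightarrow> q \<in> interior Q"
        and est: "\<forall>q\<in>Q. ut q < 0 \<longrightarrow> (\<forall>w d. orthonormal_frame (w :: 'n \<Rightarrow> real^'n) \<longrightarrow> (\<forall>i. \<forall>x\<in>Q. w i \<bullet> (x - q) \<le> d i) \<longrightarrow>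
          (- ut q) ^ ?n \<le> A * (\<Prod>i\<in>UNIV. d i) * (g * (1 / lam) * measure lebesgue Q))"
        by (elim exE conjE) (rule that)
      have G: "gamma_plus ct (Q \<times> V) / ennreal lam = ennreal (g / lam)" unfolding g(1) by (rule divide_ennreal[OF g(2) lam])
      have G0: "g / lam \<ge> 0" using g lam by simp
      let ?m = "measure lebesgue Q"
      have 1: "ennreal (\<bar>ut q\<bar> ^ ?n) \<le> ennreal C * (gamma_plus ct (Q \<times> V) / ennreal lam) * ennreal ((1 - t) powr (1 / 2 ^ (?n - 1))) * ennreal (?m\<^sup>2)"
        if j: "john_ellipsoid Q a E" and t: "1 / (2 * real ?n) < t" "t \<le> 1" and q: "q \<in> Q" "q \<in> dilation a t (frontier Q)" for a E t q
      proof (cases "ut q < 0")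
        case False
        then have "ut q = 0" using q(1) by (simp add: Q_def)
        then show ?thesis by (simp add: power_0_left)
      next
        case neg: True
        obtain z where z: "z \<in> frontier Q" "q = a + t *\<^sub>R (z - a)" using q(2) by (auto simp: dilation_def)
        \<comment> \<open>For t = 1 the point would lie on the frontier, where \<open>ut\<close>
          vanishes; the power estimates need 1 - t > 0.\<close>
        have t1: "t < 1"
        proof (rule ccontr)
          assume "\<not> t < 1"
          then have "q = z" using t z(2) by simp
          then show False using bspec[OF hyp(3) z(1)] neg by simp
        qed
        have "0 < 1 / (2 * real ?n)" by simp
        then have t0: "0 < t" using t(1) by linarith
        obtain A' :: "real^'n \<Rightarrow> real^'n" where A': "linear A'" "bij A'" "E = (\<lambda>v. a + A' v) ` cball 0 1"
          using j by (auto simp: john_ellipsoid_def is_ellipsoid_def)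
        have E1: "(\<lambda>v. a + A' v) ` cball 0 1 \<subseteq> Q" using j by (simp add: john_ellipsoid_def A')
        have "dilation a (real ?n) E = (\<lambda>v. a + A' v) ` ((*\<^sub>R) (real ?n) ` cball 0 1)"
          unfolding dilation_def A'(3) image_image by (simp add: linear_cmul[OF A'(1)])
        also have "(*\<^sub>R) (real ?n) ` cball (0 :: real^'n) 1 = cball 0 (real ?n)" by (simp add: cball_scale)
        finally have E2: "Q \<subseteq> (\<lambda>v. a + A' v) ` cball 0 (real ?n)" using j by (simp add: john_ellipsoid_def)
        have ne: "interior Q \<noteq> {}" using int q(1) neg by blast
        obtain w d where wd: "orthonormal_frame (w :: 'n \<Rightarrow> real^'n)" "\<And>i x. x \<in> Q \<Longrightarrow> w i \<bullet> (x - q) \<le> d i"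
          "(\<Prod>i\<in>UNIV. d i) \<le> C1 * (1 - t) powr (1 / 2 ^ (?n - 1)) * ?m"
          using frame_widths_near_boundary[OF A'(1,2) E1 E2 Q(1,2) ne z(1) q(1) z(2) t0 t1] unfolding C1_def by metis
        have "\<bar>ut q\<bar> ^ ?n = (- ut q) ^ ?n" using neg by simp
        also have "\<dots> \<le> A * (\<Prod>i\<in>UNIV. d i) * (g * (1 / lam) * ?m)" using est[rule_format, OF q(1) neg wd(1)] wd(2) by blast
        also have "\<dots> \<le> A * (C1 * (1 - t) powr (1 / 2 ^ (?n - 1)) * ?m) * (g * (1 / lam) * ?m)"
          using wd(3) A g lam by (intro mult_right_mono mult_left_mono) auto
        also have "\<dots> = (A * C1) * ((g / lam) * (1 - t) powr (1 / 2 ^ (?n - 1)) * ?m\<^sup>2)" by (simp add: power2_eq_square)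
        also have "\<dots> \<le> C * ((g / lam) * (1 - t) powr (1 / 2 ^ (?n - 1)) * ?m\<^sup>2)"
          by (intro mult_right_mono mult_nonneg_nonneg AC(1) G0) auto
        finally have "\<bar>ut q\<bar> ^ ?n \<le> C * (g / lam) * (1 - t) powr (1 / 2 ^ (?n - 1)) * ?m\<^sup>2" by (simp add: mult.assoc)
        then have "ennreal (\<bar>ut q\<bar> ^ ?n) \<le> ennreal (C * (g / lam) * (1 - t) powr (1 / 2 ^ (?n - 1)) * ?m\<^sup>2)" by (rule ennreal_leI)
        also have "\<dots> = ennreal C * ennreal (g / lam) * ennreal ((1 - t) powr (1 / 2 ^ (?n - 1))) * ennreal (?m\<^sup>2)"
          using C G0 by (simp add: ennreal_mult del: divide_const_simps times_divide_eq_right)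
        finally show ?thesis unfolding G .
      qed
      have 2: "gamma_plus ct (Q \<times> V) \<le> gamma_plus c (U \<times> V) * gamma_minus c (U \<times> V)"
        using at.gamma_le[of Q] hyp(1) Q(1) unfolding folds by (simp add: borel_closed compact_imp_closed)
      have 3: "ennreal (\<bar>INF q\<in>Q. ut q\<bar> ^ ?n / ?m\<^sup>2) \<le> ennreal C * (gamma_plus ct (Q \<times> V) / ennreal lam)"
      \<comment> \<open>For a section of measure zero, including an empty one, the quotient on the
        left is 0 because division by zero yields 0.\<close>
      proof (cases "?m = 0")
        case False
        then have m: "?m > 0" using measure_nonneg[of lebesgue Q] by linarith
        have "Q \<noteq> {}" using False by auto
        then obtain q where q: "q \<in> Q" "\<And>q'. q' \<in> Q \<Longrightarrow> ut q \<le> ut q'" using continuous_attains_inf[OF Q(1) _ Q(3)] by blast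
        have INF: "(INF q\<in>Q. ut q) = ut q"
          by (rule cInf_eq_minimum) (use q in auto)
        have "\<bar>ut q\<bar> ^ ?n \<le> C * (g / lam) * ?m\<^sup>2"
        proof (cases "ut q < 0")
          case False
          then have "ut q = 0" using q(1) by (simp add: Q_def)
          moreover have "0 \<le> C * (g / lam) * ?m\<^sup>2" using C by (intro mult_nonneg_nonneg G0) auto
          ultimately show ?thesis by (simp add: power_0_left)
        next
          case neg: True
          have ne: "interior Q \<noteq> {}" using int q(1) neg by blast
          obtain w d where wd: "orthonormal_frame (w :: 'n \<Rightarrow> real^'n)" "\<And>i x. x \<in> Q \<Longrightarrow> w i \<bullet> (x - q) \<le> d i"
            "(\<Prod>i\<in>UNIV. d i) \<le> C2 * ?m"
            using frame_widths[OF Q(1,2) ne q(1)] unfolding C2_def by metis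
          have "\<bar>ut q\<bar> ^ ?n = (- ut q) ^ ?n" using neg by simp
          also have "\<dots> \<le> A * (\<Prod>i\<in>UNIV. d i) * (g * (1 / lam) * ?m)" using est[rule_format, OF q(1) neg wd(1)] wd(2) by blast
          also have "\<dots> \<le> A * (C2 * ?m) * (g * (1 / lam) * ?m)"
            using wd(3) A g lam by (intro mult_right_mono mult_left_mono) auto
          also have "\<dots> = (A * C2) * ((g / lam) * ?m\<^sup>2)" by (simp add: power2_eq_square)
          also have "\<dots> \<le> C * ((g / lam) * ?m\<^sup>2)" by (intro mult_right_mono mult_nonneg_nonneg AC(2) G0) auto
          finally show ?thesis by (simp add: mult.assoc)
        qed
        then have "\<bar>INF q\<in>Q. ut q\<bar> ^ ?n / ?m\<^sup>2 \<le> C * (g / lam)" unfolding INF using m by (simp add: pos_divide_le_eq)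
        then have "ennreal (\<bar>INF q\<in>Q. ut q\<bar> ^ ?n / ?m\<^sup>2) \<le> ennreal (C * (g / lam))" by (rule ennreal_leI)
        also have "\<dots> = ennreal C * ennreal (g / lam)" using C G0 by (intro ennreal_mult) auto
        finally show ?thesis unfolding G .
      qed simp
      show "(\<forall>a E t q. john_ellipsoid {q \<in> closure (U_at U V c y0). modified_fun U V c y0 u q \<le> 0} a E \<and> 1 / (2 * real CARD('n)) < t \<and> t \<le> 1 \<and>
               q \<in> {q \<in> closure (U_at U V c y0). modified_fun U V c y0 u q \<le> 0} \<and> q \<in> dilation a t (frontier {q \<in> closure (U_at U V c y0). modified_fun U V c y0 u q \<le> 0}) \<longrightarrow>
               ennreal (\<bar>modified_fun U V c y0 u q\<bar> ^ CARD('n))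
                 \<le> ennreal C * (gamma_plus (modified_cost U V c y0) ({q \<in> closure (U_at U V c y0). modified_fun U V c y0 u q \<le> 0} \<times> V) / ennreal lam)
                   * ennreal ((1 - t) powr (1 / 2 ^ (CARD('n) - 1)))
                   * ennreal ((measure lebesgue {q \<in> closure (U_at U V c y0). modified_fun U V c y0 u q \<le> 0})\<^sup>2)) \<and>
            gamma_plus (modified_cost U V c y0) ({q \<in> closure (U_at U V c y0). modified_fun U V c y0 u q \<le> 0} \<times> V) \<le> gamma_plus c (U \<times> V) * gamma_minus c (U \<times> V) \<and>
            ennreal (\<bar>INF q\<in>{q \<in> closure (U_at U V c y0). modified_fun U V c y0 u q \<le> 0}. modified_fun U V c y0 u q\<bar> ^ CARD('n) / (measure lebesgue {q \<in> closure (U_at U V c y0). modified_fun U V c y0 u q \<le> 0})\<^sup>2)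
              \<le> ennreal C * (gamma_plus (modified_cost U V c y0) ({q \<in> closure (U_at U V c y0). modified_fun U V c y0 u q \<le> 0} \<times> V) / ennreal lam)"
        unfolding folds using 1 2 3 by blast
    qed
  qed
  then show ?thesis using C by (intro exI[of _ C]) blast
qed

end
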